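(* Let $(G,R)$ be an instance of \textsc{Directed Steiner Network}, let $g$ be the genus of $G$, let $T=V(R)$ and $q=|T|$, and let $H$ be an inclusion-minimal solution to $(G,R)$. Then the treewidth of (the underlying undirected graph of) $H$ is $O\!\left(20^{4(4g+3)}g\cdot q\right)$.
   Context: \textsc{Directed Steiner Network}: the input is a directed graph $G$ with positive arc weights and an unweighted directed graph $R$ with $V(R)\subseteq V(G)$. A subgraph $H$ of $G$ is a solution to $(G,R)$ if for every arc $st\in A(R)$ there is a directed path from $s$ to $t$ in $H$; it is an inclusion-minimal solution if it is a solution but $H-e$ is not a solution for every arc $e\in A(H)$. The genus of a directed graph means the genus of its underlying undirected graph, and treewidth of a directed graph means treewidth of its underlying undirected graph.
   Formalization: The factor g in the bound is replaced by max(g,1), since for planar G (g = 0) the literal bound is 0 and fails already for a single arc from s to t, whose treewidth is 1; vertices are taken to be natural numbers, which covers every finite graph up to isomorphism. *)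

theory Defs
  imports Complex_Main
begin

(* Directed graphs are given as a vertex set V and an arc set A \<subseteq> V \<times> V.
   Undirected graphs are given by a set of 2-element edges. *)

definition ugraph_edges :: "('a \<times> 'a) set \<Rightarrow> 'a set set" where
  "ugraph_edges A = {{u, v} | u v. (u, v) \<in> A \<and> u \<noteq> v}"

definition adj :: "'a set set \<Rightarrow> ('a \<times> 'a) set" where
  "adj F = {(i, j). {i, j} \<in> F}"

(* ---------- treewidth ---------- *)

definition is_tree :: "nat set \<Rightarrow> nat set set \<Rightarrow> bool" where
  "is_tree I F \<longleftrightarrow> finite I \<and> I \<noteq> {} \<and>
     (\<forall>e\<in>F. \<exists>i j. e = {i, j} \<and> i \<in> I \<and> j \<in> I \<and> i \<noteq> j) \<and>
     (\<forall>i\<in>I. \<forall>j\<in>I. (i, j) \<in> (adj F)\<^sup>*) \<and>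
     card F = card I - 1"

definition tree_decomp ::
  "'a set \<Rightarrow> 'a set set \<Rightarrow> nat set \<Rightarrow> nat set set \<Rightarrow> (nat \<Rightarrow> 'a set) \<Rightarrow> bool" where
  "tree_decomp V E I F B \<longleftrightarrow> is_tree I F \<and>
     (\<forall>i\<in>I. B i \<subseteq> V) \<and>
     (\<forall>v\<in>V. \<exists>i\<in>I. v \<in> B i) \<and>
     (\<forall>e\<in>E. \<exists>i\<in>I. e \<subseteq> B i) \<and>
     (\<forall>v\<in>V. \<forall>i\<in>I. \<forall>j\<in>I. v \<in> B i \<longrightarrow> v \<in> B j \<longrightarrow>
        (i, j) \<in> (adj F \<inter> ({k. v \<in> B k} \<times> {k. v \<in> B k}))\<^sup>*)"

definition decomp_width :: "nat set \<Rightarrow> (nat \<Rightarrow> 'a set) \<Rightarrow> nat" where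
  "decomp_width I B = Max ((\<lambda>i. card (B i)) ` I) - 1"

definition treewidth :: "'a set \<Rightarrow> 'a set set \<Rightarrow> nat" where
  "treewidth V E = (LEAST k. \<exists>I F B. tree_decomp V E I F B \<and> decomp_width I B = k)"

(* ---------- orientable genus via rotation systems (Heffter-Edmonds-Ringel) ---------- *)

definition nbrs :: "'a set set \<Rightarrow> 'a \<Rightarrow> 'a set" where
  "nbrs E v = {u. {v, u} \<in> E}"

definition is_rotation_system :: "'a set set \<Rightarrow> ('a \<Rightarrow> 'a \<Rightarrow> 'a) \<Rightarrow> bool" where
  "is_rotation_system E rho \<longleftrightarrow>
     (\<forall>v. bij_betw (rho v) (nbrs E v) (nbrs E v) \<and>
          (\<forall>x\<in>nbrs E v. \<forall>y\<in>nbrs E v. \<exists>k. (rho v ^^ k) x = y))"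

definition darts :: "'a set set \<Rightarrow> ('a \<times> 'a) set" where
  "darts E = {(u, v). {u, v} \<in> E}"

definition face_perm :: "('a \<Rightarrow> 'a \<Rightarrow> 'a) \<Rightarrow> 'a \<times> 'a \<Rightarrow> 'a \<times> 'a" where
  "face_perm rho d = (snd d, rho (snd d) (fst d))"

definition faces :: "'a set set \<Rightarrow> ('a \<Rightarrow> 'a \<Rightarrow> 'a) \<Rightarrow> ('a \<times> 'a) set set" where
  "faces E rho = {{(face_perm rho ^^ k) d | k. True} | d. d \<in> darts E}"

(* connected components of the graph formed by the non-isolated vertices *)
definition comps :: "'a set set \<Rightarrow> 'a set set" where
  "comps E = {(adj E)\<^sup>* `` {v} | v. v \<in> \<Union>E}"

(* genus of the embedding given by rho: Euler's formula summed over components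
   with at least one edge (isolated vertices contribute genus 0) *)
definition emb_genus :: "'a set set \<Rightarrow> ('a \<Rightarrow> 'a \<Rightarrow> 'a) \<Rightarrow> nat" where
  "emb_genus E rho = nat ((2 * int (card (comps E)) - int (card (\<Union>E)) + int (card E)
                           - int (card (faces E rho))) div 2)"

definition genus :: "'a set set \<Rightarrow> nat" where
  "genus E = (LEAST g. \<exists>rho. is_rotation_system E rho \<and> emb_genus E rho = g)"

(* ---------- Directed Steiner Network ---------- *)

definition is_solution ::
  "('a \<times> 'a) set \<Rightarrow> 'a set \<Rightarrow> ('a \<times> 'a) set \<Rightarrow> bool" where
  "is_solution AR VH AH \<longleftrightarrow>
     (\<forall>(s, t)\<in>AR. s \<in> VH \<and> t \<in> VH \<and> (s, t) \<in> AH\<^sup>*)"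

definition is_subgraph ::
  "'a set \<Rightarrow> ('a \<times> 'a) set \<Rightarrow> 'a set \<Rightarrow> ('a \<times> 'a) set \<Rightarrow> bool" where
  "is_subgraph V A VH AH \<longleftrightarrow> VH \<subseteq> V \<and> AH \<subseteq> A \<and> AH \<subseteq> VH \<times> VH"

definition is_min_solution ::
  "'a set \<Rightarrow> ('a \<times> 'a) set \<Rightarrow> ('a \<times> 'a) set \<Rightarrow> 'a set \<Rightarrow> ('a \<times> 'a) set \<Rightarrow> bool" where
  "is_min_solution V A AR VH AH \<longleftrightarrow>
     is_subgraph V A VH AH \<and> is_solution AR VH AH \<and>
     (\<forall>e\<in>AH. \<not> is_solution AR VH (AH - {e}))"

end

theory Submission
  imports Defs
begin

text \<open>Fix a weak component of the solution, so that every arc is critical for some pair of the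
  \<open>q\<close> terminals, and contract its strong components. The acyclic quotient is embedded in the
  surface; Euler's formula, combined with walks along the left sides of faces that end in distinct
  private sources, shows that it has at most \<open>|V| + O(q\<^sup>2 + gq)\<close> arcs. Hence all but
  \<open>O(q\<^sup>2 + gq)\<close> strong components are single vertices of in- and out-degree one.
  A strong component is minimal subject to strongly connecting the vertices where it meets terminals
  or other components, and an ear decomposition in which almost every ear attaches
  only to its predecessor arranges it linearly with bounded cuts. So the whole
  component has a linear arrangement of bounded width away from a set \<open>M\<close> of
  \<open>O(q\<^sup>2 + gq)\<close> marked vertices. Contracting the stretches between consecutive marks
  leaves an embedded graph with \<open>n = O(q\<^sup>2 + gq)\<close> vertices; deleting every \<open>q\<close>-th
  breadth-first layer, and decomposing the rest along a tree and its dual tree, yields width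
  \<open>O(gq + n/q)\<close>. Gluing back the stretches, which have bounded width and boundary, gives
  \<open>O((g + 1) q)\<close>, without the exponential factor.\<close>

section \<open>Tree decompositions\<close>

text \<open>The number of vertices is not bounded in \<open>q\<close> and the genus, since paths may
  be subdivided at will; only the excess of arcs over vertices in the acyclic quotient is. So bounds
  are stated as excesses, and the unbounded remainder has to consist of paths and ears. Criticality
  supplies the two facts behind this: an arc \<open>(u, v)\<close> needed by a pair
  \<open>(s, t)\<close> has \<open>s\<close> as a private source, which reaches \<open>u\<close> but
  the tail of no other arc into the strong component of \<open>v\<close>; and inside a strong
  component no proper subset of the arcs connects the attachment vertices. A quadratic number of
  marks is affordable because some residue class of layers modulo \<open>q\<close> holds at most a
  \<open>1/q\<close> fraction of the vertices, while a window of \<open>q\<close> layers meets a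
  tree path in at most \<open>q\<close> vertices. The surface is that of the host graph throughout:
  subgraphs and contractions are treated inside its rotation system, by \<open>delete_edges\<close>
  and \<open>quotient_map\<close>, and the rounding in the definition of the genus turns
  \<open>2g\<close> into \<open>2g + 1\<close>. Planar instances are covered by
  \<open>max g 1\<close>.\<close>

definition nadj :: "'n set \<Rightarrow> 'n \<Rightarrow> ('n \<Rightarrow> 'n) \<Rightarrow> ('n \<times> 'n) set" where
  "nadj N r p = {(i, j). i \<in> N \<and> j \<in> N \<and> ((i \<noteq> r \<and> j = p i) \<or> (j \<noteq> r \<and> i = p j))}"

text \<open>A rooted tree given by a parent function. The rank that decreases towards the root rules
  out cycles and serves as the measure for inductions, so trees are glued by just writing down new
  parents and ranks.\<close>

definition rtree :: "'n set \<Rightarrow> 'n \<Rightarrow> ('n \<Rightarrow> 'n) \<Rightarrow> ('n \<Rightarrow> nat) \<Rightarrow> bool" where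
  "rtree N r p rk \<longleftrightarrow> finite N \<and> r \<in> N \<and> (\<forall>i\<in>N. i \<noteq> r \<longrightarrow> p i \<in> N \<and> rk (p i) < rk i)"

definition restr_to :: "'n set \<Rightarrow> ('n \<times> 'n) set \<Rightarrow> ('n \<times> 'n) set" where
  "restr_to K R = R \<inter> (K \<times> K)"

definition td :: "'a set \<Rightarrow> 'a set set \<Rightarrow> 'n set \<Rightarrow> 'n \<Rightarrow> ('n \<Rightarrow> 'n) \<Rightarrow> ('n \<Rightarrow> nat) \<Rightarrow> ('n \<Rightarrow> 'a set) \<Rightarrow> bool" where
  "td V E N r p rk b \<longleftrightarrow> rtree N r p rk \<and> (\<forall>i\<in>N. b i \<subseteq> V) \<and>
     (\<forall>v\<in>V. \<exists>i\<in>N. v \<in> b i) \<and> (\<forall>e\<in>E. \<exists>i\<in>N. e \<subseteq> b i) \<and>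
     (\<forall>v\<in>V. \<forall>i\<in>N. \<forall>j\<in>N. v \<in> b i \<longrightarrow> v \<in> b j \<longrightarrow> (i, j) \<in> (restr_to {k. v \<in> b k} (nadj N r p))\<^sup>*)"

text \<open>The members of \<open>E\<close> may be arbitrary sets: a separator put into \<open>E\<close> is forced into a bag,
  where further pieces can be attached.\<close>

definition has_td :: "'a set \<Rightarrow> 'a set set \<Rightarrow> nat \<Rightarrow> bool" where
  "has_td V E w \<longleftrightarrow> (\<exists>(N::nat set) r p rk b. td V E N r p rk b \<and> (\<forall>i\<in>N. card (b i) \<le> w))"

lemma rtrancl_image:
  assumes "(i, j) \<in> R\<^sup>*" and "\<And>x y. (x, y) \<in> R \<Longrightarrow> (f x, f y) \<in> R'\<^sup>*"
  shows "(f i, f j) \<in> R'\<^sup>*"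
  using assms(1) by (induction) (auto intro: rtrancl_trans assms(2))

lemma nadj_sym: "sym (nadj N r p)"
  by (auto simp: nadj_def sym_def)

lemma restr_to_sym: "sym R \<Longrightarrow> sym (restr_to K R)"
  by (auto simp: restr_to_def sym_def)

lemma nadj_conn_sym: "(i, j) \<in> (restr_to K (nadj N r p))\<^sup>* \<Longrightarrow> (j, i) \<in> (restr_to K (nadj N r p))\<^sup>*"
  by (meson nadj_sym restr_to_sym sym_rtrancl symD)

lemma rtree_conn_root:
  assumes "rtree N r p rk" "i \<in> N" "\<And>j. j \<in> N \<Longrightarrow> j \<in> K"
  shows "(i, r) \<in> (restr_to K (nadj N r p))\<^sup>*"
  using assms(2)
proof (induction "rk i" arbitrary: i rule: less_induct)
  case less
  show ?case
  proof (cases "i = r")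
    case False
    then have *: "p i \<in> N" "rk (p i) < rk i" using assms(1) less.prems by (auto simp: rtree_def)
    then have "(i, p i) \<in> restr_to K (nadj N r p)"
      using False less.prems assms(3) by (auto simp: restr_to_def nadj_def)
    then show ?thesis using less.hyps[OF *(2) *(1)] by (meson converse_rtrancl_into_rtrancl)
  qed simp
qed

lemma rtree_conn:
  assumes "rtree N r p rk" "i \<in> N" "i' \<in> N" "\<And>j. j \<in> N \<Longrightarrow> j \<in> K"
  shows "(i, i') \<in> (restr_to K (nadj N r p))\<^sup>*"
  using rtree_conn_root[OF assms(1,2,4)] rtree_conn_root[OF assms(1,3,4)]
  by (meson nadj_conn_sym rtrancl_trans)

text \<open>Nodes of any type may be used, because a finite set of nodes can be renamed by an
  injection into the naturals. Later the nodes are elements of a sum type or darts of a map.\<close>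

lemma has_tdI:
  fixes N :: "'n set"
  assumes "td V E N r p rk b" "\<And>i. i \<in> N \<Longrightarrow> card (b i) \<le> w"
  shows "has_td V E w"
proof -
  have "finite N" using assms(1) by (auto simp: td_def rtree_def)
  then obtain f :: "'n \<Rightarrow> nat" where f: "inj_on f N"
    using finite_imp_inj_to_nat_seg by blast
  define g where "g = inv_into N f"
  have g: "g (f i) = i" if "i \<in> N" for i using that f by (auto simp: g_def)
  have conn: "(f i, f j) \<in> (restr_to {k. v \<in> b (g k)} (nadj (f ` N) (f r) (f \<circ> p \<circ> g)))\<^sup>*"
    if "(i, j) \<in> (restr_to {k. v \<in> b k} (nadj N r p))\<^sup>*" for i j v
  proof (rule rtrancl_image[OF that])
    fix x y assume "(x, y) \<in> restr_to {k. v \<in> b k} (nadj N r p)"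
    moreover have "r \<in> N" using assms(1) by (auto simp: td_def rtree_def)
    ultimately show "(f x, f y) \<in> (restr_to {k. v \<in> b (g k)} (nadj (f ` N) (f r) (f \<circ> p \<circ> g)))\<^sup>*"
      by (intro r_into_rtrancl) (auto simp: restr_to_def nadj_def g inj_on_eq_iff[OF f])
  qed
  have rt: "rtree N r p rk" and sub: "\<forall>i\<in>N. b i \<subseteq> V" and ver: "\<forall>v\<in>V. \<exists>i\<in>N. v \<in> b i"
    and edg: "\<forall>e\<in>E. \<exists>i\<in>N. e \<subseteq> b i"
    and con: "\<forall>v\<in>V. \<forall>i\<in>N. \<forall>j\<in>N. v \<in> b i \<longrightarrow> v \<in> b j \<longrightarrow> (i, j) \<in> (restr_to {k. v \<in> b k} (nadj N r p))\<^sup>*"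
    using assms(1) by (auto simp: td_def)
  have rn: "r \<in> N" using rt by (auto simp: rtree_def)
  have "td V E (f ` N) (f r) (f \<circ> p \<circ> g) (rk \<circ> g) (b \<circ> g)"
    unfolding td_def
  proof (intro conjI)
    show "rtree (f ` N) (f r) (f \<circ> p \<circ> g) (rk \<circ> g)"
      using rt by (auto simp: rtree_def g)
    show "\<forall>i\<in>f ` N. (b \<circ> g) i \<subseteq> V" using sub by (auto simp: g)
    show "\<forall>v\<in>V. \<exists>i\<in>f ` N. v \<in> (b \<circ> g) i" using ver by (auto simp: g)
    show "\<forall>e\<in>E. \<exists>i\<in>f ` N. e \<subseteq> (b \<circ> g) i" using edg by (fastforce simp: g)
    show "\<forall>v\<in>V. \<forall>i\<in>f ` N. \<forall>j\<in>f ` N. v \<in> (b \<circ> g) i \<longrightarrow> v \<in> (b \<circ> g) j \<longrightarrow>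
       (i, j) \<in> (restr_to {k. v \<in> (b \<circ> g) k} (nadj (f ` N) (f r) (f \<circ> p \<circ> g)))\<^sup>*"
      using con conn by (auto simp: g)
  qed
  moreover have "\<forall>i\<in>f ` N. card ((b \<circ> g) i) \<le> w" using assms(2) by (auto simp: g)
  ultimately show ?thesis unfolding has_td_def by blast
qed

text \<open>\<open>w\<close> bounds the size of the bags, so the width is one less. The tree edges
  \<open>{i, p i}\<close> are pairwise distinct, since two equal ones would make each of two nodes
  the parent of the other, against the rank; this yields the number of edges in
  \<open>is_tree\<close>.\<close>

lemma has_td_treewidth:
  assumes "has_td V E w"
  shows "treewidth V E \<le> w - 1"
proof -
  obtain N :: "nat set" and r p rk b where t: "td V E N r p rk b" and w: "\<forall>i\<in>N. card (b i) \<le> w"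
    using assms by (auto simp: has_td_def)
  have rt: "rtree N r p rk" using t by (auto simp: td_def)
  have fin: "finite N" and rN: "r \<in> N" using rt by (auto simp: rtree_def)
  define F where "F = (\<lambda>i. {i, p i}) ` (N - {r})"
  have rk: "p i \<in> N" "rk (p i) < rk i" if "i \<in> N" "i \<noteq> r" for i using rt that by (auto simp: rtree_def)
  have "inj_on (\<lambda>i. {i, p i}) (N - {r})"
  proof (rule inj_onI)
    fix i j assume ij: "i \<in> N - {r}" "j \<in> N - {r}" "{i, p i} = {j, p j}"
    show "i = j"
    proof (rule ccontr)
      assume "i \<noteq> j"
      then have "i = p j" "j = p i" using ij(3) by (auto simp: doubleton_eq_iff)
      then have "rk i < rk j" "rk j < rk i" using rk(2)[of i] rk(2)[of j] ij by auto
      then show False by simp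
    qed
  qed
  then have cF: "card F = card N - 1" unfolding F_def using fin rN by (simp add: card_image)
  have adjF: "nadj N r p \<subseteq> adj F" by (auto simp: nadj_def adj_def F_def)
  have "is_tree N F"
    unfolding is_tree_def
  proof (intro conjI)
    show "finite N" "N \<noteq> {}" "card F = card N - 1" using fin rN cF by auto
    show "\<forall>e\<in>F. \<exists>i j. e = {i, j} \<and> i \<in> N \<and> j \<in> N \<and> i \<noteq> j"
    proof
      fix e assume "e \<in> F"
      then obtain i where i: "i \<in> N" "i \<noteq> r" "e = {i, p i}" by (auto simp: F_def)
      with rk[of i] show "\<exists>i j. e = {i, j} \<and> i \<in> N \<and> j \<in> N \<and> i \<noteq> j" by (metis less_irrefl)
    qed
    show "\<forall>i\<in>N. \<forall>j\<in>N. (i, j) \<in> (adj F)\<^sup>*"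
    proof (intro ballI)
      fix i j assume "i \<in> N" "j \<in> N"
      then have "(i, j) \<in> (restr_to UNIV (nadj N r p))\<^sup>*" using rtree_conn[OF rt] by blast
      then show "(i, j) \<in> (adj F)\<^sup>*" using adjF by (simp add: restr_to_def) (meson rtrancl_mono subsetD)
    qed
  qed
  then have "tree_decomp V E N F b"
    using t unfolding td_def tree_decomp_def
  proof (intro conjI; (elim conjE)?; assumption?)
    assume *: "\<forall>v\<in>V. \<forall>i\<in>N. \<forall>j\<in>N. v \<in> b i \<longrightarrow> v \<in> b j \<longrightarrow> (i, j) \<in> (restr_to {k. v \<in> b k} (nadj N r p))\<^sup>*"
    have "restr_to {k. v \<in> b k} (nadj N r p) \<subseteq> adj F \<inter> ({k. v \<in> b k} \<times> {k. v \<in> b k})" for v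
      using adjF by (auto simp: restr_to_def)
    then show "\<forall>v\<in>V. \<forall>i\<in>N. \<forall>j\<in>N. v \<in> b i \<longrightarrow> v \<in> b j \<longrightarrow>
        (i, j) \<in> (adj F \<inter> {k. v \<in> b k} \<times> {k. v \<in> b k})\<^sup>*"
      using * rtrancl_mono by blast
  qed
  then have "treewidth V E \<le> decomp_width N b"
    unfolding treewidth_def by (intro Least_le) blast
  also have "Max ((\<lambda>i. card (b i)) ` N) \<le> w" using w fin rN by (subst Max_le_iff) auto
  then have "decomp_width N b \<le> w - 1" by (simp add: decomp_width_def)
  finally show ?thesis .
qed

section \<open>Building tree decompositions from given ones\<close>

lemma has_td_mono:
  assumes "has_td V E w" "w \<le> w'" "\<And>e. e \<in> E' \<Longrightarrow> \<exists>e'\<in>E. e \<subseteq> e'"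
  shows "has_td V E' w'"
proof -
  obtain N :: "nat set" and r p rk b where t: "td V E N r p rk b" "\<forall>i\<in>N. card (b i) \<le> w"
    using assms(1) by (auto simp: has_td_def)
  then have "td V E' N r p rk b" unfolding td_def using assms(3) by (meson subset_trans)
  then show ?thesis using t(2) assms(2) by (intro has_tdI) (auto intro: order_trans)
qed

lemma has_td_empty: "has_td {} {} w"
proof (rule has_tdI)
  show "td {} {} {0::nat} 0 id id (\<lambda>_. {})" by (auto simp: td_def rtree_def)
qed simp

text \<open>Makes the empty separator available, over which disjoint parts are glued.\<close>

lemma has_td_insert_empty: "has_td V E w \<Longrightarrow> has_td V (insert {} E) w"
proof -
  assume "has_td V E w"
  then obtain N :: "nat set" and r p rk b where t: "td V E N r p rk b" "\<forall>i\<in>N. card (b i) \<le> w"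
    by (auto simp: has_td_def)
  then have "td V (insert {} E) N r p rk b" by (auto simp: td_def rtree_def)
  then show ?thesis using t(2) by (intro has_tdI) auto
qed

text \<open>The second decomposition is hung below a node whose bag contains \<open>S\<close>, and
  \<open>S\<close> is added to each of its bags. It therefore only has to cover the traces of the
  sets of \<open>E2\<close> on \<open>V2\<close>; its bags grow to \<open>w2 + card S\<close>, while
  those of the first decomposition are unchanged.\<close>

lemma has_td_glue:
  fixes V1 V2 S :: "'a set"
  assumes "has_td V1 E1 w" "S \<in> E1" "has_td V2 ((\<lambda>e. e \<inter> V2) ` E2) w2" "w2 + card S \<le> w"
    "V1 \<inter> V2 = {}" "\<And>e. e \<in> E2 \<Longrightarrow> e \<subseteq> V2 \<union> S"
  shows "has_td (V1 \<union> V2) (E1 \<union> E2) w"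
proof -
  obtain N1 :: "nat set" and r1 p1 rk1 b1 where t1: "td V1 E1 N1 r1 p1 rk1 b1" and w1: "\<forall>i\<in>N1. card (b1 i) \<le> w"
    using assms(1) by (auto simp: has_td_def)
  obtain N2 :: "nat set" and r2 p2 rk2 b2 where t2: "td V2 ((\<lambda>e. e \<inter> V2) ` E2) N2 r2 p2 rk2 b2" and w2: "\<forall>i\<in>N2. card (b2 i) \<le> w2"
    using assms(3) by (auto simp: has_td_def)
  obtain i0 where i0: "i0 \<in> N1" "S \<subseteq> b1 i0" using t1 assms(2) by (auto simp: td_def)
  have rt1: "rtree N1 r1 p1 rk1" and rt2: "rtree N2 r2 p2 rk2" using t1 t2 by (auto simp: td_def)
  have bV1: "\<And>i. i \<in> N1 \<Longrightarrow> b1 i \<subseteq> V1" and bV2: "\<And>i. i \<in> N2 \<Longrightarrow> b2 i \<subseteq> V2"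
    using t1 t2 by (auto simp: td_def)
  have SV: "S \<subseteq> V1" using i0 bV1 by blast
  define N where "N = Inl ` N1 \<union> Inr ` N2"
  define p where "p = (\<lambda>x. case x of Inl i \<Rightarrow> Inl (p1 i) | Inr i \<Rightarrow> if i = r2 then Inl i0 else Inr (p2 i))"
  \<comment> \<open>The ranks of the second tree are raised above that of the attachment node
    \<open>i0\<close>, which becomes the parent of \<open>r2\<close>.\<close>
  define rk where "rk = (\<lambda>x. case x of Inl i \<Rightarrow> rk1 i | Inr i \<Rightarrow> Suc (rk1 i0 + rk2 i))"
  define b where "b = (\<lambda>x. case x of Inl i \<Rightarrow> b1 i | Inr i \<Rightarrow> b2 i \<union> S)"
  define r :: "nat + nat" where "r = Inl r1"
  let ?R = "\<lambda>v. restr_to {k. v \<in> b k} (nadj N r p)"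
  have c1: "(Inl i, Inl j) \<in> (?R v)\<^sup>*" if "(i, j) \<in> (restr_to {k. v \<in> b1 k} (nadj N1 r1 p1))\<^sup>*" for i j v
    by (rule rtrancl_image[OF that])
      (auto simp: restr_to_def nadj_def N_def p_def b_def r_def intro!: r_into_rtrancl)
  have c2: "(Inr i, Inr j) \<in> (?R v)\<^sup>*"
    if "(i, j) \<in> (restr_to K (nadj N2 r2 p2))\<^sup>*" "\<And>k. k \<in> K \<Longrightarrow> k \<in> N2 \<Longrightarrow> v \<in> b (Inr k)" for i j v K
    by (rule rtrancl_image[OF that(1)], use that(2) in
      \<open>auto simp: restr_to_def nadj_def N_def p_def r_def intro!: r_into_rtrancl\<close>)
  have c3: "(Inr i, Inl i0) \<in> (?R v)\<^sup>*" if "v \<in> S" "i \<in> N2" for i v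
  proof -
    have "(i, r2) \<in> (restr_to UNIV (nadj N2 r2 p2))\<^sup>*" using rtree_conn_root[OF rt2 that(2)] by blast
    then have "(Inr i, Inr r2) \<in> (?R v)\<^sup>*" by (rule c2) (simp add: b_def that(1))
    moreover have "(Inr r2, Inl i0) \<in> ?R v"
      using that i0 rt2 by (auto simp: restr_to_def nadj_def N_def p_def r_def b_def rtree_def)
    ultimately show ?thesis by (rule rtrancl_into_rtrancl)
  qed
  have "td (V1 \<union> V2) (E1 \<union> E2) N r p rk b"
    unfolding td_def
  proof (intro conjI)
    show "rtree N r p rk"
      unfolding rtree_def
    proof (intro conjI ballI impI)
      show "finite N" "r \<in> N" using rt1 rt2 by (auto simp: rtree_def N_def r_def)
    next
      fix i assume "i \<in> N" "i \<noteq> r"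
      then consider a where "i = Inl a" "a \<in> N1" "a \<noteq> r1" | a where "i = Inr a" "a \<in> N2"
        by (auto simp: N_def r_def)
      then show "p i \<in> N" "rk (p i) < rk i"
        using rt1 rt2 i0 by (cases; force simp: rtree_def N_def p_def rk_def)+
    qed
    show "\<forall>i\<in>N. b i \<subseteq> V1 \<union> V2" using bV1 bV2 SV by (fastforce simp: N_def b_def)
    show "\<forall>v\<in>V1 \<union> V2. \<exists>i\<in>N. v \<in> b i"
    proof
      fix v assume "v \<in> V1 \<union> V2"
      then consider i where "i \<in> N1" "v \<in> b1 i" | i where "i \<in> N2" "v \<in> b2 i" using t1 t2 by (auto simp: td_def)
      then show "\<exists>i\<in>N. v \<in> b i"
      proof cases
        case (1 i) then show ?thesis by (intro bexI[of _ "Inl i"]) (auto simp: N_def b_def)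
      next
        case (2 i) then show ?thesis by (intro bexI[of _ "Inr i"]) (auto simp: N_def b_def)
      qed
    qed
    show "\<forall>e\<in>E1 \<union> E2. \<exists>i\<in>N. e \<subseteq> b i"
    proof
      fix e assume "e \<in> E1 \<union> E2"
      then show "\<exists>i\<in>N. e \<subseteq> b i"
      proof
        assume "e \<in> E1"
        then obtain i where "i \<in> N1" "e \<subseteq> b1 i" using t1 by (auto simp: td_def)
        then show ?thesis by (intro bexI[of _ "Inl i"]) (auto simp: N_def b_def)
      next
        assume e: "e \<in> E2"
        then obtain i where "i \<in> N2" "e \<inter> V2 \<subseteq> b2 i" using t2 by (auto simp: td_def)
        then show ?thesis using assms(6)[OF e] by (intro bexI[of _ "Inr i"]) (auto simp: N_def b_def)
      qed
    qed
    show "\<forall>v\<in>V1 \<union> V2. \<forall>i\<in>N. \<forall>j\<in>N. v \<in> b i \<longrightarrow> v \<in> b j \<longrightarrow> (i, j) \<in> (?R v)\<^sup>*"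
    proof (intro ballI impI)
      fix v i j assume v: "v \<in> V1 \<union> V2" "i \<in> N" "j \<in> N" "v \<in> b i" "v \<in> b j"
      show "(i, j) \<in> (?R v)\<^sup>*"
      proof (cases "v \<in> V2")
        case True
        then have nv: "v \<notin> V1" "v \<notin> S" using assms(5) SV by auto
        then obtain i' j' where ij: "i = Inr i'" "j = Inr j'" "i' \<in> N2" "j' \<in> N2" "v \<in> b2 i'" "v \<in> b2 j'"
          using v bV1 unfolding N_def b_def by (fastforce split: sum.splits)
        then have "(i', j') \<in> (restr_to {k. v \<in> b2 k} (nadj N2 r2 p2))\<^sup>*"
          using t2 True by (auto simp: td_def)
        then show ?thesis unfolding ij by (rule c2) (auto simp: b_def)
      next
        case False
        then have v1: "v \<in> V1" using v by blast
        have L: "(Inl i', Inl j') \<in> (?R v)\<^sup>*" if "i' \<in> N1" "j' \<in> N1" "v \<in> b1 i'" "v \<in> b1 j'" for i' j'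
          using t1 v1 that by (intro c1) (auto simp: td_def)
        have L0: "\<exists>i'\<in>N1. v \<in> b1 i' \<and> (x, Inl i') \<in> (?R v)\<^sup>*" if "x \<in> N" "v \<in> b x" for x
        proof (cases x)
          case (Inl a) then show ?thesis using that by (auto simp: N_def b_def)
        next
          case (Inr a)
          then have "v \<in> S" "a \<in> N2" using that False bV2 by (auto simp: N_def b_def)
          then show ?thesis using c3 i0 Inr by blast
        qed
        obtain i' where i': "i' \<in> N1" "v \<in> b1 i'" "(i, Inl i') \<in> (?R v)\<^sup>*" using L0 v by blast
        obtain j' where j': "j' \<in> N1" "v \<in> b1 j'" "(j, Inl j') \<in> (?R v)\<^sup>*" using L0 v by blast
        show ?thesis using i' j' L[of i' j'] by (meson nadj_conn_sym rtrancl_trans)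
      qed
    qed
  qed
  moreover have "card (b i) \<le> w" if "i \<in> N" for i
  proof (cases i)
    case (Inl a) then show ?thesis using that w1 by (auto simp: N_def b_def)
  next
    case (Inr a)
    then have "card (b i) \<le> card (b2 a) + card S" by (simp add: b_def card_Un_le)
    also have "\<dots> \<le> w" using Inr that w2 assms(4) by (fastforce simp: N_def)
    finally show ?thesis .
  qed
  ultimately show ?thesis by (rule has_tdI)
qed

lemma has_td_disjoint_Union:
  assumes "finite J" "\<And>j. j \<in> J \<Longrightarrow> has_td (V j) (E j) w" "\<And>j e. j \<in> J \<Longrightarrow> e \<in> E j \<Longrightarrow> e \<subseteq> V j"
    "\<And>i j. i \<in> J \<Longrightarrow> j \<in> J \<Longrightarrow> i \<noteq> j \<Longrightarrow> V i \<inter> V j = {}"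
  shows "has_td (\<Union>j\<in>J. V j) (\<Union>j\<in>J. E j) w"
  using assms
proof (induction J)
  case empty then show ?case by (simp add: has_td_empty)
next
  case (insert x F)
  have 1: "has_td (\<Union>j\<in>F. V j) (insert {} (\<Union>j\<in>F. E j)) w"
    by (intro has_td_insert_empty insert.IH insert.prems) auto
  have "(\<lambda>e. e \<inter> V x) ` E x = E x" using insert.prems(2)[of x]
    by (simp add: image_def Int_absorb2)
  then have 2: "has_td (V x) ((\<lambda>e. e \<inter> V x) ` E x) w" using insert.prems(1)[of x] by simp
  have "V y \<inter> V x = {}" if "y \<in> F" for y using insert.prems(3)[of y x] insert.hyps that by auto
  then have 3: "(\<Union>j\<in>F. V j) \<inter> V x = {}" by blast
  have 4: "e \<subseteq> V x \<union> {}" if "e \<in> E x" for e using insert.prems(2)[of x e] that by simp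
  have "has_td ((\<Union>j\<in>F. V j) \<union> V x) (insert {} (\<Union>j\<in>F. E j) \<union> E x) w"
    by (rule has_td_glue[OF 1 _ 2 _ 3 4]) simp_all
  from has_td_mono[OF this order_refl] show ?case by (simp add: Un_commute) blast
qed

lemma td_restrict:
  assumes t: "td V E N r p rk b" and WV: "W \<subseteq> V" and E': "\<And>e. e \<in> E' \<Longrightarrow> \<exists>e'\<in>E. e \<subseteq> e' \<inter> W"
  shows "td W E' N r p rk (\<lambda>i. b i \<inter> W)"
  unfolding td_def
proof (intro conjI ballI impI)
  show "rtree N r p rk" using t by (simp add: td_def)
  show "b i \<inter> W \<subseteq> W" for i by simp
  show "\<exists>i\<in>N. v \<in> b i \<inter> W" if "v \<in> W" for v using t WV that by (auto simp: td_def)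
  show "\<exists>i\<in>N. e \<subseteq> b i \<inter> W" if "e \<in> E'" for e
  proof -
    obtain e' where e': "e' \<in> E" "e \<subseteq> e' \<inter> W" using E'[OF \<open>e \<in> E'\<close>] by auto
    then obtain i where "i \<in> N" "e' \<subseteq> b i" using t by (auto simp: td_def)
    then show ?thesis using e' by auto
  qed
  fix v i j assume v: "v \<in> W" "i \<in> N" "j \<in> N" "v \<in> b i \<inter> W" "v \<in> b j \<inter> W"
  then have "(i, j) \<in> (restr_to {k. v \<in> b k} (nadj N r p))\<^sup>*" using t WV by (auto simp: td_def)
  then show "(i, j) \<in> (restr_to {k. v \<in> b k \<inter> W} (nadj N r p))\<^sup>*" using v(1) by simp
qed

lemma has_td_add:
  assumes "has_td (V - Z) ((\<lambda>e. e - Z) ` E) w" "Z \<subseteq> V"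
  shows "has_td V E (w + card Z)"
proof -
  obtain N :: "nat set" and r p rk b where t: "td (V - Z) ((\<lambda>e. e - Z) ` E) N r p rk b" and w: "\<forall>i\<in>N. card (b i) \<le> w"
    using assms(1) by (auto simp: has_td_def)
  have rt: "rtree N r p rk" using t by (auto simp: td_def)
  have "td V E N r p rk (\<lambda>i. b i \<union> Z)"
    unfolding td_def
  proof (intro conjI)
    show "rtree N r p rk" by fact
    have rN: "r \<in> N" using rt by (auto simp: rtree_def)
    show "\<forall>i\<in>N. b i \<union> Z \<subseteq> V" using t assms(2) by (auto simp: td_def)
    show "\<forall>v\<in>V. \<exists>i\<in>N. v \<in> b i \<union> Z" using t rN by (auto simp: td_def)
    show "\<forall>e\<in>E. \<exists>i\<in>N. e \<subseteq> b i \<union> Z"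
    proof
      fix e assume "e \<in> E"
      then obtain i where "i \<in> N" "e - Z \<subseteq> b i" using t by (auto simp: td_def)
      then show "\<exists>i\<in>N. e \<subseteq> b i \<union> Z" by (intro bexI[of _ i]) auto
    qed
    show "\<forall>v\<in>V. \<forall>i\<in>N. \<forall>j\<in>N. v \<in> b i \<union> Z \<longrightarrow> v \<in> b j \<union> Z \<longrightarrow>
      (i, j) \<in> (restr_to {k. v \<in> b k \<union> Z} (nadj N r p))\<^sup>*"
    proof (intro ballI impI)
      fix v i j assume *: "v \<in> V" "i \<in> N" "j \<in> N" "v \<in> b i \<union> Z" "v \<in> b j \<union> Z"
      show "(i, j) \<in> (restr_to {k. v \<in> b k \<union> Z} (nadj N r p))\<^sup>*"
      proof (cases "v \<in> Z")
        case True then show ?thesis using * by (intro rtree_conn[OF rt]) auto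
      next
        case False
        then have "(i, j) \<in> (restr_to {k. v \<in> b k} (nadj N r p))\<^sup>*" using * t by (auto simp: td_def)
        then show ?thesis using False by simp
      qed
    qed
  qed
  moreover have "card (b i \<union> Z) \<le> w + card Z" if "i \<in> N" for i
    using w that card_Un_le[of "b i" Z] by fastforce
  ultimately show ?thesis by (rule has_tdI)
qed

text \<open>The levels congruent to \<open>m\<close> modulo \<open>k\<close> go into all bags. Since
  a set of \<open>E\<close> spans at most two consecutive levels, the rest falls into blocks between
  consecutive removed levels, and in a block only a window of \<open>k\<close> levels of each bag
  survives. The given bags may thus be large as long as each window of them is small.\<close>

lemma has_td_layers:
  assumes t: "td V E N r p rk b" and "finite V" and EV: "\<And>e. e \<in> E \<Longrightarrow> e \<subseteq> V"
    and lev: "\<And>e x y. e \<in> E \<Longrightarrow> x \<in> e \<Longrightarrow> y \<in> e \<Longrightarrow> lev y \<le> lev x + (1::nat)"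
    and win: "\<And>i l. i \<in> N \<Longrightarrow> card {x \<in> b i. l \<le> lev x \<and> lev x < l + k} \<le> w"
    and k: "m < k"
  shows "has_td V E (w + card {v \<in> V. lev v mod k = m})"
proof -
  define Z where "Z = {v \<in> V. lev v mod k = m}"
  \<comment> \<open>Block \<open>0\<close> lies below level \<open>m\<close>, and block
    \<open>j + 1\<close> strictly between the levels \<open>j * k + m\<close> and
    \<open>(j + 1) * k + m\<close>.\<close>
  define blk where "blk v = lev v div k + (if lev v mod k < m then 0 else 1)" for v
  define J where "J = blk ` (V - Z)"
  define W where "W j = {v \<in> V - Z. blk v = j}" for j
  define F where "F j = {e - Z | e. e \<in> E \<and> e - Z \<subseteq> W j}" for j
  have step: "blk x = blk y" if "x \<in> V - Z" "y \<in> V - Z" "lev y = lev x + 1" for x y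
  proof (cases "Suc (lev x mod k) = k")
    case True
    then have "lev y div k = Suc (lev x div k)" "lev y mod k = 0" using that(3)
      by (simp_all add: mod_Suc div_Suc)
    moreover have "lev x mod k \<noteq> m" "lev y mod k \<noteq> m" using that by (auto simp: Z_def)
    moreover have "\<not> lev x mod k < m" using True k by auto
    ultimately show ?thesis by (auto simp: blk_def)
  next
    case False
    then have "lev y div k = lev x div k" "lev y mod k = Suc (lev x mod k)" using that(3)
      by (simp_all add: mod_Suc div_Suc)
    moreover have "lev x mod k \<noteq> m" "lev y mod k \<noteq> m" using that by (auto simp: Z_def)
    ultimately show ?thesis by (auto simp: blk_def)
  qed
  have same: "blk x = blk y" if e: "e \<in> E" "x \<in> e - Z" "y \<in> e - Z" for e x y
  proof -
    have xy: "x \<in> V - Z" "y \<in> V - Z" using e EV by auto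
    have "lev y \<le> lev x + 1" "lev x \<le> lev y + 1" using lev e by blast+
    then consider "lev y = lev x + 1" | "lev x = lev y + 1" | "lev x = lev y" by linarith
    then show ?thesis using step[OF xy] step[OF xy(2,1)] by cases (auto simp: blk_def)
  qed
  have range: "\<exists>l. \<forall>x\<in>W j. l \<le> lev x \<and> lev x < l + k" for j
  proof (cases j)
    case 0
    have "\<forall>x\<in>W j. 0 \<le> lev x \<and> lev x < 0 + k"
    proof
      fix x assume "x \<in> W j"
      then have "lev x div k = 0" using 0 by (auto simp: W_def blk_def split: if_splits)
      then show "0 \<le> lev x \<and> lev x < 0 + k" using k by (auto simp: div_eq_0_iff)
    qed
    then show ?thesis by blast
  next
    case (Suc j')
    have "\<forall>x\<in>W j. j' * k + m \<le> lev x \<and> lev x < j' * k + m + k"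
    proof
      fix x assume x: "x \<in> W j"
      have d: "lev x = lev x div k * k + lev x mod k" by simp
      show "j' * k + m \<le> lev x \<and> lev x < j' * k + m + k"
      proof (cases "lev x mod k < m")
        case True
        then have "lev x div k = Suc j'" using x Suc by (auto simp: W_def blk_def)
        then have "lev x = j' * k + k + lev x mod k" using d by (simp add: add.commute)
        then show ?thesis using True k by linarith
      next
        case False
        then have "lev x div k = j'" using x Suc by (auto simp: W_def blk_def)
        then have "lev x = j' * k + lev x mod k" using d by simp
        moreover have "lev x mod k < k" using k by simp
        ultimately show ?thesis using False by linarith
      qed
    qed
    then show ?thesis by blast
  qed
  have hj: "has_td (W j) (F j) w" for j
  proof (rule has_tdI)
    show "td (W j) (F j) N r p rk (\<lambda>i. b i \<inter> W j)"
      by (rule td_restrict[OF t]) (auto simp: W_def F_def)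
    fix i assume i: "i \<in> N"
    obtain l where l: "\<forall>x\<in>W j. l \<le> lev x \<and> lev x < l + k" using range by blast
    have "finite (b i)" using t i \<open>finite V\<close> by (auto simp: td_def intro: finite_subset)
    then have "card (b i \<inter> W j) \<le> card {x \<in> b i. l \<le> lev x \<and> lev x < l + k}"
      using l by (intro card_mono) auto
    then show "card (b i \<inter> W j) \<le> w" using win[OF i, of l] by simp
  qed
  have "has_td (\<Union>j\<in>J. W j) (\<Union>j\<in>J. F j) w"
    using \<open>finite V\<close> hj by (intro has_td_disjoint_Union) (auto simp: J_def W_def F_def)
  moreover have "(\<Union>j\<in>J. W j) = V - Z" by (auto simp: J_def W_def)
  ultimately have "has_td (V - Z) (insert {} (\<Union>j\<in>J. F j)) w" by (simp add: has_td_insert_empty)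
  note 1 = this
  have "\<exists>e'\<in>insert {} (\<Union>j\<in>J. F j). e \<subseteq> e'" if "e \<in> (\<lambda>e. e - Z) ` E" for e
  proof (cases "e = {}")
    case False
    then obtain e0 x where e0: "e0 \<in> E" "e = e0 - Z" "x \<in> e" using \<open>e \<in> _\<close> by auto
    have "e \<subseteq> W (blk x)"
    proof
      fix y assume "y \<in> e"
      then show "y \<in> W (blk x)" using same[OF e0(1), of y x] EV[OF e0(1)] e0 by (auto simp: W_def)
    qed
    moreover have "blk x \<in> J" using e0 EV by (auto simp: J_def)
    ultimately show ?thesis using e0 by (intro bexI[of _ e]) (auto simp: F_def)
  qed auto
  from has_td_mono[OF 1 order_refl this] have "has_td (V - Z) ((\<lambda>e. e - Z) ` E) w" .
  then show ?thesis using has_td_add unfolding Z_def by blast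
qed

text \<open>Every vertex \<open>z\<close> is replaced by the set \<open>rep z\<close>. An element
  \<open>v\<close> may occur in several of these sets; it has a home \<open>c v\<close> that equals
  or is adjacent to every such \<open>z\<close>, so a common bag links the nodes of \<open>z\<close>
  to those of \<open>c v\<close>, and the nodes containing \<open>v\<close> stay connected.\<close>

lemma has_td_blowup:
  assumes t: "td V0 E0 N r p rk b" and fin: "finite V0" and E0: "\<And>e. e \<in> E0 \<Longrightarrow> e \<subseteq> V0"
    and w: "\<And>i. i \<in> N \<Longrightarrow> card (b i) \<le> w"
    and rep: "\<And>z. z \<in> V0 \<Longrightarrow> card (rep z) \<le> m"
    and V: "V = (\<Union>z\<in>V0. rep z)"
    and c: "\<And>z v. z \<in> V0 \<Longrightarrow> v \<in> rep z \<Longrightarrow> c v \<in> V0 \<and> v \<in> rep (c v) \<and> (z = c v \<or> {z, c v} \<in> E0)"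
    and E: "\<And>e. e \<in> E \<Longrightarrow> (\<exists>e0\<in>E0. e \<subseteq> (\<Union>z\<in>e0. rep z)) \<or> (\<exists>z\<in>V0. e \<subseteq> rep z)"
  shows "has_td V E (w * m)"
proof (rule has_tdI)
  let ?b = "\<lambda>i. \<Union>z\<in>b i. rep z"
  let ?R = "\<lambda>v. restr_to {k. v \<in> ?b k} (nadj N r p)"
  have bV: "b i \<subseteq> V0" if "i \<in> N" for i using t that by (auto simp: td_def)
  have ver: "\<forall>v\<in>V0. \<exists>i\<in>N. v \<in> b i" and edg: "\<forall>e\<in>E0. \<exists>i\<in>N. e \<subseteq> b i" using t by (auto simp: td_def)
  have con: "(i, j) \<in> (?R v)\<^sup>*" if "z \<in> V0" "v \<in> rep z" "i \<in> N" "j \<in> N" "z \<in> b i" "z \<in> b j" for v z i j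
  proof -
    have "(i, j) \<in> (restr_to {k. z \<in> b k} (nadj N r p))\<^sup>*" using t that by (auto simp: td_def)
    moreover have "restr_to {k. z \<in> b k} (nadj N r p) \<subseteq> ?R v" using that by (auto simp: restr_to_def)
    ultimately show ?thesis using rtrancl_mono by blast
  qed
  have toc: "\<exists>j\<in>N. c v \<in> b j \<and> (i, j) \<in> (?R v)\<^sup>*" if "i \<in> N" "z \<in> b i" "v \<in> rep z" for i z v
  proof -
    have z: "z \<in> V0" using that bV by blast
    show ?thesis
    proof (cases "z = c v")
      case True then show ?thesis using that by auto
    next
      case False
      then have "{z, c v} \<in> E0" using c[OF z that(3)] by auto
      then obtain j where "j \<in> N" "z \<in> b j" "c v \<in> b j" using t by (auto simp: td_def)
      then show ?thesis using con[OF z that(3) that(1)] that by blast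
    qed
  qed
  show "td V E N r p rk ?b"
    unfolding td_def
  proof (intro conjI)
    show "rtree N r p rk" using t by (auto simp: td_def)
    show "\<forall>i\<in>N. ?b i \<subseteq> V" using bV V by blast
    show "\<forall>v\<in>V. \<exists>i\<in>N. v \<in> ?b i"
    proof
      fix v assume "v \<in> V"
      then obtain z where "z \<in> V0" "v \<in> rep z" using V by auto
      moreover from this obtain i where "i \<in> N" "z \<in> b i" using ver by meson
      ultimately show "\<exists>i\<in>N. v \<in> ?b i" by blast
    qed
    show "\<forall>e\<in>E. \<exists>i\<in>N. e \<subseteq> ?b i"
    proof
      fix e assume "e \<in> E"
      then consider e0 where "e0 \<in> E0" "e \<subseteq> (\<Union>z\<in>e0. rep z)" | z where "z \<in> V0" "e \<subseteq> rep z"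
        using E[OF \<open>e \<in> E\<close>] by (elim disjE bexE)
      then show "\<exists>i\<in>N. e \<subseteq> ?b i"
      proof cases
        case (1 e0)
        then obtain i where "i \<in> N" "e0 \<subseteq> b i" using edg by meson
        moreover have "(\<Union>z\<in>e0. rep z) \<subseteq> ?b i" using \<open>e0 \<subseteq> b i\<close> by (rule UN_mono) simp
        ultimately show ?thesis using 1(2) by (meson subset_trans)
      next
        case (2 z)
        then obtain i where "i \<in> N" "z \<in> b i" using ver by meson
        moreover have "rep z \<subseteq> ?b i" using \<open>z \<in> b i\<close> by auto
        ultimately show ?thesis using 2(2) by (meson subset_trans)
      qed
    qed
    show "\<forall>v\<in>V. \<forall>i\<in>N. \<forall>j\<in>N. v \<in> ?b i \<longrightarrow> v \<in> ?b j \<longrightarrow> (i, j) \<in> (?R v)\<^sup>*"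
    proof (intro ballI impI)
      fix v i j assume *: "v \<in> V" "i \<in> N" "j \<in> N" "v \<in> ?b i" "v \<in> ?b j"
      obtain i' where i': "i' \<in> N" "c v \<in> b i'" "(i, i') \<in> (?R v)\<^sup>*" using toc * by blast
      obtain j' where j': "j' \<in> N" "c v \<in> b j'" "(j, j') \<in> (?R v)\<^sup>*" using toc * by blast
      have "c v \<in> V0" "v \<in> rep (c v)" using c * bV by blast+
      then have "(i', j') \<in> (?R v)\<^sup>*" using con i' j' by blast
      then show "(i, j) \<in> (?R v)\<^sup>*" using i' j' by (meson nadj_conn_sym rtrancl_trans)
    qed
  qed
  fix i assume i: "i \<in> N"
  have fb: "finite (b i)" using bV[OF i] fin finite_subset by blast
  have "card (?b i) \<le> (\<Sum>z\<in>b i. card (rep z))" by (rule card_UN_le[OF fb])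
  also have "\<dots> \<le> (\<Sum>z\<in>b i. m)" using rep bV[OF i] by (intro sum_mono) auto
  also have "\<dots> \<le> w * m" using w[OF i] by simp
  finally show "card (?b i) \<le> w * m" .
qed

text \<open>The left ends of the pairs that cross the cut before position \<open>c\<close>. The
  largest size of such a set is the vertex separation number of the arrangement, which bounds the
  pathwidth.\<close>

definition cut_left :: "('a \<Rightarrow> 'a \<Rightarrow> bool) \<Rightarrow> 'a list \<Rightarrow> nat \<Rightarrow> 'a set" where
  "cut_left R xs c = {x \<in> set (take c xs). \<exists>y\<in>set (drop c xs). R x y}"

text \<open>The tree is a path, and the bag at position \<open>i\<close> is the cut there together
  with \<open>xs ! i\<close>, hence the \<open>+ 1\<close>. A vertex lies in the bags from its own
  position to that of its last neighbour on the right, which is an interval.\<close>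

lemma has_td_linear:
  assumes xs: "distinct xs" and sym: "\<And>x y. R x y \<Longrightarrow> R y x"
    and w: "\<And>c. card (cut_left R xs c) \<le> w"
  shows "has_td (set xs) {{x, y} | x y. x \<in> set xs \<and> y \<in> set xs \<and> R x y} (w + 1)"
proof (cases "xs = []")
  case True then show ?thesis by (simp add: has_td_empty)
next
  case False
  define n where "n = length xs"
  have n: "n > 0" using False by (simp add: n_def)
  define b where "b i = cut_left R xs i \<union> {xs ! i}" for i
  define p where "p i = i - (1::nat)" for i
  have inb: "xs ! j \<in> b i \<longleftrightarrow> i = j \<or> j < i \<and> (\<exists>m. i \<le> m \<and> m < n \<and> R (xs ! j) (xs ! m))"
    if "i < n" "j < n" for i j
  proof -
    have "xs ! j \<in> set (take i xs) \<longleftrightarrow> j < i"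
      using that xs by (auto simp: in_set_conv_nth n_def nth_eq_iff_index_eq)
    moreover have "(\<exists>y\<in>set (drop i xs). R (xs ! j) y) \<longleftrightarrow> (\<exists>m. i \<le> m \<and> m < n \<and> R (xs ! j) (xs ! m))"
    proof
      assume "\<exists>y\<in>set (drop i xs). R (xs ! j) y"
      then obtain m where "m < length xs - i" "R (xs ! j) (drop i xs ! m)" by (auto simp: in_set_conv_nth)
      then show "\<exists>m. i \<le> m \<and> m < n \<and> R (xs ! j) (xs ! m)"
        by (intro exI[of _ "i + m"]) (auto simp: n_def)
    next
      assume "\<exists>m. i \<le> m \<and> m < n \<and> R (xs ! j) (xs ! m)"
      then obtain m where m: "i \<le> m" "m < n" "R (xs ! j) (xs ! m)" by blast
      then have "xs ! m = drop i xs ! (m - i)" "m - i < length (drop i xs)" by (auto simp: n_def)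
      then show "\<exists>y\<in>set (drop i xs). R (xs ! j) y" using m by (metis nth_mem)
    qed
    moreover have "xs ! j = xs ! i \<longleftrightarrow> i = j" using that xs by (auto simp: n_def nth_eq_iff_index_eq)
    ultimately show ?thesis by (auto simp: b_def cut_left_def)
  qed
  show ?thesis
  proof (rule has_tdI)
    show "td (set xs) {{x, y} | x y. x \<in> set xs \<and> y \<in> set xs \<and> R x y} {..<n} 0 p id b"
      unfolding td_def
    proof (intro conjI)
      show "rtree {..<n} 0 p id" using n by (auto simp: rtree_def p_def)
      show "\<forall>i\<in>{..<n}. b i \<subseteq> set xs" by (auto simp: b_def cut_left_def n_def dest: in_set_takeD)
      show "\<forall>v\<in>set xs. \<exists>i\<in>{..<n}. v \<in> b i" by (auto simp: b_def in_set_conv_nth n_def)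
      show "\<forall>e\<in>{{x, y} | x y. x \<in> set xs \<and> y \<in> set xs \<and> R x y}. \<exists>i\<in>{..<n}. e \<subseteq> b i"
      proof
        fix e assume "e \<in> {{x, y} | x y. x \<in> set xs \<and> y \<in> set xs \<and> R x y}"
        then obtain i j where ij: "i < n" "j < n" "R (xs ! i) (xs ! j)" "e = {xs ! i, xs ! j}"
          by (auto simp: in_set_conv_nth n_def)
        have "R (xs ! j) (xs ! i)" using ij sym by blast
        then have "xs ! i \<in> b (max i j)" "xs ! j \<in> b (max i j)"
          using ij by (auto simp: inb max_def)
        then show "\<exists>i\<in>{..<n}. e \<subseteq> b i" using ij by (intro bexI[of _ "max i j"]) auto
      qed
      show "\<forall>v\<in>set xs. \<forall>i\<in>{..<n}. \<forall>j\<in>{..<n}. v \<in> b i \<longrightarrow> v \<in> b j \<longrightarrow>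
         (i, j) \<in> (restr_to {k. v \<in> b k} (nadj {..<n} 0 p))\<^sup>*"
      proof (intro ballI impI)
        fix v i j assume *: "v \<in> set xs" "i \<in> {..<n}" "j \<in> {..<n}" "v \<in> b i" "v \<in> b j"
        obtain a where a: "a < n" "v = xs ! a" using *(1) by (auto simp: in_set_conv_nth n_def)
        let ?R = "restr_to {k. v \<in> b k} (nadj {..<n} 0 p)"
        have down: "(i, a) \<in> ?R\<^sup>*" if "i < n" "v \<in> b i" for i
          using that
        proof (induction i)
          case 0 then show ?case using inb[of 0 a] a by auto
        next
          case (Suc i)
          show ?case
          proof (cases "Suc i = a")
            case False
            then have "a < Suc i" "\<exists>m. Suc i \<le> m \<and> m < n \<and> R (xs ! a) (xs ! m)"
              using Suc.prems inb[of "Suc i" a] a by auto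
            then have "v \<in> b i" using Suc.prems a by (subst a(2), subst inb) (auto intro: Suc_leD)
            moreover from this Suc.prems have "(Suc i, i) \<in> ?R"
              by (auto simp: restr_to_def nadj_def p_def)
            ultimately show ?thesis using Suc by (meson Suc_lessD converse_rtrancl_into_rtrancl)
          qed simp
        qed
        then show "(i, j) \<in> ?R\<^sup>*" using * by (meson lessThan_iff nadj_conn_sym rtrancl_trans)
      qed
    qed
    fix i assume "i \<in> {..<n}"
    have "card (b i) \<le> card (cut_left R xs i) + card {xs ! i}" unfolding b_def by (rule card_Un_le)
    then show "card (b i) \<le> w + 1" using w[of i] by simp
  qed
qed

section \<open>Orbits of permutations\<close>

definition orb :: "('d \<Rightarrow> 'd) \<Rightarrow> 'd \<Rightarrow> 'd set" where
  "orb f d = {(f ^^ k) d | k. True}"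

lemma orb_self [simp]: "d \<in> orb f d"
  unfolding orb_def by (auto intro: exI[of _ 0])

lemma orb_pow: "(f ^^ k) d \<in> orb f d"
  unfolding orb_def by blast

lemma orb_apply [simp]: "f d \<in> orb f d"
  using orb_pow[where k = 1] by simp

lemma orb_trans: "e \<in> orb f d \<Longrightarrow> g \<in> orb f e \<Longrightarrow> g \<in> orb f d"
  unfolding orb_def by (auto simp: funpow_add[symmetric, THEN fun_cong, simplified])

lemma orb_cong:
  assumes "\<And>e. e \<in> orb f d \<Longrightarrow> f e = g e"
  shows "orb f d = orb g d"
proof -
  have "(f ^^ k) d = (g ^^ k) d" for k
  proof (induction k)
    case (Suc k)
    have "f ((f ^^ k) d) = g ((f ^^ k) d)" by (rule assms) (rule orb_pow)
    then show ?case using Suc by simp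
  qed simp
  then show ?thesis by (simp add: orb_def)
qed

lemma orb_closed:
  assumes "\<And>e. e \<in> A \<Longrightarrow> f e \<in> A" "d \<in> A"
  shows "orb f d \<subseteq> A"
proof -
  have "(f ^^ k) d \<in> A" for k using assms by (induction k) auto
  then show ?thesis by (auto simp: orb_def)
qed

lemma bij_pow_in: "bij_betw f D D \<Longrightarrow> d \<in> D \<Longrightarrow> (f ^^ k) d \<in> D"
  by (induction k) (auto dest: bij_betwE)

lemma orb_return:
  assumes "finite D" "bij_betw f D D" "d \<in> D"
  shows "\<exists>n>0. (f ^^ n) d = d"
proof -
  have inD: "(f ^^ k) d \<in> D" for k using bij_pow_in[OF assms(2,3)] .
  have "\<not> inj_on (\<lambda>k. (f ^^ k) d) (UNIV :: nat set)"
  proof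
    assume "inj_on (\<lambda>k. (f ^^ k) d) (UNIV :: nat set)"
    moreover have "range (\<lambda>k. (f ^^ k) d) \<subseteq> D" using inD by auto
    ultimately show False using assms(1) finite_imageD finite_subset infinite_UNIV_nat by blast
  qed
  then obtain i j where ij: "i < j" "(f ^^ i) d = (f ^^ j) d"
    unfolding inj_on_def by (metis linorder_neqE_nat UNIV_I)
  have "(f ^^ (i - m)) d = (f ^^ (j - m)) d" if "m \<le> i" for m
    using that
  proof (induction m)
    case (Suc m)
    then have "f ((f ^^ (i - Suc m)) d) = f ((f ^^ (j - Suc m)) d)"
      using ij(1) by (metis Suc_diff_Suc Suc_le_lessD funpow.simps(2) less_trans o_apply Suc_leD)
    then show ?case using assms(2) inD by (metis bij_betw_def inj_on_def)
  qed (use ij in simp)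
  from this[of i] have "(f ^^ (j - i)) d = d" by simp
  then show ?thesis using ij(1) by (metis zero_less_diff)
qed

lemma orb_sym:
  assumes "finite D" "bij_betw f D D" "d \<in> D" "e \<in> orb f d"
  shows "d \<in> orb f e"
proof -
  obtain n where n: "n > 0" "(f ^^ n) d = d" using orb_return assms by metis
  obtain k where "e = (f ^^ k) d" using assms(4) by (auto simp: orb_def)
  then have e: "e = (f ^^ (k mod n)) d" using n funpow_mod_eq by metis
  have "(f ^^ (n - k mod n)) e = (f ^^ (n - k mod n + k mod n)) d" by (simp add: e funpow_add)
  also have "\<dots> = d" using n by (simp add: less_imp_le)
  finally show ?thesis using orb_pow by metis
qed

lemma orb_eq:
  assumes "finite D" "bij_betw f D D" "d \<in> D" "e \<in> orb f d"
  shows "orb f e = orb f d"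
  using orb_sym[OF assms] assms(4) orb_trans by (metis subsetI subset_antisym)

lemma orb_sub: "bij_betw f D D \<Longrightarrow> d \<in> D \<Longrightarrow> orb f d \<subseteq> D"
  by (rule orb_closed) (auto dest: bij_betwE)

lemma orb_swap_aux:
  assumes fin: "finite D" and f: "bij_betw f D D" and g: "bij_betw g D D"
    and xy: "x \<in> D" "y \<in> D"
    and eq: "\<And>d. d \<in> D \<Longrightarrow> d \<noteq> x \<Longrightarrow> d \<noteq> y \<Longrightarrow> g d = f d"
  shows "orb f ` {d \<in> D. x \<notin> orb f d \<and> y \<notin> orb f d} \<subseteq> orb g ` {d \<in> D. x \<notin> orb g d \<and> y \<notin> orb g d}"
proof
  fix Q assume "Q \<in> orb f ` {d \<in> D. x \<notin> orb f d \<and> y \<notin> orb f d}"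
  then obtain d where d: "d \<in> D" "x \<notin> orb f d" "y \<notin> orb f d" "Q = orb f d" by blast
  have "orb f d = orb g d"
  proof (rule orb_cong)
    fix e assume e: "e \<in> orb f d"
    then have "e \<in> D" "e \<noteq> x" "e \<noteq> y" using d orb_sub[OF f] by auto
    then show "f e = g e" using eq by simp
  qed
  then show "Q \<in> orb g ` {d \<in> D. x \<notin> orb g d \<and> y \<notin> orb g d}" using d by auto
qed

text \<open>\<open>g\<close> is \<open>f\<close> composed with the transposition of \<open>x\<close>
  and \<open>y\<close>, so orbits that avoid both are kept, and the others are merged or split. If
  \<open>x\<close> and \<open>y\<close> are in different orbits of \<open>g\<close>, they are in one
  orbit of \<open>f\<close>, and the number grows by exactly one.\<close>

lemma orb_swap:
  assumes fin: "finite D" and f: "bij_betw f D D" and g: "bij_betw g D D"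
    and xy: "x \<in> D" "y \<in> D" "x \<noteq> y" "g x = f y" "g y = f x"
    and eq: "\<And>d. d \<in> D \<Longrightarrow> d \<noteq> x \<Longrightarrow> d \<noteq> y \<Longrightarrow> g d = f d"
  shows "card (orb f ` D) \<le> card (orb g ` D) + 1"
    and "y \<notin> orb g x \<Longrightarrow> card (orb g ` D) = card (orb f ` D) + 1"
proof -
  define A where "A = orb f ` {d \<in> D. x \<notin> orb f d \<and> y \<notin> orb f d}"
  have A': "A = orb g ` {d \<in> D. x \<notin> orb g d \<and> y \<notin> orb g d}"
    unfolding A_def
  proof (rule subset_antisym)
    show "orb f ` {d \<in> D. x \<notin> orb f d \<and> y \<notin> orb f d} \<subseteq> orb g ` {d \<in> D. x \<notin> orb g d \<and> y \<notin> orb g d}"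
      by (rule orb_swap_aux[OF fin f g xy(1,2) eq])
    show "orb g ` {d \<in> D. x \<notin> orb g d \<and> y \<notin> orb g d} \<subseteq> orb f ` {d \<in> D. x \<notin> orb f d \<and> y \<notin> orb f d}"
      by (rule orb_swap_aux[OF fin g f xy(1,2)]) (simp add: eq)
  qed
  have finA: "finite A" using fin by (simp add: A_def)
  have decomp: "orb h ` D = orb h ` {d \<in> D. x \<notin> orb h d \<and> y \<notin> orb h d} \<union> {orb h x, orb h y}"
    if h: "bij_betw h D D" for h
  proof -
    have 1: "orb h d = orb h x" if "d \<in> D" "x \<in> orb h d" for d using orb_eq[OF fin h that] by simp
    have 2: "orb h d = orb h y" if "d \<in> D" "y \<in> orb h d" for d using orb_eq[OF fin h that] by simp
    show ?thesis
    proof (intro set_eqI iffI)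
      fix Q assume "Q \<in> orb h ` D"
      then obtain d where d: "d \<in> D" "Q = orb h d" by blast
      show "Q \<in> orb h ` {d \<in> D. x \<notin> orb h d \<and> y \<notin> orb h d} \<union> {orb h x, orb h y}"
        using 1[OF d(1)] 2[OF d(1)] d by (cases "x \<in> orb h d"; cases "y \<in> orb h d") simp_all
    qed (use xy in auto)
  qed
  have notin: "orb h x \<notin> orb h ` {d \<in> D. x \<notin> orb h d \<and> y \<notin> orb h d}"
    "orb h y \<notin> orb h ` {d \<in> D. x \<notin> orb h d \<and> y \<notin> orb h d}" for h
    using orb_self[of x h] orb_self[of y h] by blast+
  have Df: "orb f ` D = A \<union> {orb f x, orb f y}" using decomp[OF f] by (simp add: A_def)
  have Dg: "orb g ` D = A \<union> {orb g x, orb g y}" using decomp[OF g] by (simp add: A')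
  have nf: "orb f x \<notin> A" "orb f y \<notin> A" using notin[of f] by (auto simp: A_def)
  have ng: "orb g x \<notin> A" "orb g y \<notin> A" using notin[of g] by (auto simp: A')
  have "card {orb f x, orb f y} \<le> 2" by (simp add: card_insert_if)
  then have "card (orb f ` D) \<le> card A + 2"
    unfolding Df using card_Un_le[of A "{orb f x, orb f y}"] by linarith
  moreover have "card (orb g ` D) \<ge> card A + 1"
  proof -
    have "card (insert (orb g x) A) \<le> card (orb g ` D)" unfolding Dg using finA by (intro card_mono) auto
    then show ?thesis using ng finA by simp
  qed
  ultimately show "card (orb f ` D) \<le> card (orb g ` D) + 1" by simp
  assume y: "y \<notin> orb g x"
  then have "x \<notin> orb g y" using orb_sym[OF fin g] xy by metis
  then have ne: "orb g x \<noteq> orb g y" using y by (metis orb_self)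
  have "y \<in> orb f x"
  proof -
    \<comment> \<open>The return time of \<open>y\<close> under \<open>g\<close>. Started at
      \<open>x\<close>, \<open>f\<close> makes the first \<open>g\<close>-step of \<open>y\<close>
      and then follows the \<open>g\<close>-orbit of \<open>y\<close>, which avoids
      \<open>x\<close>, until it arrives at \<open>y\<close>.\<close>
    define n where "n = (LEAST n. n > 0 \<and> (g ^^ n) y = y)"
    have "\<exists>n. n > 0 \<and> (g ^^ n) y = y" using orb_return[OF fin g xy(2)] by blast
    then have n: "n > 0" "(g ^^ n) y = y" unfolding n_def by (metis (mono_tags, lifting) LeastI)+
    have least: "(g ^^ k) y \<noteq> y" if "0 < k" "k < n" for k
      using that not_less_Least[of k "\<lambda>n. n > 0 \<and> (g ^^ n) y = y"] by (auto simp: n_def)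
    have "(f ^^ Suc k) x = (g ^^ Suc k) y" if "k < n" for k
      using that
    proof (induction k)
      case 0 then show ?case using xy by simp
    next
      case (Suc k)
      let ?e = "(g ^^ Suc k) y"
      have "?e \<in> D" using bij_pow_in[OF g xy(2)] .
      moreover have "?e \<noteq> y" using least Suc.prems by blast
      moreover have "?e \<noteq> x" using \<open>x \<notin> orb g y\<close> orb_pow by metis
      ultimately have "g ?e = f ?e" using eq by blast
      moreover have "(f ^^ Suc k) x = ?e" using Suc by simp
      ultimately show ?case by (metis funpow.simps(2) o_apply)
    qed
    from this[of "n - 1"] n have "(f ^^ n) x = y" by simp
    then show ?thesis using orb_pow by metis
  qed
  then have "orb f y = orb f x" using orb_eq[OF fin f xy(1)] by metis
  then have "card (orb f ` D) = card A + 1" unfolding Df using nf finA by simp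
  moreover have "card (orb g ` D) = card A + 2" unfolding Dg using ng ne finA by simp
  ultimately show "card (orb g ` D) = card (orb f ` D) + 1" by simp
qed

section \<open>Connected components\<close>

definition classes :: "'v set \<Rightarrow> ('v \<times> 'v) set \<Rightarrow> 'v set set" where
  "classes V R = (\<lambda>v. R\<^sup>* `` {v}) ` V"

lemma sym_rtrancl_class_eq:
  assumes "sym R"
  shows "R\<^sup>* `` {v} = R\<^sup>* `` {w} \<longleftrightarrow> (v, w) \<in> R\<^sup>*"
  using sym_rtrancl[OF assms] by (auto dest: symD intro: rtrancl_trans)

text \<open>A walk that needs the new edge starts and ends in the classes of \<open>a\<close> and
  \<open>b\<close>. Two classes other than that of \<open>b\<close> therefore cannot merge, so at
  most one class disappears.\<close>

lemma classes_insert_edge: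
  assumes fin: "finite V" and sym: "sym R" and R': "R' = R \<union> {(a, b), (b, a)}"
  shows "card (classes V R) \<le> card (classes V R') + 1"
    and "(a, b) \<in> R\<^sup>* \<Longrightarrow> classes V R = classes V R'"
proof -
  have sub: "R\<^sup>* \<subseteq> R'\<^sup>*" by (rule rtrancl_mono) (auto simp: R')
  have key: "(v, u) \<in> R\<^sup>* \<or> ((v, a) \<in> R\<^sup>* \<or> (v, b) \<in> R\<^sup>*) \<and> ((a, u) \<in> R\<^sup>* \<or> (b, u) \<in> R\<^sup>*)"
    if "(v, u) \<in> R'\<^sup>*" for v u
    using that
  proof (induction)
    case (step y z)
    from step(2) consider "(y, z) \<in> R" | "y = a" "z = b" | "y = b" "z = a" by (auto simp: R')
    then show ?case
    proof cases
      case 1 then show ?thesis using step.IH by (meson rtrancl.rtrancl_into_rtrancl)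
    qed (use step.IH in auto)
  qed simp
  have symt: "(x, y) \<in> R\<^sup>* \<Longrightarrow> (y, x) \<in> R\<^sup>*" for x y using sym_rtrancl[OF sym] by (auto dest: symD)
  define C where "C = (\<lambda>v. R\<^sup>* `` {v}) ` {v \<in> V. (v, b) \<notin> R\<^sup>*}"
  have "classes V R \<subseteq> insert (R\<^sup>* `` {b}) C"
    unfolding classes_def C_def using sym_rtrancl_class_eq[OF sym] by auto
  then have "card (classes V R) \<le> card (insert (R\<^sup>* `` {b}) C)"
    using fin by (intro card_mono) (auto simp: C_def)
  also have "\<dots> \<le> card C + 1" by (simp add: card_insert_le_m1 card_insert_if fin C_def)
  also have "card C \<le> card (classes V R')"
  proof (rule card_inj_on_le)
    show "inj_on (\<lambda>K. R'\<^sup>* `` K) C"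
    proof (rule inj_onI)
      fix K L assume "K \<in> C" "L \<in> C" and eq: "R'\<^sup>* `` K = R'\<^sup>* `` L"
      then obtain v w where v: "K = R\<^sup>* `` {v}" "(v, b) \<notin> R\<^sup>*" and w: "L = R\<^sup>* `` {w}" "(w, b) \<notin> R\<^sup>*"
        by (auto simp: C_def)
      have "v \<in> R'\<^sup>* `` L" using eq v by blast
      then have "(w, v) \<in> R'\<^sup>*" using w sub by (auto intro: rtrancl_trans)
      then have "(w, v) \<in> R\<^sup>*" using key[of w v] v w symt by (meson rtrancl_trans)
      then show "K = L" using v w sym_rtrancl_class_eq[OF sym] by metis
    qed
    show "(\<lambda>K. R'\<^sup>* `` K) ` C \<subseteq> classes V R'"
    proof -
      have "R'\<^sup>* `` (R\<^sup>* `` {v}) = R'\<^sup>* `` {v}" for v using sub by (auto intro: rtrancl_trans)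
      then show ?thesis by (auto simp: C_def classes_def)
    qed
    show "finite (classes V R')" using fin by (simp add: classes_def)
  qed
  finally show "card (classes V R) \<le> card (classes V R') + 1" by simp
  assume ab: "(a, b) \<in> R\<^sup>*"
  have "R' \<subseteq> R\<^sup>*" using ab symt by (auto simp: R')
  then have "R'\<^sup>* = R\<^sup>*" using sub by (metis rtrancl_subset_rtrancl subset_antisym)
  then show "classes V R = classes V R'" by (simp add: classes_def)
qed

section \<open>Combinatorial maps with stubs\<close>

text \<open>A dart fixed by \<open>\<alpha>\<close> is a stub: deleting an edge turns its two darts into stubs, so that
  the dart set and the rotation \<open>\<sigma>\<close> never have to be changed.\<close>

locale cmap =
  fixes D :: "'d set" and \<sigma> \<alpha> :: "'d \<Rightarrow> 'd" and vt :: "'d \<Rightarrow> 'v"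
  assumes finD: "finite D" and bij\<sigma>: "bij_betw \<sigma> D D" and vt\<sigma>: "\<And>d. d \<in> D \<Longrightarrow> vt (\<sigma> d) = vt d"
    and trans\<sigma>: "\<And>d d'. d \<in> D \<Longrightarrow> d' \<in> D \<Longrightarrow> vt d = vt d' \<Longrightarrow> d' \<in> orb \<sigma> d"
    and \<alpha>D: "\<And>d. d \<in> D \<Longrightarrow> \<alpha> d \<in> D" and \<alpha>\<alpha>: "\<And>d. d \<in> D \<Longrightarrow> \<alpha> (\<alpha> d) = d"

definition restr :: "('d \<Rightarrow> 'd) \<Rightarrow> 'd set \<Rightarrow> 'd \<Rightarrow> 'd" where
  "restr \<alpha> X d = (if d \<in> X then \<alpha> d else d)"

definition fcs :: "'d set \<Rightarrow> ('d \<Rightarrow> 'd) \<Rightarrow> ('d \<Rightarrow> 'd) \<Rightarrow> 'd set set" where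
  "fcs D \<sigma> \<alpha> = orb (\<lambda>d. \<sigma> (\<alpha> d)) ` D"

definition erel :: "('d \<Rightarrow> 'd) \<Rightarrow> ('d \<Rightarrow> 'v) \<Rightarrow> 'd set \<Rightarrow> ('v \<times> 'v) set" where
  "erel \<alpha> vt X = {(vt d, vt (\<alpha> d)) | d. d \<in> X}"

definition egs :: "('d \<Rightarrow> 'd) \<Rightarrow> 'd set \<Rightarrow> 'd set set" where
  "egs \<alpha> X = {{d, \<alpha> d} | d. d \<in> X \<and> \<alpha> d \<noteq> d}"

context cmap begin

lemma \<sigma>D: "d \<in> D \<Longrightarrow> \<sigma> d \<in> D"
  using bij\<sigma> by (auto dest: bij_betwE)

lemma bij_restr:
  assumes "X \<subseteq> D" "\<And>d. d \<in> X \<Longrightarrow> \<alpha> d \<in> X"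
  shows "bij_betw (restr \<alpha> X) D D"
  by (rule bij_betw_byWitness[where f' = "restr \<alpha> X"]) (use assms \<alpha>D \<alpha>\<alpha> in \<open>auto simp: restr_def\<close>)

lemma bij_phi:
  assumes "X \<subseteq> D" "\<And>d. d \<in> X \<Longrightarrow> \<alpha> d \<in> X"
  shows "bij_betw (\<lambda>d. \<sigma> (restr \<alpha> X d)) D D"
  using bij_betw_trans[OF bij_restr[OF assms] bij\<sigma>] by (simp add: o_def)

lemma bij_phi0: "bij_betw (\<lambda>d. \<sigma> (\<alpha> d)) D D"
proof -
  have "bij_betw \<alpha> D D"
    by (rule bij_betw_byWitness[where f' = \<alpha>]) (use \<alpha>D \<alpha>\<alpha> in auto)
  from bij_betw_trans[OF this bij\<sigma>] show ?thesis by (simp add: o_def)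
qed

lemma sym_erel:
  assumes "X \<subseteq> D" "\<And>d. d \<in> X \<Longrightarrow> \<alpha> d \<in> X"
  shows "sym (erel \<alpha> vt X)"
proof (rule symI)
  fix a b assume "(a, b) \<in> erel \<alpha> vt X"
  then obtain d where "d \<in> X" "a = vt d" "b = vt (\<alpha> d)" by (auto simp: erel_def)
  then show "(b, a) \<in> erel \<alpha> vt X" using assms \<alpha>\<alpha> unfolding erel_def
    by (intro CollectI exI[of _ "\<alpha> d"]) auto
qed

lemma face_in_class:
  assumes "X \<subseteq> D" "\<And>d. d \<in> X \<Longrightarrow> \<alpha> d \<in> X" "d \<in> D" "e \<in> orb (\<lambda>d. \<sigma> (restr \<alpha> X d)) d"
  shows "(vt d, vt e) \<in> (erel \<alpha> vt X)\<^sup>*"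
proof -
  have "orb (\<lambda>d. \<sigma> (restr \<alpha> X d)) d \<subseteq> {e \<in> D. (vt d, vt e) \<in> (erel \<alpha> vt X)\<^sup>*}"
  proof (rule orb_closed)
    fix e assume e: "e \<in> {e \<in> D. (vt d, vt e) \<in> (erel \<alpha> vt X)\<^sup>*}"
    have "(vt e, vt (restr \<alpha> X e)) \<in> (erel \<alpha> vt X)\<^sup>*" by (auto simp: restr_def erel_def)
    moreover have "restr \<alpha> X e \<in> D" using e \<alpha>D by (auto simp: restr_def)
    ultimately show "\<sigma> (restr \<alpha> X e) \<in> {e \<in> D. (vt d, vt e) \<in> (erel \<alpha> vt X)\<^sup>*}"
      using e \<sigma>D vt\<sigma> by (auto intro: rtrancl_trans)
  qed (use assms in auto)
  then show ?thesis using assms(4) by auto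
qed

text \<open>Twice the genus, \<open>2c - |V| + |E| - |F|\<close>, does not grow when an edge is
  deleted. If its ends stay connected, the components are the same and at most one face is lost; if
  it is a bridge, its two darts lie in one face, which splits and makes up for the new component.
  The vertices do not change, because the darts stay behind as stubs.\<close>

lemma delete_edge:
  assumes X: "X \<subseteq> D" "\<And>d. d \<in> X \<Longrightarrow> \<alpha> d \<in> X" and x: "x \<in> X" "\<alpha> x \<noteq> x" and X': "X' = X - {x, \<alpha> x}"
  shows "2 * card (classes (vt ` D) (erel \<alpha> vt X')) + card (egs \<alpha> X') + card (fcs D \<sigma> (restr \<alpha> X))
    \<le> 2 * card (classes (vt ` D) (erel \<alpha> vt X)) + card (egs \<alpha> X) + card (fcs D \<sigma> (restr \<alpha> X'))"
proof -
  define y where "y = \<alpha> x"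
  have xD: "x \<in> D" "y \<in> D" "y \<in> X" "\<alpha> y = x" "x \<noteq> y" using X x \<alpha>\<alpha> by (auto simp: y_def)
  have X'c: "X' \<subseteq> D" "\<alpha> d \<in> X'" if "d \<in> X'" for d
  proof -
    show "X' \<subseteq> D" using X(1) X' by blast
    have "\<alpha> d \<in> X" "\<alpha> (\<alpha> d) = d" using that X X' \<alpha>\<alpha> by auto
    then show "\<alpha> d \<in> X'" using that X' xD by (auto simp: y_def)
  qed
  have X'D: "X' \<subseteq> D" using X X' by auto
  have egs: "egs \<alpha> X = insert {x, y} (egs \<alpha> X')"
  proof (intro set_eqI iffI)
    fix e assume "e \<in> egs \<alpha> X"
    then obtain d where d: "d \<in> X" "\<alpha> d \<noteq> d" "e = {d, \<alpha> d}" unfolding egs_def by blast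
    show "e \<in> insert {x, y} (egs \<alpha> X')"
    proof (cases "d \<in> {x, y}")
      case True
      then have "e = {x, y}" using d(3) xD(4) by (elim insertE emptyE) (simp_all add: y_def[symmetric] insert_commute)
      then show ?thesis by simp
    next
      case False
      then have "d \<in> X'" using d(1) by (simp add: X' y_def)
      then show ?thesis using d unfolding egs_def by blast
    qed
  next
    fix e assume "e \<in> insert {x, y} (egs \<alpha> X')"
    then show "e \<in> egs \<alpha> X"
    proof
      assume "e = {x, y}"
      then show ?thesis using x unfolding egs_def y_def by blast
    next
      assume "e \<in> egs \<alpha> X'"
      then show ?thesis unfolding egs_def X' by blast
    qed
  qed
  have nin: "{x, y} \<notin> egs \<alpha> X'"
  proof
    assume "{x, y} \<in> egs \<alpha> X'"
    then obtain d where "d \<in> X'" "{x, y} = {d, \<alpha> d}" unfolding egs_def by blast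
    then show False by (auto simp: X' y_def)
  qed
  have "finite (egs \<alpha> X')"
  proof -
    have "egs \<alpha> X' \<subseteq> (\<lambda>d. {d, \<alpha> d}) ` D" using X'D by (auto simp: egs_def)
    then show ?thesis using finD finite_surj by blast
  qed
  then have ce: "card (egs \<alpha> X) = card (egs \<alpha> X') + 1" using egs nin by simp
  have er: "erel \<alpha> vt X = erel \<alpha> vt X' \<union> {(vt x, vt y), (vt y, vt x)}"
  proof (intro set_eqI iffI)
    fix e assume "e \<in> erel \<alpha> vt X"
    then obtain d where d: "d \<in> X" "e = (vt d, vt (\<alpha> d))" unfolding erel_def by blast
    consider "d = x" | "d = y" | "d \<in> X'" using d(1) by (auto simp: X' y_def)
    then show "e \<in> erel \<alpha> vt X' \<union> {(vt x, vt y), (vt y, vt x)}"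
      by cases (use d xD(4) in \<open>auto simp: erel_def y_def\<close>)
  next
    fix e assume "e \<in> erel \<alpha> vt X' \<union> {(vt x, vt y), (vt y, vt x)}"
    then consider "e \<in> erel \<alpha> vt X'" | "e = (vt x, vt (\<alpha> x))" | "e = (vt y, vt (\<alpha> y))"
      using xD(4) by (auto simp: y_def)
    then show "e \<in> erel \<alpha> vt X" by cases (use x(1) xD(3) in \<open>auto simp: erel_def X'\<close>)
  qed
  have fV: "finite (vt ` D)" using finD by simp
  have sX': "sym (erel \<alpha> vt X')" using sym_erel[OF X'D] X'c by blast
  note cl = classes_insert_edge[OF fV sX' er]
  let ?f = "\<lambda>d. \<sigma> (restr \<alpha> X d)" and ?g = "\<lambda>d. \<sigma> (restr \<alpha> X' d)"
  have f: "bij_betw ?f D D" using bij_phi[OF X] .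
  have g: "bij_betw ?g D D" using bij_phi[OF X'D] X'c by blast
  have e1: "?g x = ?f y" "?g y = ?f x" using x xD by (auto simp: restr_def X' y_def[symmetric])
  have e2: "?g d = ?f d" if "d \<noteq> x" "d \<noteq> y" for d using that by (auto simp: restr_def X' y_def)
  note sw = orb_swap[OF finD f g xD(1,2,5) e1 e2]
  have c1: "card (fcs D \<sigma> (restr \<alpha> X)) \<le> card (fcs D \<sigma> (restr \<alpha> X')) + 1"
    using sw(1) by (simp add: fcs_def)
  show ?thesis
  proof (cases "(vt x, vt y) \<in> (erel \<alpha> vt X')\<^sup>*")
    case True
    then show ?thesis using cl(2) c1 ce by simp
  next
    case False
    then have "y \<notin> orb ?g x" using face_in_class[OF X'D X'c(2) xD(1)] by blast
    then have "card (fcs D \<sigma> (restr \<alpha> X')) = card (fcs D \<sigma> (restr \<alpha> X)) + 1"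
      using sw(2) by (simp add: fcs_def)
    then show ?thesis using cl(1) ce by simp
  qed
qed

lemma delete_edges:
  assumes "X \<subseteq> D" "\<And>d. d \<in> X \<Longrightarrow> \<alpha> d \<in> X" "X' \<subseteq> X" "\<And>d. d \<in> X' \<Longrightarrow> \<alpha> d \<in> X'"
    "\<And>d. d \<in> X \<Longrightarrow> \<alpha> d \<noteq> d"
  shows "2 * card (classes (vt ` D) (erel \<alpha> vt X')) + card (egs \<alpha> X') + card (fcs D \<sigma> (restr \<alpha> X))
    \<le> 2 * card (classes (vt ` D) (erel \<alpha> vt X)) + card (egs \<alpha> X) + card (fcs D \<sigma> (restr \<alpha> X'))"
  using assms
proof (induction "card (X - X')" arbitrary: X rule: less_induct)
  case less
  show ?case
  proof (cases "X = X'")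
    case False
    then obtain x where x: "x \<in> X" "x \<notin> X'" using less.prems by auto
    define Y where "Y = X - {x, \<alpha> x}"
    have ax: "\<alpha> x \<notin> X'" using x less.prems \<alpha>\<alpha> by (metis subsetD)
    have Y: "Y \<subseteq> D" "X' \<subseteq> Y" using less.prems x ax by (auto simp: Y_def)
    have Yc: "\<alpha> d \<in> Y" if "d \<in> Y" for d
      using that less.prems(1,2) \<alpha>\<alpha> x(1) unfolding Y_def by (metis DiffD1 DiffD2 DiffI insert_iff singletonD subsetD)
    have "finite X" using less.prems finD finite_subset by blast
    then have "card (Y - X') < card (X - X')" using x by (intro psubset_card_mono) (auto simp: Y_def)
    from less.hyps[OF this Y(1) Yc Y(2)] less.prems
    have "2 * card (classes (vt ` D) (erel \<alpha> vt X')) + card (egs \<alpha> X') + card (fcs D \<sigma> (restr \<alpha> Y))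
      \<le> 2 * card (classes (vt ` D) (erel \<alpha> vt Y)) + card (egs \<alpha> Y) + card (fcs D \<sigma> (restr \<alpha> X'))"
      by (auto simp: Y_def)
    moreover have "2 * card (classes (vt ` D) (erel \<alpha> vt Y)) + card (egs \<alpha> Y) + card (fcs D \<sigma> (restr \<alpha> X))
      \<le> 2 * card (classes (vt ` D) (erel \<alpha> vt X)) + card (egs \<alpha> X) + card (fcs D \<sigma> (restr \<alpha> Y))"
      using less.prems x by (intro delete_edge) (auto simp: Y_def)
    ultimately show ?thesis by simp
  qed simp
qed

end

text \<open>Walking around a subtree: at the end of the tour one is back at the edge leading to its root.\<close>

lemma (in cmap) tree_tour:
  fixes rk :: "'v \<Rightarrow> nat" and Q :: "('d \<times> 'd) set"
  assumes pd: "\<And>v. v \<in> vt ` D \<Longrightarrow> v \<notin> rts \<Longrightarrow> pd v \<in> D \<and> vt (pd v) = v \<and> rk (vt (\<alpha> (pd v))) < rk v"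
    and TD: "TD = {d. \<exists>v\<in>vt ` D - rts. d = pd v \<or> d = \<alpha> (pd v)}"
    and W: "W \<subseteq> vt ` D" "\<And>v. v \<in> vt ` D - rts \<Longrightarrow> vt (\<alpha> (pd v)) \<in> W \<Longrightarrow> v \<in> W"
    and Q: "sym Q" "trans Q" "\<And>d. d \<in> D \<Longrightarrow> (d, d) \<in> Q"
    and Q1: "\<And>d. d \<in> D \<Longrightarrow> vt d \<in> W \<Longrightarrow> d \<notin> TD \<Longrightarrow> (d, \<sigma> d) \<in> Q"
    and Q2: "\<And>d. d \<in> D \<Longrightarrow> vt d \<in> W \<Longrightarrow> d \<in> TD \<Longrightarrow> (\<alpha> d, \<sigma> d) \<in> Q"
    and w: "w \<in> W"
  shows "\<And>d d'. d \<in> D \<Longrightarrow> d' \<in> D \<Longrightarrow> vt d = w \<Longrightarrow> vt d' = w \<Longrightarrow> (d, d') \<in> Q"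
    and "w \<notin> rts \<Longrightarrow> (pd w, \<alpha> (pd w)) \<in> Q"
proof -
  \<comment> \<open>Ranks grow away from the roots, so induction on \<open>N - rk w\<close> treats
    children before their parent.\<close>
  define N where "N = Max (rk ` vt ` D)"
  have N: "rk v \<le> N" if "v \<in> vt ` D" for v using that finD by (auto simp: N_def)
  have "(\<forall>d d'. d \<in> D \<longrightarrow> d' \<in> D \<longrightarrow> vt d = w \<longrightarrow> vt d' = w \<longrightarrow> (d, d') \<in> Q) \<and> (w \<notin> rts \<longrightarrow> (pd w, \<alpha> (pd w)) \<in> Q)"
    using w
  proof (induction "N - rk w" arbitrary: w rule: less_induct)
    case less
    have wV: "w \<in> vt ` D" using less.prems W by auto
    \<comment> \<open>If \<open>d\<close> leads to a child \<open>v\<close>, the tour around the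
      subtree of \<open>v\<close> links \<open>pd v\<close> to \<open>\<alpha> (pd v) = d\<close>,
      and \<open>Q2\<close> continues from \<open>pd v\<close> to \<open>\<sigma> d\<close>.\<close>
    have step: "(d, \<sigma> d) \<in> Q" if d: "d \<in> D" "vt d = w" "w \<notin> rts \<longrightarrow> d \<noteq> pd w" for d
    proof (cases "d \<in> TD")
      case False then show ?thesis using Q1 d less.prems by blast
    next
      case True
      then obtain v where v: "v \<in> vt ` D" "v \<notin> rts" "d = pd v \<or> d = \<alpha> (pd v)" by (auto simp: TD)
      have "d \<noteq> pd v" using v d pd by auto
      then have da: "d = \<alpha> (pd v)" using v by blast
      then have "vt (\<alpha> (pd v)) = w" using d by simp
      then have vW: "v \<in> W" and rk: "rk w < rk v" using W(2) v less.prems pd[OF v(1,2)] by auto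
      have "N - rk v < N - rk w" using rk N[OF v(1)] by simp
      from less.hyps[OF this vW] have "(pd v, \<alpha> (pd v)) \<in> Q" using v(2) by blast
      then have "(pd v, d) \<in> Q" using da by simp
      moreover have "\<alpha> d = pd v" using da pd[OF v(1,2)] \<alpha>\<alpha> by simp
      moreover have "(\<alpha> d, \<sigma> d) \<in> Q" using Q2 d True less.prems by blast
      ultimately show ?thesis using Q by (metis symD transD)
    qed
    show ?case
    proof (cases "w \<in> rts")
      case True
      have "(d, (\<sigma> ^^ k) d) \<in> Q \<and> (\<sigma> ^^ k) d \<in> D \<and> vt ((\<sigma> ^^ k) d) = w" if "d \<in> D" "vt d = w" for d k
      proof (induction k)
        case (Suc k)
        then show ?case using step[of "(\<sigma> ^^ k) d"] True Q(2) \<sigma>D vt\<sigma> by (auto dest: transD)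
      qed (use that Q in auto)
      then show ?thesis using trans\<sigma> True unfolding orb_def by fastforce
    next
      case False
      note p = pd[OF wV False]
      have toP: "(d, pd w) \<in> Q" if d: "d \<in> D" "vt d = w" for d
      proof -
        have ex: "\<exists>k. (\<sigma> ^^ k) d = pd w" using trans\<sigma>[OF d(1), of "pd w"] p d by (auto simp: orb_def)
        define k where "k = (LEAST k. (\<sigma> ^^ k) d = pd w)"
        have k: "(\<sigma> ^^ k) d = pd w" unfolding k_def using ex by (rule LeastI_ex)
        have "(d, (\<sigma> ^^ j) d) \<in> Q \<and> (\<sigma> ^^ j) d \<in> D \<and> vt ((\<sigma> ^^ j) d) = w" if "j \<le> k" for j
          using that
        proof (induction j)
          case (Suc j)
          then have "(\<sigma> ^^ j) d \<noteq> pd w" using not_less_Least[of j] unfolding k_def by (metis Suc_le_lessD)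
          then show ?case using step[of "(\<sigma> ^^ j) d"] Suc Q(2) \<sigma>D vt\<sigma> by (auto dest: transD)
        qed (use d Q in auto)
        from this[of k] k show ?thesis by simp
      qed
      have "pd w \<in> TD" using wV False by (auto simp: TD)
      then have "(\<alpha> (pd w), \<sigma> (pd w)) \<in> Q" using Q2 p less.prems by simp
      moreover have "(\<sigma> (pd w), pd w) \<in> Q" using toP \<sigma>D vt\<sigma> p by simp
      ultimately have "(pd w, \<alpha> (pd w)) \<in> Q" using Q by (metis symD transD)
      moreover have "(d, d') \<in> Q" if "d \<in> D" "d' \<in> D" "vt d = w" "vt d' = w" for d d'
        using toP[of d] toP[of d'] that Q by (metis symD transD)
      ultimately show ?thesis by blast
    qed
  qed
  then show "\<And>d d'. d \<in> D \<Longrightarrow> d' \<in> D \<Longrightarrow> vt d = w \<Longrightarrow> vt d' = w \<Longrightarrow> (d, d') \<in> Q"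
    and "w \<notin> rts \<Longrightarrow> (pd w, \<alpha> (pd w)) \<in> Q" by blast+
qed

text \<open>\<open>rk\<close> is the distance from \<open>r\<close>. The last clause turns its
  values into layers that no edge can skip.\<close>

lemma bfs_tree:
  assumes reach: "\<And>v. v \<in> W \<Longrightarrow> (r, v) \<in> R\<^sup>*" and R: "R \<subseteq> W \<times> W"
  obtains pa and rk :: "'a \<Rightarrow> nat" where "rk r = 0"
    "\<And>v. v \<in> W \<Longrightarrow> v \<noteq> r \<Longrightarrow> pa v \<in> W \<and> (pa v, v) \<in> R \<and> rk v = Suc (rk (pa v))"
    "\<And>u v. (u, v) \<in> R \<Longrightarrow> rk v \<le> Suc (rk u)"
proof -
  define rk where "rk v = (LEAST n. (r, v) \<in> R ^^ n)" for v
  have le: "rk v \<le> n" if "(r, v) \<in> R ^^ n" for v n unfolding rk_def using that by (rule Least_le)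
  have ex: "(r, v) \<in> R ^^ rk v" if v: "v \<in> W" for v
    unfolding rk_def using rtrancl_imp_relpow[OF reach[OF v]] by (rule LeastI_ex)
  have r0: "rk r = 0" using le[of r 0] by simp
  have step: "rk v \<le> Suc (rk u)" if "(u, v) \<in> R" for u v
  proof -
    have "u \<in> W" using that R by auto
    then have "(r, v) \<in> R ^^ Suc (rk u)" using ex that by auto
    then show ?thesis by (rule le)
  qed
  have "\<exists>u. u \<in> W \<and> (u, v) \<in> R \<and> rk v = Suc (rk u)" if v: "v \<in> W" "v \<noteq> r" for v
  proof (cases "rk v")
    case 0 then show ?thesis using ex[OF v(1)] v by simp
  next
    case (Suc n)
    then obtain u where u: "(r, u) \<in> R ^^ n" "(u, v) \<in> R" using ex[OF v(1)] by auto
    then have "rk u \<le> n" "rk v \<le> Suc (rk u)" using le step by auto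
    then show ?thesis using u Suc R by (intro exI[of _ u]) auto
  qed
  then obtain pa where "\<And>v. v \<in> W \<Longrightarrow> v \<noteq> r \<Longrightarrow> pa v \<in> W \<and> (pa v, v) \<in> R \<and> rk v = Suc (rk (pa v))"
    by metis
  then show thesis using that r0 step by blast
qed

section \<open>Rotation systems\<close>

lemma cyclic_perm_exists:
  assumes "finite N"
  shows "\<exists>f. bij_betw f N N \<and> (\<forall>x\<in>N. \<forall>y\<in>N. \<exists>k. (f ^^ k) x = y)"
proof (cases "N = {}")
  case True then show ?thesis by (intro exI[of _ id]) auto
next
  case False
  define n where "n = card N"
  have n: "n > 0" using False assms by (simp add: n_def card_gt_0_iff)
  obtain h where h: "bij_betw h {0..<n} N" unfolding n_def using ex_bij_betw_nat_finite[OF assms] by blast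
  define g where "g = inv_into {0..<n} h"
  have gh: "g (h i) = i" if "i < n" for i unfolding g_def using h that by (simp add: bij_betw_inv_into_left)
  have hN: "h i \<in> N" if "i < n" for i using h that by (auto dest: bij_betwE)
  have surj: "\<exists>i<n. x = h i" if "x \<in> N" for x using h that unfolding bij_betw_def by fastforce
  define f where "f x = h ((g x + 1) mod n)" for x
  have fk: "(f ^^ k) (h i) = h ((i + k) mod n)" if "i < n" for i k
  proof (induction k)
    case (Suc k)
    then show ?case using n by (simp add: f_def gh mod_Suc_eq)
  qed (use that in simp)
  have tr: "\<exists>k. (f ^^ k) x = y" if xy: "x \<in> N" "y \<in> N" for x y
  proof -
    obtain i j where ij: "i < n" "x = h i" "j < n" "y = h j" using surj xy by metis
    have "(f ^^ (j + (n - i))) x = h ((i + (j + (n - i))) mod n)" using fk ij by simp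
    also have "i + (j + (n - i)) = j + n" using ij by simp
    finally show ?thesis using ij by auto
  qed
  have fN: "f x \<in> N" if "x \<in> N" for x unfolding f_def using hN n by simp
  have "N \<subseteq> f ` N"
  proof
    fix y assume y: "y \<in> N"
    obtain k where k: "(f ^^ k) (f y) = y" using tr[OF fN[OF y] y] by blast
    have "(f ^^ k) y \<in> N" using y fN by (induction k) auto
    moreover have "f ((f ^^ k) y) = y" using k by (metis funpow_swap1)
    ultimately show "y \<in> f ` N" by (metis image_eqI)
  qed
  then have "f ` N = N" using fN by auto
  then have "bij_betw f N N" using assms by (simp add: bij_betw_def eq_card_imp_inj_on)
  then show ?thesis using tr by blast
qed

text \<open>By \<open>cyclic_perm_exists\<close> the \<open>LEAST\<close> in \<open>genus\<close> is
  attained. The formula there is halved with rounding down, which costs at most one; hence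
  \<open>2 * genus E + 1\<close> takes the place of twice the genus from here on.\<close>

lemma genus_rotation:
  assumes fin: "finite E" and E2: "\<And>e. e \<in> E \<Longrightarrow> \<exists>u v. e = {u, v}"
  obtains rho where "is_rotation_system E rho"
    "2 * card (comps E) + card E \<le> card (\<Union>E) + card (faces E rho) + (2 * genus E + 1)"
proof -
  have "finite e" if e: "e \<in> E" for e using E2[OF e] by auto
  then have fU: "finite (\<Union>E)" using fin by simp
  have "finite (nbrs E v)" for v
  proof -
    have "nbrs E v \<subseteq> \<Union>E" unfolding nbrs_def by auto
    then show ?thesis using fU finite_subset by blast
  qed
  then have "\<forall>v. \<exists>f. bij_betw f (nbrs E v) (nbrs E v) \<and> (\<forall>x\<in>nbrs E v. \<forall>y\<in>nbrs E v. \<exists>k. (f ^^ k) x = y)"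
    using cyclic_perm_exists by blast
  then obtain rho0 where "is_rotation_system E rho0" unfolding is_rotation_system_def by metis
  then have "\<exists>g rho. is_rotation_system E rho \<and> emb_genus E rho = g" by blast
  then have "\<exists>rho. is_rotation_system E rho \<and> emb_genus E rho = genus E"
    unfolding genus_def by (rule LeastI_ex)
  then obtain rho where rho: "is_rotation_system E rho" "emb_genus E rho = genus E" by blast
  let ?x = "2 * int (card (comps E)) - int (card (\<Union>E)) + int (card E) - int (card (faces E rho))"
  have "?x div 2 \<le> int (genus E)" using rho(2) unfolding emb_genus_def by linarith
  then have "?x \<le> 2 * int (genus E) + 1" by linarith
  then have "2 * card (comps E) + card E \<le> card (\<Union>E) + card (faces E rho) + (2 * genus E + 1)" by linarith
  then show thesis using that rho by blast
qed

lemma rotation_cmap: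
  assumes fin: "finite E" and E2: "\<And>e. e \<in> E \<Longrightarrow> \<exists>u v. e = {u, v}" and rho: "is_rotation_system E rho"
  shows "cmap (darts E) (\<lambda>d. (fst d, rho (fst d) (snd d))) prod.swap fst"
proof
  let ?s = "\<lambda>d. (fst d, rho (fst d) (snd d))"
  have "finite e" if e: "e \<in> E" for e using E2[OF e] by auto
  then have fU: "finite (\<Union>E)" using fin by simp
  have "darts E \<subseteq> \<Union>E \<times> \<Union>E" by (auto simp: darts_def)
  then show fD: "finite (darts E)" using fU finite_subset by blast
  have bij: "bij_betw (rho v) (nbrs E v) (nbrs E v)"
    and tr: "\<And>x y. x \<in> nbrs E v \<Longrightarrow> y \<in> nbrs E v \<Longrightarrow> \<exists>k. (rho v ^^ k) x = y" for v
    using rho by (auto simp: is_rotation_system_def)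
  have dn: "(u, v) \<in> darts E \<longleftrightarrow> v \<in> nbrs E u" for u v by (simp add: darts_def nbrs_def)
  have inj: "inj_on ?s (darts E)"
  proof (rule inj_onI)
    fix d e assume "d \<in> darts E" "e \<in> darts E" "?s d = ?s e"
    then show "d = e" using bij[of "fst d"] dn by (cases d; cases e) (auto simp: bij_betw_def inj_on_def)
  qed
  have "?s ` darts E \<subseteq> darts E"
  proof
    fix d assume "d \<in> ?s ` darts E"
    then obtain u v where "v \<in> nbrs E u" "d = (u, rho u v)" using dn by auto
    then show "d \<in> darts E" using bij_betwE[OF bij[of u]] dn by simp
  qed
  then show "bij_betw ?s (darts E) (darts E)" using inj fD by (simp add: bij_betw_def endo_inj_surj)
  show "fst (?s d) = fst d" for d by simp
  show "prod.swap d \<in> darts E" if "d \<in> darts E" for d using that by (auto simp: darts_def insert_commute)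
  show "prod.swap (prod.swap d) = d" for d :: "'a \<times> 'a" by simp
  fix d d' assume d: "d \<in> darts E" "d' \<in> darts E" "fst d = fst d'"
  have "(?s ^^ k) d = (fst d, (rho (fst d) ^^ k) (snd d))" for k by (induction k) auto
  moreover obtain k where "(rho (fst d) ^^ k) (snd d) = snd d'"
    using tr[of "snd d" "fst d" "snd d'"] d dn by (metis prod.collapse)
  ultimately have "(?s ^^ k) d = d'" using d by simp
  then show "d' \<in> orb ?s d" using orb_pow by metis
qed

lemma card_egs_swap:
  assumes "\<And>e. e \<in> F \<Longrightarrow> \<exists>u v. e = {u, v} \<and> u \<noteq> v"
  shows "card (egs prod.swap {(u, v). {u, v} \<in> F}) = card F"
proof -
  let ?h = "\<lambda>e. {(u, v). {u, v} = e}"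
  have "egs prod.swap {(u, v). {u, v} \<in> F} = ?h ` F"
  proof (intro set_eqI iffI)
    fix x assume "x \<in> egs prod.swap {(u, v). {u, v} \<in> F}"
    then obtain u v where uv: "{u, v} \<in> F" "x = {(u, v), (v, u)}" unfolding egs_def by auto
    then have "x = ?h {u, v}" by (auto simp: doubleton_eq_iff)
    then show "x \<in> ?h ` F" using uv by blast
  next
    fix x assume "x \<in> ?h ` F"
    then obtain e where e: "e \<in> F" "x = ?h e" by blast
    then obtain u v where uv: "e = {u, v}" "u \<noteq> v" using assms by blast
    then have "x = {(u, v), prod.swap (u, v)}" using e by (auto simp: doubleton_eq_iff)
    moreover have "(u, v) \<in> {(u, v). {u, v} \<in> F}" "prod.swap (u, v) \<noteq> (u, v)" using e uv by auto
    ultimately show "x \<in> egs prod.swap {(u, v). {u, v} \<in> F}" unfolding egs_def by blast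
  qed
  moreover have "inj_on ?h F"
  proof (rule inj_onI)
    fix e f assume "e \<in> F" "f \<in> F" "?h e = ?h f"
    note h = this
    obtain u v where uv: "e = {u, v}" using assms[OF h(1)] by blast
    have "(u, v) \<in> ?h e" using uv by simp
    then have "(u, v) \<in> ?h f" using h(3) by (simp only:)
    then show "e = f" using uv by simp
  qed
  ultimately show ?thesis by (simp add: card_image)
qed

text \<open>Contracting a spanning forest of the fibres means rotating along the forest, which leaves the
  faces unchanged.\<close>

lemma quotient_map:
  fixes E :: "'a set set" and \<pi> :: "'a \<Rightarrow> 'b" and rk :: "'a \<Rightarrow> nat"
  assumes finE: "finite E" and E2: "\<And>e. e \<in> E \<Longrightarrow> \<exists>u v. e = {u, v} \<and> u \<noteq> v"
    and C: "C \<subseteq> \<Union>E" "C \<noteq> {}"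
    and E1: "E1 \<subseteq> E" "\<And>u v. {u, v} \<in> E1 \<Longrightarrow> u \<in> C \<and> v \<in> C \<and> \<pi> u \<noteq> \<pi> v"
    and tree: "\<And>v. v \<in> C \<Longrightarrow> v \<noteq> rt (\<pi> v) \<Longrightarrow> pa v \<in> C \<and> {v, pa v} \<in> E \<and> \<pi> (pa v) = \<pi> v \<and> rk (pa v) < rk v"
    and rt: "\<And>v. v \<in> C \<Longrightarrow> rt (\<pi> v) \<in> C \<and> \<pi> (rt (\<pi> v)) = \<pi> v"
  defines "D \<equiv> {(u, v). {u, v} \<in> E \<and> u \<in> C}"
    and "\<alpha> \<equiv> (\<lambda>(u, v). if {u, v} \<in> E1 then (v, u) else (u, v))"
  shows "\<exists>\<sigma>. cmap D \<sigma> \<alpha> (\<pi> \<circ> fst) \<and> card E1 + 2 \<le> card (\<pi> ` C) + card (fcs D \<sigma> \<alpha>) + (2 * genus E + 1)"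
proof -
  have E2': "\<exists>u v. e = {u, v}" if "e \<in> E" for e using E2[OF that] by blast
  obtain rho where rho: "is_rotation_system E rho"
    and gen: "2 * card (comps E) + card E \<le> card (\<Union>E) + card (faces E rho) + (2 * genus E + 1)"
    using genus_rotation[OF finE E2'] by blast
  define \<sigma>0 where "\<sigma>0 = (\<lambda>d. (fst d, rho (fst d) (snd d)))"
  define \<alpha>0 :: "'a \<times> 'a \<Rightarrow> 'a \<times> 'a" where "\<alpha>0 = prod.swap"
  define D0 where "D0 = darts E"
  interpret M: cmap D0 \<sigma>0 \<alpha>0 fst
    using rotation_cmap[OF finE E2' rho] by (simp add: \<sigma>0_def \<alpha>0_def D0_def)
  have D0: "(u, v) \<in> D0 \<longleftrightarrow> {u, v} \<in> E" for u v by (simp add: D0_def darts_def)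
  have a0: "\<alpha>0 (u, v) = (v, u)" for u v by (simp add: \<alpha>0_def)
  have VE: "fst ` D0 = \<Union>E"
  proof (intro set_eqI iffI)
    fix x assume "x \<in> \<Union>E"
    then obtain e where e: "e \<in> E" "x \<in> e" by blast
    then obtain y where "e = {x, y}" using E2[OF e(1)] by auto
    then show "x \<in> fst ` D0" using e D0 by force
  qed (auto simp: D0_def darts_def)
  have finU: "finite (\<Union>E)" using VE M.finD by (metis finite_imageI)
  have finC: "finite C" using C finU finite_subset by blast
  define NR where "NR = {v \<in> C. v \<noteq> rt (\<pi> v)}"
  define ET where "ET = (\<lambda>v. {v, pa v}) ` NR"
  define TX where "TX = {(u, v). {u, v} \<in> ET}"
  define X' where "X' = {(u, v). {u, v} \<in> E1 \<union> ET}"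
  have tr: "pa v \<in> C" "{v, pa v} \<in> E" "\<pi> (pa v) = \<pi> v" "rk (pa v) < rk v" if "v \<in> NR" for v
    using tree that by (auto simp: NR_def)
  have ETE: "ET \<subseteq> E" using tr by (auto simp: ET_def)
  have ETC: "u \<in> C \<and> v \<in> C \<and> \<pi> u = \<pi> v" if "{u, v} \<in> ET" for u v
  proof -
    obtain w where "w \<in> NR" "{u, v} = {w, pa w}" using \<open>{u, v} \<in> ET\<close> unfolding ET_def by blast
    then show ?thesis using tr[of w] by (auto simp: NR_def doubleton_eq_iff)
  qed
  have disj: "E1 \<inter> ET = {}"
  proof (rule ccontr)
    assume "E1 \<inter> ET \<noteq> {}"
    then obtain e where e: "e \<in> E1" "e \<in> ET" by blast
    then obtain u v where "e = {u, v}" using E1 E2 by blast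
    then show False using e ETC E1(2) by metis
  qed
  have X'D: "X' \<subseteq> D0" using E1 ETE by (auto simp: X'_def D0)
  have TXD: "TX \<subseteq> D0" using ETE by (auto simp: TX_def D0)
  have X'c: "\<alpha>0 d \<in> X'" if "d \<in> X'" for d using that by (auto simp: X'_def \<alpha>0_def insert_commute)
  have TXc: "\<alpha>0 d \<in> TX" if "d \<in> TX" for d using that by (auto simp: TX_def \<alpha>0_def insert_commute)
  have nfix: "\<alpha>0 d \<noteq> d" if "d \<in> D0" for d
  proof (cases d)
    case (Pair u v)
    then have "{u, v} \<in> E" using that D0 by simp
    then have "u \<noteq> v" using E2[of "{u, v}"] by (auto simp: doubleton_eq_iff)
    then show ?thesis using Pair a0 by simp
  qed
  \<comment> \<open>All edges except \<open>E1\<close> and the forest \<open>ET\<close> are deleted;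
    only then is the forest contracted.\<close>
  have del: "2 * card (classes (fst ` D0) (erel \<alpha>0 fst X')) + card (egs \<alpha>0 X') + card (fcs D0 \<sigma>0 (restr \<alpha>0 D0))
    \<le> 2 * card (classes (fst ` D0) (erel \<alpha>0 fst D0)) + card (egs \<alpha>0 D0) + card (fcs D0 \<sigma>0 (restr \<alpha>0 X'))"
    by (rule M.delete_edges[OF order_refl M.\<alpha>D X'D X'c nfix])
  have erD: "erel \<alpha>0 fst D0 = adj E" by (force simp: erel_def adj_def D0_def darts_def \<alpha>0_def)
  have clD: "classes (fst ` D0) (erel \<alpha>0 fst D0) = comps E"
    unfolding erD VE classes_def comps_def by blast
  have egD: "card (egs \<alpha>0 D0) = card E"
    unfolding \<alpha>0_def D0_def darts_def by (rule card_egs_swap) (rule E2)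
  have "card (egs \<alpha>0 X') = card (E1 \<union> ET)"
    unfolding \<alpha>0_def X'_def using E1 ETE E2 by (intro card_egs_swap) blast
  also have "\<dots> = card E1 + card ET"
    using disj finE E1 ETE finite_subset by (intro card_Un_disjoint) blast+
  also have "card ET = card NR"
    unfolding ET_def
  proof (rule card_image, rule inj_onI)
    fix v w assume vw: "v \<in> NR" "w \<in> NR" "{v, pa v} = {w, pa w}"
    then show "v = w" using tr(4)[of v] tr(4)[of w] by (auto simp: doubleton_eq_iff)
  qed
  also have "card NR = card C - card (\<pi> ` C)"
  proof -
    have "NR = C - (\<lambda>v. rt (\<pi> v)) ` C"
    proof (intro set_eqI iffI)
      fix v assume v: "v \<in> NR"
      have "v \<noteq> rt (\<pi> w)" if "w \<in> C" for w
        using rt[OF that] v unfolding NR_def by (metis (mono_tags, lifting) mem_Collect_eq)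
      then show "v \<in> C - (\<lambda>v. rt (\<pi> v)) ` C" using v by (auto simp: NR_def)
    next
      fix v assume "v \<in> C - (\<lambda>v. rt (\<pi> v)) ` C"
      then show "v \<in> NR" unfolding NR_def by blast
    qed
    also have "(\<lambda>v. rt (\<pi> v)) ` C = rt ` \<pi> ` C" by (simp add: image_image)
    finally have "NR = C - rt ` \<pi> ` C" .
    moreover have "rt ` \<pi> ` C \<subseteq> C" using rt by auto
    moreover have "inj_on rt (\<pi> ` C)" by (rule inj_on_inverseI[where g = \<pi>]) (use rt in auto)
    ultimately show ?thesis using finC by (simp add: card_Diff_subset card_image)
  qed
  finally have eg': "card (egs \<alpha>0 X') = card E1 + (card C - card (\<pi> ` C))" .
  have leC: "card (\<pi> ` C) \<le> card C" using finC by (rule card_image_le)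
  let ?o = "card (\<Union>E - C)"
  have oC: "card (\<Union>E) = card C + ?o" using C finU by (simp add: card_Diff_subset finC card_mono)
  \<comment> \<open>A vertex outside \<open>C\<close> has become isolated: it is a class by itself
    and, by \<open>f'\<close> below, accounts for at most one face. As components count twice in
    Euler's formula, \<open>?o\<close> cancels against vertices and faces.\<close>
  have cl': "1 + ?o \<le> card (classes (fst ` D0) (erel \<alpha>0 fst X'))"
  proof -
    have erC: "erel \<alpha>0 fst X' \<subseteq> C \<times> C" using E1(2) ETC by (auto simp: erel_def X'_def \<alpha>0_def)
    obtain c0 where c0: "c0 \<in> C" using C by blast
    let ?R = "erel \<alpha>0 fst X'"
    have single: "?R\<^sup>* `` {v} = {v}" if "v \<notin> C" for v
    proof -
      have "u = v" if "(v, u) \<in> ?R\<^sup>*" for u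
        using that
      proof (induction rule: rtrancl_induct)
        case (step y z)
        then have "(v, z) \<in> C \<times> C" using erC by blast
        then show ?case using \<open>v \<notin> C\<close> by simp
      qed simp
      then show ?thesis by auto
    qed
    have "card (insert (?R\<^sup>* `` {c0}) ((\<lambda>v. {v}) ` (\<Union>E - C))) \<le> card (classes (fst ` D0) ?R)"
    proof (rule card_mono)
      show "finite (classes (fst ` D0) ?R)" unfolding classes_def using M.finD by simp
      have "?R\<^sup>* `` {c0} \<in> classes (fst ` D0) ?R" unfolding classes_def VE using c0 C by blast
      moreover have "{v} \<in> classes (fst ` D0) ?R" if "v \<in> \<Union>E - C" for v
        unfolding classes_def VE using single[of v] that by (intro image_eqI[of _ _ v]) auto
      ultimately show "insert (?R\<^sup>* `` {c0}) ((\<lambda>v. {v}) ` (\<Union>E - C)) \<subseteq> classes (fst ` D0) ?R" by blast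
    qed
    moreover have "?R\<^sup>* `` {c0} \<notin> (\<lambda>v. {v}) ` (\<Union>E - C)"
    proof
      assume "?R\<^sup>* `` {c0} \<in> (\<lambda>v. {v}) ` (\<Union>E - C)"
      then obtain v where "v \<notin> C" "?R\<^sup>* `` {c0} = {v}" by blast
      moreover have "c0 \<in> ?R\<^sup>* `` {c0}" by simp
      ultimately show False using c0 by simp
    qed
    moreover have "card ((\<lambda>v. {v}) ` (\<Union>E - C)) = ?o" by (simp add: card_image)
    ultimately show ?thesis using finU by simp
  qed
  let ?phi' = "\<lambda>d. \<sigma>0 (restr \<alpha>0 X' d)"
  have fD: "fcs D0 \<sigma>0 (restr \<alpha>0 D0) = faces E rho"
  proof -
    have "orb (\<lambda>d. \<sigma>0 (restr \<alpha>0 D0 d)) d = orb (face_perm rho) d" if d: "d \<in> D0" for d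
    proof (rule orb_cong)
      fix e assume e: "e \<in> orb (\<lambda>d. \<sigma>0 (restr \<alpha>0 D0 d)) d"
      have "bij_betw (\<lambda>d. \<sigma>0 (restr \<alpha>0 D0 d)) D0 D0" by (rule M.bij_phi) (auto intro: M.\<alpha>D)
      from subsetD[OF orb_sub[OF this d] e] have "e \<in> D0" .
      then show "\<sigma>0 (restr \<alpha>0 D0 e) = face_perm rho e"
        by (simp add: restr_def \<sigma>0_def \<alpha>0_def face_perm_def)
    qed
    then have "fcs D0 \<sigma>0 (restr \<alpha>0 D0) = orb (face_perm rho) ` D0"
      unfolding fcs_def by (rule image_cong[OF refl])
    moreover have "faces E rho = orb (face_perm rho) ` D0"
      unfolding faces_def orb_def D0_def by (rule Setcompr_eq_image)
    ultimately show ?thesis by simp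
  qed
  have DD: "D = {d \<in> D0. fst d \<in> C}" by (auto simp: D_def D0)
  \<comment> \<open>A forest dart is crossed before turning, so \<open>\<sigma>\<close> walks around
    a whole tree as if it were one vertex. As \<open>E1\<close> and \<open>ET\<close> are disjoint,
    \<open>\<sigma> (\<alpha> d)\<close> is the face step from before the contraction, which is
    \<open>phi_eq\<close>.\<close>
  define \<sigma> where "\<sigma> = (\<lambda>d. \<sigma>0 (restr \<alpha>0 TX d))"
  have phi_eq: "\<sigma> (\<alpha> d) = ?phi' d" for d
  proof (cases d)
    case (Pair u v)
    consider "{u, v} \<in> E1" "{u, v} \<notin> ET" | "{u, v} \<in> ET" "{u, v} \<notin> E1" | "{u, v} \<notin> ET" "{u, v} \<notin> E1"
      using disj by blast
    then show ?thesis
      by cases (auto simp: \<sigma>_def \<alpha>_def restr_def X'_def TX_def Pair a0 insert_commute)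
  qed
  have f': "card (fcs D0 \<sigma>0 (restr \<alpha>0 X')) \<le> card (fcs D \<sigma> \<alpha>) + ?o"
  proof -
    have e: "fcs D \<sigma> \<alpha> = orb ?phi' ` D" by (simp add: fcs_def phi_eq)
    have out: "orb ?phi' d = orb \<sigma>0 d" if d: "d \<in> D0 - D" for d
    proof (rule orb_cong)
      have sub: "orb ?phi' d \<subseteq> D0 - D"
      proof (rule orb_closed)
        fix e assume e: "e \<in> D0 - D"
        then have "e \<notin> X'" using E1(2) ETC by (cases e) (auto simp: DD X'_def)
        then show "?phi' e \<in> D0 - D" using e M.\<sigma>D[of e] by (auto simp: DD restr_def \<sigma>0_def)
      qed (use d in simp)
      fix e assume "e \<in> orb ?phi' d"
      then have "e \<in> D0 - D" by (rule subsetD[OF sub])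
      then have "e \<notin> X'" using E1(2) ETC by (cases e) (auto simp: DD X'_def)
      then show "?phi' e = \<sigma>0 e" by (simp add: restr_def)
    qed
    have same: "orb \<sigma>0 d = orb \<sigma>0 d'" if "d \<in> D0" "d' \<in> D0" "fst d = fst d'" for d d'
      using orb_eq[OF M.finD M.bij\<sigma> that(1) M.trans\<sigma>[OF that]] by simp
    have "card (orb ?phi' ` (D0 - D)) \<le> ?o"
    proof -
      have "orb ?phi' ` (D0 - D) \<subseteq> (\<lambda>v. orb \<sigma>0 (SOME d. d \<in> D0 \<and> fst d = v)) ` (\<Union>E - C)"
      proof
        fix Q assume "Q \<in> orb ?phi' ` (D0 - D)"
        then obtain d where d: "d \<in> D0 - D" "Q = orb \<sigma>0 d" using out by auto
        have "(SOME e. e \<in> D0 \<and> fst e = fst d) \<in> D0 \<and> fst (SOME e. e \<in> D0 \<and> fst e = fst d) = fst d"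
          by (rule someI[of _ d]) (use d in simp)
        then have "Q = orb \<sigma>0 (SOME e. e \<in> D0 \<and> fst e = fst d)" using same d by auto
        moreover have "fst d \<in> \<Union>E - C" using d VE by (auto simp: DD)
        ultimately show "Q \<in> (\<lambda>v. orb \<sigma>0 (SOME d. d \<in> D0 \<and> fst d = v)) ` (\<Union>E - C)" by blast
      qed
      then have "card (orb ?phi' ` (D0 - D)) \<le> card ((\<lambda>v. orb \<sigma>0 (SOME d. d \<in> D0 \<and> fst d = v)) ` (\<Union>E - C))"
        using finU by (intro card_mono) auto
      also have "\<dots> \<le> ?o" using finU by (intro card_image_le) auto
      finally show ?thesis .
    qed
    moreover have "fcs D0 \<sigma>0 (restr \<alpha>0 X') = orb ?phi' ` D \<union> orb ?phi' ` (D0 - D)"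
      unfolding fcs_def by (auto simp: DD)
    ultimately show ?thesis using card_Un_le[of "orb ?phi' ` D" "orb ?phi' ` (D0 - D)"] by (simp add: e)
  qed
  have main: "card E1 + 2 \<le> card (\<pi> ` C) + card (fcs D \<sigma> \<alpha>) + (2 * genus E + 1)"
    using del[unfolded clD egD fD eg'] gen cl' f' leC oC by linarith
  have bs0: "bij_betw \<sigma> D0 D0" unfolding \<sigma>_def using M.bij_phi[OF TXD] TXc by blast
  have sD: "\<sigma> d \<in> D" if d: "d \<in> D" for d
  proof (cases "d \<in> TX")
    case True
    then have "\<alpha>0 d \<in> D0" "fst (\<alpha>0 d) \<in> C" using d M.\<alpha>D ETC by (auto simp: DD TX_def \<alpha>0_def)
    then show ?thesis using True M.\<sigma>D[of "\<alpha>0 d"] by (auto simp: DD \<sigma>_def restr_def \<sigma>0_def)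
  next
    case False
    then show ?thesis using d M.\<sigma>D[of d] by (auto simp: DD \<sigma>_def restr_def \<sigma>0_def)
  qed
  have bs: "bij_betw \<sigma> D D"
  proof -
    have "inj_on \<sigma> D" using bs0 unfolding bij_betw_def DD by (auto intro: inj_on_subset)
    moreover have "finite D" using M.finD by (simp add: DD)
    ultimately show ?thesis using sD by (simp add: bij_betw_def endo_inj_surj image_subset_iff)
  qed
  define Q where "Q = {(d, e). d \<in> D0 \<and> e \<in> D0 \<and> e \<in> orb \<sigma> d}"
  have symQ: "sym Q" unfolding Q_def sym_def using orb_sym[OF M.finD bs0] by blast
  have transQ: "trans Q" unfolding Q_def trans_def using orb_trans by fast
  define rts where "rts = \<Union>E - NR"
  define pd where "pd v = (v, pa v)" for v
  have NRU: "fst ` D0 - rts = NR" using C by (auto simp: VE rts_def NR_def)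
  have TDeq: "TX = {d. \<exists>v\<in>fst ` D0 - rts. d = pd v \<or> d = \<alpha>0 (pd v)}"
    unfolding NRU
  proof (intro set_eqI)
    fix d :: "'a \<times> 'a"
    obtain u v where d: "d = (u, v)" by (cases d)
    have "d \<in> TX \<longleftrightarrow> (\<exists>w\<in>NR. {u, v} = {w, pa w})" unfolding d TX_def ET_def by auto
    also have "\<dots> \<longleftrightarrow> (\<exists>w\<in>NR. d = pd w \<or> d = \<alpha>0 (pd w))"
      unfolding d pd_def a0 by (rule bex_cong[OF refl]) (simp add: doubleton_eq_iff)
    finally show "d \<in> TX \<longleftrightarrow> d \<in> {d. \<exists>v\<in>NR. d = pd v \<or> d = \<alpha>0 (pd v)}" by simp
  qed
  have pd: "pd v \<in> D0 \<and> fst (pd v) = v \<and> rk (fst (\<alpha>0 (pd v))) < rk v" if "v \<in> fst ` D0" "v \<notin> rts" for v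
  proof -
    have "v \<in> NR" using that NRU by blast
    then show ?thesis using tr[of v] by (simp add: pd_def D0 a0)
  qed
  have WC: "C \<subseteq> fst ` D0" using C VE by simp
  have W2: "v \<in> C" if "v \<in> fst ` D0 - rts" for v using that NRU by (auto simp: NR_def)
  have Qr: "(d, d) \<in> Q" if "d \<in> D0" for d using that by (simp add: Q_def)
  have Q1: "(d, \<sigma>0 d) \<in> Q" if "d \<in> D0" "d \<notin> TX" for d
  proof -
    have "\<sigma>0 d = \<sigma> d" using that by (simp add: \<sigma>_def restr_def)
    then have "\<sigma>0 d \<in> orb \<sigma> d" by simp
    then show ?thesis using that M.\<sigma>D by (simp add: Q_def)
  qed
  have Q2: "(\<alpha>0 d, \<sigma>0 d) \<in> Q" if "d \<in> D0" "d \<in> TX" for d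
  proof -
    have "\<sigma>0 d = \<sigma> (\<alpha>0 d)" using that TXc M.\<alpha>\<alpha> by (simp add: \<sigma>_def restr_def)
    then have "\<sigma>0 d \<in> orb \<sigma> (\<alpha>0 d)" by simp
    then show ?thesis using that M.\<sigma>D M.\<alpha>D by (simp add: Q_def)
  qed
  note tour = M.tree_tour[where rts = rts and pd = pd and rk = rk and W = C and Q = Q, OF pd TDeq WC W2 symQ transQ Qr Q1 Q2]
  \<comment> \<open>Any dart can be carried to the root of its fibre: within a vertex by the first
    part of \<open>tour\<close>, and across the edge to the parent by the second. This makes
    \<open>\<sigma>\<close> transitive on each fibre.\<close>
  have toroot: "\<exists>e\<in>D0. fst e = rt (\<pi> (fst d)) \<and> (d, e) \<in> Q" if "d \<in> D" for d
    using that
  proof (induction "rk (fst d)" arbitrary: d rule: less_induct)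
    case less
    have d: "d \<in> D0" "fst d \<in> C" using less.prems by (auto simp: DD)
    show ?case
    proof (cases "fst d \<in> NR")
      case False
      then have "fst d = rt (\<pi> (fst d))" using d by (auto simp: NR_def)
      then show ?thesis using d Qr by metis
    next
      case True
      define p where "p = pd (fst d)"
      have p: "p \<in> D0" "fst p = fst d" "fst (\<alpha>0 p) = pa (fst d)" "\<alpha>0 p \<in> D0"
        using tr[OF True] M.\<alpha>D by (auto simp: p_def pd_def D0 a0)
      have "\<alpha>0 p \<in> D" using p tr[OF True] by (simp add: DD)
      with less.hyps[of "\<alpha>0 p"] obtain e where e: "e \<in> D0" "fst e = rt (\<pi> (fst (\<alpha>0 p)))" "(\<alpha>0 p, e) \<in> Q"
        using p tr[OF True] by auto
      have "(d, p) \<in> Q" using tour(1)[of "fst d" d p] d p by simp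
      moreover have "fst d \<notin> rts" using True by (simp add: rts_def)
      then have "(p, \<alpha>0 p) \<in> Q" unfolding p_def using tour(2)[of "fst d"] d by simp
      ultimately have "(d, e) \<in> Q" using e transQ by (meson transD)
      then show ?thesis using e p tr[OF True] by auto
    qed
  qed
  have "cmap D \<sigma> \<alpha> (\<pi> \<circ> fst)"
  proof
    show "finite D" using M.finD by (simp add: DD)
    show "bij_betw \<sigma> D D" by (rule bs)
    show "(\<pi> \<circ> fst) (\<sigma> d) = (\<pi> \<circ> fst) d" for d
    proof (cases "d \<in> TX")
      case True
      then show ?thesis using ETC by (cases d) (auto simp: \<sigma>_def restr_def \<sigma>0_def a0 TX_def)
    qed (simp add: \<sigma>_def restr_def \<sigma>0_def)
    show "\<alpha> d \<in> D" if "d \<in> D" for d using that E1(2)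
      by (cases d; cases "{fst d, snd d} \<in> E1") (auto simp: \<alpha>_def D_def insert_commute)
    show "\<alpha> (\<alpha> d) = d" for d by (cases d) (auto simp: \<alpha>_def insert_commute)
    fix d d' assume d: "d \<in> D" "d' \<in> D" "(\<pi> \<circ> fst) d = (\<pi> \<circ> fst) d'"
    obtain e where e: "e \<in> D0" "fst e = rt (\<pi> (fst d))" "(d, e) \<in> Q" using toroot[OF d(1)] by blast
    obtain e' where e': "e' \<in> D0" "fst e' = rt (\<pi> (fst d))" "(d', e') \<in> Q" using toroot[OF d(2)] d(3) by auto
    have "rt (\<pi> (fst d)) \<in> C" using rt d by (auto simp: DD)
    then have "(e, e') \<in> Q" using tour(1)[of _ e e'] e e' by simp
    then have "(d, d') \<in> Q" using e e' symQ transQ by (meson symD transD)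
    then show "d' \<in> orb \<sigma> d" by (simp add: Q_def)
  qed
  then show ?thesis using main by blast
qed

section \<open>Treewidth of embedded graphs\<close>

text \<open>\<open>W\<close> is the subtree hanging from \<open>z\<close>, and climbing to
  \<open>z\<close> connects the tours around its single vertices.\<close>

lemma (in cmap) tree_tour_all:
  fixes rk :: "'v \<Rightarrow> nat" and Q :: "('d \<times> 'd) set"
  assumes pd: "\<And>v. v \<in> vt ` D \<Longrightarrow> v \<notin> rts \<Longrightarrow> pd v \<in> D \<and> vt (pd v) = v \<and> rk (vt (\<alpha> (pd v))) < rk v"
    and TD: "TD = {d. \<exists>v\<in>vt ` D - rts. d = pd v \<or> d = \<alpha> (pd v)}"
    and W: "W \<subseteq> vt ` D" "\<And>v. v \<in> vt ` D - rts \<Longrightarrow> vt (\<alpha> (pd v)) \<in> W \<Longrightarrow> v \<in> W"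
    and Q: "sym Q" "trans Q" "\<And>d. d \<in> D \<Longrightarrow> (d, d) \<in> Q"
    and Q1: "\<And>d. d \<in> D \<Longrightarrow> vt d \<in> W \<Longrightarrow> d \<notin> TD \<Longrightarrow> (d, \<sigma> d) \<in> Q"
    and Q2: "\<And>d. d \<in> D \<Longrightarrow> vt d \<in> W \<Longrightarrow> d \<in> TD \<Longrightarrow> (\<alpha> d, \<sigma> d) \<in> Q"
    and z: "z \<in> W" "\<And>w. w \<in> W \<Longrightarrow> w \<noteq> z \<Longrightarrow> w \<notin> rts \<and> vt (\<alpha> (pd w)) \<in> W"
    and de: "d \<in> D" "e \<in> D" "vt d \<in> W" "vt e \<in> W"
  shows "(d, e) \<in> Q"
proof -
  have tour1: "(d, d') \<in> Q" if "d \<in> D" "d' \<in> D" "vt d \<in> W" "vt d' = vt d" for d d'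
    by (rule tree_tour(1)[OF pd TD W Q Q1 Q2, of "vt d"]) (use that in auto)
  have tour2: "(pd w, \<alpha> (pd w)) \<in> Q" if "w \<in> W" "w \<notin> rts" for w
    by (rule tree_tour(2)[OF pd TD W Q Q1 Q2]) (use that in auto)
  obtain dz where dz: "dz \<in> D" "vt dz = z" using z(1) W(1) by auto
  have "(d, dz) \<in> Q" if "d \<in> D" "vt d \<in> W" for d
    using that
  proof (induction "rk (vt d)" arbitrary: d rule: less_induct)
    case less
    show ?case
    proof (cases "vt d = z")
      case True then show ?thesis using tour1[OF less.prems(1) dz(1)] dz less.prems by simp
    next
      case False
      define w where "w = vt d"
      have w: "w \<in> W" "w \<notin> rts" "vt (\<alpha> (pd w)) \<in> W" using less.prems z(2) False by (auto simp: w_def)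
      have wD: "w \<in> vt ` D" using w W(1) by auto
      note p = pd[OF wD w(2)]
      have "(d, pd w) \<in> Q" using tour1[OF less.prems(1)] p less.prems by (simp add: w_def)
      moreover have "(pd w, \<alpha> (pd w)) \<in> Q" by (rule tour2[OF w(1,2)])
      moreover have "(\<alpha> (pd w), dz) \<in> Q"
        using less.hyps[of "\<alpha> (pd w)"] p w(3) \<alpha>D by (simp add: w_def)
      ultimately show ?thesis using Q(2) by (meson transD)
    qed
  qed
  then show ?thesis using de Q by (meson symD transD)
qed

lemma pigeonhole_mod:
  assumes "finite V" "0 < (k::nat)"
  shows "\<exists>m<k. card {v \<in> V. lev v mod k = m} \<le> card V div k"
proof (rule ccontr)
  assume "\<not> ?thesis"
  then have *: "card V div k + 1 \<le> card {v \<in> V. lev v mod k = m}" if "m \<in> {..<k}" for m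
    using that by (metis lessThan_iff not_le Suc_eq_plus1 Suc_leI)
  have "k * (card V div k + 1) = (\<Sum>m<k. card V div k + 1)" by simp
  also have "\<dots> \<le> (\<Sum>m<k. card {v \<in> V. lev v mod k = m})" by (rule sum_mono) (rule *)
  also have "\<dots> = card (\<Union>m\<in>{..<k}. {v \<in> V. lev v mod k = m})"
    using assms by (subst card_UN_disjoint) auto
  also have "\<dots> \<le> card V" using assms by (intro card_mono) auto
  finally have "k * (card V div k + 1) \<le> card V" .
  moreover have "card V < k * (card V div k + 1)"
    using assms(2) by (metis Suc_eq_plus1 dividend_less_times_div add_mult_distrib2 mult.right_neutral add.commute)
  ultimately show False by simp
qed

lemma (in cmap) has_td_cmap:
  assumes D: "D \<noteq> {}"
    and conn: "\<And>u v. u \<in> vt ` D \<Longrightarrow> v \<in> vt ` D \<Longrightarrow> (u, v) \<in> (erel \<alpha> vt D)\<^sup>*"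
    and euler: "card (egs \<alpha> D) + 2 \<le> card (vt ` D) + card (fcs D \<sigma> \<alpha>) + G"
    and k: "0 < k"
  shows "has_td (vt ` D) {{vt d, vt (\<alpha> d)} | d. d \<in> D} ((2 * G + 3) * k + card (vt ` D) div k)"
proof -
  define V where "V = vt ` D"
  have finV: "finite V" using finD by (simp add: V_def)
  obtain d0' where "d0' \<in> D" using D by blast
  define r where "r = vt d0'"
  have rV: "r \<in> V" using \<open>d0' \<in> D\<close> by (simp add: r_def V_def)
  define R where "R = erel \<alpha> vt D"
  have RV: "R \<subseteq> V \<times> V" using \<alpha>D by (auto simp: R_def erel_def V_def)
  have symR: "sym R" unfolding R_def by (rule sym_erel) (auto intro: \<alpha>D)
  have reachR: "(r, v) \<in> R\<^sup>*" if "v \<in> V" for v using conn rV that by (simp add: R_def V_def)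
  obtain pa and lev :: "'v \<Rightarrow> nat" where lev0: "lev r = 0"
    and pa: "\<And>v. v \<in> V \<Longrightarrow> v \<noteq> r \<Longrightarrow> pa v \<in> V \<and> (pa v, v) \<in> R \<and> lev v = Suc (lev (pa v))"
    and levR: "\<And>u v. (u, v) \<in> R \<Longrightarrow> lev v \<le> Suc (lev u)"
    using bfs_tree[OF reachR RV] by metis
  have "\<exists>d. d \<in> D \<and> vt d = v \<and> vt (\<alpha> d) = pa v" if v: "v \<in> V" "v \<noteq> r" for v
  proof -
    have "(v, pa v) \<in> R" using pa[OF v] symR by (meson symD)
    then show ?thesis unfolding R_def erel_def by auto
  qed
  then obtain pd where pd: "\<And>v. v \<in> V \<Longrightarrow> v \<noteq> r \<Longrightarrow> pd v \<in> D \<and> vt (pd v) = v \<and> vt (\<alpha> (pd v)) = pa v" by metis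
  define TD where "TD = {d. \<exists>v\<in>V - {r}. d = pd v \<or> d = \<alpha> (pd v)}"
  have TDa: "\<alpha> d \<in> TD" if "d \<in> TD" for d 
  proof -
    obtain v where v: "v \<in> V - {r}" "d = pd v \<or> d = \<alpha> (pd v)" using \<open>d \<in> TD\<close> unfolding TD_def by auto
    then have "\<alpha> d = \<alpha> (pd v) \<or> \<alpha> d = pd v" using \<alpha>\<alpha>[of "pd v"] pd[of v] by auto
    then show ?thesis unfolding TD_def using v(1) by auto
  qed
  have pd': "pd v \<in> D \<and> vt (pd v) = v \<and> lev (vt (\<alpha> (pd v))) < lev v" if "v \<in> vt ` D" "v \<notin> {r}" for v
    using pd[of v] pa[of v] that by (simp add: V_def)
  have TD': "TD = {d. \<exists>v\<in>vt ` D - {r}. d = pd v \<or> d = \<alpha> (pd v)}" by (simp add: TD_def V_def)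

  define \<phi> where "\<phi> = (\<lambda>d. \<sigma> (\<alpha> d))"
  have bij\<phi>: "bij_betw \<phi> D D" unfolding \<phi>_def by (rule bij_phi0)
  have \<phi>D: "\<phi> d \<in> D" if "d \<in> D" for d using bij_betwE[OF bij\<phi>] that by blast
  have vt\<phi>: "vt (\<phi> d) = vt (\<alpha> d)" if "d \<in> D" for d using that \<alpha>D vt\<sigma> by (simp add: \<phi>_def)
  define Fc where "Fc = orb \<phi>"
  have Fc_eq: "Fc e = Fc d" if "d \<in> D" "e \<in> Fc d" for d e
    using that unfolding Fc_def by (intro orb_eq[OF finD bij\<phi>])
  have Fc\<phi>: "Fc (\<phi> d) = Fc d" if "d \<in> D" for d using Fc_eq[OF that, of "\<phi> d"] by (simp add: Fc_def)
  have Fc\<sigma>: "Fc (\<sigma> d) = Fc (\<alpha> d)" if "d \<in> D" for d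
    using Fc\<phi>[of "\<alpha> d"] that \<alpha>D \<alpha>\<alpha> by (simp add: \<phi>_def)
  have Fcs: "d \<in> Fc d" for d by (simp add: Fc_def)
  define F where "F = Fc ` D"
  have FF: "F = fcs D \<sigma> \<alpha>" by (simp add: F_def Fc_def fcs_def \<phi>_def)
  have finF: "finite F" using finD by (simp add: F_def)
  define RF where "RF = {(Fc d, Fc (\<alpha> d)) | d. d \<in> D - TD}"
  have RFF: "RF \<subseteq> F \<times> F" using \<alpha>D by (auto simp: RF_def F_def)
  have symRF: "sym RF"
  proof (rule symI)
    fix a b assume "(a, b) \<in> RF"
    then obtain d where d: "d \<in> D - TD" "a = Fc d" "b = Fc (\<alpha> d)" by (auto simp: RF_def)
    have "\<alpha> d \<notin> TD" using TDa[of "\<alpha> d"] d \<alpha>\<alpha> by auto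
    then have "\<alpha> d \<in> D - TD" "b = Fc (\<alpha> d)" "a = Fc (\<alpha> (\<alpha> d))" using d \<alpha>D \<alpha>\<alpha> by auto
    then show "(b, a) \<in> RF" unfolding RF_def by blast
  qed
  \<comment> \<open>A tour around the breadth-first tree visits all darts. Turning past a dart
    outside the tree crosses its edge in the dual graph; turning past a tree dart stays within a
    face.\<close>
  have dual_conn: "(Fc d, Fc e) \<in> RF\<^sup>*" if "d \<in> D" "e \<in> D" for d e
  proof -
    define Q where "Q = {(d, e). (Fc d, Fc e) \<in> RF\<^sup>*}"
    have "(d, e) \<in> Q"
    proof (rule tree_tour_all[where rts = "{r}" and pd = pd and rk = lev and W = "vt ` D" and z = r, OF pd' TD'])
      show "sym Q" unfolding Q_def using sym_rtrancl[OF symRF] by (auto simp: sym_def)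
      show "trans Q" unfolding Q_def trans_def by (auto intro: rtrancl_trans)
      show "(d, d) \<in> Q" for d by (simp add: Q_def)
      show "(d, \<sigma> d) \<in> Q" if "d \<in> D" "d \<notin> TD" for d
        using that by (auto simp: Q_def Fc\<sigma> RF_def)
      show "(\<alpha> d, \<sigma> d) \<in> Q" if "d \<in> D" for d using that by (simp add: Q_def Fc\<sigma>)
      show "r \<in> vt ` D" using rV by (simp add: V_def)
      show "w \<notin> {r} \<and> vt (\<alpha> (pd w)) \<in> vt ` D" if "w \<in> vt ` D" "w \<noteq> r" for w
        using that pd'[of w] \<alpha>D by auto
    qed (use that in auto)
    then show ?thesis by (simp add: Q_def)
  qed
  define d0 where "d0 = d0'"
  have d0: "d0 \<in> D" using \<open>d0' \<in> D\<close> by (simp add: d0_def)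
  define f0 where "f0 = Fc d0"
  have f0F: "f0 \<in> F" using d0 by (simp add: f0_def F_def)
  have reachF: "(f0, f) \<in> RF\<^sup>*" if "f \<in> F" for f using dual_conn[OF d0] that by (auto simp: F_def f0_def)
  obtain fpa and frk :: "'d set \<Rightarrow> nat" where frk0: "frk f0 = 0"
    and fpa: "\<And>f. f \<in> F \<Longrightarrow> f \<noteq> f0 \<Longrightarrow> fpa f \<in> F \<and> (fpa f, f) \<in> RF \<and> frk f = Suc (frk (fpa f))"
    using bfs_tree[OF reachF RFF] by metis
  have "\<exists>d. d \<in> D \<and> d \<notin> TD \<and> Fc d = f \<and> Fc (\<alpha> d) = fpa f" if f: "f \<in> F" "f \<noteq> f0" for f
  proof -
    have "(f, fpa f) \<in> RF" using fpa[OF f] symRF by (meson symD)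
    then show ?thesis unfolding RF_def by auto
  qed
  then obtain an' where an': "\<And>f. f \<in> F \<Longrightarrow> f \<noteq> f0 \<Longrightarrow> an' f \<in> D \<and> an' f \<notin> TD \<and> Fc (an' f) = f \<and> Fc (\<alpha> (an' f)) = fpa f"
    by metis
  define an where "an f = (if f = f0 then d0 else an' f)" for f
  have an: "an f \<in> D" "Fc (an f) = f" if "f \<in> F" for f using an' that d0 by (auto simp: an_def f0_def)
  have an2: "an f \<notin> TD" "Fc (\<alpha> (an f)) = fpa f" if "f \<in> F" "f \<noteq> f0" for f using an'[OF that] that by (auto simp: an_def)
  \<comment> \<open>The anchor of the face of \<open>d\<close>: its dart on the dual tree edge to
    the parent face, and \<open>d0\<close> for the root face. \<open>ps\<close> counts the face
    steps from the anchor.\<close>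
  define A where "A d = an (Fc d)" for d
  have AD: "A d \<in> D" "Fc (A d) = Fc d" if "d \<in> D" for d using an that by (auto simp: A_def F_def)
  define ps where "ps d = (LEAST n. (\<phi> ^^ n) (A d) = d)" for d
  have ps: "(\<phi> ^^ ps d) (A d) = d" if "d \<in> D" for d
  proof -
    have "d \<in> Fc (A d)" using AD[OF that] Fcs by simp
    then obtain n where "d = (\<phi> ^^ n) (A d)" unfolding Fc_def orb_def by blast
    then have "\<exists>n. (\<phi> ^^ n) (A d) = d" by metis
    then show ?thesis unfolding ps_def by (rule LeastI_ex)
  qed
  define pre where "pre d = (\<phi> ^^ (ps d - 1)) (A d)" for d
  have pre: "pre d \<in> D" "\<phi> (pre d) = d" "A (pre d) = A d" "ps (pre d) < ps d" if d: "d \<in> D" "d \<noteq> A d" for d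
  proof -
    have p0: "ps d > 0" using ps[OF d(1)] d(2) by (cases "ps d") auto
    show pD: "pre d \<in> D" unfolding pre_def by (rule bij_pow_in[OF bij\<phi> AD(1)[OF d(1)]])
    have "\<phi> (pre d) = (\<phi> ^^ Suc (ps d - 1)) (A d)" by (simp add: pre_def)
    then show *: "\<phi> (pre d) = d" using p0 ps[OF d(1)] by simp
    show A: "A (pre d) = A d" using Fc\<phi>[OF pD] * by (simp add: A_def)
    have "ps (pre d) \<le> ps d - 1" unfolding ps_def[of "pre d"] A by (rule Least_le) (simp add: pre_def)
    then show "ps (pre d) < ps d" using p0 by simp
  qed
  have pre\<phi>: "pre (\<phi> d) = d" if "d \<in> D" "\<phi> d \<noteq> A (\<phi> d)" for d
    using pre(1,2)[OF \<phi>D[OF that(1)] that(2)] that(1) bij\<phi> by (auto simp: bij_betw_def inj_on_def)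
  define M where "M = Suc (Max (ps ` D))"
  have psM: "ps d < M" if "d \<in> D" for d using finD that by (auto simp: M_def less_Suc_eq_le)
  \<comment> \<open>The parent of a dart is its predecessor on the face, and that of an anchor is
    the opposite dart, in the parent face. The factor \<open>M\<close> makes the rank lexicographic
    in face and position.\<close>
  define np where "np d = (if d = A d then \<alpha> d else pre d)" for d
  define rkN where "rkN d = frk (Fc d) * M + ps d" for d
  have rt: "rtree D d0 np rkN"
    unfolding rtree_def
  proof (intro conjI ballI impI)
    show "finite D" "d0 \<in> D" using finD d0 by auto
    fix d assume d: "d \<in> D" "d \<noteq> d0"
    have "np d \<in> D \<and> rkN (np d) < rkN d"
    proof (cases "d = A d")
      case True
      have fF: "Fc d \<in> F" using d by (simp add: F_def)
      have f: "Fc d \<noteq> f0" using True d by (auto simp: A_def an_def)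
      have "Fc (\<alpha> d) = fpa (Fc d)" using an2(2)[OF fF f] True by (simp add: A_def)
      then have "frk (Fc d) = Suc (frk (Fc (\<alpha> d)))" using fpa[OF fF f] by simp
      then have "rkN (\<alpha> d) < rkN d" using psM[of "\<alpha> d"] \<alpha>D d by (simp add: rkN_def)
      then show ?thesis using True d \<alpha>D by (simp add: np_def)
    next
      case False
      have "Fc (pre d) = Fc d" using Fc\<phi>[of "pre d"] pre[OF d(1) False] by simp
      then show ?thesis using pre[OF d(1) False] False by (simp add: np_def rkN_def)
    qed
    then show "np d \<in> D" "rkN (np d) < rkN d" by auto
  qed
  define AN where "AN = an ` (F - {f0})"
  define X where "X = {d \<in> D. \<alpha> d \<noteq> d \<and> d \<notin> TD \<and> d \<notin> AN \<and> \<alpha> d \<notin> AN}"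
  have Xa: "\<alpha> d \<in> X" if "d \<in> X" for d using that TDa \<alpha>D \<alpha>\<alpha> unfolding X_def by force
  have ANa: "\<alpha> d \<noteq> d" "\<alpha> d \<notin> AN" if dAN: "d \<in> AN" for d
  proof -
    obtain f where f: "f \<in> F" "f \<noteq> f0" "d = an f" using dAN by (auto simp: AN_def)
    have rk: "frk f = Suc (frk (fpa f))" using fpa f by auto
    have Fd: "Fc d = f" "Fc (\<alpha> d) = fpa f" using an an2 f by auto
    then show "\<alpha> d \<noteq> d" using rk by auto
    show "\<alpha> d \<notin> AN"
    proof
      assume "\<alpha> d \<in> AN"
      then obtain g where g: "g \<in> F" "g \<noteq> f0" "\<alpha> d = an g" by (auto simp: AN_def)
      have "Fc (\<alpha> d) = g" "Fc (\<alpha> (\<alpha> d)) = fpa g" using an an2 g by auto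
      then have "g = fpa f" "f = fpa g" using Fd an(1)[OF f(1)] f(3) \<alpha>\<alpha> by auto
      then show False using rk fpa[OF g(1,2)] by simp
    qed
  qed
  \<comment> \<open>The two trees have \<open>card V - 1\<close> and \<open>card F - 1\<close>
    edges, disjoint from each other and from \<open>X\<close>; Euler's formula leaves
    \<open>G\<close> for \<open>X\<close>.\<close>
  have cX: "card (egs \<alpha> X) \<le> G"
  proof -
    have finE: "finite (egs \<alpha> Y)" if "Y \<subseteq> D" for Y
    proof -
      have "egs \<alpha> Y \<subseteq> (\<lambda>d. {d, \<alpha> d}) ` D" using that by (auto simp: egs_def)
      then show ?thesis using finD finite_surj by blast
    qed
    define ET where "ET = (\<lambda>v. {pd v, \<alpha> (pd v)}) ` (V - {r})"
    define EA where "EA = (\<lambda>f. {an f, \<alpha> (an f)}) ` (F - {f0})"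
    have cT: "card ET = card V - 1"
    proof -
      have "inj_on (\<lambda>v. {pd v, \<alpha> (pd v)}) (V - {r})"
      proof (rule inj_onI)
        fix v w assume vw: "v \<in> V - {r}" "w \<in> V - {r}" "{pd v, \<alpha> (pd v)} = {pd w, \<alpha> (pd w)}"
        have v: "vt (pd v) = v" "vt (\<alpha> (pd v)) = pa v" "lev v = Suc (lev (pa v))" using pd pa vw by auto
        have w: "vt (pd w) = w" "vt (\<alpha> (pd w)) = pa w" "lev w = Suc (lev (pa w))" using pd pa vw by auto
        show "v = w"
        proof (rule ccontr)
          assume "v \<noteq> w"
          then have "pd v \<noteq> pd w" using v w by metis
          then have "pd v = \<alpha> (pd w)" "pd w = \<alpha> (pd v)" using vw(3) by (auto simp: doubleton_eq_iff)
          then have "v = pa w" "w = pa v" using v w by metis+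
          then show False using v w by simp
        qed
      qed
      then show ?thesis unfolding ET_def using rV finV by (simp add: card_image)
    qed
    have cA: "card EA = card F - 1"
    proof -
      have "inj_on (\<lambda>f. {an f, \<alpha> (an f)}) (F - {f0})"
      proof (rule inj_onI)
        fix f g assume fg: "f \<in> F - {f0}" "g \<in> F - {f0}" "{an f, \<alpha> (an f)} = {an g, \<alpha> (an g)}"
        have "an f \<in> AN" "an g \<in> AN" using fg by (auto simp: AN_def)
        then have "an f = an g" using fg(3) ANa(2)[of "an g"] by (auto simp: doubleton_eq_iff)
        then show "f = g" using an(2) fg by (metis DiffD1)
      qed
      then show ?thesis unfolding EA_def using f0F finF by (simp add: card_image)
    qed
    have sub: "ET \<union> EA \<union> egs \<alpha> X \<subseteq> egs \<alpha> D"
    proof -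
      have "{pd v, \<alpha> (pd v)} \<in> egs \<alpha> D" if v: "v \<in> V - {r}" for v
      proof -
        have "vt (pd v) = v" "vt (\<alpha> (pd v)) = pa v" "lev v = Suc (lev (pa v))" "pd v \<in> D" using pd pa v by auto
        then have "\<alpha> (pd v) \<noteq> pd v" by auto
        then show ?thesis unfolding egs_def using \<open>pd v \<in> D\<close> by blast
      qed
      moreover have "{an f, \<alpha> (an f)} \<in> egs \<alpha> D" if f: "f \<in> F - {f0}" for f
      proof -
        have "an f \<in> AN" "an f \<in> D" using f an by (auto simp: AN_def)
        then show ?thesis using ANa(1) unfolding egs_def by blast
      qed
      moreover have "egs \<alpha> X \<subseteq> egs \<alpha> D" by (auto simp: egs_def X_def)
      ultimately show ?thesis by (auto simp: ET_def EA_def)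
    qed
    have d1: "ET \<inter> EA = {}"
    proof -
      have "an f \<notin> {pd v, \<alpha> (pd v)}" if "f \<in> F - {f0}" "v \<in> V - {r}" for f v
        using an2(1)[of f] that by (auto simp: TD_def)
      then show ?thesis unfolding ET_def EA_def by blast
    qed
    have d2: "(ET \<union> EA) \<inter> egs \<alpha> X = {}"
    proof (rule ccontr)
      assume "(ET \<union> EA) \<inter> egs \<alpha> X \<noteq> {}"
      then obtain e where e: "e \<in> ET \<union> EA" "e \<in> egs \<alpha> X" by blast
      then obtain x where x: "x \<in> X" "e = {x, \<alpha> x}" unfolding egs_def by blast
      have "y \<notin> TD \<and> y \<notin> AN" if "y \<in> e" for y using that x Xa[OF x(1)] by (auto simp: X_def)
      moreover have "\<exists>y\<in>e. y \<in> TD \<or> y \<in> AN" using e(1) by (auto simp: ET_def EA_def TD_def AN_def)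
      ultimately show False by blast
    qed
    have "card ET + card EA + card (egs \<alpha> X) = card (ET \<union> EA \<union> egs \<alpha> X)"
      using d1 d2 finV finF finE[of X] by (subst card_Un_disjoint, simp_all add: ET_def EA_def X_def)+
    also have "\<dots> \<le> card (egs \<alpha> D)" using sub finE[of D] by (intro card_mono) auto
    finally have "card V - 1 + (card F - 1) + card (egs \<alpha> X) \<le> card (egs \<alpha> D)" by (simp add: cT cA)
    moreover have "card V \<ge> 1" "card F \<ge> 1" using rV finV f0F finF by (auto simp: Suc_le_eq card_gt_0_iff)
    ultimately show ?thesis using euler FF V_def by simp
  qed
  have cvX: "card (vt ` X) \<le> 2 * G"
  proof -
    have finX: "finite X" using finD by (simp add: X_def)
    have "X \<subseteq> \<Union>(egs \<alpha> X)" by (auto simp: egs_def X_def)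
    moreover have "finite (egs \<alpha> X)"
    proof -
      have "egs \<alpha> X \<subseteq> (\<lambda>d. {d, \<alpha> d}) ` X" by (auto simp: egs_def)
      then show ?thesis using finX finite_surj by blast
    qed
    ultimately have "card X \<le> card (\<Union>(egs \<alpha> X))" by (intro card_mono) (auto simp: egs_def)
    also have "\<dots> \<le> (\<Sum>e\<in>egs \<alpha> X. card e)" by (rule card_Union_le_sum_card)
    also have "\<dots> \<le> (\<Sum>e\<in>egs \<alpha> X. 2)" by (rule sum_mono) (auto simp: egs_def card_insert_if)
    also have "\<dots> \<le> 2 * G" using cX by simp
    finally show ?thesis using card_image_le[OF finX, of vt] by linarith
  qed

  define PA where "PA = {(v, pa v) | v. v \<in> V \<and> v \<noteq> r}"
  define Anc where "Anc v = {u. (v, u) \<in> PA\<^sup>*}" for v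
  have AncV: "Anc v \<subseteq> V" if "v \<in> V" for v
  proof
    fix u assume "u \<in> Anc v"
    then have "(v, u) \<in> PA\<^sup>*" by (simp add: Anc_def)
    then show "u \<in> V" using that by (induction) (use pa in \<open>auto simp: PA_def\<close>)
  qed
  have anc_lev: "lev u \<le> lev v \<and> (lev u = lev v \<longrightarrow> u = v)" if "(v, u) \<in> PA\<^sup>*" for u v
    using that
  proof (induction)
    case (step y z) then show ?case using pa by (auto simp: PA_def)
  qed simp
  have sv: "single_valued PA" by (auto simp: single_valued_def PA_def)
  have anc_inj: "inj_on lev (Anc v)" for v
  proof (rule inj_onI)
    fix x y assume "x \<in> Anc v" "y \<in> Anc v" "lev x = lev y"
    then show "x = y" using single_valued_confluent[OF sv, of v x y] anc_lev
      by (fastforce simp: Anc_def)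
  qed
  have anc_win: "card {u \<in> Anc v. l \<le> lev u \<and> lev u < l + k} \<le> k" for v l
  proof -
    have "card {u \<in> Anc v. l \<le> lev u \<and> lev u < l + k} \<le> card {l..<l + k}"
      by (rule card_inj_on_le[where f = lev]) (auto intro: inj_on_subset[OF anc_inj])
    then show ?thesis by simp
  qed
  define XA where "XA = (\<Union>x\<in>vt ` X. Anc x)"
  \<comment> \<open>The root path of the anchor is in every bag of its face, so that a vertex of
    this path can be followed back along the face to the anchor. \<open>XA\<close> is in all bags,
    which settles the vertices on the leftover root paths.\<close>
  define bag where "bag d = Anc (vt d) \<union> Anc (vt (\<alpha> d)) \<union> Anc (vt (A d)) \<union> XA" for d
  have td: "td V {{vt d, vt (\<alpha> d)} | d. d \<in> D} D d0 np rkN bag"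
    unfolding td_def
  proof (intro conjI)
    show "rtree D d0 np rkN" by (rule rt)
    have vV: "vt d \<in> V" if "d \<in> D" for d using that by (simp add: V_def)
    have "XA \<subseteq> V" using AncV vV by (auto simp: XA_def X_def)
    then show "\<forall>d\<in>D. bag d \<subseteq> V" using AncV vV \<alpha>D AD by (auto simp: bag_def)
    have self: "v \<in> Anc v" for v by (simp add: Anc_def)
    show "\<forall>v\<in>V. \<exists>d\<in>D. v \<in> bag d" using self by (auto simp: V_def bag_def)
    show "\<forall>e\<in>{{vt d, vt (\<alpha> d)} | d. d \<in> D}. \<exists>d\<in>D. e \<subseteq> bag d"
    proof
      fix e assume "e \<in> {{vt d, vt (\<alpha> d)} | d. d \<in> D}"
      then obtain d where "d \<in> D" "e = {vt d, vt (\<alpha> d)}" by blast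
      then show "\<exists>d\<in>D. e \<subseteq> bag d" using self by (intro bexI[of _ d]) (auto simp: bag_def)
    qed
    show "\<forall>z\<in>V. \<forall>d\<in>D. \<forall>e\<in>D. z \<in> bag d \<longrightarrow> z \<in> bag e \<longrightarrow> (d, e) \<in> (restr_to {k. z \<in> bag k} (nadj D d0 np))\<^sup>*"
    proof (intro ballI impI)
      fix z d e assume zV: "z \<in> V" and de: "d \<in> D" "e \<in> D" "z \<in> bag d" "z \<in> bag e"
      let ?R = "restr_to {k. z \<in> bag k} (nadj D d0 np)"
      show "(d, e) \<in> ?R\<^sup>*"
      proof (cases "z \<in> XA")
        case True
        then show ?thesis using rtree_conn[OF rt de(1,2)] by (simp add: bag_def)
      next
        case False
        \<comment> \<open>The subtree below \<open>z\<close>. Since \<open>z\<close> is not in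
          \<open>XA\<close>, a node has \<open>z\<close> in its bag exactly if an end of the dart or
          the vertex of its anchor lies in \<open>W\<close>.\<close>
        define W where "W = {v \<in> V. z \<in> Anc v}"
        define Q where "Q = {(d, e). d \<in> D \<and> e \<in> D \<and> (d, e) \<in> ?R\<^sup>*}"
        have inK: "z \<in> bag d" if "vt d \<in> W \<or> vt (\<alpha> d) \<in> W \<or> vt (A d) \<in> W" for d
          using that by (auto simp: bag_def W_def)
        have edge: "(d, np d) \<in> Q" if "d \<in> D" "d \<noteq> d0" "z \<in> bag d" "z \<in> bag (np d)" for d
        proof -
          have "np d \<in> D" using rt that by (simp add: rtree_def)
          then have "(d, np d) \<in> ?R" using that by (simp add: restr_to_def nadj_def)
          then show ?thesis using that \<open>np d \<in> D\<close> by (simp add: Q_def r_into_rtrancl)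
        qed
        have symQ: "sym Q" unfolding Q_def sym_def by (auto intro: nadj_conn_sym)
        have transQ: "trans Q" unfolding Q_def trans_def by (auto intro: rtrancl_trans)
        have reflQ: "(d, d) \<in> Q" if "d \<in> D" for d using that by (simp add: Q_def)
        have F1: "(d, A d) \<in> Q" if "d \<in> D" "vt (A d) \<in> W" for d
          using that
        proof (induction "ps d" arbitrary: d rule: less_induct)
          case less
          show ?case
          proof (cases "d = A d")
            case True then show ?thesis using reflQ less.prems by metis
          next
            case False
            note p = pre[OF less.prems(1) False]
            have "d \<noteq> d0"
            proof
              assume "d = d0"
              then have "A d = d" by (simp add: A_def f0_def[symmetric] an_def)
              then show False using False by simp
            qed
            then have "(d, pre d) \<in> Q" using edge[of d] less.prems inK p False by (simp add: np_def)
            moreover have "(pre d, A d) \<in> Q" using less.hyps[OF p(4,1)] p less.prems by simp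
            ultimately show ?thesis using transQ by (meson transD)
          qed
        qed
        have F2: "(d, \<phi> d) \<in> Q" if d: "d \<in> D" "vt (\<alpha> d) \<in> W" for d
        proof (cases "\<phi> d = A (\<phi> d)")
          case True
          have "A (\<phi> d) = A d" using Fc\<phi>[OF d(1)] by (simp add: A_def)
          then have "\<phi> d = A d" "vt (A d) \<in> W" using True d vt\<phi>[OF d(1)] by simp_all
          then show ?thesis using F1[OF d(1)] by simp
        next
          case False
          have "\<phi> d \<noteq> d0"
          proof
            assume *: "\<phi> d = d0"
            then have "A (\<phi> d) = \<phi> d" by (simp add: A_def f0_def[symmetric] an_def)
            then show False using False by simp
          qed
          moreover have "np (\<phi> d) = d" using False pre\<phi>[OF d(1)] by (simp add: np_def)
          ultimately have "(\<phi> d, d) \<in> Q" using edge[of "\<phi> d"] inK d \<phi>D vt\<phi> by simp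
          then show ?thesis using symQ by (meson symD)
        qed
        \<comment> \<open>\<open>d\<close> is no leftover dart, as \<open>z\<close> would then lie
          in \<open>XA\<close>. Unless it is a stub, its edge belongs to the dual tree, where one of
          \<open>d\<close> and \<open>\<alpha> d\<close> is the parent of the other.\<close>
        have F3: "(d, \<alpha> d) \<in> Q" if d: "d \<in> D" "vt d \<in> W" "d \<notin> TD" for d
        proof (cases "\<alpha> d = d")
          case True then show ?thesis using reflQ d by simp
        next
          case aneq: False
          have in2: "z \<in> bag d" "z \<in> bag (\<alpha> d)" using inK d \<alpha>\<alpha> by auto
          have "d \<notin> X"
          proof
            assume "d \<in> X"
            then have "z \<in> XA" using d(2) by (auto simp: XA_def W_def)
            then show False using False by simp
          qed
          then have "d \<in> AN \<or> \<alpha> d \<in> AN" using d aneq by (simp add: X_def)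
          then show ?thesis
          proof
            assume "d \<in> AN"
            then obtain f where f: "f \<in> F" "f \<noteq> f0" "d = an f" by (auto simp: AN_def)
            then have "A d = d" "d \<noteq> d0" using an by (auto simp: A_def f0_def)
            then show ?thesis using edge[OF d(1)] in2 by (simp add: np_def)
          next
            assume "\<alpha> d \<in> AN"
            then obtain f where f: "f \<in> F" "f \<noteq> f0" "\<alpha> d = an f" by (auto simp: AN_def)
            then have "A (\<alpha> d) = \<alpha> d" "\<alpha> d \<noteq> d0" using an by (auto simp: A_def f0_def)
            then have "(\<alpha> d, d) \<in> Q" using edge[of "\<alpha> d"] in2 d \<alpha>D \<alpha>\<alpha> by (simp add: np_def)
            then show ?thesis using symQ by (meson symD)
          qed
        qed
        have zW: "z \<in> W" using zV self by (simp add: W_def)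
        have all: "(d, e) \<in> Q" if "d \<in> D" "e \<in> D" "vt d \<in> W" "vt e \<in> W" for d e
        proof (rule tree_tour_all[where rts = "{r}" and pd = pd and rk = lev and W = W and z = z, OF pd' TD'])
          show "W \<subseteq> vt ` D" by (auto simp: W_def V_def)
          show "v \<in> W" if "v \<in> vt ` D - {r}" "vt (\<alpha> (pd v)) \<in> W" for v
          proof -
            have "v \<in> V" "v \<noteq> r" using that by (auto simp: V_def)
            moreover from this have "pa v \<in> W" using pd[of v] that by simp
            ultimately have "(v, pa v) \<in> PA" "(pa v, z) \<in> PA\<^sup>*" by (auto simp: PA_def W_def Anc_def)
            then have "(v, z) \<in> PA\<^sup>*" by (rule converse_rtrancl_into_rtrancl)
            then show ?thesis using \<open>v \<in> V\<close> by (simp add: W_def Anc_def)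
          qed
          show "(d, \<sigma> d) \<in> Q" if d: "d \<in> D" "vt d \<in> W" "d \<notin> TD" for d
          proof -
            have "(\<alpha> d, \<sigma> d) \<in> Q" using F2[of "\<alpha> d"] d \<alpha>D \<alpha>\<alpha> by (simp add: \<phi>_def)
            then show ?thesis using F3[OF d] transQ by (meson transD)
          qed
          show "(\<alpha> d, \<sigma> d) \<in> Q" if d: "d \<in> D" "vt d \<in> W" for d
            using F2[of "\<alpha> d"] d \<alpha>D \<alpha>\<alpha> by (simp add: \<phi>_def)
          show "w \<notin> {r} \<and> vt (\<alpha> (pd w)) \<in> W" if w: "w \<in> W" "w \<noteq> z" for w
          proof -
            have "(w, z) \<in> PA\<^sup>*" using w by (simp add: W_def Anc_def)
            then obtain y where y: "(w, y) \<in> PA" "(y, z) \<in> PA\<^sup>*" using w(2) by (metis converse_rtranclE)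
            then have wy: "w \<in> V" "w \<noteq> r" "y = pa w" by (auto simp: PA_def)
            then have "pa w \<in> W" using y pa by (simp add: W_def Anc_def)
            then show ?thesis using wy pd by simp
          qed
        qed (use symQ transQ reflQ zW that in auto)
        have toW: "\<exists>d'\<in>D. vt d' \<in> W \<and> (d, d') \<in> Q" if d: "d \<in> D" "z \<in> bag d" for d
        proof -
          have "vt d \<in> W \<or> vt (\<alpha> d) \<in> W \<or> vt (A d) \<in> W"
            using d False vV \<alpha>D AD by (auto simp: bag_def W_def)
          then show ?thesis
          proof (elim disjE)
            assume "vt d \<in> W" then show ?thesis using d reflQ by blast
          next
            assume a: "vt (\<alpha> d) \<in> W"
            then show ?thesis using F2[OF d(1) a] vt\<phi>[OF d(1)] \<phi>D[OF d(1)] by (intro bexI[of _ "\<phi> d"]) simp_all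
          next
            assume a: "vt (A d) \<in> W"
            then show ?thesis using F1[OF d(1) a] AD[OF d(1)] by (intro bexI[of _ "A d"]) simp_all
          qed
        qed
        obtain d' where d': "d' \<in> D" "vt d' \<in> W" "(d, d') \<in> Q" using toW de by blast
        obtain e' where e': "e' \<in> D" "vt e' \<in> W" "(e, e') \<in> Q" using toW de by blast
        have "(d, e) \<in> Q" using all[OF d'(1) e'(1) d'(2) e'(2)] d' e' symQ transQ by (meson symD transD)
        then show ?thesis by (simp add: Q_def)
      qed
    qed
  qed
  obtain m where m: "m < k" "card {v \<in> V. lev v mod k = m} \<le> card V div k"
    using pigeonhole_mod[OF finV k] by blast
  have "has_td V {{vt d, vt (\<alpha> d)} | d. d \<in> D} ((2 * G + 3) * k + card {v \<in> V. lev v mod k = m})"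
  proof (rule has_td_layers[OF td finV _ _ _ m(1)])
    show "e \<subseteq> V" if "e \<in> {{vt d, vt (\<alpha> d)} | d. d \<in> D}" for e using that \<alpha>D by (auto simp: V_def)
    show "lev y \<le> lev x + 1" if e: "e \<in> {{vt d, vt (\<alpha> d)} | d. d \<in> D}" "x \<in> e" "y \<in> e" for e x y
    proof -
      obtain d where d: "d \<in> D" "e = {vt d, vt (\<alpha> d)}" using e by blast
      have "(vt d, vt (\<alpha> d)) \<in> R" using d by (auto simp: R_def erel_def)
      moreover from this have "(vt (\<alpha> d), vt d) \<in> R" using symR by (meson symD)
      ultimately have "lev (vt (\<alpha> d)) \<le> Suc (lev (vt d))" "lev (vt d) \<le> Suc (lev (vt (\<alpha> d)))"
        using levR by blast+
      moreover have "x = vt d \<or> x = vt (\<alpha> d)" "y = vt d \<or> y = vt (\<alpha> d)" using e(2,3) d(2) by auto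
      ultimately show ?thesis by auto
    qed
    fix d l assume "d \<in> D"
    let ?w = "\<lambda>S. {x \<in> S. l \<le> lev x \<and> lev x < l + k}"
    have finX: "finite (vt ` X)" using finD by (simp add: X_def)
    have "?w XA = (\<Union>x\<in>vt ` X. ?w (Anc x))" by (auto simp: XA_def)
    then have "card (?w XA) \<le> (\<Sum>x\<in>vt ` X. card (?w (Anc x)))"
      using card_UN_le[OF finX, of "\<lambda>x. ?w (Anc x)"] by (simp only:)
    also have "\<dots> \<le> (\<Sum>x\<in>vt ` X. k)" by (rule sum_mono) (rule anc_win)
    also have "\<dots> \<le> 2 * G * k" using cvX by simp
    finally have "card (?w XA) \<le> 2 * G * k" .
    note wX = this
    have un: "card (P \<union> P' \<union> P'' \<union> P3) \<le> card P + card P' + card P'' + card P3" for P P' P'' P3 :: "'v set"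
      using card_Un_le[of "P \<union> P' \<union> P''" P3] card_Un_le[of "P \<union> P'" P''] card_Un_le[of P P'] by linarith
    have "?w (bag d) = ?w (Anc (vt d)) \<union> ?w (Anc (vt (\<alpha> d))) \<union> ?w (Anc (vt (A d))) \<union> ?w XA"
      unfolding bag_def by blast
    then have "card (?w (bag d)) \<le> card (?w (Anc (vt d))) + card (?w (Anc (vt (\<alpha> d))))
        + card (?w (Anc (vt (A d)))) + card (?w XA)"
      by (simp only: un)
    then have "card (?w (bag d)) \<le> k + k + k + 2 * G * k"
      using anc_win[of "vt d" l] anc_win[of "vt (\<alpha> d)" l] anc_win[of "vt (A d)" l] wX by linarith
    then show "card (?w (bag d)) \<le> (2 * G + 3) * k" by (simp add: algebra_simps)
  qed
  then show ?thesis using m(2) unfolding V_def by (rule_tac has_td_mono) auto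
qed

section \<open>Counting arcs of acyclic maps\<close>

text \<open>A fibre with \<open>c \<ge> 2\<close> elements exceeds one by \<open>c - 1\<close>,
  which is at least \<open>c / 2\<close>. This turns an excess of elements over values into a bound
  on the elements that share their value.\<close>

lemma card_nonsingletons:
  assumes fin: "finite S"
  shows "card {x \<in> S. \<exists>x'\<in>S. x' \<noteq> x \<and> h x' = h x} + 2 * card (h ` S) \<le> 2 * card S"
proof -
  define Sm where "Sm = {x \<in> S. \<exists>x'\<in>S. x' \<noteq> x \<and> h x' = h x}"
  have finSm: "finite Sm" using fin by (simp add: Sm_def)
  have sub: "Sm \<subseteq> S" by (auto simp: Sm_def)
  have "2 * card (h ` Sm) = (\<Sum>y\<in>h ` Sm. 2)" by simp
  also have "\<dots> \<le> (\<Sum>y\<in>h ` Sm. card {x \<in> Sm. h x = y})"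
  proof (rule sum_mono)
    fix y assume "y \<in> h ` Sm"
    then obtain x where x: "x \<in> Sm" "y = h x" by blast
    then obtain x' where x': "x' \<in> S" "x' \<noteq> x" "h x' = h x" "x \<in> S" unfolding Sm_def by blast
    then have "x' \<in> Sm" unfolding Sm_def by (intro CollectI conjI bexI[of _ x]) auto
    then have "card {x, x'} \<le> card {x \<in> Sm. h x = y}" using x x' finSm by (intro card_mono) auto
    then show "2 \<le> card {x \<in> Sm. h x = y}" using x' by simp
  qed
  also have "\<dots> = card (\<Union>y\<in>h ` Sm. {x \<in> Sm. h x = y})"
    using finSm by (subst card_UN_disjoint) auto
  also have "(\<Union>y\<in>h ` Sm. {x \<in> Sm. h x = y}) = Sm" by auto
  finally have 1: "2 * card (h ` Sm) \<le> card Sm" .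
  have "h ` S = h ` Sm \<union> h ` (S - Sm)" using sub by auto
  then have "card (h ` S) \<le> card (h ` Sm) + card (h ` (S - Sm))" using card_Un_le by metis
  also have "card (h ` (S - Sm)) \<le> card (S - Sm)" using fin by (intro card_image_le) auto
  also have "card (S - Sm) = card S - card Sm" using finSm sub by (rule card_Diff_subset)
  finally show ?thesis using 1 card_mono[OF fin sub] unfolding Sm_def[symmetric] by linarith
qed

text \<open>A dart lies at the tail of its arc if \<open>ou\<close> holds and at the head otherwise.
  By \<open>inner\<close> only members of \<open>T\<close> can be sources or sinks.
  \<open>priv\<close> is what criticality leaves after contraction: some \<open>s\<close> in
  \<open>T\<close> reaches the tail of the arc, but the tail of no other arc with the same
  head.\<close>

locale dag_map = cmap +
  fixes ou :: "'d \<Rightarrow> bool" and T :: "'v set" and q G :: nat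
  assumes nostub: "\<And>d. d \<in> D \<Longrightarrow> \<alpha> d \<noteq> d"
    and ou: "\<And>d. d \<in> D \<Longrightarrow> ou (\<alpha> d) \<longleftrightarrow> \<not> ou d"
    and acyc: "acyclic {(vt d, vt (\<alpha> d)) | d. d \<in> D \<and> ou d}"
    and T: "finite T" "card T \<le> q"
    and inner: "\<And>v. v \<in> vt ` D \<Longrightarrow> v \<notin> T \<Longrightarrow> (\<exists>d\<in>D. vt d = v \<and> ou d) \<and> (\<exists>d\<in>D. vt d = v \<and> \<not> ou d)"
    and priv: "\<And>e. e \<in> D \<Longrightarrow> \<not> ou e \<Longrightarrow> \<exists>s\<in>T. (s, vt (\<alpha> e)) \<in> {(vt d, vt (\<alpha> d)) | d. d \<in> D \<and> ou d}\<^sup>* \<and>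
        (\<forall>a\<in>D. \<not> ou a \<longrightarrow> vt a = vt e \<longrightarrow> a \<noteq> e \<longrightarrow> (s, vt (\<alpha> a)) \<notin> {(vt d, vt (\<alpha> d)) | d. d \<in> D \<and> ou d}\<^sup>*)"
    and euler: "card (egs \<alpha> D) + 2 \<le> card (vt ` D) + card (fcs D \<sigma> \<alpha>) + G"
begin

text \<open>\<open>pr\<close> turns at a vertex against the rotation. The members of \<open>Sc\<close> mark corners between two consecutive
  incoming darts, and \<open>LL\<close> omits one of them at every sink. From a corner, \<open>eta\<close> follows the preceding
  incoming arc backwards, turning to the adjacent dart at every vertex, until it meets another corner of \<open>LL\<close>
  or, in \<open>Dead\<close>, an outgoing dart. It is injective, and private sources along its iterates are distinct.
  Hence iterating it dies within \<open>q\<close> steps, while dead corners are rare by Euler's formula.\<close>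

definition "BR = {(vt d, vt (\<alpha> d)) | d. d \<in> D \<and> ou d}"
definition "I = {d \<in> D. \<not> ou d}"
definition "pr d = inv_into D \<sigma> d"
definition "\<phi> d = \<sigma> (\<alpha> d)"
definition "Sc = {e \<in> I. pr e \<in> I}"
definition "sink v \<longleftrightarrow> (\<forall>d\<in>D. vt d = v \<longrightarrow> \<not> ou d)"
definition "ds v = (SOME d. d \<in> D \<and> vt d = v)"
definition "LL = {e \<in> Sc. \<not> (sink (vt e) \<and> e = ds (vt e))}"
definition "src e = (SOME s. s \<in> T \<and> (s, vt (\<alpha> e)) \<in> BR\<^sup>* \<and>
        (\<forall>a\<in>D. \<not> ou a \<longrightarrow> vt a = vt e \<longrightarrow> a \<noteq> e \<longrightarrow> (s, vt (\<alpha> a)) \<notin> BR\<^sup>*))"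
definition "st e l = ((\<lambda>a. pr (\<alpha> a)) ^^ l) (pr e)"
definition "nn e = (LEAST l. st e l \<notin> I - LL)"
definition "eta e = st e (nn e)"
definition "Dead = {e \<in> LL. eta e \<notin> I}"
text \<open>The first dart of each run of incoming darts in the rotation. \<open>B\<close> and
  \<open>Sc\<close> partition \<open>I\<close>; runs are compared with vertices, and corners with
  faces.\<close>

definition "B = {e \<in> I. pr e \<notin> I}"

lemma pr: "d \<in> D \<Longrightarrow> pr d \<in> D" "d \<in> D \<Longrightarrow> \<sigma> (pr d) = d" "d \<in> D \<Longrightarrow> pr (\<sigma> d) = d" "d \<in> D \<Longrightarrow> vt (pr d) = vt d"
proof -
  have surj: "\<sigma> ` D = D" and inj: "inj_on \<sigma> D" using bij\<sigma> by (auto simp: bij_betw_def)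
  show 1: "pr d \<in> D" if "d \<in> D" using inv_into_into[of d \<sigma> D] surj that by (simp add: pr_def)
  show 2: "\<sigma> (pr d) = d" if "d \<in> D" using f_inv_into_f[of d \<sigma> D] surj that by (simp add: pr_def)
  show "pr (\<sigma> d) = d" if "d \<in> D" using inj that by (simp add: pr_def)
  show "vt (pr d) = vt d" if "d \<in> D" using vt\<sigma>[OF 1[OF that]] 2[OF that] by simp
qed

lemma ID: "d \<in> I \<Longrightarrow> d \<in> D" by (simp add: I_def)
lemma finI: "finite I" using finD by (simp add: I_def)
lemma LLI: "e \<in> LL \<Longrightarrow> e \<in> I \<and> pr e \<in> I" by (simp add: LL_def Sc_def)
lemma a_I: "d \<in> D \<Longrightarrow> \<alpha> d \<in> I \<longleftrightarrow> d \<notin> I" using ou \<alpha>D by (auto simp: I_def)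
lemma BR_I: "e \<in> I \<Longrightarrow> (vt (\<alpha> e), vt e) \<in> BR"
  unfolding BR_def using ou \<alpha>D \<alpha>\<alpha> by (intro CollectI exI[of _ "\<alpha> e"]) (auto simp: I_def)

lemma \<phi>D: "d \<in> D \<Longrightarrow> \<phi> d \<in> D" using \<alpha>D \<sigma>D by (simp add: \<phi>_def)
lemma vt\<phi>: "d \<in> D \<Longrightarrow> vt (\<phi> d) = vt (\<alpha> d)" using \<alpha>D vt\<sigma> by (simp add: \<phi>_def)
lemma bij\<phi>: "bij_betw \<phi> D D" using bij_phi0 by (simp add: \<phi>_def[abs_def])

lemma pr_orb: assumes "d \<in> D" "d' \<in> D" "vt d = vt d'" shows "\<exists>k. d' = (pr ^^ k) d"
proof -
  obtain k where k: "d = (\<sigma> ^^ k) d'" using trans\<sigma>[OF assms(2,1)] assms(3) by (auto simp: orb_def)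
  have "(pr ^^ k) ((\<sigma> ^^ k) d') = d'"
  proof (induction k)
    case (Suc k)
    have "(\<sigma> ^^ k) d' \<in> D" using bij_pow_in[OF bij\<sigma> assms(2)] .
    then have "pr ((\<sigma> ^^ Suc k) d') = (\<sigma> ^^ k) d'" using pr(3) by simp
    moreover have "(pr ^^ Suc k) y = (pr ^^ k) (pr y)" for y by (simp add: funpow_swap1)
    ultimately show ?case using Suc by metis
  qed simp
  then show ?thesis using k by metis
qed

text \<open>At a sink all darts are corners, and the one omitted from \<open>LL\<close> keeps
  \<open>pr\<close> from running around the vertex within \<open>LL\<close>. Elsewhere an outgoing
  dart does so.\<close>

lemma notLL: assumes "e \<in> D" shows "\<exists>d\<in>D. vt d = vt e \<and> d \<notin> LL"
proof (cases "sink (vt e)")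
  case True
  have "ds (vt e) \<in> D \<and> vt (ds (vt e)) = vt e" unfolding ds_def by (rule someI[of _ e]) (use assms in simp)
  then show ?thesis using True by (intro bexI[of _ "ds (vt e)"]) (auto simp: LL_def)
next
  case False
  then show ?thesis by (auto simp: sink_def LL_def Sc_def I_def)
qed

lemma pr_cycle: assumes "e \<in> LL" "\<And>i. i < j \<Longrightarrow> (pr ^^ i) e \<in> LL" "0 < j" shows "(pr ^^ j) e \<noteq> e"
proof
  assume c: "(pr ^^ j) e = e"
  have "(pr ^^ i) e \<in> LL" for i
    using assms(2)[of "i mod j"] assms(3) funpow_mod_eq[OF c] by (metis mod_less_divisor)
  moreover obtain d where "d \<in> D" "vt d = vt e" "d \<notin> LL" using notLL[of e] assms(1) LLI ID by blast
  ultimately show False using pr_orb[of e d] assms(1) LLI ID by metis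
qed

lemma src: assumes "e \<in> I"
  shows "src e \<in> T" "(src e, vt (\<alpha> e)) \<in> BR\<^sup>*" "\<And>a. a \<in> I \<Longrightarrow> vt a = vt e \<Longrightarrow> a \<noteq> e \<Longrightarrow> (src e, vt (\<alpha> a)) \<notin> BR\<^sup>*"
proof -
  have "\<exists>s. s \<in> T \<and> (s, vt (\<alpha> e)) \<in> BR\<^sup>* \<and>
        (\<forall>a\<in>D. \<not> ou a \<longrightarrow> vt a = vt e \<longrightarrow> a \<noteq> e \<longrightarrow> (s, vt (\<alpha> a)) \<notin> BR\<^sup>*)"
    using priv[of e] assms unfolding BR_def[symmetric] I_def by blast
  from someI_ex[OF this] show "src e \<in> T" "(src e, vt (\<alpha> e)) \<in> BR\<^sup>*"
    "\<And>a. a \<in> I \<Longrightarrow> vt a = vt e \<Longrightarrow> a \<noteq> e \<Longrightarrow> (src e, vt (\<alpha> a)) \<notin> BR\<^sup>*"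
    unfolding src_def[symmetric] by (auto simp: I_def)
qed

lemma wfBR: "wf BR"
proof (rule finite_acyclic_wf)
  have "BR \<subseteq> (\<lambda>d. (vt d, vt (\<alpha> d))) ` D" by (auto simp: BR_def)
  then show "finite BR" using finD finite_surj by blast
  show "acyclic BR" using acyc by (simp add: BR_def)
qed

section \<open>Walks from corners and the iteration of \<open>eta\<close>\<close>

lemma st0 [simp]: "st e 0 = pr e" by (simp add: st_def)
lemma stSuc: "st e (Suc l) = pr (\<alpha> (st e l))" by (simp add: st_def)
lemma stD: "e \<in> D \<Longrightarrow> st e l \<in> D" by (induction l) (simp_all add: stSuc pr \<alpha>D)
lemma vt_stSuc: "e \<in> D \<Longrightarrow> vt (st e (Suc l)) = vt (\<alpha> (st e l))" using stD \<alpha>D pr by (simp add: stSuc)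

text \<open>Each further position lies at the tail of an incoming arc, so an endless walk would
  descend forever in the acyclic \<open>BR\<close>.\<close>

lemma nn_ex: assumes "e \<in> D" shows "\<exists>l. st e l \<notin> I - LL"
proof (rule ccontr)
  assume "\<not> ?thesis"
  then have "st e l \<in> I" for l by blast
  then have "(vt (st e (Suc l)), vt (st e l)) \<in> BR" for l using BR_I vt_stSuc[OF assms] by simp
  then have "\<exists>f. \<forall>i. (f (Suc i), f i) \<in> BR" by (intro exI[of _ "\<lambda>l. vt (st e l)"]) simp
  then show False using wfBR unfolding wf_iff_no_infinite_down_chain by simp
qed

lemma nn: "e \<in> D \<Longrightarrow> eta e \<notin> I - LL" "l < nn e \<Longrightarrow> st e l \<in> I - LL"
  unfolding eta_def nn_def by (metis nn_ex LeastI_ex) (metis not_less_Least)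

text \<open>A position determines its predecessor through \<open>\<sigma>\<close> and
  \<open>\<alpha>\<close>, and the start is recognised by the dart to which \<open>\<sigma>\<close>
  leads: it is the incoming dart \<open>e\<close> at position \<open>0\<close> and outgoing later.
  So walks from different corners share no position, which makes \<open>eta\<close> injective and
  allows a walk to be charged to a dart that it meets.\<close>

lemma st_inj:
  assumes "e \<in> LL" "e' \<in> LL" "l \<le> nn e" "l' \<le> nn e'" "st e l = st e' l'"
  shows "e = e'"
  using assms(3-5)
proof (induction l arbitrary: l')
  case 0
  have eD: "e \<in> D" "e' \<in> D" using assms LLI ID by auto
  show ?case
  proof (cases l')
    case 0 then show ?thesis using "0.prems" eD pr by (metis st0)
  next
    case (Suc m)
    then have m: "st e' m \<in> I" using nn(2)[of m e'] "0.prems" by auto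
    then have md: "st e' m \<in> D" "\<alpha> (st e' m) \<in> D" using ID \<alpha>D by auto
    have "\<sigma> (pr e) = \<alpha> (st e' m)" using "0.prems" Suc md pr by (simp add: stSuc)
    then have "\<alpha> (st e' m) \<in> I" using eD pr assms(1) LLI by simp
    then show ?thesis using a_I md m by simp
  qed
next
  case (Suc l)
  have eD: "e \<in> D" "e' \<in> D" using assms LLI ID by auto
  have l: "st e l \<in> I" using nn(2)[of l e] Suc.prems by auto
  then have ld: "st e l \<in> D" "\<alpha> (st e l) \<in> D" using ID \<alpha>D by auto
  have sl: "\<sigma> (st e (Suc l)) = \<alpha> (st e l)" using ld pr by (simp add: stSuc)
  show ?case
  proof (cases l')
    case 0
    then have "\<alpha> (st e l) = e'" using sl Suc.prems eD pr by simp
    then show ?thesis using a_I ld l assms(2) LLI by auto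
  next
    case (Suc m)
    then have m: "st e' m \<in> I" using nn(2)[of m e'] Suc.prems by auto
    then have md: "st e' m \<in> D" "\<alpha> (st e' m) \<in> D" using ID \<alpha>D by auto
    have "\<sigma> (st e' (Suc m)) = \<alpha> (st e' m)" using md pr by (simp add: stSuc)
    then have "\<alpha> (st e l) = \<alpha> (st e' m)" using sl Suc.prems Suc by simp
    then have "st e l = st e' m" using \<alpha>\<alpha> ld md by metis
    then show ?thesis using Suc.IH[of m] Suc.prems Suc by simp
  qed
qed

lemma eta_LL: "e \<in> LL \<Longrightarrow> e \<notin> Dead \<Longrightarrow> eta e \<in> LL"
  using nn(1)[of e] LLI ID by (auto simp: Dead_def)

lemma eta_inj: "e \<in> LL \<Longrightarrow> e' \<in> LL \<Longrightarrow> eta e = eta e' \<Longrightarrow> e = e'"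
  using st_inj[of e e' "nn e" "nn e'"] by (simp add: eta_def)

lemma st_reach:
  assumes "e \<in> LL" "1 \<le> l" "l \<le> nn e"
  shows "(vt (st e l), vt (\<alpha> (pr e))) \<in> BR\<^sup>*"
  using assms(2,3)
proof (induction l rule: nat_induct_at_least)
  case base then show ?case using vt_stSuc[of e 0] assms LLI ID by simp
next
  case (Suc n)
  then have "st e n \<in> I" using nn(2)[of n e] by auto
  then have "(vt (st e (Suc n)), vt (st e n)) \<in> BR" using BR_I vt_stSuc assms LLI ID by simp
  then show ?case using Suc by (meson converse_rtrancl_into_rtrancl Suc_leD)
qed

lemma eta_step:
  assumes "e \<in> LL" "e \<notin> Dead"
  shows "eta e = pr e \<or> pr e \<notin> LL \<and> (vt (eta e), vt (\<alpha> (pr e))) \<in> BR\<^sup>*"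
proof (cases "nn e = 0")
  case True then show ?thesis by (simp add: eta_def)
next
  case False
  then have "pr e \<notin> LL" using nn(2)[of 0 e] by simp
  moreover have "(vt (eta e), vt (\<alpha> (pr e))) \<in> BR\<^sup>*" using st_reach[of e "nn e"] assms False by (simp add: eta_def)
  ultimately show ?thesis by simp
qed

text \<open>The iterates turn at the vertex of \<open>e\<close> as long as they stay in
  \<open>LL\<close>. They can leave it only through the tail of an incoming arc \<open>a\<close> at
  this vertex, and that tail is reachable from every later iterate. \<open>a\<close> differs from
  \<open>e\<close> because \<open>e\<close> is in \<open>LL\<close> and \<open>a\<close> is not at
  the moment of leaving.\<close>

lemma chain:
  assumes "e \<in> LL" "\<And>i. i < j \<Longrightarrow> (eta ^^ i) e \<in> LL - Dead"
  shows "(eta ^^ j) e \<in> LL \<and> ((vt ((eta ^^ j) e) = vt e \<and> (eta ^^ j) e = (pr ^^ j) e \<and> (\<forall>i\<le>j. (pr ^^ i) e \<in> LL))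
    \<or> (\<exists>a\<in>I. vt a = vt e \<and> a \<noteq> e \<and> (vt ((eta ^^ j) e), vt (\<alpha> a)) \<in> BR\<^sup>*))"
  using assms(2)
proof (induction j)
  case 0 then show ?case using assms(1) by simp
next
  case (Suc j)
  let ?x = "(eta ^^ j) e"
  have x: "?x \<in> LL" "?x \<notin> Dead" using Suc.prems[of j] by auto
  have xD: "?x \<in> D" using x LLI ID by blast
  have y: "eta ?x \<in> LL" using eta_LL[OF x] .
  have vx: "(vt (eta ?x), vt ?x) \<in> BR\<^sup>*"
  proof -
    have "(vt (\<alpha> (pr ?x)), vt (pr ?x)) \<in> BR" using BR_I x LLI by blast
    then have "(vt (\<alpha> (pr ?x)), vt ?x) \<in> BR" using pr xD by simp
    moreover have "vt (pr ?x) = vt ?x" using pr xD by simp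
    ultimately show ?thesis using eta_step[OF x] by (metis rtrancl.rtrancl_into_rtrancl rtrancl.rtrancl_refl)
  qed
  have IH: "(vt ?x = vt e \<and> ?x = (pr ^^ j) e \<and> (\<forall>i\<le>j. (pr ^^ i) e \<in> LL))
    \<or> (\<exists>a\<in>I. vt a = vt e \<and> a \<noteq> e \<and> (vt ?x, vt (\<alpha> a)) \<in> BR\<^sup>*)"
    using Suc.IH Suc.prems by auto
  show ?case
  proof (cases "\<exists>a\<in>I. vt a = vt e \<and> a \<noteq> e \<and> (vt ?x, vt (\<alpha> a)) \<in> BR\<^sup>*")
    case True
    then have "\<exists>a\<in>I. vt a = vt e \<and> a \<noteq> e \<and> (vt (eta ?x), vt (\<alpha> a)) \<in> BR\<^sup>*"
      using vx by (meson rtrancl_trans)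
    then show ?thesis using y by simp
  next
    case False
    then have A: "vt ?x = vt e" "?x = (pr ^^ j) e" "\<forall>i\<le>j. (pr ^^ i) e \<in> LL" using IH by auto
    have px: "pr ?x = (pr ^^ Suc j) e" using A by simp
    from eta_step[OF x] show ?thesis
    proof
      assume e: "eta ?x = pr ?x"
      then have "\<forall>i\<le>Suc j. (pr ^^ i) e \<in> LL" using A(3) y px by (auto simp: le_Suc_eq)
      then show ?thesis using e y px A pr xD by simp
    next
      assume e: "pr ?x \<notin> LL \<and> (vt (eta ?x), vt (\<alpha> (pr ?x))) \<in> BR\<^sup>*"
      then have "pr ?x \<noteq> e" using assms(1) by auto
      moreover have "pr ?x \<in> I" "vt (pr ?x) = vt e" using x LLI A pr xD by auto
      ultimately show ?thesis using e y by auto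
    qed
  qed
qed

text \<open>A common source would reach the tail of a second arc into the vertex of
  \<open>e\<close>: the iterate itself if it is still at this vertex, and otherwise the arc
  \<open>a\<close> from \<open>chain\<close>. That contradicts privacy.\<close>

lemma src_distinct:
  assumes "e \<in> LL" "\<And>i. i < j \<Longrightarrow> (eta ^^ i) e \<in> LL - Dead" "0 < j"
  shows "src ((eta ^^ j) e) \<noteq> src e"
proof
  assume eq: "src ((eta ^^ j) e) = src e"
  let ?x = "(eta ^^ j) e"
  note c = chain[OF assms(1,2)]
  have eI: "e \<in> I" and xI: "?x \<in> I" using assms(1) c LLI by auto
  have r: "(src e, vt (\<alpha> ?x)) \<in> BR\<^sup>*" using src(2)[OF xI] eq by simp
  then have r2: "(src e, vt ?x) \<in> BR\<^sup>*" using BR_I[OF xI] by simp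
  from c consider "vt ?x = vt e" "?x = (pr ^^ j) e" "\<forall>i\<le>j. (pr ^^ i) e \<in> LL"
    | a where "a \<in> I" "vt a = vt e" "a \<noteq> e" "(vt ?x, vt (\<alpha> a)) \<in> BR\<^sup>*" by blast
  then show False
  proof cases
    case 1
    then have "?x \<noteq> e" using pr_cycle[OF assms(1) _ assms(3)] by auto
    then show False using src(3)[OF eI xI] 1 r by blast
  next
    case 2
    then show False using src(3)[OF eI] r2 by (meson rtrancl_trans)
  qed
qed

text \<open>If the iterates with index below \<open>q\<close> were all alive, those with index
  \<open>0\<close> to \<open>q\<close> would have \<open>q + 1\<close> different sources in
  \<open>T\<close>.\<close>

lemma chain_end:
  assumes "e \<in> LL"
  shows "\<exists>i<q. (eta ^^ i) e \<in> Dead \<and> (\<forall>j<i. (eta ^^ j) e \<in> LL - Dead)"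
proof (rule ccontr)
  assume "\<not> ?thesis"
  then have no: "(eta ^^ i) e \<notin> Dead" if "i < q" "\<forall>j<i. (eta ^^ j) e \<in> LL - Dead" for i using that by blast
  have all: "(eta ^^ i) e \<in> LL - Dead" if "i < q" for i
    using that
  proof (induction i rule: less_induct)
    case (less i)
    then have "(eta ^^ i) e \<in> LL" using chain[OF assms, of i] by auto
    then show ?case using no[of i] less by auto
  qed
  have "inj_on (\<lambda>i. src ((eta ^^ i) e)) {..q}"
  proof (rule linorder_inj_onI)
    fix i j assume ij: "i < j" "i \<in> {..q}" "j \<in> {..q}"
    let ?x = "(eta ^^ i) e"
    have "?x \<in> LL" using all[of i] ij by auto
    moreover have "(eta ^^ m) ?x \<in> LL - Dead" if "m < j - i" for m
      using all[of "m + i"] that ij by (simp add: funpow_add)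
    ultimately have "src ((eta ^^ (j - i)) ?x) \<noteq> src ?x" using src_distinct ij by auto
    moreover have "(eta ^^ (j - i)) ?x = (eta ^^ (j - i + i)) e" by (simp only: funpow_add o_apply)
    ultimately show "src ((eta ^^ i) e) \<noteq> src ((eta ^^ j) e)" using ij by simp
  qed auto
  moreover have "(\<lambda>i. src ((eta ^^ i) e)) ` {..q} \<subseteq> T"
  proof -
    have "(eta ^^ i) e \<in> LL" if "i \<le> q" for i using chain[OF assms, of i] all that by auto
    then show ?thesis using src(1) LLI by auto
  qed
  ultimately have "card {..q} \<le> card T" using T(1) card_inj_on_le by blast
  then show False using T(2) by simp
qed

lemma finLL: "finite LL" using finI by (auto simp: LL_def Sc_def)

text \<open>Since \<open>eta\<close> is injective, a corner is determined by the dead corner at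
  which its iteration ends and the number of steps, which is below \<open>q\<close>.\<close>

lemma card_LL: "card LL \<le> q * card Dead"
proof -
  obtain ix where ix: "\<And>e. e \<in> LL \<Longrightarrow> ix e < q \<and> (eta ^^ ix e) e \<in> Dead \<and> (\<forall>j<ix e. (eta ^^ j) e \<in> LL - Dead)"
    using chain_end by metis
  have finDead: "finite Dead" using finLL by (simp add: Dead_def)
  have pinj: "e = e'" if "e \<in> LL" "e' \<in> LL" "\<forall>j<i. (eta ^^ j) e \<in> LL - Dead" "\<forall>j<i. (eta ^^ j) e' \<in> LL - Dead"
    "(eta ^^ i) e = (eta ^^ i) e'" for e e' i
    using that
  proof (induction i)
    case (Suc i)
    then have "(eta ^^ i) e = (eta ^^ i) e'" using eta_inj[of "(eta ^^ i) e" "(eta ^^ i) e'"] by simp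
    then show ?case using Suc by simp
  qed simp
  have "card LL \<le> card (Dead \<times> {..<q})"
  proof (rule card_inj_on_le)
    show "inj_on (\<lambda>e. ((eta ^^ ix e) e, ix e)) LL"
    proof (rule inj_onI)
      fix e e' assume e: "e \<in> LL" "e' \<in> LL" and eq: "((eta ^^ ix e) e, ix e) = ((eta ^^ ix e') e', ix e')"
      have i: "ix e' = ix e" using eq by simp
      show "e = e'"
        by (rule pinj[OF e, of "ix e"]) (use ix[OF e(1)] ix[OF e(2)] eq i in auto)
    qed
    show "(\<lambda>e. ((eta ^^ ix e) e, ix e)) ` LL \<subseteq> Dead \<times> {..<q}" using ix by auto
    show "finite (Dead \<times> {..<q})" using finDead by simp
  qed
  also have "\<dots> = q * card Dead" by (simp add: card_cartesian_product)
  finally show ?thesis .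
qed

text \<open>\<open>b\<close> is a run of length one. The next incoming dart in the rotation begins
  another run, and it is not \<open>b\<close> itself, since all darts in between are outgoing and
  \<open>b'\<close> would be missed.\<close>

lemma B_other:
  assumes b: "b \<in> B" "\<sigma> b \<notin> I" and b': "b' \<in> I" "b' \<noteq> b" "vt b' = vt b"
  shows "\<exists>c\<in>B. c \<noteq> b \<and> vt c = vt b"
proof -
  have bD: "b \<in> D" "b' \<in> D" "\<sigma> b \<in> D" using b b' ID \<sigma>D by (auto simp: B_def)
  have sD: "(\<sigma> ^^ j) (\<sigma> b) \<in> D \<and> vt ((\<sigma> ^^ j) (\<sigma> b)) = vt b" for j
    by (induction j) (auto simp: bD vt\<sigma> \<sigma>D)
  have "b' \<in> orb \<sigma> (\<sigma> b)" using trans\<sigma>[OF bD(3,2)] vt\<sigma> bD b' by simp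
  then obtain k where k: "b' = (\<sigma> ^^ k) (\<sigma> b)" by (auto simp: orb_def)
  define j where "j = (LEAST j. (\<sigma> ^^ j) (\<sigma> b) \<in> I)"
  have ex: "\<exists>j. (\<sigma> ^^ j) (\<sigma> b) \<in> I" using k b'(1) by auto
  have j: "(\<sigma> ^^ j) (\<sigma> b) \<in> I" unfolding j_def using ex by (rule LeastI_ex)
  have lt: "(\<sigma> ^^ i) (\<sigma> b) \<notin> I" if "i < j" for i using not_less_Least[of i] that unfolding j_def by blast
  let ?c = "(\<sigma> ^^ j) (\<sigma> b)"
  have j0: "j \<noteq> 0" using j b(2) by (intro notI) simp
  then obtain i where i: "j = Suc i" by (cases j) auto
  have "pr ?c = (\<sigma> ^^ i) (\<sigma> b)" using sD[of i] pr by (simp add: i)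
  then have "pr ?c \<notin> I" using lt i by simp
  then have "?c \<in> B" using j by (simp add: B_def)
  moreover have "?c \<noteq> b"
  proof
    assume cb: "?c = b"
    have per: "(\<sigma> ^^ Suc j) b = b" using cb by (simp add: funpow_swap1)
    have "b' = (\<sigma> ^^ Suc k) b" using k by (simp add: funpow_swap1)
    then have b'm: "b' = (\<sigma> ^^ (Suc k mod Suc j)) b" using funpow_mod_eq[OF per] by metis
    show False
    proof (cases "Suc k mod Suc j")
      case 0 then show False using b'm b'(2) by simp
    next
      case (Suc m)
      then have "m < j" using mod_less_divisor[of "Suc j" "Suc k"] by linarith
      moreover have "b' = (\<sigma> ^^ m) (\<sigma> b)" using b'm Suc by (simp add: funpow_swap1)
      ultimately show False using lt b'(1) by simp
    qed
  qed
  ultimately show ?thesis using sD by blast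
qed

text \<open>A corner in \<open>Sc\<close> is a local sink of the face boundary. Without one, a
  forward direction is never reversed along the face, so the boundary is a closed directed walk in
  one of its two senses, against acyclicity.\<close>

lemma face_Sc:
  assumes "d \<in> D"
  shows "\<exists>e\<in>Sc. e \<in> orb \<phi> d"
proof (rule ccontr)
  assume no: "\<not> ?thesis"
  have orbD: "orb \<phi> d \<subseteq> D" by (rule orb_sub[OF bij\<phi> assms])
  have keep: "\<phi> x \<notin> I" if "x \<in> orb \<phi> d" "x \<notin> I" for x
  proof
    assume i: "\<phi> x \<in> I"
    have xD: "x \<in> D" using that orbD by auto
    have "pr (\<phi> x) = \<alpha> x" using pr(3) \<alpha>D xD by (simp add: \<phi>_def)
    then have "\<phi> x \<in> Sc" using i a_I[OF xD] that by (simp add: Sc_def)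
    moreover have "\<phi> x \<in> orb \<phi> d" using that(1) by (rule orb_trans) simp
    ultimately show False using no by blast
  qed
  have step: "(vt (\<phi> x), vt x) \<in> BR" if "x \<in> orb \<phi> d" "x \<in> I" for x
    using that BR_I orbD vt\<phi>[of x] by auto
  have step': "(vt x, vt (\<phi> x)) \<in> BR" if "x \<in> orb \<phi> d" "x \<notin> I" for x
  proof -
    have xD: "x \<in> D" using that orbD by auto
    then have "(vt (\<alpha> (\<alpha> x)), vt (\<alpha> x)) \<in> BR" using BR_I[of "\<alpha> x"] a_I that by simp
    then show ?thesis using xD \<alpha>\<alpha> vt\<phi> by simp
  qed
  have ac: "acyclic BR" using acyc by (simp add: BR_def)
  show False
  proof (cases "\<exists>x\<in>orb \<phi> d. x \<notin> I")
    case True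
    then obtain x where x: "x \<in> orb \<phi> d" "x \<notin> I" by blast
    have "(\<phi> ^^ k) x \<in> orb \<phi> d \<and> (\<phi> ^^ k) x \<notin> I \<and> (k > 0 \<longrightarrow> (vt x, vt ((\<phi> ^^ k) x)) \<in> BR\<^sup>+)" for k
    proof (induction k)
      case (Suc k)
      let ?y = "(\<phi> ^^ k) x"
      have y: "?y \<in> orb \<phi> d" "?y \<notin> I" "k > 0 \<longrightarrow> (vt x, vt ?y) \<in> BR\<^sup>+" using Suc by auto
      have "(vt x, vt (\<phi> ?y)) \<in> BR\<^sup>+"
      proof (cases "k = 0")
        case True then show ?thesis using step'[OF y(1,2)] by auto
      next
        case False then show ?thesis using y(3) step'[OF y(1,2)] by (meson neq0_conv trancl.trancl_into_trancl)
      qed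
      then show ?case using keep[OF y(1,2)] orb_trans[OF y(1), of "\<phi> ?y"] by simp
    qed (use x in simp)
    moreover obtain n where "n > 0" "(\<phi> ^^ n) x = x" using orb_return[OF finD bij\<phi>] x orbD by blast
    ultimately have "(vt x, vt x) \<in> BR\<^sup>+" by metis
    then show False using ac by (simp add: acyclic_def)
  next
    case False
    have "(\<phi> ^^ k) d \<in> orb \<phi> d \<and> (k > 0 \<longrightarrow> (vt ((\<phi> ^^ k) d), vt d) \<in> BR\<^sup>+)" for k
    proof (induction k)
      case (Suc k)
      let ?y = "(\<phi> ^^ k) d"
      have y: "?y \<in> orb \<phi> d" "k > 0 \<longrightarrow> (vt ?y, vt d) \<in> BR\<^sup>+" using Suc by auto
      then have s: "(vt (\<phi> ?y), vt ?y) \<in> BR" using step False by blast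
      have "(vt (\<phi> ?y), vt d) \<in> BR\<^sup>+"
      proof (cases "k = 0")
        case True then show ?thesis using s by auto
      next
        case False then show ?thesis using y(2) s by (meson neq0_conv trancl_into_trancl2)
      qed
      then show ?case using orb_trans[OF y(1), of "\<phi> ?y"] by simp
    qed simp
    moreover obtain n where "n > 0" "(\<phi> ^^ n) d = d" using orb_return[OF finD bij\<phi> assms] by blast
    ultimately have "(vt d, vt d) \<in> BR\<^sup>+" by metis
    then show False using ac by (simp add: acyclic_def)
  qed
qed

text \<open>Otherwise every inner vertex of the walk has a single incoming arc and is no terminal,
  so the source of \<open>pr e\<close> can only come down through the top vertex of the walk. As
  \<open>e\<close> is the only corner of its face, the other side of the face leads from the same
  vertex down to the tail of \<open>e\<close>. Thus the source of \<open>pr e\<close> also reaches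
  the tail of \<open>e\<close> and is not private.\<close>

lemma dead_cases:
  assumes e: "e \<in> Dead"
  shows "(\<exists>l\<le>nn e. st e l \<in> B \<and> (vt (st e l) \<in> T \<or> (\<exists>b\<in>B. b \<noteq> st e l \<and> vt b = vt (st e l))))
    \<or> (\<exists>x\<in>Sc. x \<noteq> e \<and> orb \<phi> x = orb \<phi> e)"
proof (rule ccontr)
  assume "\<not> ?thesis"
  then have no1: "\<And>l. l \<le> nn e \<Longrightarrow> st e l \<in> B \<Longrightarrow> vt (st e l) \<notin> T \<and> (\<forall>b\<in>B. b \<noteq> st e l \<longrightarrow> vt b \<noteq> vt (st e l))"
    and no2: "\<And>x. x \<in> Sc \<Longrightarrow> x \<noteq> e \<Longrightarrow> orb \<phi> x \<noteq> orb \<phi> e" by blast+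
  have eLL: "e \<in> LL" and eta: "st e (nn e) \<notin> I" using e by (auto simp: Dead_def eta_def)
  have eD: "e \<in> D" and eI: "e \<in> I" and pI: "pr e \<in> I" using eLL LLI ID by auto
  have n0: "nn e \<noteq> 0"
  proof
    assume "nn e = 0" then show False using eta pI by simp
  qed
  define n where "n = nn e - 1"
  have n: "nn e = Suc n" using n0 by (simp add: n_def)
  define a where "a l = st e l" for l
  have aI: "a l \<in> I" "a l \<notin> LL" if "l \<le> n" for l using nn(2)[of l e] that n by (auto simp: a_def)
  have aD: "a l \<in> D" for l using stD eD by (simp add: a_def)
  have sa: "\<sigma> (a (Suc l)) = \<alpha> (a l)" for l using aD \<alpha>D pr by (simp add: a_def stSuc)
  have va: "vt (a (Suc l)) = vt (\<alpha> (a l))" for l using vt_stSuc eD by (simp add: a_def)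
  define c where "c = a (Suc n)"
  have cI: "c \<notin> I" and cD: "c \<in> D" using eta aD by (auto simp: c_def a_def n)
  \<comment> \<open>After position \<open>0\<close> the dart following \<open>a l\<close> in the
    rotation is outgoing, so the vertex is no sink, and \<open>a l\<close> outside \<open>LL\<close>
    is no corner but a run of length one. By \<open>B_other\<close> it is the only incoming dart
    there.\<close>
  have in_uniq: "vt (a l) \<notin> T \<and> (\<forall>b\<in>I. vt b = vt (a l) \<longrightarrow> b = a l)" if l: "1 \<le> l" "l \<le> n" for l
  proof -
    obtain m where m: "l = Suc m" using l by (cases l) auto
    have mI: "a m \<in> I" using aI(1)[of m] l m by simp
    have s: "\<sigma> (a l) \<notin> I" using sa[of m] a_I[OF aD, of m] mI m by simp
    have so: "\<sigma> (a l) \<in> D" "vt (\<sigma> (a l)) = vt (a l)" using \<sigma>D vt\<sigma> aD by auto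
    then have "\<not> sink (vt (a l))" using s unfolding sink_def I_def by blast
    then have "a l \<notin> Sc" using aI[OF l(2)] by (simp add: LL_def)
    then have aB: "a l \<in> B" using aI[OF l(2)] by (simp add: Sc_def B_def)
    then have t: "vt (a l) \<notin> T" "\<And>b. b \<in> B \<Longrightarrow> b \<noteq> a l \<Longrightarrow> vt b \<noteq> vt (a l)"
      using no1[of l] l n by (auto simp: a_def)
    have "b = a l" if b: "b \<in> I" "vt b = vt (a l)" for b
    proof (rule ccontr)
      assume "b \<noteq> a l"
      from B_other[OF aB s b(1) this b(2)] obtain c where "c \<in> B" "c \<noteq> a l" "vt c = vt (a l)" by blast
      then show False using t(2) by blast
    qed
    then show ?thesis using t by blast
  qed
  have oe: "x \<in> orb \<phi> e \<Longrightarrow> x \<in> Sc \<Longrightarrow> x = e" for x using no2[of x] orb_eq[OF finD bij\<phi> eD] by metis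
  have "\<phi> (\<alpha> (a 0)) = e" using \<alpha>\<alpha> aD pr eD by (simp add: \<phi>_def a_def)
  have bk: "e \<in> orb \<phi> (\<alpha> (a l))" for l
  proof (induction l)
    case 0 then show ?case using \<open>\<phi> (\<alpha> (a 0)) = e\<close> orb_apply[of \<phi> "\<alpha> (a 0)"] by simp
  next
    case (Suc l)
    have "\<phi> (\<alpha> (a (Suc l))) = \<alpha> (a l)" using \<alpha>\<alpha> aD sa by (simp add: \<phi>_def)
    then have "\<alpha> (a l) \<in> orb \<phi> (\<alpha> (a (Suc l)))" using orb_apply[of \<phi> "\<alpha> (a (Suc l))"] by simp
    then show ?case using Suc by (rule orb_trans)
  qed
  have "\<alpha> c \<in> orb \<phi> e" using orb_sym[OF finD bij\<phi> \<alpha>D[OF cD]] bk[of "Suc n"] by (simp add: c_def)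
  then have ex: "\<exists>k. (\<phi> ^^ k) e = \<alpha> c" by (auto simp: orb_def)
  define k where "k = (LEAST k. (\<phi> ^^ k) e = \<alpha> c)"
  have k: "(\<phi> ^^ k) e = \<alpha> c" unfolding k_def using ex by (rule LeastI_ex)
  have kmin: "(\<phi> ^^ i) e \<noteq> \<alpha> c" if "i < k" for i using not_less_Least that unfolding k_def by blast
  have pD: "(\<phi> ^^ i) e \<in> D" for i by (rule bij_pow_in[OF bij\<phi> eD])
  \<comment> \<open>Going back from the first visit of \<open>\<alpha> c\<close>, a change from an
    outgoing to an incoming dart would be a corner, hence \<open>e\<close> itself; but then
    \<open>\<alpha> c\<close> would have been visited before.\<close>
  have runI: "(\<phi> ^^ (k - i)) e \<in> I" if "i \<le> k" for i
    using that
  proof (induction i)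
    case 0 then show ?case using k a_I cD cI by simp
  next
    case (Suc i)
    define m where "m = k - Suc i"
    have m: "k - i = Suc m" using Suc.prems by (simp add: m_def)
    show ?case
    proof (rule ccontr)
      assume "(\<phi> ^^ (k - Suc i)) e \<notin> I"
      then have y: "(\<phi> ^^ m) e \<notin> I" by (simp add: m_def)
      have z: "(\<phi> ^^ Suc m) e \<in> I" using Suc m by simp
      have "pr ((\<phi> ^^ Suc m) e) = \<alpha> ((\<phi> ^^ m) e)" using pr(3) \<alpha>D pD by (simp add: \<phi>_def)
      then have "(\<phi> ^^ Suc m) e \<in> Sc" using z y a_I pD by (simp add: Sc_def)
      then have per: "(\<phi> ^^ Suc m) e = e" by (rule oe[OF orb_pow])
      have "(\<phi> ^^ k) e = (\<phi> ^^ i) ((\<phi> ^^ Suc m) e)"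
      proof -
        have "k = i + Suc m" using m Suc.prems by linarith
        then show ?thesis by (simp only: funpow_add o_apply)
      qed
      then have "(\<phi> ^^ i) e = \<alpha> c" using per k by simp
      then show False using kmin[of i] Suc.prems by simp
    qed
  qed
  have run: "(vt (\<alpha> ((\<phi> ^^ i) e)), vt (\<alpha> e)) \<in> BR\<^sup>*" if "i \<le> k" for i
    using that
  proof (induction i)
    case (Suc i)
    have "(\<phi> ^^ Suc i) e \<in> I" using runI[of "k - Suc i"] Suc.prems by simp
    then have "(vt (\<alpha> ((\<phi> ^^ Suc i) e)), vt ((\<phi> ^^ Suc i) e)) \<in> BR" by (rule BR_I)
    moreover have "vt ((\<phi> ^^ Suc i) e) = vt (\<alpha> ((\<phi> ^^ i) e))" using vt\<phi> pD by simp
    ultimately show ?case using Suc by (metis Suc_leD converse_rtrancl_into_rtrancl)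
  qed simp
  have ce: "(vt c, vt (\<alpha> e)) \<in> BR\<^sup>*" using run[of k] k \<alpha>\<alpha> cD by simp
  define s where "s = src (a 0)"
  have a0: "a 0 = pr e" by (simp add: a_def)
  have a0I: "a 0 \<in> I" using pI a0 by simp
  have sT: "s \<in> T" "(s, vt (\<alpha> (a 0))) \<in> BR\<^sup>*" using src[OF a0I] by (auto simp: s_def)
  have "(s, vt (\<alpha> (a l))) \<in> BR\<^sup>*" if "l \<le> n" for l
    using that
  proof (induction l)
    case 0 then show ?case using sT by simp
  next
    case (Suc l)
    have u: "vt (a (Suc l)) \<notin> T" "\<And>b. b \<in> I \<Longrightarrow> vt b = vt (a (Suc l)) \<Longrightarrow> b = a (Suc l)"
      using in_uniq[of "Suc l"] Suc.prems by auto
    have "(s, vt (a (Suc l))) \<in> BR\<^sup>*" using Suc va by simp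
    moreover have "s \<noteq> vt (a (Suc l))" using u sT by auto
    ultimately obtain y where y: "(s, y) \<in> BR\<^sup>*" "(y, vt (a (Suc l))) \<in> BR" by (metis rtranclE)
    then obtain d where d: "d \<in> D" "ou d" "y = vt d" "vt (a (Suc l)) = vt (\<alpha> d)" by (auto simp: BR_def)
    then have "\<alpha> d \<in> I" using a_I by (simp add: I_def)
    then have "\<alpha> d = a (Suc l)" using u(2) d by simp
    then have "d = \<alpha> (a (Suc l))" using \<alpha>\<alpha> d by metis
    then show ?case using y d by simp
  qed
  then have "(s, vt c) \<in> BR\<^sup>*" using va by (simp add: c_def)
  then have "(s, vt (\<alpha> e)) \<in> BR\<^sup>*" using ce by (rule rtrancl_trans)
  moreover have "e \<noteq> a 0" using pr_cycle[of e 1] eLL a0 by auto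
  moreover have "vt e = vt (a 0)" using a0 pr eD by simp
  ultimately show False using src(3)[OF a0I eI] by (simp add: s_def)
qed

text \<open>An arc is counted at its head, as a corner in \<open>Sc\<close> or as the start of a run
  in \<open>B\<close>. Every face contains a corner, so Euler's formula bounds the excess of runs
  over vertices and of corners over faces together. By \<open>dead_cases\<close> dead corners are
  charged to these two excesses and to \<open>T\<close>, which leaves at most
  \<open>3 * q + 2 * G\<close> of them; \<open>card_LL\<close> then bounds all corners of
  \<open>LL\<close>.\<close>

theorem card_edges: "card (egs \<alpha> D) \<le> card (vt ` D) + q * (3 * q + 2 * G) + q + G"
proof -
  have "egs \<alpha> D = (\<lambda>e. {e, \<alpha> e}) ` I"
  proof (intro set_eqI iffI)
    fix x assume "x \<in> egs \<alpha> D"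
    then obtain d where d: "d \<in> D" "x = {d, \<alpha> d}" by (auto simp: egs_def)
    show "x \<in> (\<lambda>e. {e, \<alpha> e}) ` I"
    proof (cases "d \<in> I")
      case True then show ?thesis using d by blast
    next
      case False
      then have "\<alpha> d \<in> I" "x = {\<alpha> d, \<alpha> (\<alpha> d)}" using d a_I \<alpha>\<alpha> by (auto simp: insert_commute)
      then show ?thesis by blast
    qed
  next
    fix x assume "x \<in> (\<lambda>e. {e, \<alpha> e}) ` I"
    then show "x \<in> egs \<alpha> D" using ID nostub unfolding egs_def by blast
  qed
  moreover have "inj_on (\<lambda>e. {e, \<alpha> e}) I"
  proof (rule inj_onI)
    fix e f assume ef: "e \<in> I" "f \<in> I" "{e, \<alpha> e} = {f, \<alpha> f}"
    have "e \<noteq> \<alpha> f" using a_I[OF ID[OF ef(2)]] ef by auto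
    then show "e = f" using ef(3) by (auto simp: doubleton_eq_iff)
  qed
  ultimately have E: "card (egs \<alpha> D) = card I" by (simp add: card_image)
  have finSc: "finite Sc" and finB: "finite B" using finI by (auto simp: Sc_def B_def)
  have "I = Sc \<union> B" "Sc \<inter> B = {}" by (auto simp: Sc_def B_def)
  then have cI: "card I = card Sc + card B" using finSc finB by (simp add: card_Un_disjoint)
  have fc: "fcs D \<sigma> \<alpha> = orb \<phi> ` Sc"
  proof (intro set_eqI iffI)
    fix f assume "f \<in> fcs D \<sigma> \<alpha>"
    then obtain d where d: "d \<in> D" "f = orb \<phi> d" by (auto simp: fcs_def \<phi>_def[abs_def])
    then obtain e where e: "e \<in> Sc" "e \<in> orb \<phi> d" using face_Sc by blast
    have "f = orb \<phi> e" using orb_eq[OF finD bij\<phi> d(1) e(2)] d by simp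
    then show "f \<in> orb \<phi> ` Sc" using e by blast
  next
    fix f assume "f \<in> orb \<phi> ` Sc"
    then show "f \<in> fcs D \<sigma> \<alpha>" by (auto simp: fcs_def \<phi>_def[abs_def] Sc_def I_def)
  qed
  have BV: "card (vt ` D - vt ` B) \<le> q \<and> vt ` B \<subseteq> vt ` D"
  proof
    show sub: "vt ` B \<subseteq> vt ` D" by (auto simp: B_def I_def)
    have "vt ` D - vt ` B \<subseteq> T"
    proof (rule ccontr)
      assume "\<not> ?thesis"
      then obtain v where v: "v \<in> vt ` D" "v \<notin> vt ` B" "v \<notin> T" by blast
      then obtain o' i where oi: "o' \<in> D" "vt o' = v" "ou o'" "i \<in> D" "vt i = v" "\<not> ou i" using inner by blast
      have sD: "(\<sigma> ^^ j) o' \<in> D \<and> vt ((\<sigma> ^^ j) o') = v" for j by (induction j) (auto simp: oi vt\<sigma> \<sigma>D)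
      have "(\<sigma> ^^ j) o' \<notin> I" for j
      proof (induction j)
        case (Suc j)
        show ?case
        proof
          assume i: "(\<sigma> ^^ Suc j) o' \<in> I"
          have "pr ((\<sigma> ^^ Suc j) o') = (\<sigma> ^^ j) o'" using sD[of j] pr by simp
          then have "(\<sigma> ^^ Suc j) o' \<in> B" using Suc i by (simp add: B_def)
          then show False using v(2) sD[of "Suc j"] by blast
        qed
      qed (use oi in \<open>simp add: I_def\<close>)
      moreover have "i \<in> orb \<sigma> o'" using trans\<sigma> oi by simp
      then obtain j where "i = (\<sigma> ^^ j) o'" by (auto simp: orb_def)
      ultimately show False using oi by (auto simp: I_def)
    qed
    then show "card (vt ` D - vt ` B) \<le> q" using T by (meson card_mono le_trans)
  qed
  have cV: "card (vt ` D) = card (vt ` B) + card (vt ` D - vt ` B)"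
    using BV finB finD by (subst card_Diff_subset) (auto simp: card_mono)
  have "LL \<subseteq> Sc" by (auto simp: LL_def)
  have "card (Sc - LL) \<le> card (vt ` D - vt ` B)"
  proof (rule card_inj_on_le[where f = vt])
    show "inj_on vt (Sc - LL)" by (rule inj_onI) (auto simp: LL_def)
    show "vt ` (Sc - LL) \<subseteq> vt ` D - vt ` B"
    proof
      fix v assume "v \<in> vt ` (Sc - LL)"
      then obtain e where e: "e \<in> D" "v = vt e" "sink v" by (auto simp: LL_def Sc_def I_def)
      have "v \<notin> vt ` B"
      proof
        assume "v \<in> vt ` B"
        then obtain b where b: "b \<in> B" "vt b = v" by blast
        then have "pr b \<in> D" "vt (pr b) = v" "pr b \<notin> I" using pr ID by (auto simp: B_def)
        then show False using e(3) by (auto simp: sink_def I_def)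
      qed
      then show "v \<in> vt ` D - vt ` B" using e by blast
    qed
  qed (use finD in auto)
  moreover have "card Sc = card LL + card (Sc - LL)"
    using \<open>LL \<subseteq> Sc\<close> finSc finLL by (subst card_Diff_subset) (auto simp: card_mono)
  ultimately have ScLL: "card Sc \<le> card LL + card (vt ` D - vt ` B)" by simp
  \<comment> \<open>\<open>B1\<close> and \<open>S1\<close> collect the runs and corners that share
    their vertex or face with another one; \<open>B2\<close> collects the single runs at
    terminals.\<close>
  define B1 where "B1 = {b \<in> B. \<exists>b'\<in>B. b' \<noteq> b \<and> vt b' = vt b}"
  define B2 where "B2 = {b \<in> B - B1. vt b \<in> T}"
  define S1 where "S1 = {e \<in> Sc. \<exists>x\<in>Sc. x \<noteq> e \<and> orb \<phi> x = orb \<phi> e}"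
  have cB1: "card B1 + 2 * card (vt ` B) \<le> 2 * card B" unfolding B1_def by (rule card_nonsingletons[OF finB])
  have cS1: "card S1 + 2 * card (fcs D \<sigma> \<alpha>) \<le> 2 * card Sc" unfolding S1_def fc by (rule card_nonsingletons[OF finSc])
  have cB2: "card B2 \<le> q"
  proof -
    have "card B2 \<le> card T"
    proof (rule card_inj_on_le[where f = vt])
      show "inj_on vt B2"
      proof (rule inj_onI)
        fix b b' assume "b \<in> B2" "b' \<in> B2" "vt b = vt b'"
        then show "b = b'" unfolding B2_def B1_def by (metis (mono_tags, lifting) DiffE mem_Collect_eq)
      qed
    qed (use T in \<open>auto simp: B2_def\<close>)
    then show ?thesis using T by simp
  qed
  define D1 where "D1 = {e \<in> Dead. \<exists>l\<le>nn e. st e l \<in> B1 \<union> B2}"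
  have D1LL: "D1 \<subseteq> LL" by (auto simp: D1_def Dead_def)
  have "card D1 \<le> card (B1 \<union> B2)"
  proof -
    have "\<forall>e. e \<in> D1 \<longrightarrow> (\<exists>l. l \<le> nn e \<and> st e l \<in> B1 \<union> B2)" unfolding D1_def by simp
    then obtain lx where lx: "\<And>e. e \<in> D1 \<Longrightarrow> lx e \<le> nn e \<and> st e (lx e) \<in> B1 \<union> B2" by metis
    show ?thesis
    proof (rule card_inj_on_le[where f = "\<lambda>e. st e (lx e)"])
      show "inj_on (\<lambda>e. st e (lx e)) D1"
      proof (rule inj_onI)
        fix e e' assume "e \<in> D1" "e' \<in> D1" "st e (lx e) = st e' (lx e')"
        then show "e = e'" using st_inj[of e e' "lx e" "lx e'"] lx[of e] lx[of e'] D1LL by blast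
      qed
      show "(\<lambda>e. st e (lx e)) ` D1 \<subseteq> B1 \<union> B2" using lx by blast
      show "finite (B1 \<union> B2)" using finB by (auto simp: B1_def B2_def)
    qed
  qed
  then have cD1: "card D1 \<le> card B1 + q" using card_Un_le[of B1 B2] cB2 by linarith
  have "Dead \<subseteq> D1 \<union> S1"
  proof
    fix e assume e: "e \<in> Dead"
    have "e \<in> Sc" using e by (auto simp: Dead_def LL_def)
    from dead_cases[OF e] show "e \<in> D1 \<union> S1"
    proof
      assume "\<exists>l\<le>nn e. st e l \<in> B \<and> (vt (st e l) \<in> T \<or> (\<exists>b\<in>B. b \<noteq> st e l \<and> vt b = vt (st e l)))"
      then obtain l where l: "l \<le> nn e" "st e l \<in> B" "vt (st e l) \<in> T \<or> (\<exists>b\<in>B. b \<noteq> st e l \<and> vt b = vt (st e l))" by blast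
      then have "st e l \<in> B1 \<union> B2" unfolding B1_def B2_def by blast
      then show ?thesis using e l unfolding D1_def by blast
    next
      assume "\<exists>x\<in>Sc. x \<noteq> e \<and> orb \<phi> x = orb \<phi> e"
      then show ?thesis using \<open>e \<in> Sc\<close> unfolding S1_def by blast
    qed
  qed
  moreover have "finite (D1 \<union> S1)" using finLL D1LL finSc finite_subset by (auto simp: S1_def)
  ultimately have "card Dead \<le> card (D1 \<union> S1)" by (rule card_mono[rotated])
  also have "\<dots> \<le> card D1 + card S1" by (rule card_Un_le)
  finally have "card Dead \<le> card B1 + q + card S1" using cD1 by simp
  then have cDead: "card Dead \<le> 3 * q + 2 * G"
    using cB1 cS1 euler E cI cV BV by linarith
  have "card LL \<le> q * (3 * q + 2 * G)" using card_LL cDead by (meson le_trans mult_le_mono2)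
  moreover have "card B \<le> card (vt ` B) + q + G"
    using euler E cI cV BV cS1 by linarith
  ultimately show ?thesis using E cI ScLL cV by linarith
qed

end

text \<open>\<open>nx\<close> turns to the next dart that is no stub. A face step of the new map is
  a sequence of old ones that slides over stubs, and by \<open>full\<close> every old face contains
  a dart of \<open>Dr\<close>. So each old face contains a new one, and no face is lost.\<close>

lemma (in cmap) remove_stubs:
  assumes full: "\<And>v. v \<in> vt ` D \<Longrightarrow> \<exists>d\<in>D. vt d = v \<and> \<alpha> d \<noteq> d"
  defines "Dr \<equiv> {d \<in> D. \<alpha> d \<noteq> d}"
  shows "\<exists>nx. cmap Dr nx \<alpha> vt \<and> vt ` Dr = vt ` D \<and> egs \<alpha> Dr = egs \<alpha> D \<and> card (fcs D \<sigma> \<alpha>) \<le> card (fcs Dr nx \<alpha>)"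
proof -
  have DrD: "Dr \<subseteq> D" by (auto simp: Dr_def)
  define kk where "kk d = (LEAST k. 0 < k \<and> (\<sigma> ^^ k) d \<in> Dr)" for d
  define nx where "nx d = (\<sigma> ^^ kk d) d" for d
  have kk: "0 < kk d \<and> nx d \<in> Dr" if d: "d \<in> Dr" for d
  proof -
    obtain n where n: "0 < n" "(\<sigma> ^^ n) d = d" using orb_return[OF finD bij\<sigma> subsetD[OF DrD d]] by blast
    have "\<exists>k. 0 < k \<and> (\<sigma> ^^ k) d \<in> Dr" by (rule exI[of _ n]) (simp add: n d)
    from LeastI_ex[OF this] show ?thesis unfolding kk_def[symmetric] nx_def .
  qed
  have kmin: "(\<sigma> ^^ i) d \<notin> Dr" if "0 < i" "i < kk d" for i d
    using not_less_Least[of i "\<lambda>k. 0 < k \<and> (\<sigma> ^^ k) d \<in> Dr"] that unfolding kk_def by blast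
  have kle: "kk d \<le> i" if "0 < i" "(\<sigma> ^^ i) d \<in> Dr" for i d using kmin[of i d] that by linarith
  have cancel: "x = (\<sigma> ^^ m) y" if "(\<sigma> ^^ n) x = (\<sigma> ^^ (n + m)) y" "x \<in> D" "y \<in> D" for n m x y
    using that(1)
  proof (induction n)
    case (Suc n)
    have "(\<sigma> ^^ n) x \<in> D" "(\<sigma> ^^ (n + m)) y \<in> D" using bij_pow_in[OF bij\<sigma>] that by auto
    moreover have "inj_on \<sigma> D" using bij\<sigma> by (simp add: bij_betw_def)
    ultimately show ?case using Suc by (auto dest: inj_onD)
  qed simp
  have injl: "d = e" if de: "d \<in> Dr" "e \<in> Dr" "nx d = nx e" "kk d \<le> kk e" for d e
  proof -
    define m where "m = kk e - kk d"
    have "d = (\<sigma> ^^ m) e"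
      using cancel[of "kk d" d m e] de DrD by (auto simp: nx_def m_def)
    moreover have "m = 0"
    proof (rule ccontr)
      assume "m \<noteq> 0"
      then have "0 < m" "m < kk e" using kk[OF de(1)] de(4) by (auto simp: m_def)
      then show False using kmin[of m e] \<open>d = (\<sigma> ^^ m) e\<close> de(1) by simp
    qed
    ultimately show ?thesis by simp
  qed
  have vtp: "vt ((\<sigma> ^^ k) d) = vt d" if "d \<in> D" for k d
    by (induction k) (use bij_pow_in[OF bij\<sigma> that] vt\<sigma> in auto)
  have finDr: "finite Dr" using finD DrD finite_subset by blast
  have bijnx: "bij_betw nx Dr Dr"
  proof -
    have "inj_on nx Dr" by (rule inj_onI) (metis injl nle_le)
    moreover have "nx ` Dr \<subseteq> Dr" using kk by blast
    ultimately show ?thesis using finDr by (simp add: bij_betw_def endo_inj_surj)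
  qed
  have tr: "(\<sigma> ^^ m) d \<in> orb nx d" if "d \<in> Dr" "(\<sigma> ^^ m) d \<in> Dr" for m d
    using that
  proof (induction m arbitrary: d rule: less_induct)
    case (less m)
    show ?case
    proof (cases "m = 0")
      case False
      then have le: "kk d \<le> m" using kle less.prems by blast
      then have "(\<sigma> ^^ m) d = (\<sigma> ^^ (m - kk d + kk d)) d" by simp
      then have eq: "(\<sigma> ^^ m) d = (\<sigma> ^^ (m - kk d)) (nx d)" by (simp only: funpow_add o_apply nx_def)
      have "m - kk d < m" using kk[OF less.prems(1)] le by simp
      then have "(\<sigma> ^^ m) d \<in> orb nx (nx d)" using less.IH[of "m - kk d" "nx d"] kk less.prems eq by simp
      then show ?thesis using orb_trans[OF orb_apply] by metis
    qed simp
  qed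
  have aDr: "\<alpha> d \<in> Dr" if "d \<in> Dr" for d
  proof -
    have "d \<in> D" "\<alpha> d \<noteq> d" using that by (auto simp: Dr_def)
    then have "\<alpha> d \<in> D" "\<alpha> (\<alpha> d) \<noteq> \<alpha> d" using \<alpha>D \<alpha>\<alpha> by auto
    then show ?thesis by (simp add: Dr_def)
  qed
  have cm: "cmap Dr nx \<alpha> vt"
  proof
    show "finite Dr" by (rule finDr)
    show "bij_betw nx Dr Dr" by (rule bijnx)
    show "vt (nx d) = vt d" if "d \<in> Dr" for d using vtp that DrD by (auto simp: nx_def)
    show "d' \<in> orb nx d" if "d \<in> Dr" "d' \<in> Dr" "vt d = vt d'" for d d'
    proof -
      have "d' \<in> orb \<sigma> d" using trans\<sigma> that DrD by blast
      then obtain m where "d' = (\<sigma> ^^ m) d" unfolding orb_def by blast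
      then show ?thesis using tr that by simp
    qed
    show "\<alpha> d \<in> Dr" if "d \<in> Dr" for d using aDr that .
    show "\<alpha> (\<alpha> d) = d" if "d \<in> Dr" for d using \<alpha>\<alpha> that DrD by blast
  qed
  define \<phi> where "\<phi> = (\<lambda>d. \<sigma> (\<alpha> d))"
  define \<psi> where "\<psi> = (\<lambda>d. nx (\<alpha> d))"
  have bij\<phi>: "bij_betw \<phi> D D" unfolding \<phi>_def by (rule bij_phi0)
  have slide: "(\<phi> ^^ i) (\<sigma> x) = (\<sigma> ^^ Suc i) x" if "x \<in> D" "\<And>j. 0 < j \<Longrightarrow> j \<le> i \<Longrightarrow> (\<sigma> ^^ j) x \<notin> Dr" for i x
    using that(2)
  proof (induction i)
    case (Suc i)
    have "(\<sigma> ^^ Suc i) x \<in> D" by (rule bij_pow_in[OF bij\<sigma> that(1)])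
    moreover have "(\<sigma> ^^ Suc i) x \<notin> Dr" using Suc.prems by blast
    ultimately have "\<alpha> ((\<sigma> ^^ Suc i) x) = (\<sigma> ^^ Suc i) x" by (simp add: Dr_def)
    then show ?case using Suc by (simp add: \<phi>_def)
  qed simp
  have psi: "\<psi> d \<in> orb \<phi> d" if d: "d \<in> Dr" for d
  proof -
    obtain i where i: "kk (\<alpha> d) = Suc i" using kk[OF aDr[OF d]] by (cases "kk (\<alpha> d)") auto
    have "(\<phi> ^^ i) (\<sigma> (\<alpha> d)) = (\<sigma> ^^ Suc i) (\<alpha> d)"
      by (rule slide) (use aDr[OF d] DrD kmin i in auto)
    then have "\<psi> d = (\<phi> ^^ i) (\<phi> d)" using i by (simp add: \<psi>_def nx_def \<phi>_def)
    also have "\<dots> = (\<phi> ^^ Suc i) d" by (simp only: funpow_Suc_right o_apply)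
    finally have "\<psi> d = (\<phi> ^^ Suc i) d" .
    then show ?thesis by (simp only: orb_pow)
  qed
  have meets: "\<exists>e\<in>Dr. e \<in> orb \<phi> d" if d: "d \<in> D" for d
  proof (cases "d \<in> Dr")
    case True then show ?thesis by (intro bexI[of _ d]) simp_all
  next
    case False
    obtain e where e: "e \<in> Dr" "vt e = vt d" using full[of "vt d"] d by (auto simp: Dr_def)
    then have "e \<in> orb \<sigma> d" using trans\<sigma> d DrD by auto
    then have ex: "\<exists>m. (\<sigma> ^^ m) d \<in> Dr" using e unfolding orb_def by auto
    define m where "m = (LEAST m. (\<sigma> ^^ m) d \<in> Dr)"
    have m: "(\<sigma> ^^ m) d \<in> Dr" unfolding m_def using ex by (rule LeastI_ex)
    have mm: "(\<sigma> ^^ i) d \<notin> Dr" if "i < m" for i using not_less_Least that unfolding m_def by blast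
    obtain i where i: "m = Suc i" using m False by (cases m) auto
    have "(\<phi> ^^ i) (\<sigma> d) = (\<sigma> ^^ Suc i) d" by (rule slide) (use d mm i in auto)
    moreover have "\<sigma> d = \<phi> d" using False d by (simp add: Dr_def \<phi>_def)
    ultimately have "(\<phi> ^^ i) (\<phi> d) = (\<sigma> ^^ m) d" using i by simp
    then have "(\<sigma> ^^ m) d = (\<phi> ^^ Suc i) d" by (simp only: funpow_Suc_right o_apply)
    then have "(\<sigma> ^^ m) d \<in> orb \<phi> d" by (simp only: orb_pow)
    then show ?thesis using m by blast
  qed
  have sub: "orb \<psi> d \<subseteq> {e \<in> Dr. e \<in> orb \<phi> d}" if "d \<in> Dr" for d
  proof (rule orb_closed)
    fix e assume e: "e \<in> {e \<in> Dr. e \<in> orb \<phi> d}"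
    then have "e \<in> orb \<phi> d" "\<psi> e \<in> orb \<phi> e" using psi[of e] by auto
    then have "\<psi> e \<in> orb \<phi> d" by (rule orb_trans)
    moreover have "\<psi> e \<in> Dr" using e kk aDr by (simp add: \<psi>_def)
    ultimately show "\<psi> e \<in> {e \<in> Dr. e \<in> orb \<phi> d}" by simp
  qed (use that in simp)
  have "card (fcs D \<sigma> \<alpha>) \<le> card (fcs Dr nx \<alpha>)"
  proof -
    define h where "h Q = orb \<phi> (SOME e. e \<in> Q)" for Q
    have h: "h (orb \<psi> d) = orb \<phi> d" if "d \<in> Dr" for d
    proof -
      have "(SOME e. e \<in> orb \<psi> d) \<in> orb \<psi> d" by (rule someI[of _ d]) simp
      then have "(SOME e. e \<in> orb \<psi> d) \<in> orb \<phi> d" using sub[OF that] by blast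
      then show ?thesis unfolding h_def using that DrD by (intro orb_eq[OF finD bij\<phi>]) auto
    qed
    have "fcs D \<sigma> \<alpha> \<subseteq> h ` fcs Dr nx \<alpha>"
    proof
      fix f assume "f \<in> fcs D \<sigma> \<alpha>"
      then obtain d where d: "d \<in> D" "f = orb \<phi> d" by (auto simp: fcs_def \<phi>_def)
      then obtain e where e: "e \<in> Dr" "e \<in> orb \<phi> d" using meets[OF d(1)] by blast
      have "f = orb \<phi> e" using orb_eq[OF finD bij\<phi> d(1) e(2)] d(2) by simp
      then have "f = h (orb \<psi> e)" using h e by simp
      then show "f \<in> h ` fcs Dr nx \<alpha>" using e by (auto simp: fcs_def \<psi>_def)
    qed
    moreover have "finite (fcs Dr nx \<alpha>)" using finDr by (simp add: fcs_def)
    ultimately show ?thesis by (rule surj_card_le[rotated])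
  qed
  moreover have "vt ` Dr = vt ` D"
  proof
    show "vt ` D \<subseteq> vt ` Dr"
    proof
      fix v assume "v \<in> vt ` D"
      from full[OF this] show "v \<in> vt ` Dr" unfolding Dr_def by blast
    qed
  qed (use DrD in auto)
  moreover have "egs \<alpha> Dr = egs \<alpha> D" by (auto simp: egs_def Dr_def)
  ultimately show ?thesis using cm by blast
qed

section \<open>Linear arrangements of strongly connected digraphs\<close>

lemma simple_path:
  assumes "(a, b) \<in> R\<^sup>*"
  shows "\<exists>zs. distinct (a # zs) \<and> last (a # zs) = b \<and> set (zip (a # zs) zs) \<subseteq> R"
  using assms
proof (induction rule: converse_rtrancl_induct)
  case base then show ?case by (intro exI[of _ "[]"]) auto
next
  case (step y z)
  then obtain zs where zs: "distinct (z # zs)" "last (z # zs) = b" "set (zip (z # zs) zs) \<subseteq> R" by blast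
  show ?case
  proof (cases "y \<in> set (z # zs)")
    case False
    then show ?thesis using zs step(1) by (intro exI[of _ "z # zs"]) auto
  next
    case True
    then obtain p s where ps: "z # zs = p @ y # s" by (meson split_list)
    have "set (zip (y # s) s) \<subseteq> set (zip (z # zs) (tl (z # zs)))"
      unfolding ps
    proof (induction p)
      case (Cons a p)
      then show ?case by (cases p) auto
    qed simp
    then have "set (zip (y # s) s) \<subseteq> R" using zs(3) by simp
    moreover have "distinct (y # s)" "last (y # s) = b" using zs(1,2) unfolding ps by auto
    ultimately show ?thesis by blast
  qed
qed

section \<open>Arrangements and the effect of adding an ear\<close>

definition rm :: "('a \<times> 'a) set \<Rightarrow> 'a set \<Rightarrow> 'a \<Rightarrow> 'a \<Rightarrow> bool" where
  "rm A M x y \<longleftrightarrow> ((x, y) \<in> A \<or> (y, x) \<in> A) \<and> \<not> (x \<in> M \<and> y \<in> M)"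

definition ear :: "'a \<Rightarrow> 'a list \<Rightarrow> 'a \<Rightarrow> ('a \<times> 'a) set" where
  "ear u ys w = set (zip (u # ys) (ys @ [w]))"

lemma ear_cases:
  assumes "(x, y) \<in> ear u ys w" "ys \<noteq> []"
  obtains "x = u" "y = hd ys" | "x = last ys" "y = w" | i where "Suc i < length ys" "x = ys ! i" "y = ys ! Suc i"
proof -
  obtain i where i: "i < Suc (length ys)" "x = (u # ys) ! i" "y = (ys @ [w]) ! i"
    using assms by (auto simp: ear_def in_set_zip)
  show thesis
  proof (cases i)
    case 0 then show thesis using i assms(2) that(1) by (simp add: nth_append hd_conv_nth)
  next
    case (Suc j)
    show thesis
    proof (cases "Suc j = length ys")
      case True then show thesis using i Suc assms(2) that(2) by (simp add: nth_append last_conv_nth flip: True)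
    next
      case False then show thesis using i Suc that(3)[of j] by (simp add: nth_append)
    qed
  qed
qed

lemma walk_reach:
  assumes "set (zip L (tl L)) \<subseteq> R" "x \<in> set L"
  shows "(hd L, x) \<in> R\<^sup>*" "(x, last L) \<in> R\<^sup>*"
proof -
  have "(hd L, x) \<in> R\<^sup>* \<and> (x, last L) \<in> R\<^sup>* \<and> (hd L, last L) \<in> R\<^sup>*"
    using assms
  proof (induction L arbitrary: x)
    case (Cons a L)
    show ?case
    proof (cases L)
      case Nil then show ?thesis using Cons.prems by simp
    next
      case (Cons b L')
      then have ab: "(a, b) \<in> R" and sub: "set (zip L (tl L)) \<subseteq> R" using Cons.prems(1) by auto
      have "hd L = b" "b \<in> set L" "last (a # L) = last L" using Cons by auto
      then show ?thesis using Cons.IH[OF sub] Cons.prems(2) ab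
        by (metis converse_rtrancl_into_rtrancl list.sel(1) rtrancl.rtrancl_refl set_ConsD)
    qed
  qed simp
  then show "(hd L, x) \<in> R\<^sup>*" "(x, last L) \<in> R\<^sup>*" by auto
qed

lemma ear_walk: "ear u ys w = set (zip (u # ys @ [w]) (tl (u # ys @ [w])))"
proof -
  have "zip (xs @ [w]) zs = zip xs zs" if "length zs = length xs" for xs zs :: "'a list"
    using that by (simp add: zip_append1)
  from this[of "ys @ [w]" "u # ys"] show ?thesis by (simp add: ear_def)
qed

lemma ear_reach:
  assumes "y \<in> set ys"
  shows "(u, y) \<in> (ear u ys w)\<^sup>*" "(y, w) \<in> (ear u ys w)\<^sup>*"
  using walk_reach[of "u # ys @ [w]" "ear u ys w" y] assms by (auto simp: ear_walk)

text \<open>Arcs inside \<open>M\<close> are exempt from the bounds; \<open>M\<close> collects the ends of the ears that do not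
  attach to their predecessor only.\<close>

definition arrangement :: "('a \<times> 'a) set \<Rightarrow> 'a set \<Rightarrow> 'a list \<Rightarrow> bool" where
  "arrangement A M xs \<longleftrightarrow> distinct xs \<and> A \<subseteq> set xs \<times> set xs \<and> M \<subseteq> set xs \<and>
     (\<forall>c. card (cut_left (rm A M) xs c) \<le> 4) \<and> (\<forall>v. card {u. rm A M v u} \<le> 4)"

text \<open>\<open>J\<close> is the ear added last; the smaller bounds there leave room for both ends of the next ear.\<close>

definition arr_end :: "('a \<times> 'a) set \<Rightarrow> 'a set \<Rightarrow> 'a list \<Rightarrow> 'a list \<Rightarrow> bool" where
  "arr_end A M pre J \<longleftrightarrow> arrangement A M (pre @ J) \<and>
     (\<forall>c\<ge>length pre. card (cut_left (rm A M) (pre @ J) c) \<le> 2) \<and> (\<forall>v\<in>set J. card {u. rm A M v u} \<le> 2)"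

lemma finite_cut_left [simp]: "finite (cut_left R xs c)"
  by (simp add: cut_left_def)

lemma arr_end_single: "arr_end {} {r} [] [r]"
  by (auto simp: arr_end_def arrangement_def cut_left_def rm_def)

lemma finite_rm: "arrangement A M xs \<Longrightarrow> finite {u. rm A M v u}"
  by (rule finite_subset[of _ "set xs"]) (auto simp: arrangement_def rm_def)

lemma rm_set: "arrangement A M xs \<Longrightarrow> rm A M x y \<Longrightarrow> x \<in> set xs \<and> y \<in> set xs"
  by (auto simp: arrangement_def rm_def)

lemma rm_ear:
  assumes "rm (A \<union> ear u ys w) M' x y" "M \<subseteq> M'" "ys \<noteq> []"
  obtains "rm A M x y"
    | "\<not> (u \<in> M' \<and> hd ys \<in> M')" "x = u \<and> y = hd ys \<or> y = u \<and> x = hd ys"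
    | "\<not> (w \<in> M' \<and> last ys \<in> M')" "x = w \<and> y = last ys \<or> y = w \<and> x = last ys"
    | i where "Suc i < length ys" "x = ys ! i \<and> y = ys ! Suc i \<or> y = ys ! i \<and> x = ys ! Suc i"
proof -
  have nm: "\<not> (x \<in> M' \<and> y \<in> M')" using assms(1) by (simp add: rm_def)
  consider "(x, y) \<in> A \<or> (y, x) \<in> A" | "(x, y) \<in> ear u ys w" | "(y, x) \<in> ear u ys w"
    using assms(1) by (auto simp: rm_def)
  then show thesis
  proof cases
    case 1 then show thesis using that(1) nm assms(2) by (auto simp: rm_def)
  next
    case 2 then show thesis using assms(3) by (elim ear_cases) (use nm that in auto)
  next
    case 3 then show thesis using assms(3) by (elim ear_cases) (use nm that in auto)
  qed
qed

lemma nth_ear_nbrs: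
  assumes d: "distinct ys" "k < length ys" "u \<notin> set ys" "w \<notin> set ys"
    and A: "arrangement A M xs" "set xs \<inter> set ys = {}" and M: "M \<subseteq> M'"
  shows "card {y. rm (A \<union> ear u ys w) M' (ys ! k) y} \<le> 2"
proof -
  have ne: "ys \<noteq> []" using d by auto
  have "{y. rm (A \<union> ear u ys w) M' (ys ! k) y} \<subseteq> {if k = 0 then u else ys ! (k - 1), if Suc k = length ys then w else ys ! Suc k}"
  proof
    fix y assume "y \<in> {y. rm (A \<union> ear u ys w) M' (ys ! k) y}"
    then have r: "rm (A \<union> ear u ys w) M' (ys ! k) y" by simp
    have kin: "ys ! k \<in> set ys" using d by simp
    from r M ne show "y \<in> {if k = 0 then u else ys ! (k - 1), if Suc k = length ys then w else ys ! Suc k}"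
    proof (cases rule: rm_ear)
      case 1 then show ?thesis using rm_set[OF A(1)] A(2) kin by blast
    next
      case 2
      then have "ys ! k = hd ys" "y = u" using kin d(3) by auto
      then have "k = 0" using d ne by (simp add: hd_conv_nth nth_eq_iff_index_eq)
      then show ?thesis using \<open>y = u\<close> by simp
    next
      case 3
      then have "ys ! k = last ys" "y = w" using kin d(4) by auto
      then have "k = length ys - 1" using d ne by (simp add: last_conv_nth nth_eq_iff_index_eq)
      then have "Suc k = length ys" using d(2) by linarith
      then show ?thesis using \<open>y = w\<close> by simp
    next
      case (4 i)
      then consider "k = i" "y = ys ! Suc i" | "k = Suc i" "y = ys ! i"
        using d by (auto simp: nth_eq_iff_index_eq)
      then show ?thesis using 4(1) by cases auto
    qed
  qed
  then have "card {y. rm (A \<union> ear u ys w) M' (ys ! k) y} \<le> card {if k = 0 then u else ys ! (k - 1), if Suc k = length ys then w else ys ! Suc k}"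
    by (intro card_mono) auto
  also have "\<dots> \<le> 2" by (simp add: card_insert_if)
  finally show ?thesis .
qed

text \<open>In a cut through the new ear, only the vertex of the ear just before the cut
  (\<open>u\<close> at its very beginning) and the end \<open>w\<close>, to which the last arc
  returns, have neighbours on the right.\<close>

lemma cut_new:
  assumes d: "distinct ys" "u \<in> set xs" "w \<in> set xs" "ys \<noteq> []" "set xs \<inter> set ys = {}" "length xs \<le> c"
    and A: "arrangement A M xs" and M: "M \<subseteq> M'"
  shows "card (cut_left (rm (A \<union> ear u ys w) M') (xs @ ys) c) \<le> 2"
proof -
  define i where "i = c - length xs"
  have c: "c = length xs + i" using d by (simp add: i_def)
  have tk: "set (take c (xs @ ys)) = set xs \<union> set (take i ys)" and dr: "set (drop c (xs @ ys)) = set (drop i ys)"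
    by (auto simp: c)
  have idx: "ys ! k \<in> set (take i ys) \<longleftrightarrow> k < i" "ys ! k \<in> set (drop i ys) \<longleftrightarrow> i \<le> k" if "k < length ys" for k
  proof -
    show 1: "ys ! k \<in> set (take i ys) \<longleftrightarrow> k < i"
      using that d(1) by (auto simp: in_set_conv_nth nth_eq_iff_index_eq)
    have "set (take i ys) \<inter> set (drop i ys) = {}" "set (take i ys) \<union> set (drop i ys) = set ys"
      using d(1) set_take_disj_set_drop_if_distinct[of ys i i] by (auto simp: set_append[symmetric] simp del: set_append)
    then show "ys ! k \<in> set (drop i ys) \<longleftrightarrow> i \<le> k" using 1 that by (metis IntI UnE empty_iff nth_mem not_le)
  qed
  have "cut_left (rm (A \<union> ear u ys w) M') (xs @ ys) c \<subseteq> {w, if i = 0 then u else ys ! (i - 1)}"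
  proof
    fix x assume "x \<in> cut_left (rm (A \<union> ear u ys w) M') (xs @ ys) c"
    then obtain y where x: "x \<in> set xs \<union> set (take i ys)" and y: "y \<in> set (drop i ys)"
      and r: "rm (A \<union> ear u ys w) M' x y" unfolding cut_left_def tk dr by blast
    have yy: "y \<in> set ys" "y \<notin> set xs" using y d(5) by (auto dest: in_set_dropD)
    from r M d(4) show "x \<in> {w, if i = 0 then u else ys ! (i - 1)}"
    proof (cases rule: rm_ear)
      case 1 then show ?thesis using rm_set[OF A] yy by blast
    next
      case 2
      then have "x = u" "y = hd ys" using yy d(2) by auto
      then have "i = 0" using y idx(2)[of 0] d(4) by (simp add: hd_conv_nth)
      then show ?thesis using \<open>x = u\<close> by simp
    next
      case 3
      then show ?thesis using yy d(3) by auto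
    next
      case (4 k)
      then consider "x = ys ! k" "y = ys ! Suc k" | "x = ys ! Suc k" "y = ys ! k" by blast
      then show ?thesis
      proof cases
        case 1
        then have "x \<in> set (take i ys)" using x d(5) 4(1) by (metis IntI Suc_lessD UnE empty_iff nth_mem)
        then have "k < i" "i \<le> Suc k" using idx 4(1) 1 y by auto
        then show ?thesis using 1 by (simp add: le_Suc_eq)
      next
        case 2
        then have "x \<in> set (take i ys)" using x d(5) 4(1) by (metis IntI UnE empty_iff nth_mem)
        then have "Suc k < i" "i \<le> k" using idx 4(1) 2 y by auto
        then show ?thesis by simp
      qed
    qed
  qed
  then have "card (cut_left (rm (A \<union> ear u ys w) M') (xs @ ys) c) \<le> card {w, if i = 0 then u else ys ! (i - 1)}"
    by (intro card_mono) auto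
  also have "\<dots> \<le> 2" by (simp add: card_insert_if)
  finally show ?thesis .
qed

lemma cut_old:
  assumes d: "u \<in> set xs" "w \<in> set xs" "ys \<noteq> []" "set xs \<inter> set ys = {}" "c \<le> length xs"
    and A: "arrangement A M xs" and M: "M \<subseteq> M'"
  shows "cut_left (rm (A \<union> ear u ys w) M') (xs @ ys) c \<subseteq> cut_left (rm A M) xs c \<union>
     {x. x \<in> set (take c xs) \<and> (x = u \<and> \<not> (u \<in> M' \<and> hd ys \<in> M') \<or> x = w \<and> \<not> (w \<in> M' \<and> last ys \<in> M'))}"
proof
  fix x assume "x \<in> cut_left (rm (A \<union> ear u ys w) M') (xs @ ys) c"
  then obtain y where x: "x \<in> set (take c xs)" and y: "y \<in> set (drop c xs) \<union> set ys"
    and r: "rm (A \<union> ear u ys w) M' x y" unfolding cut_left_def using d(5) by auto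
  have xx: "x \<in> set xs" "x \<notin> set ys" using x d(4) by (auto dest: in_set_takeD)
  from r M d(3) show "x \<in> cut_left (rm A M) xs c \<union>
     {x. x \<in> set (take c xs) \<and> (x = u \<and> \<not> (u \<in> M' \<and> hd ys \<in> M') \<or> x = w \<and> \<not> (w \<in> M' \<and> last ys \<in> M'))}"
  proof (cases rule: rm_ear)
    case 1
    then have "y \<in> set (drop c xs)" using y rm_set[OF A] d(4) by blast
    then show ?thesis using 1 x by (auto simp: cut_left_def)
  next
    case 2
    then show ?thesis using xx x d(3) hd_in_set by auto
  next
    case 3
    then show ?thesis using xx x d(3) last_in_set by auto
  next
    case (4 k)
    then show ?thesis using xx by (metis Suc_lessD nth_mem)
  qed
qed

lemma old_nbrs:
  assumes d: "v \<in> set xs" "ys \<noteq> []" "set xs \<inter> set ys = {}" and M: "M \<subseteq> M'"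
  shows "{y. rm (A \<union> ear u ys w) M' v y} \<subseteq> {y. rm A M v y} \<union>
     {y. v = u \<and> y = hd ys \<and> \<not> (u \<in> M' \<and> hd ys \<in> M') \<or> v = w \<and> y = last ys \<and> \<not> (w \<in> M' \<and> last ys \<in> M')}"
proof
  fix y assume "y \<in> {y. rm (A \<union> ear u ys w) M' v y}"
  then have r: "rm (A \<union> ear u ys w) M' v y" by simp
  have vy: "v \<notin> set ys" using d by auto
  from r M d(2) show "y \<in> {y. rm A M v y} \<union>
     {y. v = u \<and> y = hd ys \<and> \<not> (u \<in> M' \<and> hd ys \<in> M') \<or> v = w \<and> y = last ys \<and> \<not> (w \<in> M' \<and> last ys \<in> M')}"
  proof (cases rule: rm_ear)
    case 2 then show ?thesis using vy d(2) hd_in_set by auto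
  next
    case 3 then show ?thesis using vy d(2) last_in_set by auto
  next
    case (4 k) then show ?thesis using vy by (metis Suc_lessD nth_mem)
  qed simp
qed

text \<open>If both ends lie in \<open>J\<close>, they raise degrees and old cuts only from there
  on, from two to at most four; cuts inside \<open>pre\<close> have both ends on their right.
  Otherwise the first and the last arc of the ear have both ends in \<open>M'\<close> and count
  nowhere. On the new ear the bounds are two again, so the next ear can attach to it.\<close>

lemma add_ear_arr:
  assumes a: "arr_end A M pre J" and ys: "distinct ys" "ys \<noteq> []" "set (pre @ J) \<inter> set ys = {}"
    and M': "M \<subseteq> M'" "M' \<subseteq> set (pre @ J @ ys)"
    and uw: "u \<in> set (pre @ J)" "w \<in> set (pre @ J)"
    and attach: "u \<in> set J \<and> w \<in> set J \<or> u \<in> M' \<and> w \<in> M' \<and> hd ys \<in> M' \<and> last ys \<in> M'"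
  shows "arr_end (A \<union> ear u ys w) M' (pre @ J) ys"
proof -
  let ?xs = "pre @ J" and ?A = "A \<union> ear u ys w"
  have A: "arrangement A M ?xs" using a by (simp add: arr_end_def)
  have dx: "distinct ?xs" using A by (simp add: arrangement_def)
  have new: "card (cut_left (rm ?A M') (?xs @ ys) c) \<le> 2" if "length ?xs \<le> c" for c
    by (rule cut_new[OF ys(1) uw ys(2,3) that A M'(1)])
  have degn: "card {y. rm ?A M' v y} \<le> 2" if v: "v \<in> set ys" for v
  proof -
    obtain k where "k < length ys" "v = ys ! k" using v by (auto simp: in_set_conv_nth)
    moreover have "u \<notin> set ys" "w \<notin> set ys" using uw ys(3) by auto
    ultimately show ?thesis using nth_ear_nbrs[OF ys(1) _ _ _ A ys(3) M'(1)] by blast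
  qed
  have old: "card (cut_left (rm ?A M') (?xs @ ys) c) \<le> 4" if c: "c < length ?xs" for c
  proof -
    define Y where "Y = {x. x \<in> set (take c ?xs) \<and> (x = u \<and> \<not> (u \<in> M' \<and> hd ys \<in> M') \<or> x = w \<and> \<not> (w \<in> M' \<and> last ys \<in> M'))}"
    have sub: "cut_left (rm ?A M') (?xs @ ys) c \<subseteq> cut_left (rm A M) ?xs c \<union> Y"
      unfolding Y_def by (rule cut_old[OF uw ys(2,3) _ A M'(1)]) (use c in simp)
    have Yuw: "Y \<subseteq> {u, w}" by (auto simp: Y_def)
    have cY: "card Y \<le> 2" using card_mono[OF _ Yuw] by (auto simp: card_insert_if split: if_splits)
    have finY: "finite Y" using Yuw finite_subset by blast
    have le: "card (cut_left (rm ?A M') (?xs @ ys) c) \<le> card (cut_left (rm A M) ?xs c) + card Y"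
      using card_mono[OF _ sub] finY card_Un_le[of "cut_left (rm A M) ?xs c" Y] by simp
    show ?thesis
    proof (cases "length pre \<le> c")
      case True
      then have "card (cut_left (rm A M) ?xs c) \<le> 2" using a by (simp add: arr_end_def)
      then show ?thesis using le cY by linarith
    next
      case False
      have "Y = {}"
      proof (cases "u \<in> set J \<and> w \<in> set J")
        case True
        have "set (take c ?xs) \<subseteq> set pre" using False by (auto dest: in_set_takeD)
        then show ?thesis using True dx by (auto simp: Y_def)
      next
        case False
        then show ?thesis using attach by (auto simp: Y_def)
      qed
      moreover have "card (cut_left (rm A M) ?xs c) \<le> 4" using A by (simp add: arrangement_def)
      ultimately show ?thesis using le by simp
    qed
  qed
  have dego: "card {y. rm ?A M' v y} \<le> 4" if v: "v \<in> set ?xs" for v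
  proof -
    define Y where "Y = {y. v = u \<and> y = hd ys \<and> \<not> (u \<in> M' \<and> hd ys \<in> M') \<or> v = w \<and> y = last ys \<and> \<not> (w \<in> M' \<and> last ys \<in> M')}"
    have sub: "{y. rm ?A M' v y} \<subseteq> {y. rm A M v y} \<union> Y" unfolding Y_def by (rule old_nbrs[OF v ys(2,3) M'(1)])
    have Yuw: "Y \<subseteq> {hd ys, last ys}" by (auto simp: Y_def)
    have cY: "card Y \<le> 2" using card_mono[OF _ Yuw] by (auto simp: card_insert_if split: if_splits)
    have finY: "finite Y" using Yuw finite_subset by blast
    have le: "card {y. rm ?A M' v y} \<le> card {y. rm A M v y} + card Y"
      using card_mono[OF _ sub] finY finite_rm[OF A] card_Un_le[of "{y. rm A M v y}" Y] by simp
    show ?thesis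
    proof (cases "v \<in> set J")
      case True
      then have "card {y. rm A M v y} \<le> 2" using a by (simp add: arr_end_def)
      then show ?thesis using le cY by linarith
    next
      case False
      then have "Y = {}" using attach by (auto simp: Y_def)
      moreover have "card {y. rm A M v y} \<le> 4" using A by (simp add: arrangement_def)
      ultimately show ?thesis using le by simp
    qed
  qed
  have AA: "?A \<subseteq> set (?xs @ ys) \<times> set (?xs @ ys)"
  proof -
    have "ear u ys w \<subseteq> set (u # ys) \<times> set (ys @ [w])" unfolding ear_def by (auto dest: set_zip_leftD set_zip_rightD)
    then show ?thesis using A uw by (auto simp: arrangement_def)
  qed
  have degz: "card {y. rm ?A M' v y} \<le> 4" for v
  proof (cases "v \<in> set (?xs @ ys)")
    case True then show ?thesis using dego[of v] degn[of v] by auto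
  next
    case False
    then have "{y. rm ?A M' v y} = {}" using AA by (auto simp: rm_def)
    then show ?thesis by (simp only: card.empty)
  qed
  have cuts: "card (cut_left (rm ?A M') (?xs @ ys) c) \<le> 4" for c
    using old[of c] new[of c] by (cases "c < length ?xs") auto
  have "arrangement ?A M' (?xs @ ys)"
    unfolding arrangement_def using dx ys AA M' degz cuts by auto
  then show ?thesis unfolding arr_end_def using new degn by auto
qed

text \<open>The ear follows \<open>ps\<close> to its last vertex \<open>ps ! j\<close> from which
  one can return to \<open>Y\<close> without meeting \<open>ps\<close> or \<open>Y\<close> on the
  way. By this choice every way back to \<open>Y\<close> from the rest of \<open>ps\<close> meets
  the new ear. That is the premise of the last conclusion for the following ear, with
  \<open>J\<close> the present one, and forces its end \<open>w\<close> into
  \<open>J\<close>.\<close>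

lemma ear_exists:
  assumes conn: "\<And>x. x \<in> S \<Longrightarrow> (x, y0) \<in> AS\<^sup>*" and AS: "AS \<subseteq> S \<times> S" and y0: "y0 \<in> Y"
    and ps: "ps \<noteq> []" "distinct ps" "set ps \<inter> Y = {}" "set ps \<subseteq> S"
    and walk: "set (zip (u # ps) ps) \<subseteq> AS"
  obtains j zs w where "j < length ps" "w \<in> Y"
    "distinct (take (Suc j) ps @ zs)" "set (take (Suc j) ps @ zs) \<inter> Y = {}" "set (take (Suc j) ps @ zs) \<inter> set (drop (Suc j) ps) = {}"
    "ear u (take (Suc j) ps @ zs) w \<subseteq> AS"
    "\<And>p y. p \<in> set (drop (Suc j) ps) \<Longrightarrow> y \<in> Y \<Longrightarrow>
       (p, y) \<notin> {(a, b) \<in> AS. a \<notin> set (take (Suc j) ps @ zs) \<and> b \<notin> set (take (Suc j) ps @ zs)}\<^sup>*"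
    "\<And>J. J \<subseteq> Y \<Longrightarrow> (\<And>p y. p \<in> set ps \<Longrightarrow> y \<in> Y - J \<Longrightarrow> (p, y) \<notin> {(a, b) \<in> AS. a \<notin> J \<and> b \<notin> J}\<^sup>*) \<Longrightarrow> w \<in> J"
proof -
  define Rint where "Rint = {(a, b) \<in> AS. b \<notin> Y \<and> b \<notin> set ps}"
  define Q where "Q a \<longleftrightarrow> (\<exists>z w. (a, z) \<in> Rint\<^sup>* \<and> (z, w) \<in> AS \<and> w \<in> Y)" for a
  \<comment> \<open>On a walk from \<open>a\<close> up to its first visit of \<open>Y\<close>, the
    last vertex that is \<open>a\<close> or lies on \<open>ps\<close> satisfies
    \<open>Q\<close>.\<close>
  have search: "a \<in> Y \<or> Q a \<or> (\<exists>p\<in>P. Q p)"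
    if R: "R \<subseteq> AS" and P: "\<And>a b. (a, b) \<in> R \<Longrightarrow> b \<in> set ps \<Longrightarrow> b \<in> P" and a: "(a, y) \<in> R\<^sup>*" "y \<in> Y" for R P a y
    using a
  proof (induction rule: converse_rtrancl_induct)
    case (step a b)
    have ab: "(a, b) \<in> AS" using step(1) R by blast
    consider "b \<in> Y" | "b \<in> set ps" "Q b" | "\<exists>p\<in>P. Q p" | "b \<notin> Y" "b \<notin> set ps" "Q b"
      using step by blast
    then show ?case
    proof cases
      case 1 then have "Q a" unfolding Q_def using ab by blast
      then show ?thesis by simp
    next
      case 2 then show ?thesis using P step(1) by blast
    next
      case 4
      then have "(a, b) \<in> Rint" using ab by (simp add: Rint_def)
      then have "Q a" using 4(3) unfolding Q_def by (meson converse_rtrancl_into_rtrancl)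
      then show ?thesis by simp
    qed simp
  qed simp
  have "last ps \<in> set ps" using ps(1) by simp
  then have "(last ps, y0) \<in> AS\<^sup>*" "last ps \<notin> Y" using conn ps by blast+
  then have "\<exists>p\<in>set ps. Q p" using search[of AS "set ps" "last ps" y0] y0 \<open>last ps \<in> set ps\<close> by auto
  then obtain i0 where "i0 < length ps" "Q (ps ! i0)" by (auto simp: in_set_conv_nth)
  define j where "j = Max {i. i < length ps \<and> Q (ps ! i)}"
  have fin: "finite {i. i < length ps \<and> Q (ps ! i)}" by simp
  have "j \<in> {i. i < length ps \<and> Q (ps ! i)}" unfolding j_def using fin \<open>i0 < length ps\<close> \<open>Q (ps ! i0)\<close> by (intro Max_in) auto
  then have j: "j < length ps" "Q (ps ! j)" by auto
  have jmax: "\<not> Q (ps ! i)" if "j < i" "i < length ps" for i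
    using Max_ge[OF fin, of i] that unfolding j_def[symmetric] by auto
  have dropQ: "\<not> Q p" if p: "p \<in> set (drop (Suc j) ps)" for p
  proof -
    obtain k where "k < length ps - Suc j" "p = ps ! (Suc j + k)" using p j by (auto simp: in_set_conv_nth)
    then show ?thesis using jmax[of "Suc j + k"] by simp
  qed
  obtain z w where zw: "(ps ! j, z) \<in> Rint\<^sup>*" "(z, w) \<in> AS" "w \<in> Y" using j(2) unfolding Q_def by blast
  obtain zs where zs: "distinct (ps ! j # zs)" "last (ps ! j # zs) = z" "set (zip (ps ! j # zs) zs) \<subseteq> Rint"
    using simple_path[OF zw(1)] by blast
  have zsn: "b \<notin> Y \<and> b \<notin> set ps" if b: "b \<in> set zs" for b
  proof -
    obtain k where "k < length zs" "b = zs ! k" using b by (auto simp: in_set_conv_nth)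
    then have "((ps ! j # zs) ! k, b) \<in> set (zip (ps ! j # zs) zs)" by (auto simp: in_set_zip intro: exI[of _ k])
    then show ?thesis using zs(3) by (auto simp: Rint_def)
  qed
  define ys where "ys = take (Suc j) ps @ zs"
  have tk: "take (Suc j) ps = take j ps @ [ps ! j]" using j by (simp add: take_Suc_conv_app_nth)
  have split: "ps = take (Suc j) ps @ drop (Suc j) ps" by simp
  have d1: "distinct ys"
    unfolding ys_def using ps(2) zs(1) zsn by (auto simp: distinct_take dest: in_set_takeD)
  have d2: "set ys \<inter> Y = {}" unfolding ys_def using ps(3) zsn by (auto dest: in_set_takeD)
  have d3: "set ys \<inter> set (drop (Suc j) ps) = {}"
  proof -
    have "set (take (Suc j) ps) \<inter> set (drop (Suc j) ps) = {}"
      using ps(2) by (metis distinct_append split)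
    then show ?thesis unfolding ys_def using zsn by (auto dest: in_set_dropD)
  qed
  have earA: "ear u ys w \<subseteq> AS"
  proof -
    have e: "ear u (xs @ p # zs) w = set (zip (u # xs) (xs @ [p])) \<union> set (zip (p # zs) (zs @ [w]))" for xs p u
      by (induction xs arbitrary: u) (auto simp: ear_def)
    have zt: "set (zip (u # take j ps) (take j ps @ [ps ! j])) \<subseteq> set (zip (u # ps) ps)"
    proof -
      have "zip (u # take j ps) (take j ps @ [ps ! j]) = take (Suc j) (zip (u # ps) ps)"
        unfolding take_zip tk by simp
      then show ?thesis using set_take_subset by metis
    qed
    have ziplast: "zip (p # zs) (zs @ [w]) = zip (p # zs) zs @ [(last (p # zs), w)]" for p and zs :: "'a list"
      by (induction zs arbitrary: p) auto
    have "zip (ps ! j # zs) (zs @ [w]) = zip (ps ! j # zs) zs @ [(z, w)]"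
      unfolding zs(2)[symmetric]
      by (rule ziplast)
    then show ?thesis using zt e[of u "take j ps" "ps ! j"] walk zs(3) zw(2) unfolding ys_def tk by (auto simp: Rint_def)
  qed
  have blocked: "(p, y) \<notin> {(a, b) \<in> AS. a \<notin> set ys \<and> b \<notin> set ys}\<^sup>*" if p: "p \<in> set (drop (Suc j) ps)" "y \<in> Y" for p y
  proof
    assume r: "(p, y) \<in> {(a, b) \<in> AS. a \<notin> set ys \<and> b \<notin> set ys}\<^sup>*"
    have P: "b \<in> set (drop (Suc j) ps)" if "(a, b) \<in> {(a, b) \<in> AS. a \<notin> set ys \<and> b \<notin> set ys}" "b \<in> set ps" for a b
    proof -
      have "b \<in> set (take (Suc j) ps) \<union> set (drop (Suc j) ps)" using that(2) split by (metis set_append)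
      then show ?thesis using that(1) by (auto simp: ys_def)
    qed
    have "p \<in> Y \<or> Q p \<or> (\<exists>p\<in>set (drop (Suc j) ps). Q p)"
      by (rule search[OF _ P r p(2)]) auto
    moreover have "p \<notin> Y" using p(1) ps(3) by (auto dest: in_set_dropD)
    ultimately show False using dropQ p(1) by blast
  qed
  have wJ: "w \<in> J" if J: "J \<subseteq> Y" "\<And>p y. p \<in> set ps \<Longrightarrow> y \<in> Y - J \<Longrightarrow> (p, y) \<notin> {(a, b) \<in> AS. a \<notin> J \<and> b \<notin> J}\<^sup>*" for J
  proof (rule ccontr)
    assume w: "w \<notin> J"
    have pj: "ps ! j \<in> set ps" using j by simp
    have "(ps ! j, z) \<in> {(a, b) \<in> AS. a \<notin> J \<and> b \<notin> J}\<^sup>* \<and> z \<notin> J"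
      using zw(1)
    proof (induction)
      case base then show ?case using pj ps(3) J(1) by auto
    next
      case (step y z)
      then have "z \<notin> J" using J(1) by (auto simp: Rint_def)
      then have "(y, z) \<in> {(a, b) \<in> AS. a \<notin> J \<and> b \<notin> J}" using step by (auto simp: Rint_def)
      then show ?case using step \<open>z \<notin> J\<close> by (meson rtrancl.rtrancl_into_rtrancl)
    qed
    then have "(ps ! j, w) \<in> {(a, b) \<in> AS. a \<notin> J \<and> b \<notin> J}\<^sup>*" using zw(2) w
      by (auto intro: rtrancl.rtrancl_into_rtrancl)
    then show False using J(2)[OF pj, of w] w zw(3) by blast
  qed
  show thesis
    by (rule that[of j w zs, folded ys_def, OF j(1) zw(3) d1 d2 d3 earA]) (fact blocked, fact wJ)
qed

section \<open>Exhausting a strongly connected digraph by ears\<close>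

definition sconn :: "('a \<times> 'a) set \<Rightarrow> 'a set \<Rightarrow> bool" where
  "sconn A Y \<longleftrightarrow> (\<forall>x\<in>Y. \<forall>y\<in>Y. (x, y) \<in> A\<^sup>*)"

lemma sconn_ear:
  assumes s: "sconn A Y" and uw: "u \<in> Y" "w \<in> Y"
  shows "sconn (A \<union> ear u ys w) (Y \<union> set ys)"
proof -
  let ?R = "A \<union> ear u ys w"
  have m: "A\<^sup>* \<subseteq> ?R\<^sup>*" "(ear u ys w)\<^sup>* \<subseteq> ?R\<^sup>*" by (auto intro!: rtrancl_mono)
  have "(u, x) \<in> ?R\<^sup>* \<and> (x, u) \<in> ?R\<^sup>*" if x: "x \<in> Y \<union> set ys" for x
  proof (cases "x \<in> Y")
    case True
    then have "(u, x) \<in> A\<^sup>*" "(x, u) \<in> A\<^sup>*" using s uw by (auto simp: sconn_def)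
    then show ?thesis using m by blast
  next
    case False
    then have "x \<in> set ys" using x by simp
    then have "(u, x) \<in> ?R\<^sup>*" "(x, w) \<in> ?R\<^sup>*" using subsetD[OF m(2) ear_reach(1)] subsetD[OF m(2) ear_reach(2)] by simp_all
    moreover have "(w, u) \<in> ?R\<^sup>*" using s uw m by (auto simp: sconn_def)
    ultimately show ?thesis by (meson rtrancl_trans)
  qed
  then show ?thesis unfolding sconn_def by (meson rtrancl_trans)
qed

lemma drop_walk:
  assumes j: "j < length ps" and walk: "set (zip (u # ps) ps) \<subseteq> R"
  shows "set (zip (ps ! j # drop (Suc j) ps) (drop (Suc j) ps)) \<subseteq> R"
    "last (ps ! j # drop (Suc j) ps) = last (u # ps)"
proof -
  have "drop (Suc j) (u # ps) = ps ! j # drop (Suc j) ps" using j by (simp add: Cons_nth_drop_Suc)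
  then have "zip (ps ! j # drop (Suc j) ps) (drop (Suc j) ps) = drop (Suc j) (zip (u # ps) ps)"
    by (simp only: drop_zip)
  then show "set (zip (ps ! j # drop (Suc j) ps) (drop (Suc j) ps)) \<subseteq> R"
    using walk set_drop_subset by (metis subset_trans)
  have ne: "ps \<noteq> []" using j by auto
  show "last (ps ! j # drop (Suc j) ps) = last (u # ps)"
  proof (cases "drop (Suc j) ps = []")
    case True
    then have "length ps = Suc j" using j by simp
    then have "ps ! j = last ps" using last_conv_nth[OF ne] by simp
    then show ?thesis using True ne by simp
  next
    case False
    then have "last (drop (Suc j) ps) = last ps" by (intro last_drop) simp
    then show ?thesis using False ne by simp
  qed
qed

lemma ear_sub:
  assumes "ear u ys w \<subseteq> AS" "AS \<subseteq> S \<times> S"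
  shows "set ys \<subseteq> S"
proof
  fix y assume "y \<in> set ys"
  then obtain k where k: "k < length ys" "y = ys ! k" by (auto simp: in_set_conv_nth)
  have "((u # ys) ! k, (ys @ [w]) ! k) \<in> ear u ys w" unfolding ear_def in_set_zip
    using k(1) by (intro exI[of _ k]) simp
  then show "y \<in> S" using k assms by (auto simp: nth_append)
qed

text \<open>Each ear starts on its predecessor, since \<open>u'\<close> lies there, and by
  \<open>block\<close> it also ends there. So the rest of the path is absorbed by ears that need no
  new marks, and \<open>M\<close> stays the same.\<close>

lemma extend_chain:
  assumes conn: "sconn AS S" and AS: "AS \<subseteq> S \<times> S" and YS: "set (pre @ J) \<subseteq> S"
    and a: "arr_end A M pre J" and A: "A \<subseteq> AS" "sconn A (set (pre @ J))"
    and ps: "distinct ps" "set ps \<inter> set (pre @ J) = {}" "set ps \<subseteq> S" and u: "u \<in> set J"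
    and walk: "set (zip (u # ps) ps) \<subseteq> AS"
    and block: "\<And>p y. p \<in> set ps \<Longrightarrow> y \<in> set (pre @ J) - set J \<Longrightarrow> (p, y) \<notin> {(a, b) \<in> AS. a \<notin> set J \<and> b \<notin> set J}\<^sup>*"
  shows "\<exists>A' pre' J'. arr_end A' M pre' J' \<and> A' \<subseteq> AS \<and> sconn A' (set (pre' @ J')) \<and> set (pre' @ J') \<subseteq> S \<and>
     set (pre @ J) \<union> {last (u # ps)} \<subseteq> set (pre' @ J')"
  using YS a A ps u walk block
proof (induction "length ps" arbitrary: ps u A pre J rule: less_induct)
  case less
  show ?case
  proof (cases "ps = []")
    case True
    then show ?thesis using less.prems by (intro exI[of _ A] exI[of _ pre] exI[of _ J]) auto
  next
    case False
    let ?Y = "set (pre @ J)"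
    have uY: "u \<in> ?Y" using less.prems by simp
    have c: "(x, u) \<in> AS\<^sup>*" if "x \<in> S" for x using conn that uY less.prems(1) by (auto simp: sconn_def)
    obtain j zs w where E: "j < length ps" "w \<in> ?Y"
      "distinct (take (Suc j) ps @ zs)" "set (take (Suc j) ps @ zs) \<inter> ?Y = {}" "set (take (Suc j) ps @ zs) \<inter> set (drop (Suc j) ps) = {}"
      "ear u (take (Suc j) ps @ zs) w \<subseteq> AS"
      and blk: "\<And>p y. p \<in> set (drop (Suc j) ps) \<Longrightarrow> y \<in> ?Y \<Longrightarrow>
       (p, y) \<notin> {(a, b) \<in> AS. a \<notin> set (take (Suc j) ps @ zs) \<and> b \<notin> set (take (Suc j) ps @ zs)}\<^sup>*"
      and wJ: "\<And>J. J \<subseteq> ?Y \<Longrightarrow> (\<And>p y. p \<in> set ps \<Longrightarrow> y \<in> ?Y - J \<Longrightarrow> (p, y) \<notin> {(a, b) \<in> AS. a \<notin> J \<and> b \<notin> J}\<^sup>*) \<Longrightarrow> w \<in> J"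
      proof (rule ear_exists[OF c AS uY False less.prems(5,6,7,9)], goal_cases)
        case (2 j zs w)
        show ?case by (rule 2(1)[OF 2(2-7)]) (fact 2(8), fact 2(9))
      qed assumption
    define ys where "ys = take (Suc j) ps @ zs"
    note E = E[folded ys_def] and blk = blk[folded ys_def]
    have wJ: "w \<in> set J" by (rule wJ[OF _ less.prems(10)]) auto
    have ne: "ys \<noteq> []" using E(1) by (cases ps) (auto simp: ys_def)
    have Msub: "M \<subseteq> set (pre @ J @ ys)" using less.prems(2) by (auto simp: arr_end_def arrangement_def)
    have arr: "arr_end (A \<union> ear u ys w) M (pre @ J) ys"
      by (rule add_ear_arr[OF less.prems(2) E(3) ne _ order_refl Msub uY E(2)]) (use E(4) wJ less.prems(8) in auto)
    have yS: "set ys \<subseteq> S" by (rule ear_sub[OF E(6) AS])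
    define u' where "u' = ps ! j"
    have u': "u' \<in> set ys" using E(1) by (simp add: ys_def u'_def take_Suc_conv_app_nth)
    have len: "length (drop (Suc j) ps) < length ps" using E(1) by simp
    note w' = drop_walk(1)[OF E(1) less.prems(9), folded u'_def] and lst = drop_walk(2)[OF E(1) less.prems(9), folded u'_def]
    have "\<exists>A' pre' J'. arr_end A' M pre' J' \<and> A' \<subseteq> AS \<and> sconn A' (set (pre' @ J')) \<and> set (pre' @ J') \<subseteq> S \<and>
     set ((pre @ J) @ ys) \<union> {last (u' # drop (Suc j) ps)} \<subseteq> set (pre' @ J')"
    proof (rule less.hyps[OF len _ arr _ _ _ _ _ u' w'])
      show "set ((pre @ J) @ ys) \<subseteq> S" using less.prems(1) yS by auto
      show "A \<union> ear u ys w \<subseteq> AS" using less.prems(3) E(6) by blast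
      show "sconn (A \<union> ear u ys w) (set ((pre @ J) @ ys))" using sconn_ear[OF less.prems(4) uY E(2)] by (simp add: Un_assoc)
      show "distinct (drop (Suc j) ps)" using less.prems(5) by simp
      show "set (drop (Suc j) ps) \<inter> set ((pre @ J) @ ys) = {}" using less.prems(6) E(5) by (auto dest: in_set_dropD)
      show "set (drop (Suc j) ps) \<subseteq> S" using less.prems(7) by (auto dest: in_set_dropD)
      show "(p, y) \<notin> {(a, b) \<in> AS. a \<notin> set ys \<and> b \<notin> set ys}\<^sup>*"
        if "p \<in> set (drop (Suc j) ps)" "y \<in> set ((pre @ J) @ ys) - set ys" for p y
        using blk[of p y] that by auto
    qed
    then show ?thesis unfolding lst by (auto 4 4)
  qed
qed

text \<open>Only the first ear on the way to \<open>x\<close> may return anywhere in the old part;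
  its two ends and its first and last inner vertices are the four new marks. The later ears attach
  to their predecessors, by \<open>extend_chain\<close>.\<close>

lemma add_target:
  assumes conn: "sconn AS S" and AS: "AS \<subseteq> S \<times> S" and YS: "set (pre @ J) \<subseteq> S" "pre @ J \<noteq> []" and xS: "x \<in> S"
    and a: "arr_end A M pre J" and A: "A \<subseteq> AS" "sconn A (set (pre @ J))"
  shows "\<exists>A' M' pre' J'. arr_end A' M' pre' J' \<and> A' \<subseteq> AS \<and> sconn A' (set (pre' @ J')) \<and> set (pre' @ J') \<subseteq> S \<and>
     set (pre @ J) \<union> {x} \<subseteq> set (pre' @ J') \<and> card M' \<le> card M + 4"
proof (cases "x \<in> set (pre @ J)")
  case True
  then show ?thesis using YS a A by (intro exI[of _ A] exI[of _ M] exI[of _ pre] exI[of _ J]) auto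
next
  case xY: False
  let ?Y = "set (pre @ J)"
  obtain y0 where y0: "y0 \<in> ?Y" using YS(2) by (cases "pre @ J") auto
  have "(y0, x) \<in> AS\<^sup>*" using conn xS y0 YS(1) by (auto simp: sconn_def)
  then obtain zs where zs: "distinct (y0 # zs)" "last (y0 # zs) = x" "set (zip (y0 # zs) zs) \<subseteq> AS" using simple_path[of y0 x AS] by metis
  have "\<exists>z\<in>set (y0 # zs). z \<in> ?Y" using y0 by auto
  then obtain p u ps where ps: "y0 # zs = p @ u # ps" "u \<in> ?Y" "\<forall>z\<in>set ps. z \<notin> ?Y"
    using split_list_last_prop[of "y0 # zs" "\<lambda>z. z \<in> ?Y"] by metis
  have lx: "last (u # ps) = x" using zs(2) unfolding ps(1) by simp
  have ne: "ps \<noteq> []" using lx ps(2) xY by auto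
  have dps: "distinct ps" using zs(1) unfolding ps(1) by simp
  have walk: "set (zip (u # ps) ps) \<subseteq> AS"
  proof -
    have "set (zip (u # ps) ps) \<subseteq> set (zip (y0 # zs) (tl (y0 # zs)))"
      unfolding ps(1)
    proof (induction p)
      case (Cons a p)
      then show ?case by (cases p) auto
    qed simp
    then show ?thesis using zs(3) by simp
  qed
  have psS: "set ps \<subseteq> S"
  proof
    fix y assume "y \<in> set ps"
    then obtain k where "k < length ps" "y = ps ! k" by (auto simp: in_set_conv_nth)
    then have "((u # ps) ! k, y) \<in> set (zip (u # ps) ps)" unfolding in_set_zip by (intro exI[of _ k]) simp
    then show "y \<in> S" using walk AS by blast
  qed
  have c: "(x, u) \<in> AS\<^sup>*" if "x \<in> S" for x using conn that ps(2) YS(1) by (auto simp: sconn_def)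
  have psY: "set ps \<inter> ?Y = {}" using ps(3) by blast
  obtain j zs w where E: "j < length ps" "w \<in> ?Y"
      "distinct (take (Suc j) ps @ zs)" "set (take (Suc j) ps @ zs) \<inter> ?Y = {}" "set (take (Suc j) ps @ zs) \<inter> set (drop (Suc j) ps) = {}"
      "ear u (take (Suc j) ps @ zs) w \<subseteq> AS"
      and blk: "\<And>p y. p \<in> set (drop (Suc j) ps) \<Longrightarrow> y \<in> ?Y \<Longrightarrow>
       (p, y) \<notin> {(a, b) \<in> AS. a \<notin> set (take (Suc j) ps @ zs) \<and> b \<notin> set (take (Suc j) ps @ zs)}\<^sup>*"
  proof (rule ear_exists[OF c AS ps(2) ne dps psY psS walk], goal_cases)
    case (2 j zs w)
    show ?case by (rule 2(1)[OF 2(2-7)]) (fact 2(8))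
  qed assumption
  define ys where "ys = take (Suc j) ps @ zs"
  note E = E[folded ys_def] and blk = blk[folded ys_def]
  have yne: "ys \<noteq> []" using E(1) by (cases ps) (auto simp: ys_def)
  define M' where "M' = M \<union> {u, w, hd ys, last ys}"
  have M: "M \<subseteq> ?Y" using a by (simp add: arr_end_def arrangement_def)
  have "card {u, w, hd ys, last ys} \<le> 4" by (simp add: card_insert_if)
  then have cM: "card M' \<le> card M + 4" unfolding M'_def using card_Un_le[of M "{u, w, hd ys, last ys}"] by linarith
  have M'sub: "M' \<subseteq> set (pre @ J @ ys)" using M ps(2) E(2) yne by (auto simp: M'_def)
  have arr: "arr_end (A \<union> ear u ys w) M' (pre @ J) ys"
    by (rule add_ear_arr[OF a E(3) yne _ _ M'sub ps(2) E(2)]) (use E(4) in \<open>auto simp: M'_def\<close>)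
  have yS: "set ys \<subseteq> S" by (rule ear_sub[OF E(6) AS])
  define u' where "u' = ps ! j"
  have u': "u' \<in> set ys" using E(1) by (simp add: ys_def u'_def take_Suc_conv_app_nth)
  note w' = drop_walk(1)[OF E(1) walk, folded u'_def] and lst = drop_walk(2)[OF E(1) walk, folded u'_def]
  have "\<exists>A' pre' J'. arr_end A' M' pre' J' \<and> A' \<subseteq> AS \<and> sconn A' (set (pre' @ J')) \<and> set (pre' @ J') \<subseteq> S \<and>
   set ((pre @ J) @ ys) \<union> {last (u' # drop (Suc j) ps)} \<subseteq> set (pre' @ J')"
  proof (rule extend_chain[OF conn AS _ arr _ _ _ _ _ u' w'])
    show "set ((pre @ J) @ ys) \<subseteq> S" using YS(1) yS by auto
    show "A \<union> ear u ys w \<subseteq> AS" using A(1) E(6) by blast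
    show "sconn (A \<union> ear u ys w) (set ((pre @ J) @ ys))" using sconn_ear[OF A(2) ps(2) E(2)] by (simp add: Un_assoc)
    show "distinct (drop (Suc j) ps)" using dps by simp
    show "set (drop (Suc j) ps) \<inter> set ((pre @ J) @ ys) = {}" using psY E(5) by (auto dest: in_set_dropD)
    show "set (drop (Suc j) ps) \<subseteq> S" using psS by (auto dest: in_set_dropD)
    show "(p, y) \<notin> {(a, b) \<in> AS. a \<notin> set ys \<and> b \<notin> set ys}\<^sup>*"
      if "p \<in> set (drop (Suc j) ps)" "y \<in> set ((pre @ J) @ ys) - set ys" for p y
      using blk[of p y] that by auto
  qed
  then obtain A' pre' J' where "arr_end A' M' pre' J'" "A' \<subseteq> AS" "sconn A' (set (pre' @ J'))" "set (pre' @ J') \<subseteq> S"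
   "set ((pre @ J) @ ys) \<union> {last (u' # drop (Suc j) ps)} \<subseteq> set (pre' @ J')" by blast
  then show ?thesis using cM lst lx by (intro exI[of _ A'] exI[of _ M'] exI[of _ pre'] exI[of _ J']) auto
qed

lemma arrangement_mono:
  assumes a: "arrangement A M xs" and M: "M \<subseteq> M'" "M' \<subseteq> set xs"
  shows "arrangement A M' xs"
proof -
  have r: "rm A M' x y \<Longrightarrow> rm A M x y" for x y using M(1) by (auto simp: rm_def)
  have "card (cut_left (rm A M') xs c) \<le> 4" for c
  proof -
    have "cut_left (rm A M') xs c \<subseteq> cut_left (rm A M) xs c" using r by (auto simp: cut_left_def)
    then have "card (cut_left (rm A M') xs c) \<le> card (cut_left (rm A M) xs c)" by (intro card_mono) auto
    also have "\<dots> \<le> 4" using a by (simp add: arrangement_def)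
    finally show ?thesis .
  qed
  moreover have "card {u. rm A M' v u} \<le> 4" for v
  proof -
    have "card {u. rm A M' v u} \<le> card {u. rm A M v u}" using r finite_rm[OF a] by (intro card_mono) auto
    also have "\<dots> \<le> 4" using a by (simp add: arrangement_def)
    finally show ?thesis .
  qed
  ultimately show ?thesis using a M by (auto simp: arrangement_def)
qed

text \<open>Starting from one member of \<open>X\<close>, all members are added in turn, at four
  marks each. The arcs collected strongly connect \<open>X\<close>, so by minimality they are all
  arcs. Marking \<open>X\<close> as well gives at most
  \<open>1 + 5 * card X \<le> 6 * card X\<close>.\<close>

lemma sconn_arrangement:
  assumes conn: "sconn AS S" and AS: "AS \<subseteq> S \<times> S" and X: "finite X" "X \<subseteq> S" "X \<noteq> {}"
    and min: "\<And>A'. A' \<subseteq> AS \<Longrightarrow> sconn A' X \<Longrightarrow> A' = AS"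
  shows "\<exists>xs M. arrangement AS M xs \<and> set xs = S \<and> X \<subseteq> M \<and> card M \<le> 6 * card X"
proof -
  obtain r where r: "r \<in> X" using X(3) by blast
  have "\<exists>A M pre J. arr_end A M pre J \<and> A \<subseteq> AS \<and> sconn A (set (pre @ J)) \<and> set (pre @ J) \<subseteq> S \<and>
     insert r X' \<subseteq> set (pre @ J) \<and> card M \<le> 1 + 4 * card X'" if "finite X'" "X' \<subseteq> S" for X'
    using that
  proof (induction X' rule: finite_induct)
    case empty
    have "arr_end {} {r} [] [r] \<and> {} \<subseteq> AS \<and> sconn {} (set ([] @ [r])) \<and> set ([] @ [r]) \<subseteq> S \<and> insert r {} \<subseteq> set ([] @ [r]) \<and> card {r} \<le> 1 + 4 * card {}"
      using arr_end_single r X(2) by (auto simp: sconn_def)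
    then show ?case by (intro exI[of _ "{}"] exI[of _ "{r}"] exI[of _ "[]"] exI[of _ "[r]"])
  next
    case (insert x X')
    then have xS: "x \<in> S" by simp
    obtain A M pre J where IH: "arr_end A M pre J" "A \<subseteq> AS" "sconn A (set (pre @ J))" "set (pre @ J) \<subseteq> S"
      "insert r X' \<subseteq> set (pre @ J)" "card M \<le> 1 + 4 * card X'" using insert by auto
    have ne: "pre @ J \<noteq> []" using IH(5) by auto
    obtain A' M' pre' J' where "arr_end A' M' pre' J'" "A' \<subseteq> AS" "sconn A' (set (pre' @ J'))" "set (pre' @ J') \<subseteq> S"
      "set (pre @ J) \<union> {x} \<subseteq> set (pre' @ J')" "card M' \<le> card M + 4"
      using add_target[OF conn AS IH(4) ne xS IH(1-3)] by metis
    moreover have "card M \<le> 1 + 4 * card X' \<Longrightarrow> card M' \<le> card M + 4 \<Longrightarrow> card M' \<le> 1 + 4 * card (insert x X')"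
      using insert.hyps by simp
    ultimately show ?case using IH(5,6) by (intro exI[of _ A'] exI[of _ M'] exI[of _ pre'] exI[of _ J']) auto
  qed
  from this[OF X(1,2)] obtain A M pre J where st: "arr_end A M pre J" "A \<subseteq> AS" "sconn A (set (pre @ J))" "set (pre @ J) \<subseteq> S"
     "insert r X \<subseteq> set (pre @ J)" "card M \<le> 1 + 4 * card X" by metis
  have "sconn A X" using st(3,5) by (auto simp: sconn_def)
  then have AA: "A = AS" by (rule min[OF st(2)])
  let ?xs = "pre @ J"
  have arr: "arrangement AS M ?xs" using st(1) AA by (simp add: arr_end_def)
  have "S \<subseteq> set ?xs"
  proof
    fix v assume v: "v \<in> S"
    have "r \<in> S" using r X(2) by blast
    then have vr: "(v, r) \<in> AS\<^sup>*" using conn v by (simp add: sconn_def)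
    have rx: "r \<in> set ?xs" using st(5) by simp
    from vr show "v \<in> set ?xs"
    proof (cases rule: converse_rtranclE)
      case base then show ?thesis using rx by simp
    next
      case (step z) then show ?thesis using arr by (auto simp: arrangement_def)
    qed
  qed
  then have S: "set ?xs = S" using st(4) by blast
  have MX: "M \<subseteq> set ?xs" using arr by (simp add: arrangement_def)
  have arr2: "arrangement AS (M \<union> X) ?xs" by (rule arrangement_mono[OF arr]) (use MX X(2) S in auto)
  have "card X > 0" using X by (simp add: card_gt_0_iff)
  then have "card (M \<union> X) \<le> 6 * card X" using card_Un_le[of M X] st(6) by linarith
  then show ?thesis using arr2 S by blast
qed

text \<open>Arcs between the two lists join marked vertices and are exempt, so each cut and each
  degree sees one list only.\<close>

lemma arrangement_append:
  assumes a: "arrangement A1 M1 xs1" "arrangement A2 M2 xs2" and disj: "set xs1 \<inter> set xs2 = {}"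
    and A: "A \<subseteq> A1 \<union> A2 \<union> M1 \<times> M2 \<union> M2 \<times> M1"
  shows "arrangement A (M1 \<union> M2) (xs1 @ xs2)"
proof -
  have sub: "A1 \<subseteq> set xs1 \<times> set xs1" "A2 \<subseteq> set xs2 \<times> set xs2" "M1 \<subseteq> set xs1" "M2 \<subseteq> set xs2"
    using a by (auto simp: arrangement_def)
  let ?R = "rm A (M1 \<union> M2)"
  have r: "rm A1 M1 x y \<or> rm A2 M2 x y" if "?R x y" for x y
    using that A unfolding rm_def by blast
  have r1: "?R x y \<Longrightarrow> x \<in> set xs1 \<Longrightarrow> rm A1 M1 x y" and r2: "?R x y \<Longrightarrow> x \<in> set xs2 \<Longrightarrow> rm A2 M2 x y" for x y
    using r[of x y] rm_set[OF a(1), of x y] rm_set[OF a(2), of x y] disj by blast+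
  have in1: "rm A1 M1 x y \<Longrightarrow> y \<in> set xs1" and in2: "rm A2 M2 x y \<Longrightarrow> y \<in> set xs2" for x y
    using rm_set[OF a(1)] rm_set[OF a(2)] by blast+
  have "card (cut_left ?R (xs1 @ xs2) c) \<le> 4" for c
  proof (cases "c \<le> length xs1")
    case True
    have "cut_left ?R (xs1 @ xs2) c \<subseteq> cut_left (rm A1 M1) xs1 c"
    proof
      fix x assume "x \<in> cut_left ?R (xs1 @ xs2) c"
      then obtain y where x: "x \<in> set (take c xs1)" and y: "y \<in> set (drop c xs1) \<union> set xs2" "?R x y"
        using True by (auto simp: cut_left_def)
      have rr: "rm A1 M1 x y" using r1[OF y(2)] x by (auto dest: in_set_takeD)
      then have "y \<in> set (drop c xs1)" using in1 y disj by blast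
      then show "x \<in> cut_left (rm A1 M1) xs1 c" using x rr by (auto simp: cut_left_def)
    qed
    then have "card (cut_left ?R (xs1 @ xs2) c) \<le> card (cut_left (rm A1 M1) xs1 c)" by (intro card_mono) auto
    also have "\<dots> \<le> 4" using a by (simp add: arrangement_def)
    finally show ?thesis .
  next
    case False
    define c' where "c' = c - length xs1"
    have c: "take c (xs1 @ xs2) = xs1 @ take c' xs2" "drop c (xs1 @ xs2) = drop c' xs2" using False by (auto simp: c'_def)
    have "cut_left ?R (xs1 @ xs2) c \<subseteq> cut_left (rm A2 M2) xs2 c'"
    proof
      fix x assume "x \<in> cut_left ?R (xs1 @ xs2) c"
      then obtain y where x: "x \<in> set xs1 \<union> set (take c' xs2)" and y: "y \<in> set (drop c' xs2)" "?R x y"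
        unfolding cut_left_def c by auto
      have y2: "y \<in> set xs2" using y(1) by (auto dest: in_set_dropD)
      then have "x \<notin> set xs1" using r1[OF y(2)] in1 disj by blast
      then have x': "x \<in> set (take c' xs2)" using x by blast
      then have "rm A2 M2 x y" using r2[OF y(2)] by (auto dest: in_set_takeD)
      then show "x \<in> cut_left (rm A2 M2) xs2 c'" using x' y by (auto simp: cut_left_def)
    qed
    then have "card (cut_left ?R (xs1 @ xs2) c) \<le> card (cut_left (rm A2 M2) xs2 c')" by (intro card_mono) auto
    also have "\<dots> \<le> 4" using a by (simp add: arrangement_def)
    finally show ?thesis .
  qed
  moreover have "card {u. ?R v u} \<le> 4" for v
  proof (cases "v \<in> set xs1")
    case True
    then have "card {u. ?R v u} \<le> card {u. rm A1 M1 v u}" using r1 finite_rm[OF a(1)] by (intro card_mono) auto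
    also have "\<dots> \<le> 4" using a by (simp add: arrangement_def)
    finally show ?thesis .
  next
    case False
    then have "{u. ?R v u} \<subseteq> {u. rm A2 M2 v u}" using r rm_set[OF a(1)] by blast
    then have "card {u. ?R v u} \<le> card {u. rm A2 M2 v u}" using finite_rm[OF a(2)] by (intro card_mono)
    also have "\<dots> \<le> 4" using a by (simp add: arrangement_def)
    finally show ?thesis .
  qed
  moreover have "A \<subseteq> set (xs1 @ xs2) \<times> set (xs1 @ xs2)" using A sub by fastforce
  ultimately show ?thesis using a disj sub by (auto simp: arrangement_def)
qed

lemma arrangement_Union:
  assumes "finite P" and "\<And>p. p \<in> P \<Longrightarrow> \<exists>xs. arrangement (AS p) (M p) xs \<and> set xs = S p"
    and "\<And>p p'. p \<in> P \<Longrightarrow> p' \<in> P \<Longrightarrow> p \<noteq> p' \<Longrightarrow> S p \<inter> S p' = {}"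
    and "\<And>x y. (x, y) \<in> A \<Longrightarrow> (\<exists>p\<in>P. (x, y) \<in> AS p) \<or> (\<exists>p\<in>P. \<exists>p'\<in>P. p \<noteq> p' \<and> x \<in> M p \<and> y \<in> M p')"
  shows "\<exists>xs. arrangement A (\<Union>(M ` P)) xs \<and> set xs = \<Union>(S ` P)"
  using assms
proof (induction P arbitrary: A rule: finite_induct)
  case empty
  then have "A = {}" by auto
  then have "arrangement A {} []" by (auto simp: arrangement_def cut_left_def rm_def)
  then show ?case by auto
next
  case (insert p P)
  define A1 where "A1 = {(x, y). (\<exists>p\<in>P. (x, y) \<in> AS p) \<or> (\<exists>p\<in>P. \<exists>p'\<in>P. p \<noteq> p' \<and> x \<in> M p \<and> y \<in> M p')}"
  have "\<exists>xs. arrangement A1 (\<Union>(M ` P)) xs \<and> set xs = \<Union>(S ` P)"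
    by (rule insert.IH) (use insert.prems in \<open>auto simp: A1_def\<close>)
  then obtain xs1 where 1: "arrangement A1 (\<Union>(M ` P)) xs1" "set xs1 = \<Union>(S ` P)" by blast
  obtain xs2 where 2: "arrangement (AS p) (M p) xs2" "set xs2 = S p" using insert.prems(1) by blast
  have "arrangement A (\<Union>(M ` P) \<union> M p) (xs1 @ xs2)"
  proof (rule arrangement_append[OF 1(1) 2(1)])
    show "set xs1 \<inter> set xs2 = {}" using 1 2 insert.prems(2) insert.hyps by fastforce
    show "A \<subseteq> A1 \<union> AS p \<union> \<Union>(M ` P) \<times> M p \<union> M p \<times> \<Union>(M ` P)"
    proof (rule subrelI)
      fix x y assume "(x, y) \<in> A"
      from insert.prems(3)[OF this] show "(x, y) \<in> A1 \<union> AS p \<union> \<Union>(M ` P) \<times> M p \<union> M p \<times> \<Union>(M ` P)"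
        unfolding A1_def by auto
    qed
  qed
  moreover have "\<Union>(M ` P) \<union> M p = \<Union>(M ` insert p P)" "set (xs1 @ xs2) = \<Union>(S ` insert p P)" using 1(2) 2(2) by auto
  ultimately show ?case by metis
qed

section \<open>From arrangements to tree decompositions\<close>

text \<open>Supplies the spanning forest of the fibres that \<open>quotient_map\<close> asks
  for.\<close>

lemma fibre_trees:
  assumes conn: "\<And>u v. u \<in> C \<Longrightarrow> v \<in> C \<Longrightarrow> \<pi> u = \<pi> v \<Longrightarrow> (u, v) \<in> {(x, y). x \<in> C \<and> y \<in> C \<and> {x, y} \<in> E \<and> \<pi> x = \<pi> y}\<^sup>*"
  obtains rt pa and rk :: "'a \<Rightarrow> nat" where
    "\<And>v. v \<in> C \<Longrightarrow> v \<noteq> rt (\<pi> v) \<Longrightarrow> pa v \<in> C \<and> {v, pa v} \<in> E \<and> \<pi> (pa v) = \<pi> v \<and> rk (pa v) < rk v"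
    "\<And>v. v \<in> C \<Longrightarrow> rt (\<pi> v) \<in> C \<and> \<pi> (rt (\<pi> v)) = \<pi> v"
proof -
  let ?R = "{(x, y). x \<in> C \<and> y \<in> C \<and> {x, y} \<in> E \<and> \<pi> x = \<pi> y}"
  define rt where "rt p = (SOME v. v \<in> C \<and> \<pi> v = p)" for p
  have rt: "rt (\<pi> v) \<in> C \<and> \<pi> (rt (\<pi> v)) = \<pi> v" if "v \<in> C" for v
    unfolding rt_def by (rule someI[of _ v]) (use that in simp)
  have "\<exists>pa (rk :: 'a \<Rightarrow> nat). \<forall>v\<in>C. \<pi> v = \<pi> v0 \<longrightarrow> v \<noteq> rt (\<pi> v0) \<longrightarrow> pa v \<in> C \<and> {v, pa v} \<in> E \<and> \<pi> (pa v) = \<pi> v0 \<and> rk (pa v) < rk v"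
    if v0: "v0 \<in> C" for v0
  proof -
    let ?p = "\<pi> v0"
    let ?W = "{v \<in> C. \<pi> v = ?p}"
    let ?RW = "{(x, y). x \<in> ?W \<and> y \<in> ?W \<and> {x, y} \<in> E}"
    have reach: "(rt ?p, v) \<in> ?RW\<^sup>*" if v: "v \<in> ?W" for v
    proof -
      have "(rt ?p, v) \<in> ?R\<^sup>*" using conn[of "rt ?p" v] rt[OF v0] v by simp
      then have "v \<in> ?W \<and> (rt ?p, v) \<in> ?RW\<^sup>*"
      proof (induction)
        case base then show ?case using rt[OF v0] by simp
      next
        case (step y z)
        then have "(y, z) \<in> ?RW" by simp
        then show ?case using step.IH by (auto intro: rtrancl.rtrancl_into_rtrancl)
      qed
      then show ?thesis by simp
    qed
    have RW: "?RW \<subseteq> ?W \<times> ?W" by auto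
    obtain pa and rk :: "'a \<Rightarrow> nat" where
      h: "\<And>v. v \<in> ?W \<Longrightarrow> v \<noteq> rt ?p \<Longrightarrow> pa v \<in> ?W \<and> (pa v, v) \<in> ?RW \<and> rk v = Suc (rk (pa v))"
      proof (rule bfs_tree[OF reach RW], goal_cases)
      case (2 rk pa)
      show ?case by (rule 2(1)) (fact 2(3))
    qed assumption
    have "pa v \<in> C \<and> {v, pa v} \<in> E \<and> \<pi> (pa v) = ?p \<and> rk (pa v) < rk v" if "v \<in> C" "\<pi> v = ?p" "v \<noteq> rt ?p" for v
      using h[of v] that by (simp add: insert_commute)
    then show ?thesis by blast
  qed
  note step = this
  have "\<forall>p\<in>\<pi> ` C. \<exists>pr :: ('a \<Rightarrow> 'a) \<times> ('a \<Rightarrow> nat). \<forall>v\<in>C. \<pi> v = p \<longrightarrow> v \<noteq> rt p \<longrightarrow> fst pr v \<in> C \<and> {v, fst pr v} \<in> E \<and> \<pi> (fst pr v) = p \<and> snd pr (fst pr v) < snd pr v"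
  proof
    fix p assume "p \<in> \<pi> ` C"
    then obtain v0 where v0: "v0 \<in> C" "p = \<pi> v0" by blast
    obtain pa' and rk' :: "'a \<Rightarrow> nat" where "\<forall>v\<in>C. \<pi> v = \<pi> v0 \<longrightarrow> v \<noteq> rt (\<pi> v0) \<longrightarrow> pa' v \<in> C \<and> {v, pa' v} \<in> E \<and> \<pi> (pa' v) = \<pi> v0 \<and> rk' (pa' v) < rk' v"
      using step[OF v0(1)] by (elim exE)
    then show "\<exists>pr :: ('a \<Rightarrow> 'a) \<times> ('a \<Rightarrow> nat). \<forall>v\<in>C. \<pi> v = p \<longrightarrow> v \<noteq> rt p \<longrightarrow> fst pr v \<in> C \<and> {v, fst pr v} \<in> E \<and> \<pi> (fst pr v) = p \<and> snd pr (fst pr v) < snd pr v"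
      unfolding v0(2) by (intro exI[of _ "(pa', rk')"]) simp
  qed
  then obtain F :: "'b \<Rightarrow> ('a \<Rightarrow> 'a) \<times> ('a \<Rightarrow> nat)" where
    F: "\<forall>p\<in>\<pi> ` C. \<forall>v\<in>C. \<pi> v = p \<longrightarrow> v \<noteq> rt p \<longrightarrow> fst (F p) v \<in> C \<and> {v, fst (F p) v} \<in> E \<and> \<pi> (fst (F p) v) = p \<and> snd (F p) (fst (F p) v) < snd (F p) v"
    by (rule bchoice[THEN exE]) blast
  define pa where "pa v = fst (F (\<pi> v)) v" for v
  define rk where "rk v = snd (F (\<pi> v)) v" for v
  have "pa v \<in> C \<and> {v, pa v} \<in> E \<and> \<pi> (pa v) = \<pi> v \<and> rk (pa v) < rk v" if v: "v \<in> C" "v \<noteq> rt (\<pi> v)" for v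
  proof -
    have "pa v \<in> C \<and> {v, pa v} \<in> E \<and> \<pi> (pa v) = \<pi> v \<and> snd (F (\<pi> v)) (pa v) < snd (F (\<pi> v)) v"
      using F v unfolding pa_def by simp
    then show ?thesis unfolding rk_def by simp
  qed
  then show thesis using that rt by blast
qed

lemma quotient_map_connected:
  fixes E :: "'a set set" and \<pi> :: "'a \<Rightarrow> 'b"
  assumes finE: "finite E" and E2: "\<And>e. e \<in> E \<Longrightarrow> \<exists>u v. e = {u, v} \<and> u \<noteq> v"
    and C: "C \<subseteq> \<Union>E" "C \<noteq> {}"
    and E1: "E1 \<subseteq> E" "\<And>u v. {u, v} \<in> E1 \<Longrightarrow> u \<in> C \<and> v \<in> C \<and> \<pi> u \<noteq> \<pi> v"
    and conn: "\<And>u v. u \<in> C \<Longrightarrow> v \<in> C \<Longrightarrow> \<pi> u = \<pi> v \<Longrightarrow> (u, v) \<in> {(x, y). x \<in> C \<and> y \<in> C \<and> {x, y} \<in> E \<and> \<pi> x = \<pi> y}\<^sup>*"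
  defines "D \<equiv> {(u, v). {u, v} \<in> E \<and> u \<in> C}"
    and "\<alpha> \<equiv> (\<lambda>(u, v). if {u, v} \<in> E1 then (v, u) else (u, v))"
  shows "\<exists>\<sigma>. cmap D \<sigma> \<alpha> (\<pi> \<circ> fst) \<and> (\<pi> \<circ> fst) ` D = \<pi> ` C \<and> card (egs \<alpha> D) = card E1 \<and>
    card (egs \<alpha> D) + 2 \<le> card ((\<pi> \<circ> fst) ` D) + card (fcs D \<sigma> \<alpha>) + (2 * genus E + 1)"
proof -
  obtain rt pa and rk :: "'a \<Rightarrow> nat" where
    t: "\<And>v. v \<in> C \<Longrightarrow> v \<noteq> rt (\<pi> v) \<Longrightarrow> pa v \<in> C \<and> {v, pa v} \<in> E \<and> \<pi> (pa v) = \<pi> v \<and> rk (pa v) < rk v"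
    and rt: "\<And>v. v \<in> C \<Longrightarrow> rt (\<pi> v) \<in> C \<and> \<pi> (rt (\<pi> v)) = \<pi> v"
  proof (rule fibre_trees[OF conn], goal_cases)
    case (4 rt pa rk)
    show ?case by (rule 4(1)) (fact 4(2), fact 4(3))
  qed assumption
  obtain \<sigma> where \<sigma>: "cmap D \<sigma> \<alpha> (\<pi> \<circ> fst)" "card E1 + 2 \<le> card (\<pi> ` C) + card (fcs D \<sigma> \<alpha>) + (2 * genus E + 1)"
    using quotient_map[where rt = rt and pa = pa and rk = rk and \<pi> = \<pi>, OF finE E2 C E1 t rt] unfolding D_def \<alpha>_def by blast
  have "fst ` D = C"
  proof
    show "C \<subseteq> fst ` D"
    proof
      fix v assume v: "v \<in> C"
      then obtain e where e: "e \<in> E" "v \<in> e" using C by blast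
      then obtain y where "e = {v, y}" using E2[OF e(1)] by auto
      then have "(v, y) \<in> D" using e v by (simp add: D_def)
      then show "v \<in> fst ` D" by force
    qed
  qed (auto simp: D_def)
  then have VC: "(\<pi> \<circ> fst) ` D = \<pi> ` C" by (metis image_comp)
  have "egs \<alpha> D = egs prod.swap {(u, v). {u, v} \<in> E1}"
  proof (intro set_eqI iffI)
    fix x assume "x \<in> egs \<alpha> D"
    then obtain u v where uv: "(u, v) \<in> D" "x = {(u, v), \<alpha> (u, v)}" "\<alpha> (u, v) \<noteq> (u, v)" unfolding egs_def by (auto simp del: split_paired_All)
    then have "{u, v} \<in> E1" by (auto simp: \<alpha>_def split: if_splits)
    then show "x \<in> egs prod.swap {(u, v). {u, v} \<in> E1}" using uv unfolding egs_def
      by (intro CollectI exI[of _ "(u, v)"]) (auto simp: \<alpha>_def)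
  next
    fix x assume "x \<in> egs prod.swap {(u, v). {u, v} \<in> E1}"
    then obtain u v where uv: "{u, v} \<in> E1" "x = {(u, v), (v, u)}" unfolding egs_def by auto
    then have "u \<in> C" "u \<noteq> v" using E1(2)[of u v] by auto
    then show "x \<in> egs \<alpha> D" using uv E1(1) unfolding egs_def
      by (intro CollectI exI[of _ "(u, v)"]) (auto simp: \<alpha>_def D_def)
  qed
  moreover have "card (egs prod.swap {(u, v). {u, v} \<in> E1}) = card E1"
    by (rule card_egs_swap) (use E1 E2 in blast)
  ultimately have "card (egs \<alpha> D) = card E1" by simp
  then show ?thesis using \<sigma> VC by (intro exI[of _ \<sigma>]) simp
qed

lemma has_td_glue_all:
  assumes "finite J" and "has_td V1 E1 w" and "\<And>j. j \<in> J \<Longrightarrow> S j \<in> E1"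
    and "\<And>j. j \<in> J \<Longrightarrow> has_td (V2 j) ((\<lambda>e. e \<inter> V2 j) ` E2 j) w2" and "\<And>j. j \<in> J \<Longrightarrow> w2 + card (S j) \<le> w"
    and "\<And>j. j \<in> J \<Longrightarrow> V1 \<inter> V2 j = {}" and "\<And>i j. i \<in> J \<Longrightarrow> j \<in> J \<Longrightarrow> i \<noteq> j \<Longrightarrow> V2 i \<inter> V2 j = {}"
    and "\<And>j e. j \<in> J \<Longrightarrow> e \<in> E2 j \<Longrightarrow> e \<subseteq> V2 j \<union> S j"
  shows "has_td (V1 \<union> (\<Union>j\<in>J. V2 j)) (E1 \<union> (\<Union>j\<in>J. E2 j)) w"
  using assms
proof (induction J rule: finite_induct)
  case (insert x F)
  have IH: "has_td (V1 \<union> (\<Union>j\<in>F. V2 j)) (E1 \<union> (\<Union>j\<in>F. E2 j)) w"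
    by (rule insert.IH[OF insert.prems(1)]) (use insert.prems in auto)
  have "has_td ((V1 \<union> (\<Union>j\<in>F. V2 j)) \<union> V2 x) ((E1 \<union> (\<Union>j\<in>F. E2 j)) \<union> E2 x) w"
  proof (rule has_td_glue[OF IH])
    show "S x \<in> E1 \<union> (\<Union>j\<in>F. E2 j)" using insert.prems(2) by blast
    show "has_td (V2 x) ((\<lambda>e. e \<inter> V2 x) ` E2 x) w2" using insert.prems(3) by blast
    show "w2 + card (S x) \<le> w" using insert.prems(4) by blast
    show "(V1 \<union> (\<Union>j\<in>F. V2 j)) \<inter> V2 x = {}" using insert.prems(5,6) insert.hyps by blast
    show "e \<subseteq> V2 x \<union> S x" if "e \<in> E2 x" for e using insert.prems(7) that by blast
  qed
  moreover have "(V1 \<union> (\<Union>j\<in>F. V2 j)) \<union> V2 x = V1 \<union> (\<Union>j\<in>insert x F. V2 j)"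
    "(E1 \<union> (\<Union>j\<in>F. E2 j)) \<union> E2 x = E1 \<union> (\<Union>j\<in>insert x F. E2 j)" by auto
  ultimately show ?case by metis
qed simp

lemma has_td_restrict:
  assumes "has_td V E w" "finite V" "W \<subseteq> V" "\<And>e. e \<in> E' \<Longrightarrow> \<exists>e'\<in>E. e \<subseteq> e' \<inter> W"
  shows "has_td W E' w"
proof -
  obtain N :: "nat set" and r p rk b where t: "td V E N r p rk b" "\<forall>i\<in>N. card (b i) \<le> w"
    using assms(1) by (auto simp: has_td_def)
  have "td W E' N r p rk (\<lambda>i. b i \<inter> W)" by (rule td_restrict[OF t(1) assms(3,4)])
  moreover have "card (b i \<inter> W) \<le> w" if "i \<in> N" for i
  proof -
    have "finite (b i)" using t(1) that assms(2) finite_subset by (auto simp: td_def)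
    then have "card (b i \<inter> W) \<le> card (b i)" by (intro card_mono) auto
    then show ?thesis using t(2) that by fastforce
  qed
  ultimately show ?thesis by (intro has_tdI) auto
qed

text \<open>\<open>K\<close> has at most \<open>5 * card M\<close> vertices, a mark and a cut of
  four for each. A component of the rest has at most \<open>9\<close> neighbours in
  \<open>K\<close>, from two cuts and one mark, and by the degree bound there are at most
  \<open>4 * card K\<close> components; contracting them leaves at most \<open>25 * card M\<close>
  vertices. In a decomposition of this embedded quotient each component is replaced by its
  neighbours in \<open>K\<close>, which multiplies the bags by \<open>9\<close>. These neighbour
  sets are the separators over which the components, decomposed along paths with bags of size
  \<open>5\<close>, are glued: \<open>5 + 9 = 14\<close>.\<close>

lemma arrangement_has_td:
  fixes A :: "('a \<times> 'a) set"
  assumes finE: "finite E" and E2: "\<And>e. e \<in> E \<Longrightarrow> \<exists>u v. e = {u, v} \<and> u \<noteq> v"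
    and arr: "arrangement A M xs" and AE: "ugraph_edges A \<subseteq> E"
    and conn: "\<And>u v. u \<in> set xs \<Longrightarrow> v \<in> set xs \<Longrightarrow> (u, v) \<in> (adj (ugraph_edges A))\<^sup>*"
    and M: "M \<noteq> {}" and q: "0 < q"
  shows "has_td (set xs) (ugraph_edges A) (((2 * (2 * genus E + 1) + 3) * q + 25 * card M div q) * 9 + 14)"
proof (cases "ugraph_edges A = {}")
  case True
  have "has_td (set xs) {{x, y} | x y. x \<in> set xs \<and> y \<in> set xs \<and> False} (0 + 1)"
    by (rule has_td_linear) (use arr in \<open>auto simp: arrangement_def cut_left_def\<close>)
  then show ?thesis by (rule has_td_mono) (use True in auto)
next
  case False
  define UA where "UA = ugraph_edges A"
  define C where "C = set xs"
  define R where "R = rm A M"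
  define n where "n = length xs"
  \<comment> \<open>A component of \<open>C - K\<close> cannot jump over a mark, so its neighbours lie in the cuts at the two
    marks around it.\<close>
  define K where "K = M \<union> (\<Union>i\<in>{i. i < n \<and> xs ! i \<in> M}. cut_left R xs i)"
  have AC: "A \<subseteq> C \<times> C" and MC: "M \<subseteq> C" and dx: "distinct xs" and cut4: "\<And>c. card (cut_left R xs c) \<le> 4"
    and deg4: "\<And>v. card {u. R v u} \<le> 4" using arr by (auto simp: arrangement_def C_def R_def)
  have finC: "finite C" by (simp add: C_def)
  have finR: "finite {u. R v u}" for v using finite_rm[OF arr] by (simp add: R_def)
  have finM: "finite M" using MC finC finite_subset by blast
  have symR: "R x y \<Longrightarrow> R y x" for x y by (auto simp: R_def rm_def)
  have cutC: "cut_left R xs i \<subseteq> C" for i by (auto simp: cut_left_def C_def dest: in_set_takeD)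
  have KC: "K \<subseteq> C" using MC cutC by (auto simp: K_def)
  have finK: "finite K" using KC finC finite_subset by blast
  have MK: "M \<subseteq> K" by (simp add: K_def)
  have cutK: "cut_left R xs i \<subseteq> K" if "i < n" "xs ! i \<in> M" for i using that by (auto simp: K_def)
  have cardK: "card K \<le> 5 * card M"
  proof -
    let ?I = "{i. i < n \<and> xs ! i \<in> M}"
    have "inj_on ((!) xs) ?I" using dx by (auto simp: inj_on_def nth_eq_iff_index_eq n_def)
    then have "card ?I \<le> card M" using card_inj_on_le[OF _ _ finM, of "(!) xs" ?I] by auto
    moreover have "card (\<Union>i\<in>?I. cut_left R xs i) \<le> (\<Sum>i\<in>?I. card (cut_left R xs i))" by (intro card_UN_le) simp
    moreover have "(\<Sum>i\<in>?I. card (cut_left R xs i)) \<le> (\<Sum>i\<in>?I. 4)" by (intro sum_mono cut4)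
    ultimately show ?thesis unfolding K_def using card_Un_le[of M "\<Union>i\<in>?I. cut_left R xs i"] by simp
  qed
  have UA: "{x, y} \<in> UA \<longleftrightarrow> ((x, y) \<in> A \<or> (y, x) \<in> A) \<and> x \<noteq> y" for x y
    by (auto simp: UA_def ugraph_edges_def doubleton_eq_iff)
  have UAC: "{x, y} \<in> UA \<Longrightarrow> x \<in> C \<and> y \<in> C" for x y using AC by (auto simp: UA)
  have UA2: "\<exists>x y. e = {x, y} \<and> x \<noteq> y" if "e \<in> UA" for e using that by (auto simp: UA_def ugraph_edges_def)
  have UAE: "UA \<subseteq> E" using AE by (simp add: UA_def)
  have conn: "(u, v) \<in> (adj UA)\<^sup>*" if "u \<in> C" "v \<in> C" for u v using conn that by (simp add: C_def UA_def)
  have UAR: "R x y" if "{x, y} \<in> UA" "x \<notin> M \<or> y \<notin> M" for x y using that by (auto simp: UA R_def rm_def)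
  define Q where "Q = {(x, y). x \<in> C - K \<and> y \<in> C - K \<and> {x, y} \<in> UA}"
  define cmp where "cmp x = Q\<^sup>* `` {x}" for x
  have symQ: "sym Q" by (auto simp: Q_def sym_def insert_commute)
  have symQ': "(x, y) \<in> Q\<^sup>* \<Longrightarrow> (y, x) \<in> Q\<^sup>*" for x y using symQ by (meson sym_rtrancl symD)
  have cmp_self: "x \<in> cmp x" for x by (simp add: cmp_def)
  have cmp_eq: "y \<in> cmp x \<Longrightarrow> cmp y = cmp x" for x y
    unfolding cmp_def using symQ' rtrancl_trans by (metis (no_types, lifting) Image_singleton_iff set_eqI)
  have cmpC: "cmp x \<subseteq> C - K" if "x \<in> C - K" for x
  proof
    fix y assume "y \<in> cmp x"
    then have "(x, y) \<in> Q\<^sup>*" by (simp add: cmp_def)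
    then show "y \<in> C - K" using that by (induction) (auto simp: Q_def)
  qed
  define \<pi> where "\<pi> v = (if v \<in> K then {v} else cmp v)" for v
  define Nn where "Nn X = {z \<in> K. \<exists>x\<in>X. {z, x} \<in> UA}" for X
  define J where "J = cmp ` (C - K)"
  have finJ: "finite J" using finC by (simp add: J_def)
  have JC: "X \<subseteq> C - K" "X \<noteq> {}" if "X \<in> J" for X using that cmpC cmp_self by (auto simp: J_def)
  have Jdisj: "X \<inter> Y = {}" if "X \<in> J" "Y \<in> J" "X \<noteq> Y" for X Y
  proof (rule ccontr)
    assume "X \<inter> Y \<noteq> {}"
    then obtain z where "z \<in> X" "z \<in> Y" by blast
    moreover have "cmp z = X" if "X \<in> J" "z \<in> X" for X z using that cmp_eq by (auto simp: J_def)
    ultimately show False using that by blast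
  qed
  have JU: "\<Union>J = C - K" using cmpC cmp_self by (auto simp: J_def)
  have Jstep: "y \<in> X" if "X \<in> J" "x \<in> X" "y \<in> C - K" "{x, y} \<in> UA" for X x y
  proof -
    have "x \<in> C - K" using JC that by blast
    then have "(x, y) \<in> Q" using that by (simp add: Q_def)
    then have "y \<in> cmp x" by (auto simp: cmp_def)
    then show ?thesis using that cmp_eq by (auto simp: J_def)
  qed
  have Ncard: "card (Nn X) \<le> 9" if X: "X \<in> J" for X
  proof -
    obtain x0 where x0: "x0 \<in> C - K" "X = cmp x0" using X by (auto simp: J_def)
    obtain k0 where k0: "k0 < n" "x0 = xs ! k0" using x0 by (auto simp: C_def n_def in_set_conv_nth)
    have k0M: "xs ! k0 \<notin> M" using x0 k0 MK by auto
    \<comment> \<open>\<open>ca\<close> is the position after the last mark left of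
      \<open>x0\<close>, or \<open>0\<close>, and \<open>cb\<close> that of the first mark on the
      right, or \<open>n\<close>. The component of \<open>x0\<close> stays in between.\<close>
    define lo where "lo = insert 0 {Suc i | i. i < k0 \<and> xs ! i \<in> M}"
    define up where "up = insert n {i. k0 < i \<and> i < n \<and> xs ! i \<in> M}"
    define ca where "ca = Max lo"
    define cb where "cb = Min up"
    have finlo: "finite lo" by (simp add: lo_def)
    have finup: "finite up" by (simp add: up_def)
    have "ca \<in> lo" unfolding ca_def using finlo by (intro Max_in) (auto simp: lo_def)
    then have ca: "ca = 0 \<or> (\<exists>i<k0. ca = Suc i \<and> xs ! i \<in> M)" by (auto simp: lo_def)
    have "cb \<in> up" unfolding cb_def using finup by (intro Min_in) (auto simp: up_def)
    then have cb: "cb = n \<or> k0 < cb \<and> cb < n \<and> xs ! cb \<in> M" by (auto simp: up_def)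
    have camax: "i < k0 \<Longrightarrow> xs ! i \<in> M \<Longrightarrow> i < ca" for i
      using Max_ge[OF finlo, of "Suc i", folded ca_def] by (auto simp: lo_def)
    have cbmin: "k0 < i \<Longrightarrow> i < n \<Longrightarrow> xs ! i \<in> M \<Longrightarrow> cb \<le> i" for i
      using Min_le[OF finup, of i, folded cb_def] by (auto simp: up_def)
    have cut: "xs ! i \<in> cut_left R xs c" if "i < c" "c \<le> j" "j < n" "R (xs ! i) (xs ! j)" for i j c
    proof -
      have "xs ! i \<in> set (take c xs)" using that by (auto simp: in_set_conv_nth n_def intro!: exI[of _ i])
      moreover have "xs ! j \<in> set (drop c xs)" using that by (auto simp: in_set_conv_nth n_def intro!: exI[of _ "j - c"])
      ultimately show ?thesis using that by (auto simp: cut_left_def)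
    qed
    have between: "x \<in> C - K \<and> (\<exists>k. x = xs ! k \<and> ca \<le> k \<and> k < cb \<and> k < n)" if "x \<in> X" for x
    proof -
      have "(x0, x) \<in> Q\<^sup>*" using that by (simp add: x0 cmp_def)
      then show ?thesis
      proof (induction)
        case base
        have "ca \<le> k0" "k0 < cb" using ca cb k0 by auto
        then show ?case using x0 k0 by auto
      next
        case (step y z)
        then obtain k where k: "y = xs ! k" "ca \<le> k" "k < cb" "k < n" by blast
        have yz: "y \<in> C - K" "z \<in> C - K" "{y, z} \<in> UA" using step by (auto simp: Q_def)
        obtain k' where k': "k' < n" "z = xs ! k'" using yz by (auto simp: C_def n_def in_set_conv_nth)
        have r: "R y z" "R z y" using UAR[OF yz(3)] yz MK symR by blast+
        have "ca \<le> k'"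
        proof (rule ccontr)
          assume a: "\<not> ca \<le> k'"
          then obtain i where i: "i < k0" "ca = Suc i" "xs ! i \<in> M" using ca by auto
          have "k' \<noteq> i" using i yz k' MK by auto
          then have "z \<in> cut_left R xs i" using cut[of k' i k] a i k k' r by auto
          moreover have "i < n" using i k0 by simp
          ultimately show False using cutK i yz by blast
        qed
        moreover have "k' < cb"
        proof (rule ccontr)
          assume a: "\<not> k' < cb"
          then have b: "cb < n" "xs ! cb \<in> M" using cb k' by auto
          have "y \<in> cut_left R xs cb" using cut[of k cb k'] a k k' r by auto
          then show False using cutK b yz by blast
        qed
        ultimately show ?case using yz k' by auto
      qed
    qed
    \<comment> \<open>For \<open>cb = n\<close> the entry \<open>xs ! cb\<close> is unspecified,
      which can only enlarge the set on the right.\<close>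
    have "Nn X \<subseteq> cut_left R xs ca \<union> cut_left R xs cb \<union> {xs ! cb}"
    proof
      fix z assume "z \<in> Nn X"
      then obtain x where z: "z \<in> K" "x \<in> X" "{z, x} \<in> UA" by (auto simp: Nn_def)
      obtain k where k: "x = xs ! k" "ca \<le> k" "k < cb" "k < n" and xK: "x \<in> C - K" using between[OF z(2)] by blast
      have "z \<in> set xs" using z KC by (auto simp: C_def)
      then obtain j where j: "j < n" "z = xs ! j" by (auto simp: n_def in_set_conv_nth)
      have r: "R z x" "R x z" using UAR[OF z(3)] xK MK symR by blast+
      consider "j < ca" | "ca \<le> j" "j < cb" | "j = cb" | "cb < j" by linarith
      then show "z \<in> cut_left R xs ca \<union> cut_left R xs cb \<union> {xs ! cb}"
      proof cases
        case 1
        then show ?thesis using cut[of j ca k] r j k by simp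
      next
        case 2
        have "z \<notin> M"
        proof
          assume zM: "z \<in> M"
          then have "j \<noteq> k0" using k0M j by auto
          then show False using camax[of j] cbmin[of j] 2 j zM by (cases "j < k0") auto
        qed
        \<comment> \<open>\<open>z\<close> is unmarked, so the cut at some mark \<open>i\<close> put
          it into \<open>K\<close>. There is no mark from \<open>ca\<close> up to \<open>cb\<close>,
          hence \<open>cb \<le> i\<close>, and the neighbour of \<open>z\<close> beyond
          \<open>i\<close> is also beyond \<open>cb\<close>.\<close>
        then obtain i where i: "i < n" "xs ! i \<in> M" "z \<in> cut_left R xs i" using z by (auto simp: K_def)
        have ji: "j < i"
        proof -
          obtain j' where j': "j' < i" "j' < n" "z = xs ! j'" using i(3) by (auto simp: cut_left_def in_set_conv_nth n_def)
          then have "j' = j" using j dx by (auto simp: nth_eq_iff_index_eq n_def)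
          then show ?thesis using j' by simp
        qed
        have "i \<noteq> k0" using i k0M by auto
        then have "cb \<le> i" using camax[of i] cbmin[of i] i ji 2 by (cases "i < k0") auto
        obtain y where y: "y \<in> set (drop i xs)" "R z y" using i(3) by (auto simp: cut_left_def)
        have "set (drop i xs) \<subseteq> set (drop cb xs)" using \<open>cb \<le> i\<close> by (rule set_drop_subset_set_drop)
        moreover have "z \<in> set (take cb xs)" using 2 j by (auto simp: in_set_conv_nth n_def intro!: exI[of _ j])
        ultimately show ?thesis using y by (auto simp: cut_left_def)
      next
        case 3 then show ?thesis using j by simp
      next
        case 4
        then have "cb < n" "xs ! cb \<in> M" using cb j by auto
        moreover have "x \<in> cut_left R xs cb" using cut[of k cb j] 4 k j r by simp
        ultimately show ?thesis using cutK xK by blast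
      qed
    qed
    then have "card (Nn X) \<le> card (cut_left R xs ca \<union> cut_left R xs cb \<union> {xs ! cb})" by (intro card_mono) auto
    also have "\<dots> \<le> card (cut_left R xs ca \<union> cut_left R xs cb) + 1"
      using card_Un_le[of "cut_left R xs ca \<union> cut_left R xs cb" "{xs ! cb}"] by simp
    also have "\<dots> \<le> 9" using card_Un_le[of "cut_left R xs ca" "cut_left R xs cb"] cut4[of ca] cut4[of cb] by simp
    finally show ?thesis .
  qed
  have nbrK: "\<exists>y z. y \<in> cmp x \<and> z \<in> K \<and> {z, y} \<in> UA" if x: "x \<in> C - K" for x
  proof -
    obtain k where k: "k \<in> K" using M MK by blast
    have "(x, k) \<in> (adj UA)\<^sup>*" using conn x k KC by blast
    then show ?thesis using x
    proof (induction rule: converse_rtrancl_induct)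
      case base then show ?case using k by simp
    next
      case (step y z)
      have yz: "{y, z} \<in> UA" using step by (simp add: adj_def)
      show ?case
      proof (cases "z \<in> K")
        case True then show ?thesis using yz cmp_self by (metis insert_commute)
      next
        case False
        then have zC: "z \<in> C - K" using UAC[OF yz] by simp
        then have "(y, z) \<in> Q" using step yz by (simp add: Q_def)
        then have "cmp z = cmp y" by (intro cmp_eq) (auto simp: cmp_def)
        then show ?thesis using step.IH[OF zC] by simp
      qed
    qed
  qed
  have cardJ: "card J \<le> 4 * card K"
  proof -
    have sub: "J \<subseteq> cmp ` (\<Union>z\<in>K. {u. R z u})"
    proof
      fix X assume "X \<in> J"
      then obtain x where x: "x \<in> C - K" "X = cmp x" by (auto simp: J_def)
      obtain y z where yz: "y \<in> cmp x" "z \<in> K" "{z, y} \<in> UA" using nbrK[OF x(1)] by blast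
      have "y \<notin> M" using yz cmpC[OF x(1)] MK by blast
      then have "R z y" using UAR yz by blast
      then show "X \<in> cmp ` (\<Union>z\<in>K. {u. R z u})" using yz x cmp_eq[OF yz(1)] by (intro image_eqI[of _ _ y]) auto
    qed
    have fin: "finite (\<Union>z\<in>K. {u. R z u})" using finK finR by blast
    have "card J \<le> card (\<Union>z\<in>K. {u. R z u})" using card_mono[OF _ sub] card_image_le[OF fin, of cmp] fin by simp
    also have "\<dots> \<le> (\<Sum>z\<in>K. card {u. R z u})" by (rule card_UN_le[OF finK])
    also have "\<dots> \<le> (\<Sum>z\<in>K. 4)" by (intro sum_mono deg4)
    finally show ?thesis by simp
  qed
  have tdX: "has_td X ((\<lambda>e. e \<inter> X) ` {e \<in> UA. e \<inter> X \<noteq> {}}) 5" if X: "X \<in> J" for X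
  proof -
    let ?R = "\<lambda>x y. R x y \<or> x = y"
    have c: "card (cut_left ?R xs c) \<le> 4" for c
    proof -
      have "set (take c xs) \<inter> set (drop c xs) = {}" using dx by (simp add: set_take_disj_set_drop_if_distinct)
      then have "cut_left ?R xs c = cut_left R xs c" by (auto simp: cut_left_def)
      then show ?thesis using cut4 by simp
    qed
    have "has_td (set xs) {{x, y} | x y. x \<in> set xs \<and> y \<in> set xs \<and> ?R x y} (4 + 1)"
      by (rule has_td_linear[OF dx _ c]) (use symR in auto)
    then have "has_td X ((\<lambda>e. e \<inter> X) ` {e \<in> UA. e \<inter> X \<noteq> {}}) (4 + 1)"
    proof (rule has_td_restrict)
      show "X \<subseteq> set xs" using JC[OF X] by (auto simp: C_def)
      fix e' assume "e' \<in> (\<lambda>e. e \<inter> X) ` {e \<in> UA. e \<inter> X \<noteq> {}}"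
      then obtain e where e: "e' = e \<inter> X" "e \<in> UA" "e \<inter> X \<noteq> {}" by blast
      obtain x y where xy: "e = {x, y}" "x \<in> X"
      proof -
        obtain a b where ab: "e = {a, b}" using UA2 e by blast
        then consider "a \<in> X" | "b \<in> X" using e by auto
        then show thesis using that[of a b] that[of b a] ab by cases (auto simp: insert_commute)
      qed
      have "x \<notin> M" using JC[OF X] xy MK by blast
      then have r: "R x y" using UAR e xy by blast
      have "x \<in> set xs" "y \<in> set xs" using UAC e xy by (auto simp: C_def)
      then show "\<exists>e''\<in>{{x, y} | x y. x \<in> set xs \<and> y \<in> set xs \<and> ?R x y}. e' \<subseteq> e'' \<inter> X"
        using r e(1) xy(1) by (intro bexI[of _ "{x, y}"]) auto
    qed simp
    then show ?thesis by simp
  qed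
  let ?W = "(2 * (2 * genus E + 1) + 3) * q + 25 * card M div q"
  define E1 where "E1 = {e \<in> UA. e \<subseteq> K} \<union> Nn ` J"
  have main: "has_td K E1 (?W * 9)"
  proof -
    define F where "F = {e \<in> UA. \<exists>u v. e = {u, v} \<and> \<pi> u \<noteq> \<pi> v}"
    have F: "{u, v} \<in> F \<longleftrightarrow> {u, v} \<in> UA \<and> \<pi> u \<noteq> \<pi> v" for u v by (auto simp: F_def doubleton_eq_iff)
    obtain e where e: "e \<in> UA" using False by (auto simp: UA_def)
    obtain a b where ab: "{a, b} \<in> UA" "a \<noteq> b" using UA2[OF e] e by auto
    have abC: "a \<in> C" "b \<in> C" using UAC ab by auto
    have CE: "C \<subseteq> \<Union>E"
    proof
      fix v assume v: "v \<in> C"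
      obtain u where u: "u \<in> C" "u \<noteq> v" using ab abC by blast
      from conn[OF v u(1)] obtain z where "(v, z) \<in> adj UA"
        by (cases rule: converse_rtranclE) (use u(2) in auto)
      then show "v \<in> \<Union>E" using UAE by (auto simp: adj_def)
    qed
    define D where "D = {(u, v). {u, v} \<in> E \<and> u \<in> C}"
    define \<alpha> where "\<alpha> = (\<lambda>(u, v). if {u, v} \<in> F then (v, u) else (u, v))"
    have fib: "(u, v) \<in> {(x, y). x \<in> C \<and> y \<in> C \<and> {x, y} \<in> E \<and> \<pi> x = \<pi> y}\<^sup>*"
      if uv: "u \<in> C" "v \<in> C" "\<pi> u = \<pi> v" for u v
    proof (cases "u \<in> K")
      case True
      then have "v = u" using uv cmp_self cmpC by (auto simp: \<pi>_def split: if_splits)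
      then show ?thesis by simp
    next
      case False
      have "v \<notin> K"
      proof
        assume "v \<in> K"
        then have "v \<in> cmp u" using uv False by (simp add: \<pi>_def)
        then show False using cmpC[of u] uv False \<open>v \<in> K\<close> by blast
      qed
      then have "cmp u = cmp v" using uv False by (simp add: \<pi>_def)
      then have "v \<in> cmp u" using cmp_self by simp
      then have "(u, v) \<in> Q\<^sup>*" by (simp add: cmp_def)
      moreover have "Q \<subseteq> {(x, y). x \<in> C \<and> y \<in> C \<and> {x, y} \<in> E \<and> \<pi> x = \<pi> y}"
      proof (rule subrelI)
        fix x y assume xy: "(x, y) \<in> Q"
        then have "y \<in> cmp x" by (auto simp: cmp_def)
        then have "cmp y = cmp x" by (rule cmp_eq)
        then show "(x, y) \<in> {(x, y). x \<in> C \<and> y \<in> C \<and> {x, y} \<in> E \<and> \<pi> x = \<pi> y}"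
          using xy UAE by (auto simp: Q_def \<pi>_def)
      qed
      ultimately show ?thesis using rtrancl_mono by blast
    qed
    have F1: "F \<subseteq> E" using UAE by (auto simp: F_def)
    have F2: "\<And>u v. {u, v} \<in> F \<Longrightarrow> u \<in> C \<and> v \<in> C \<and> \<pi> u \<noteq> \<pi> v" using F UAC by blast
    have Cne: "C \<noteq> {}" using abC by blast
    obtain \<sigma> where \<sigma>: "cmap D \<sigma> \<alpha> (\<pi> \<circ> fst)" "(\<pi> \<circ> fst) ` D = \<pi> ` C"
        "card (egs \<alpha> D) + 2 \<le> card ((\<pi> \<circ> fst) ` D) + card (fcs D \<sigma> \<alpha>) + (2 * genus E + 1)"
      using quotient_map_connected[OF finE E2 CE Cne F1 F2 fib] unfolding D_def \<alpha>_def by blast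
    interpret cmap D \<sigma> \<alpha> "\<pi> \<circ> fst" by (rule \<sigma>(1))
    define V0 where "V0 = \<pi> ` C"
    define E0 where "E0 = {{(\<pi> \<circ> fst) d, (\<pi> \<circ> fst) (\<alpha> d)} | d. d \<in> D}"
    have F0: "{\<pi> u, \<pi> v} \<in> E0" if "{u, v} \<in> F" for u v
      unfolding E0_def using that F2[OF that] F1 by (intro CollectI exI[of _ "(u, v)"]) (auto simp: D_def \<alpha>_def)
    have "has_td V0 E0 ((2 * (2 * genus E + 1) + 3) * q + card V0 div q)"
      unfolding V0_def E0_def \<sigma>(2)[symmetric]
    proof (rule has_td_cmap[OF _ _ \<sigma>(3) q])
      show "D \<noteq> {}" using ab UAE abC by (auto simp: D_def)
      fix u v assume "u \<in> (\<pi> \<circ> fst) ` D" "v \<in> (\<pi> \<circ> fst) ` D"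
      then obtain x y where xy: "x \<in> C" "y \<in> C" "u = \<pi> x" "v = \<pi> y" unfolding \<sigma>(2) by blast
      have "(\<pi> x, \<pi> y) \<in> (erel \<alpha> (\<pi> \<circ> fst) D)\<^sup>*"
      proof (rule rtrancl_image[OF conn[OF xy(1,2)]])
        fix x y assume "(x, y) \<in> adj UA"
        then have xy: "{x, y} \<in> UA" by (simp add: adj_def)
        show "(\<pi> x, \<pi> y) \<in> (erel \<alpha> (\<pi> \<circ> fst) D)\<^sup>*"
        proof (cases "\<pi> x = \<pi> y")
          case False
          then have "{x, y} \<in> F" using xy F by blast
          then have "(x, y) \<in> D" "\<alpha> (x, y) = (y, x)" using F1 F2 by (auto simp: D_def \<alpha>_def)
          then have "(\<pi> x, \<pi> y) \<in> erel \<alpha> (\<pi> \<circ> fst) D" unfolding erel_def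
            by (intro CollectI exI[of _ "(x, y)"]) simp
          then show ?thesis by blast
        qed simp
      qed
      then show "(u, v) \<in> (erel \<alpha> (\<pi> \<circ> fst) D)\<^sup>*" using xy by simp
    qed
    then obtain N :: "nat set" and r p rk b where t: "td V0 E0 N r p rk b"
      and w: "\<forall>i\<in>N. card (b i) \<le> (2 * (2 * genus E + 1) + 3) * q + card V0 div q"
      unfolding has_td_def by blast
    have V0: "V0 = (\<lambda>k. {k}) ` K \<union> J"
    proof -
      have "V0 = \<pi> ` K \<union> \<pi> ` (C - K)" using KC by (auto simp: V0_def)
      moreover have "\<pi> ` K = (\<lambda>k. {k}) ` K" "\<pi> ` (C - K) = J"
        unfolding J_def by (auto simp: \<pi>_def intro!: image_cong)
      ultimately show ?thesis by simp
    qed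
    have "card V0 \<le> 25 * card M"
    proof -
      have "card V0 \<le> card K + card J" unfolding V0 using card_Un_le[of "(\<lambda>k. {k}) ` K" J] card_image_le[OF finK, of "\<lambda>k. {k}"] by linarith
      then show ?thesis using cardK cardJ by linarith
    qed
    then have Wle: "(2 * (2 * genus E + 1) + 3) * q + card V0 div q \<le> ?W" by (simp add: div_le_mono)
    \<comment> \<open>A vertex of \<open>K\<close> stands for itself and a component for its
      neighbours. The home of \<open>v\<close> is \<open>{v}\<close>, which is adjacent in the
      quotient to every component that has \<open>v\<close> as a neighbour.\<close>
    define rep where "rep X = (X \<inter> K) \<union> Nn (X - K)" for X
    have repK: "rep {k} = {k}" if "k \<in> K" for k using that by (auto simp: rep_def Nn_def)
    have repJ: "rep X = Nn X" if "X \<in> J" for X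
    proof -
      have "X \<inter> K = {}" "X - K = X" using JC(1)[OF that] by auto
      then show ?thesis by (simp add: rep_def)
    qed
    show ?thesis
    proof (rule has_td_blowup[OF t, where rep = rep and c = "\<lambda>v. {v}"])
      show "finite V0" using finC by (simp add: V0_def)
      show "e \<subseteq> V0" if e0: "e \<in> E0" for e
      proof -
        obtain d where "d \<in> D" "e = {(\<pi> \<circ> fst) d, (\<pi> \<circ> fst) (\<alpha> d)}" using e0 unfolding E0_def by blast
        then show ?thesis using \<alpha>D[of d] \<sigma>(2) unfolding V0_def by blast
      qed
      show "card (b i) \<le> ?W" if "i \<in> N" for i using w that Wle by (meson order_trans)
      show "card (rep z) \<le> 9" if "z \<in> V0" for z
        using that unfolding V0 by (auto simp: repK repJ Ncard)
      show "K = (\<Union>z\<in>V0. rep z)"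
      proof
        show "K \<subseteq> (\<Union>z\<in>V0. rep z)" unfolding V0 using repK by blast
        show "(\<Union>z\<in>V0. rep z) \<subseteq> K" by (auto simp: rep_def Nn_def)
      qed
      show "{v} \<in> V0 \<and> v \<in> rep {v} \<and> (z = {v} \<or> {z, {v}} \<in> E0)" if z: "z \<in> V0" "v \<in> rep z" for z v
      proof -
        have vK: "v \<in> K" using z(2) by (auto simp: rep_def Nn_def)
        have "z = {v} \<or> {z, {v}} \<in> E0"
        proof (cases "z \<in> J")
          case True
          then obtain x where x: "x \<in> z" "{v, x} \<in> UA" using z(2) repJ by (auto simp: Nn_def)
          have xK: "x \<in> C - K" using JC(1)[OF True] x by blast
          have "cmp x = z" using True x cmp_eq by (auto simp: J_def)
          then have "\<pi> x = z" "\<pi> v = {v}" using xK vK by (auto simp: \<pi>_def)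
          moreover have "z \<noteq> {v}" using JC(1)[OF True] vK by blast
          ultimately have "{x, v} \<in> F" using F x by (auto simp: insert_commute)
          then show ?thesis using F0[of x v] \<open>\<pi> x = z\<close> \<open>\<pi> v = {v}\<close> by simp
        next
          case False
          then obtain k where "k \<in> K" "z = {k}" using z(1) V0 by blast
          then show ?thesis using z(2) repK by auto
        qed
        moreover have "{v} \<in> V0" unfolding V0 using vK by blast
        ultimately show ?thesis using repK[OF vK] by simp
      qed
      show "(\<exists>e0\<in>E0. e \<subseteq> (\<Union>z\<in>e0. rep z)) \<or> (\<exists>z\<in>V0. e \<subseteq> rep z)" if e: "e \<in> E1" for e
      proof (cases "e \<in> Nn ` J")
        case True
        then obtain X where X: "X \<in> J" "e = Nn X" by blast
        then have "X \<in> V0" "e \<subseteq> rep X" using repJ V0 by auto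
        then show ?thesis by blast
      next
        case False
        then have eK: "e \<in> UA" "e \<subseteq> K" using e by (auto simp: E1_def)
        obtain x y where xy: "e = {x, y}" "x \<noteq> y" using UA2[OF eK(1)] by blast
        have p: "\<pi> x = {x}" "\<pi> y = {y}" using eK xy by (auto simp: \<pi>_def)
        then have "{x, y} \<in> F" using F eK xy by auto
        then have "{{x}, {y}} \<in> E0" using F0[of x y] p by simp
        moreover have "e \<subseteq> (\<Union>z\<in>{{x}, {y}}. rep z)" using repK eK xy by auto
        ultimately show ?thesis by blast
      qed
    qed
  qed
  have "has_td (K \<union> (\<Union>X\<in>J. X)) (E1 \<union> (\<Union>X\<in>J. {e \<in> UA. e \<inter> X \<noteq> {}})) (?W * 9 + 14)"
  proof (rule has_td_glue_all[OF finJ, where S = Nn and ?w2.0 = 5])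
    show "has_td K E1 (?W * 9 + 14)" by (rule has_td_mono[OF main]) auto
    show "Nn X \<in> E1" if "X \<in> J" for X using that by (simp add: E1_def)
    show "has_td X ((\<lambda>e. e \<inter> X) ` {e \<in> UA. e \<inter> X \<noteq> {}}) 5" if "X \<in> J" for X using tdX[OF that] .
    show "5 + card (Nn X) \<le> ?W * 9 + 14" if "X \<in> J" for X using Ncard[OF that] by simp
    show "K \<inter> X = {}" if "X \<in> J" for X using JC[OF that] by blast
    show "X \<inter> Y = {}" if "X \<in> J" "Y \<in> J" "X \<noteq> Y" for X Y using Jdisj[OF that] .
    show "e \<subseteq> X \<union> Nn X" if X: "X \<in> J" and e: "e \<in> {e \<in> UA. e \<inter> X \<noteq> {}}" for X e
    proof -
      obtain x y where xy: "e = {x, y}" "x \<in> X"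
      proof -
        obtain a b where ab: "e = {a, b}" using UA2 e by blast
        then consider "a \<in> X" | "b \<in> X" using e by auto
        then show thesis using that[of a b] that[of b a] ab by cases (auto simp: insert_commute)
      qed
      have "{x, y} \<in> UA" using e xy by simp
      then have "y \<in> X \<or> y \<in> K" using Jstep[OF X xy(2), of y] UAC by blast
      then show ?thesis using xy \<open>{x, y} \<in> UA\<close> by (auto simp: Nn_def insert_commute)
    qed
  qed
  moreover have "K \<union> (\<Union>X\<in>J. X) = set xs" using JU KC by (auto simp: C_def)
  ultimately have "has_td (set xs) (E1 \<union> (\<Union>X\<in>J. {e \<in> UA. e \<inter> X \<noteq> {}})) (?W * 9 + 14)" by simp
  then show ?thesis
  proof (rule has_td_mono)
    fix e assume e: "e \<in> ugraph_edges A"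
    then have eUA: "e \<in> UA" by (simp add: UA_def)
    have "e \<in> E1 \<union> (\<Union>X\<in>J. {e \<in> UA. e \<inter> X \<noteq> {}})"
    proof (cases "e \<subseteq> K")
      case True then show ?thesis using eUA by (simp add: E1_def)
    next
      case False
      then obtain x where x: "x \<in> e" "x \<notin> K" by blast
      have "x \<in> C" using UA2[OF eUA] UAC eUA x by blast
      then have "x \<in> \<Union>J" using JU x by blast
      then show ?thesis using eUA x by blast
    qed
    then show "\<exists>e'\<in>E1 \<union> (\<Union>X\<in>J. {e \<in> UA. e \<inter> X \<noteq> {}}). e \<subseteq> e'" by blast
  qed simp
qed

section \<open>Critical digraphs\<close>

lemma rtrancl_remove:
  assumes "(x, y) \<in> A\<^sup>*"
  shows "(x, y) \<in> (A - {(u, v)})\<^sup>* \<or> (x, u) \<in> (A - {(u, v)})\<^sup>* \<and> (v, y) \<in> (A - {(u, v)})\<^sup>*"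
proof -
  have "(x, y) \<in> (insert (u, v) (A - {(u, v)}))\<^sup>*" using assms rtrancl_mono[of A "insert (u, v) (A - {(u, v)})"] by blast
  then show ?thesis unfolding rtrancl_insert by simp
qed

lemma rtrancl_enter:
  assumes "(x, y) \<in> R\<^sup>*" "x \<notin> p" "y \<in> p"
  shows "\<exists>a b. (a, b) \<in> R \<and> a \<notin> p \<and> b \<in> p \<and> (x, a) \<in> R\<^sup>*"
  using assms
proof (induction)
  case (step y z)
  then show ?case by (cases "y \<in> p") auto
qed simp

text \<open>\<open>R\<close> is a disjoint union of paths, which may be listed one after the other.
  A vertex \<open>v\<close> without predecessor is taken out and reinserted directly before its
  successor; this separates no pair, since the successor has no other predecessor.\<close>

lemma consecutive_list:
  assumes "finite W" "R \<subseteq> W \<times> W" "acyclic R" "\<And>x y z. (x, y) \<in> R \<Longrightarrow> (x, z) \<in> R \<Longrightarrow> y = z"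
    "\<And>x y z. (y, x) \<in> R \<Longrightarrow> (z, x) \<in> R \<Longrightarrow> y = z"
  shows "\<exists>xs. distinct xs \<and> set xs = W \<and> (\<forall>(x, y)\<in>R. \<exists>ps qs. xs = ps @ x # y # qs)"
  using assms
proof (induction "card W" arbitrary: W R)
  case 0
  then show ?case by (intro exI[of _ "[]"]) auto
next
  case (Suc m)
  have "finite R" using Suc.prems(1,2) finite_subset by blast
  then have "wf R" using Suc.prems(3) by (simp add: wf_iff_acyclic_if_finite)
  moreover obtain w0 where "w0 \<in> W" using Suc.hyps(2) by fastforce
  ultimately obtain v where v: "v \<in> W" "\<And>y. (y, v) \<in> R \<Longrightarrow> y \<notin> W" by (meson wfE_min)
  have nov: "(y, v) \<notin> R" for y using v Suc.prems(2) by blast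
  let ?R = "R \<inter> (W - {v}) \<times> (W - {v})"
  have "\<exists>xs. distinct xs \<and> set xs = W - {v} \<and> (\<forall>(x, y)\<in>?R. \<exists>ps qs. xs = ps @ x # y # qs)"
  proof (rule Suc.hyps(1))
    show "m = card (W - {v})" using Suc.hyps(2) Suc.prems(1) v(1) by simp
    show "acyclic ?R" using Suc.prems(3) by (rule acyclic_subset) blast
  qed (use Suc.prems in auto)
  then obtain xs where xs0: "distinct xs \<and> set xs = W - {v} \<and> (\<forall>(x, y)\<in>?R. \<exists>ps qs. xs = ps @ x # y # qs)" by (elim exE)
  then have H: "\<forall>e\<in>?R. case e of (x, y) \<Rightarrow> \<exists>ps qs. xs = ps @ x # y # qs" by (elim conjE)
  have "\<exists>ps qs. xs = ps @ x # y # qs" if "(x, y) \<in> ?R" for x y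
    using bspec[OF H that] by (simp only: prod.case)
  with xs0 have xs: "distinct xs" "set xs = W - {v}" "(x, y) \<in> ?R \<Longrightarrow> \<exists>ps qs. xs = ps @ x # y # qs" for x y
    by simp_all
  show ?case
  proof (cases "\<exists>w. (v, w) \<in> R")
    case False
    have "\<exists>ps qs. v # xs = ps @ x # y # qs" if xy: "(x, y) \<in> R" for x y
    proof -
      have "(x, y) \<in> ?R" using xy Suc.prems(2) nov False by blast
      then obtain ps qs where "xs = ps @ x # y # qs" using xs(3) by blast
      then show ?thesis by (intro exI[of _ "v # ps"] exI[of _ qs]) simp
    qed
    then show ?thesis using xs(1,2) v(1) by (intro exI[of _ "v # xs"]) auto
  next
    case True
    then obtain w where w: "(v, w) \<in> R" by blast
    have "w \<noteq> v" using w nov by blast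
    then have "w \<in> set xs" using w xs(2) Suc.prems(2) by blast
    then obtain as bs where ab: "xs = as @ w # bs" by (meson split_list)
    have "\<exists>ps qs. as @ v # w # bs = ps @ x # y # qs" if xy: "(x, y) \<in> R" for x y
    proof (cases "x = v")
      case True
      then have "y = w" using xy w Suc.prems(4) by blast
      then show ?thesis using True by blast
    next
      case False
      then have yw: "y \<noteq> w" using xy w Suc.prems(5) by blast
      have "(x, y) \<in> ?R" using xy Suc.prems(2) nov False by blast
      then obtain ps qs where pq: "xs = ps @ x # y # qs" using xs(3) by blast
      from ab pq have "as @ w # bs = ps @ x # y # qs" by simp
      then consider us where "as = ps @ us" "us @ w # bs = x # y # qs" | us where "ps = as @ us" "w # bs = us @ x # y # qs"
        by (auto simp: append_eq_append_conv2)
      then show ?thesis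
      proof cases
        case 1
        show ?thesis
        proof (cases us)
          case Nil
          then show ?thesis using 1 by (intro exI[of _ "as @ [v]"] exI[of _ qs]) simp
        next
          case (Cons a us')
          then have "us' \<noteq> []" using 1(2) yw by auto
          then obtain us'' where "us = x # y # us''" using Cons 1(2) by (cases us') auto
          then show ?thesis using 1 by (intro exI[of _ ps] exI[of _ "us'' @ v # w # bs"]) simp
        qed
      next
        case 2
        then show ?thesis by (intro exI[of _ "as @ v # us"] exI[of _ qs]) simp
      qed
    qed
    moreover have "distinct (as @ v # w # bs)" "set (as @ v # w # bs) = W" using xs(1,2) v(1) unfolding ab by auto
    ultimately show ?thesis by (intro exI[of _ "as @ v # w # bs"]) auto
  qed
qed

lemma consecutive_arrangement:
  assumes R: "R \<subseteq> W \<times> W" "\<And>x y z. (x, y) \<in> R \<Longrightarrow> (x, z) \<in> R \<Longrightarrow> y = z" "\<And>x y z. (y, x) \<in> R \<Longrightarrow> (z, x) \<in> R \<Longrightarrow> y = z"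
    and xs: "distinct xs" "set xs = W" "\<And>x y. (x, y) \<in> R \<Longrightarrow> \<exists>ps qs. xs = ps @ x # y # qs" and M: "M \<subseteq> W"
  shows "arrangement R M xs"
proof -
  have idx: "\<exists>i. Suc i < length xs \<and> x = xs ! i \<and> y = xs ! Suc i" if xy: "(x, y) \<in> R" for x y
  proof -
    obtain ps qs where "xs = ps @ x # y # qs" using xs(3)[OF xy] by blast
    then show ?thesis by (intro exI[of _ "length ps"]) (simp add: nth_append)
  qed
  have ix: "xs ! i \<in> set (take c xs) \<longleftrightarrow> i < c" "xs ! i \<in> set (drop c xs) \<longleftrightarrow> c \<le> i" if i: "i < length xs" for i c
  proof -
    show 1: "xs ! i \<in> set (take c xs) \<longleftrightarrow> i < c"
      using i xs(1) by (auto simp: in_set_conv_nth nth_eq_iff_index_eq)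
    have "set (take c xs) \<inter> set (drop c xs) = {}" "set (take c xs) \<union> set (drop c xs) = set xs"
      using xs(1) set_take_disj_set_drop_if_distinct[of xs c c] by (auto simp: set_append[symmetric] simp del: set_append)
    then show "xs ! i \<in> set (drop c xs) \<longleftrightarrow> c \<le> i" using 1 i by (metis IntI UnE empty_iff nth_mem not_le)
  qed
  have "card (cut_left (rm R M) xs c) \<le> 4" for c
  proof -
    have "cut_left (rm R M) xs c \<subseteq> {xs ! (c - 1)}"
    proof
      fix x assume "x \<in> cut_left (rm R M) xs c"
      then obtain y where x: "x \<in> set (take c xs)" and y: "y \<in> set (drop c xs)" and "(x, y) \<in> R \<or> (y, x) \<in> R"
        by (auto simp: cut_left_def rm_def)
      then consider i where "Suc i < length xs" "x = xs ! i" "y = xs ! Suc i" | i where "Suc i < length xs" "y = xs ! i" "x = xs ! Suc i"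
        using idx by blast
      then show "x \<in> {xs ! (c - 1)}"
      proof cases
        case 1
        then have "i < c" "c \<le> Suc i" using ix(1)[of i c] ix(2)[of "Suc i" c] x y by auto
        then have "c - 1 = i" by simp
        then show ?thesis using 1 by simp
      next
        case 2
        then have "Suc i < c" "c \<le> i" using ix(1)[of "Suc i" c] ix(2)[of i c] x y by auto
        then show ?thesis by simp
      qed
    qed
    then have "card (cut_left (rm R M) xs c) \<le> card {xs ! (c - 1)}" by (intro card_mono) auto
    then show ?thesis by simp
  qed
  moreover have "card {u. rm R M v u} \<le> 4" for v
  proof -
    have "{u. rm R M v u} \<subseteq> {THE u. (v, u) \<in> R, THE u. (u, v) \<in> R}"
    proof
      fix u assume "u \<in> {u. rm R M v u}"
      then consider "(v, u) \<in> R" | "(u, v) \<in> R" by (auto simp: rm_def)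
      then show "u \<in> {THE u. (v, u) \<in> R, THE u. (u, v) \<in> R}"
      proof cases
        case 1
        then have "(THE u. (v, u) \<in> R) = u" using R(2) by (intro the_equality) auto
        then show ?thesis by simp
      next
        case 2
        then have "(THE u. (u, v) \<in> R) = u" using R(3) by (intro the_equality) auto
        then show ?thesis by simp
      qed
    qed
    then have "card {u. rm R M v u} \<le> card {THE u. (v, u) \<in> R, THE u. (u, v) \<in> R}" by (intro card_mono) auto
    also have "\<dots> \<le> 2" by (simp add: card_insert_if)
    finally show ?thesis by simp
  qed
  ultimately show ?thesis using R(1) xs M by (auto simp: arrangement_def)
qed

text \<open>\<open>f\<close> will count the arcs that enter, or leave, a strong component: at least
  one, except for the at most \<open>q\<close> members of \<open>P - N\<close>. A total of at most
  \<open>card P + B\<close> leaves room for few values above one, and on a set containing all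
  exceptions the excess is still at most \<open>B\<close>.\<close>

lemma excess:
  assumes P: "finite P" "N \<subseteq> P" "\<And>p. p \<in> N \<Longrightarrow> (1::nat) \<le> f p" "sum f P \<le> card P + B" "card (P - N) \<le> q"
  shows "card {p \<in> N. 2 \<le> f p} \<le> B + q" "\<And>S. P - N \<subseteq> S \<Longrightarrow> S \<subseteq> P \<Longrightarrow> sum f S \<le> B + card S"
proof -
  have finN: "finite N" using P finite_subset by blast
  have "(\<Sum>p\<in>N. 1 + of_bool (2 \<le> f p)) \<le> sum f N" using P(3) by (intro sum_mono) fastforce
  also have "\<dots> \<le> sum f P" using P(1,2) by (intro sum_mono2) auto
  also have "(\<Sum>p\<in>N. 1 + of_bool (2 \<le> f p)) = card N + card {p \<in> N. 2 \<le> f p}"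
    unfolding sum.distrib using finN by (simp add: sum_of_bool_eq Int_def)
  finally have "card N + card {p \<in> N. 2 \<le> f p} \<le> card P + B" using P(4) by linarith
  moreover have "card P = card N + card (P - N)" using P(1,2) finN by (simp add: card_Diff_subset card_mono)
  ultimately show "card {p \<in> N. 2 \<le> f p} \<le> B + q" using P(5) by linarith
  fix S assume S: "P - N \<subseteq> S" "S \<subseteq> P"
  have finS: "finite S" using S P(1) finite_subset by blast
  have "sum f P = sum f S + sum f (P - S)" using P(1) S(2) sum.subset_diff[OF S(2) P(1), of f] by simp
  moreover have "card (P - S) \<le> sum f (P - S)"
  proof -
    have "(\<Sum>p\<in>P - S. 1) \<le> sum f (P - S)" using S P(3) by (intro sum_mono) blast
    then show ?thesis by simp
  qed
  moreover have "card P = card S + card (P - S)" using P(1) S finS by (simp add: card_Diff_subset card_mono)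
  ultimately show "sum f S \<le> B + card S" using P(4) by linarith
qed

text \<open>\<open>A\<close> is a weak component of the solution and \<open>E\<close> the host
  graph, so the genus in all bounds is that of the input. \<open>q\<close> merely bounds
  \<open>card T\<close>, because every component is treated with the total number of
  terminals.\<close>

locale critical_digraph =
  fixes A :: "('a \<times> 'a) set" and C T :: "'a set" and E :: "'a set set" and q :: nat
  assumes finC: "finite C" and AC: "A \<subseteq> C \<times> C" and TC: "T \<subseteq> C" and cT: "card T \<le> q"
    and crit: "\<And>e. e \<in> A \<Longrightarrow> \<exists>s\<in>T. \<exists>t\<in>T. (s, t) \<in> A\<^sup>* \<and> (s, t) \<notin> (A - {e})\<^sup>*"
    and finE: "finite E" and E2: "\<And>e. e \<in> E \<Longrightarrow> \<exists>u v. e = {u, v} \<and> u \<noteq> v"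
    and UE: "ugraph_edges A \<subseteq> E"
    and conn: "\<And>u v. u \<in> C \<Longrightarrow> v \<in> C \<Longrightarrow> (u, v) \<in> (adj (ugraph_edges A))\<^sup>*"
    and Ane: "A \<noteq> {}"
begin

section \<open>Strong components and the acyclic quotient\<close>

definition "bl v = {u. (u, v) \<in> A\<^sup>* \<and> (v, u) \<in> A\<^sup>*}"
definition "IA = {(u, v) \<in> A. bl u \<noteq> bl v}"
definition "P = bl ` C"
definition "AS p = {(x, y) \<in> A. x \<in> p \<and> y \<in> p}"

lemma finA: "finite A" using AC finC finite_subset by blast
lemma finT: "finite T" using TC finC finite_subset by blast
lemma finP: "finite P" using finC by (simp add: P_def)
lemma finIA: "finite IA" using finA by (rule rev_finite_subset) (auto simp: IA_def)

lemma reachC: "(u, v) \<in> A\<^sup>* \<Longrightarrow> v \<in> C \<Longrightarrow> u \<in> C"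
  by (erule converse_rtranclE) (use AC in auto)

lemma bl_self: "v \<in> bl v" by (simp add: bl_def)

lemma bl_eq: "u \<in> bl v \<Longrightarrow> bl u = bl v"
  unfolding bl_def by (auto intro: rtrancl_trans)

lemma bl_sub: "v \<in> C \<Longrightarrow> bl v \<subseteq> C" using reachC by (auto simp: bl_def)

lemma P_mem: "p \<in> P \<Longrightarrow> x \<in> p \<Longrightarrow> x \<in> C \<and> bl x = p"
  using bl_eq subsetD[OF bl_sub] by (auto simp: P_def)

lemma P_reach: "p \<in> P \<Longrightarrow> x \<in> p \<Longrightarrow> y \<in> p \<Longrightarrow> (x, y) \<in> A\<^sup>*"
  using P_mem[of p x] P_mem[of p y] bl_self[of x] by (auto simp: bl_def)

lemma P_disj: "p \<in> P \<Longrightarrow> p' \<in> P \<Longrightarrow> p \<noteq> p' \<Longrightarrow> p \<inter> p' = {}"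
  using P_mem by blast

lemma IA_iff: "(u, v) \<in> IA \<longleftrightarrow> (u, v) \<in> A \<and> (v, u) \<notin> A\<^sup>*"
proof -
  have "bl u = bl v \<longleftrightarrow> (v, u) \<in> A\<^sup>*" if "(u, v) \<in> A"
  proof
    assume "bl u = bl v" then have "u \<in> bl v" using bl_self[of u] by simp
    then show "(v, u) \<in> A\<^sup>*" by (simp add: bl_def)
  next
    assume "(v, u) \<in> A\<^sup>*"
    then have "u \<in> bl v" using that by (auto simp: bl_def)
    then show "bl u = bl v" by (rule bl_eq)
  qed
  then show ?thesis by (auto simp: IA_def)
qed

lemma IA_A: "(u, v) \<in> IA \<Longrightarrow> (u, v) \<in> A" by (simp add: IA_iff)

lemma cross_IA: "(x, y) \<in> A \<Longrightarrow> p \<in> P \<Longrightarrow> x \<in> p \<longleftrightarrow> y \<notin> p \<Longrightarrow> (x, y) \<in> IA"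
  using P_mem[of p x] P_mem[of p y] bl_self[of x] bl_self[of y] by (auto simp: IA_def)

lemma IA_cross: "(x, y) \<in> IA \<Longrightarrow> p \<in> P \<Longrightarrow> x \<in> p \<Longrightarrow> y \<notin> p"
  using P_reach by (auto simp: IA_iff)

lemma crit2:
  assumes e: "(u, v) \<in> A"
  obtains s t where "s \<in> T" "t \<in> T" "(s, t) \<notin> (A - {(u, v)})\<^sup>*" "(s, u) \<in> (A - {(u, v)})\<^sup>*" "(v, t) \<in> (A - {(u, v)})\<^sup>*"
  using crit[OF e] rtrancl_remove[of _ _ A u v] by blast

lemma sub_reach: "(x, y) \<in> (A - X)\<^sup>* \<Longrightarrow> (x, y) \<in> A\<^sup>*"
  using rtrancl_mono[of "A - X" A] by blast

lemma Tne: "T \<noteq> {}" using Ane crit by blast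

lemma q_pos: "0 < q"
proof -
  have "0 < card T" using Tne finT by (simp add: card_gt_0_iff)
  then show ?thesis using cT by linarith
qed

lemma noloop: "(x, x) \<notin> A"
proof
  assume a: "(x, x) \<in> A"
  then obtain s t where "(s, t) \<notin> (A - {(x, x)})\<^sup>*" "(s, x) \<in> (A - {(x, x)})\<^sup>*" "(x, t) \<in> (A - {(x, x)})\<^sup>*"
    by (elim crit2)
  then show False by (meson rtrancl_trans)
qed

lemma blob_conn:
  assumes "p \<in> P" "x \<in> p" "y \<in> p"
  shows "(x, y) \<in> (AS p)\<^sup>*"
proof -
  have "(x, y) \<in> A\<^sup>*" using P_reach assms by blast
  then show ?thesis using assms(2)
  proof (induction rule: converse_rtrancl_induct)
    case (step a b)
    have "(b, a) \<in> A\<^sup>*" using step(2) P_reach[OF assms(1,3) step(4)] by (meson rtrancl_trans)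
    then have "b \<in> bl a" using step(1) by (auto simp: bl_def)
    then have "b \<in> p" using P_mem[OF assms(1) step(4)] by simp
    then have "(a, b) \<in> AS p" using step by (simp add: AS_def)
    then show ?case using step.IH[OF \<open>b \<in> p\<close>] by (meson converse_rtrancl_into_rtrancl)
  qed simp
qed

lemma blob_full:
  assumes p: "p \<in> P" "p \<noteq> C"
  shows "\<exists>x y. (x, y) \<in> IA \<and> (x \<in> p \<or> y \<in> p)"
proof -
  obtain v where v: "v \<in> p" using p bl_self by (auto simp: P_def)
  obtain u where u: "u \<in> C" "u \<notin> p" using p P_mem by blast
  have "(u, v) \<in> (adj (ugraph_edges A))\<^sup>*" using conn u P_mem[OF p(1) v] by blast
  from rtrancl_enter[OF this u(2) v] obtain a b where ab: "{a, b} \<in> ugraph_edges A" "a \<notin> p" "b \<in> p"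
    by (auto simp: adj_def)
  then have "(a, b) \<in> A \<or> (b, a) \<in> A" by (auto simp: ugraph_edges_def doubleton_eq_iff)
  then show ?thesis using cross_IA[OF _ p(1), of a b] cross_IA[OF _ p(1), of b a] ab by blast
qed

text \<open>By connectivity some arc \<open>(x, y)\<close> between components touches
  \<open>p\<close>. The pair that needs it has its terminals outside \<open>p\<close>, so a path
  from \<open>s\<close> to \<open>t\<close> over this arc both enters and leaves
  \<open>p\<close>.\<close>

lemma blob_in_out:
  assumes p: "p \<in> P" "p \<noteq> C" "p \<inter> T = {}"
  shows "\<exists>x y. (x, y) \<in> IA \<and> y \<in> p" "\<exists>x y. (x, y) \<in> IA \<and> x \<in> p"
proof -
  obtain x y where xy: "(x, y) \<in> IA" "x \<in> p \<or> y \<in> p" using blob_full[OF p(1,2)] by blast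
  obtain s t where st: "s \<in> T" "t \<in> T" "(s, x) \<in> (A - {(x, y)})\<^sup>*" "(y, t) \<in> (A - {(x, y)})\<^sup>*"
    using IA_A[OF xy(1)] by (elim crit2)
  have st': "s \<notin> p" "t \<notin> p" using p st by auto
  have sx: "(s, x) \<in> A\<^sup>*" "(y, t) \<in> A\<^sup>*" using st sub_reach by auto
  show "\<exists>x y. (x, y) \<in> IA \<and> y \<in> p"
  proof (cases "y \<in> p")
    case True then show ?thesis using xy by blast
  next
    case False
    then have "x \<in> p" using xy by blast
    from rtrancl_enter[OF sx(1) st'(1) this] show ?thesis using cross_IA[OF _ p(1)] by blast
  qed
  show "\<exists>x y. (x, y) \<in> IA \<and> x \<in> p"
  proof (cases "x \<in> p")
    case True then show ?thesis using xy by blast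
  next
    case False
    then have "y \<in> p" using xy by blast
    from rtrancl_enter[OF sx(2), of "- p"] this st' obtain a b where "(a, b) \<in> A" "a \<in> p" "b \<notin> p" by auto
    then show ?thesis using cross_IA[OF _ p(1)] by blast
  qed
qed


text \<open>The excess of arcs over vertices in \<open>card_edges\<close>, for
  \<open>G = 2 * genus E + 1\<close>.\<close>

definition "B0 = q * (3 * q + 2 * (2 * genus E + 1)) + q + (2 * genus E + 1)"

text \<open>The quotient by strong components is set up as a \<open>dag_map\<close>. Its darts are
  still pairs of original vertices, so parallel arcs between two components are counted separately.
  If \<open>C\<close> itself is a strong component, there are no arcs to count, and its vertex would
  lose all darts with the stubs; this case is treated first.\<close>

lemma card_IA:
  shows "card IA \<le> card P + B0"
proof (cases "\<exists>p\<in>P. p = C")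
  case True
  then have CP: "C \<in> P" by blast
  have "IA = {}"
  proof (rule ccontr)
    assume "IA \<noteq> {}"
    then obtain x y where xy: "(x, y) \<in> IA" by auto
    then have "x \<in> C" "y \<in> C" using IA_A AC by blast+
    then show False using IA_cross[OF xy CP] by blast
  qed
  then show ?thesis by simp
next
  case False
  define F where "F = {{u, v} | u v. (u, v) \<in> IA}"
  have F: "{u, v} \<in> F \<longleftrightarrow> (u, v) \<in> IA \<or> (v, u) \<in> IA" for u v by (auto simp: F_def doubleton_eq_iff)
  have FE: "F \<subseteq> E" using UE IA_A noloop by (fastforce simp: F_def ugraph_edges_def)
  have IAC: "u \<in> C \<and> v \<in> C" if "(u, v) \<in> IA" for u v using IA_A[OF that] AC by blast
  have F2: "u \<in> C \<and> v \<in> C \<and> bl u \<noteq> bl v" if "{u, v} \<in> F" for u v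
    using that unfolding F using IAC by (auto simp: IA_def)
  have cF: "card F = card IA"
  proof -
    have "F = (\<lambda>(u, v). {u, v}) ` IA" by (auto simp: F_def)
    moreover have "inj_on (\<lambda>(u, v). {u, v}) IA"
    proof (rule inj_onI)
      fix d e assume de: "d \<in> IA" "e \<in> IA" "(\<lambda>(u, v). {u, v}) d = (\<lambda>(u, v). {u, v}) e"
      obtain u v u' v' where d: "d = (u, v)" "e = (u', v')" by (cases d, cases e)
      then have "u = u' \<and> v = v' \<or> u = v' \<and> v = u'" using de(3) by (simp add: doubleton_eq_iff)
      moreover have "\<not> (u = v' \<and> v = u')" using de(1,2) d by (auto simp: IA_iff)
      ultimately show "d = e" using d by simp
    qed
    ultimately show ?thesis by (simp add: card_image)
  qed
  obtain a0 b0 where ab0: "(a0, b0) \<in> A" using Ane by auto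
  have Cne: "C \<noteq> {}" using ab0 AC by blast
  have CE: "C \<subseteq> \<Union>E"
  proof
    fix v assume v: "v \<in> C"
    have "a0 \<noteq> b0" "a0 \<in> C" "b0 \<in> C" using ab0 noloop AC by auto
    then obtain u where u: "u \<in> C" "u \<noteq> v" by blast
    from conn[OF v u(1)] obtain z where "(v, z) \<in> adj (ugraph_edges A)"
      by (cases rule: converse_rtranclE) (use u(2) in auto)
    then show "v \<in> \<Union>E" using UE by (auto simp: adj_def)
  qed
  have fib: "(u, v) \<in> {(x, y). x \<in> C \<and> y \<in> C \<and> {x, y} \<in> E \<and> bl x = bl y}\<^sup>*"
    if uv: "u \<in> C" "v \<in> C" "bl u = bl v" for u v
  proof -
    have p: "bl u \<in> P" using uv by (simp add: P_def)
    have "(u, v) \<in> (AS (bl u))\<^sup>*" by (rule blob_conn[OF p bl_self]) (use uv bl_self in auto)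
    moreover have "AS (bl u) \<subseteq> {(x, y). x \<in> C \<and> y \<in> C \<and> {x, y} \<in> E \<and> bl x = bl y}"
    proof (rule subrelI)
      fix x y assume xy: "(x, y) \<in> AS (bl u)"
      then have "(x, y) \<in> A" "x \<in> bl u" "y \<in> bl u" by (auto simp: AS_def)
      moreover have "{x, y} \<in> E" using UE \<open>(x, y) \<in> A\<close> noloop by (fastforce simp: ugraph_edges_def)
      ultimately show "(x, y) \<in> {(x, y). x \<in> C \<and> y \<in> C \<and> {x, y} \<in> E \<and> bl x = bl y}"
        using P_mem[OF p] by auto
    qed
    ultimately show ?thesis using rtrancl_mono by blast
  qed
  define D where "D = {(u, v). {u, v} \<in> E \<and> u \<in> C}"
  define \<alpha> where "\<alpha> = (\<lambda>(u, v). if {u, v} \<in> F then (v, u) else (u, v))"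
  let ?vt = "bl \<circ> fst"
  obtain \<sigma> where \<sigma>: "cmap D \<sigma> \<alpha> ?vt" "?vt ` D = P" "card (egs \<alpha> D) = card F"
      "card (egs \<alpha> D) + 2 \<le> card (?vt ` D) + card (fcs D \<sigma> \<alpha>) + (2 * genus E + 1)"
    using quotient_map_connected[OF finE E2 CE Cne FE F2 fib] unfolding D_def \<alpha>_def P_def by blast
  interpret M: cmap D \<sigma> \<alpha> ?vt by (rule \<sigma>(1))
  have \<alpha>F: "\<alpha> (u, v) = (v, u)" "(u, v) \<in> D" "(v, u) \<in> D" "\<alpha> (u, v) \<noteq> (u, v)" if "{u, v} \<in> F" for u v
    using that F2[OF that] FE by (auto simp: \<alpha>_def D_def insert_commute)
  define Dr where "Dr = {d \<in> D. \<alpha> d \<noteq> d}"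
  have Dr: "(u, v) \<in> Dr \<longleftrightarrow> {u, v} \<in> F" for u v
    using \<alpha>F[of u v] by (auto simp: Dr_def \<alpha>_def split: if_splits)
  have full: "\<exists>d\<in>D. ?vt d = p \<and> \<alpha> d \<noteq> d" if p: "p \<in> ?vt ` D" for p
  proof -
    have pP: "p \<in> P" "p \<noteq> C" using p \<sigma>(2) False by auto
    from blob_full[OF pP] obtain x y where xy: "(x, y) \<in> IA" "x \<in> p \<or> y \<in> p" by blast
    have "bl x = p \<or> bl y = p" using xy(2) P_mem[OF pP(1)] by blast
    moreover have "{x, y} \<in> F" "{y, x} \<in> F" using xy(1) F by auto
    ultimately show ?thesis using \<alpha>F[of x y] \<alpha>F[of y x] by (elim disjE) (auto intro: bexI[of _ "(x, y)"] bexI[of _ "(y, x)"])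
  qed
  obtain nx where nx: "cmap Dr nx \<alpha> ?vt" "?vt ` Dr = ?vt ` D" "egs \<alpha> Dr = egs \<alpha> D" "card (fcs D \<sigma> \<alpha>) \<le> card (fcs Dr nx \<alpha>)"
    using M.remove_stubs[OF full] unfolding Dr_def by blast
  interpret N: cmap Dr nx \<alpha> ?vt by (rule nx(1))
  define ou where "ou d \<longleftrightarrow> d \<in> IA" for d :: "'a \<times> 'a"
  have ouA: "ou (u, v) \<longleftrightarrow> (u, v) \<in> IA" for u v by (simp add: ou_def)
  define BR where "BR = {(?vt d, ?vt (\<alpha> d)) | d. d \<in> Dr \<and> ou d}"
  have BR: "BR = {(bl u, bl v) | u v. (u, v) \<in> IA}"
  proof (intro set_eqI iffI)
    fix z assume "z \<in> BR"
    then obtain u v where "(u, v) \<in> Dr" "ou (u, v)" "z = (bl u, bl (fst (\<alpha> (u, v))))" by (auto simp: BR_def)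
    then show "z \<in> {(bl u, bl v) | u v. (u, v) \<in> IA}" using \<alpha>F(1)[of u v] Dr by (auto simp: ouA)
  next
    fix z assume "z \<in> {(bl u, bl v) | u v. (u, v) \<in> IA}"
    then obtain u v where uv: "(u, v) \<in> IA" "z = (bl u, bl v)" by blast
    then have "{u, v} \<in> F" using F by blast
    then show "z \<in> BR" unfolding BR_def using uv \<alpha>F(1)[of u v] Dr by (intro CollectI exI[of _ "(u, v)"]) (auto simp: ouA)
  qed
  have BRr: "(x, y) \<in> A\<^sup>*" if "(bl x, p) \<in> BR\<^sup>*" "y \<in> p" "p \<in> P" "x \<in> C" for x y p
    using that
  proof (induction arbitrary: y)
    case base then show ?case using P_reach bl_self by blast
  next
    case (step p p')
    then obtain u v where uv: "(u, v) \<in> IA" "p = bl u" "p' = bl v" unfolding BR by blast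
    then have "p \<in> P" using IAC by (auto simp: P_def)
    then have "(x, u) \<in> A\<^sup>*" using step.IH[of u] uv bl_self step.prems by blast
    moreover have "(v, y) \<in> A\<^sup>*" using P_reach[OF step.prems(2), of v y] uv bl_self step.prems by blast
    ultimately show ?case using IA_A[OF uv(1)] by (meson rtrancl.rtrancl_into_rtrancl rtrancl_trans)
  qed
  have rBR: "(bl x, bl y) \<in> BR\<^sup>*" if "(x, y) \<in> A\<^sup>*" for x y
  proof (rule rtrancl_image[OF that])
    fix a b assume ab: "(a, b) \<in> A"
    show "(bl a, bl b) \<in> BR\<^sup>*"
    proof (cases "bl a = bl b")
      case False
      then have "(a, b) \<in> IA" using ab by (simp add: IA_def)
      then show ?thesis unfolding BR by blast
    qed simp
  qed
  interpret dag_map Dr nx \<alpha> ?vt ou "bl ` T" q "2 * genus E + 1"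
  proof
    show "\<alpha> d \<noteq> d" if "d \<in> Dr" for d using that by (simp add: Dr_def)
    show "ou (\<alpha> d) \<longleftrightarrow> \<not> ou d" if "d \<in> Dr" for d
    proof -
      obtain u v where d: "d = (u, v)" by (cases d)
      then have f: "{u, v} \<in> F" using that Dr by simp
      then have "(u, v) \<in> IA \<or> (v, u) \<in> IA" using F by simp
      moreover have "\<not> ((u, v) \<in> IA \<and> (v, u) \<in> IA)" by (auto simp: IA_iff)
      ultimately show ?thesis using d \<alpha>F(1)[OF f] by (auto simp: ouA)
    qed
    show "acyclic {(?vt d, ?vt (\<alpha> d)) | d. d \<in> Dr \<and> ou d}"
      unfolding BR_def[symmetric]
    proof (rule acyclicI, intro allI notI)
      fix p assume "(p, p) \<in> BR\<^sup>+"
      then obtain p' where p': "(p, p') \<in> BR" "(p', p) \<in> BR\<^sup>*" by (meson tranclD)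
      then obtain u v where uv: "(u, v) \<in> IA" "p = bl u" "p' = bl v" unfolding BR by blast
      then have "(v, u) \<in> A\<^sup>*" using BRr[of v p u] p' bl_self IAC[OF uv(1)] by (auto simp: P_def)
      then show False using uv(1) by (simp add: IA_iff)
    qed
    show "finite (bl ` T)" using finT by simp
    show "card (bl ` T) \<le> q" using card_image_le[OF finT, of bl] cT by linarith
    show "(\<exists>d\<in>Dr. ?vt d = v \<and> ou d) \<and> (\<exists>d\<in>Dr. ?vt d = v \<and> \<not> ou d)" if v: "v \<in> ?vt ` Dr" "v \<notin> bl ` T" for v
    proof -
      have vP: "v \<in> P" "v \<noteq> C" using v \<sigma>(2) nx(2) False by auto
      have "v \<inter> T = {}" using P_mem[OF vP(1)] v(2) by auto
      from blob_in_out[OF vP this] obtain x y x' y' where xy: "(x, y) \<in> IA" "y \<in> v" "(x', y') \<in> IA" "x' \<in> v" by blast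
      have "(y, x) \<in> Dr" "(x', y') \<in> Dr" using xy F by (auto simp: Dr)
      moreover have "\<not> ou (y, x)" "ou (x', y')" using xy by (auto simp: ouA IA_iff)
      moreover have "bl y = v" "bl x' = v" using P_mem[OF vP(1)] xy by auto
      ultimately show ?thesis by (auto intro: bexI[of _ "(y, x)"] bexI[of _ "(x', y')"])
    qed
    show "\<exists>s\<in>bl ` T. (s, ?vt (\<alpha> e)) \<in> {(?vt d, ?vt (\<alpha> d)) | d. d \<in> Dr \<and> ou d}\<^sup>* \<and>
        (\<forall>a\<in>Dr. \<not> ou a \<longrightarrow> ?vt a = ?vt e \<longrightarrow> a \<noteq> e \<longrightarrow> (s, ?vt (\<alpha> a)) \<notin> {(?vt d, ?vt (\<alpha> d)) | d. d \<in> Dr \<and> ou d}\<^sup>*)"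
      if e: "e \<in> Dr" "\<not> ou e" for e
      unfolding BR_def[symmetric]
    proof -
      obtain v u where ev: "e = (v, u)" by (cases e)
      have uv: "(u, v) \<in> IA" using e F by (auto simp: ev Dr ouA insert_commute)
      let ?A = "A - {(u, v)}"
      obtain s t where st: "s \<in> T" "t \<in> T" "(s, t) \<notin> ?A\<^sup>*" "(s, u) \<in> ?A\<^sup>*" "(v, t) \<in> ?A\<^sup>*"
        using IA_A[OF uv] by (elim crit2)
      have ae: "fst (\<alpha> e) = u" using e \<alpha>F(1)[of v u] by (simp add: ev Dr)
      have "(bl s, bl u) \<in> BR\<^sup>*" using rBR[OF sub_reach[OF st(4)]] .
      \<comment> \<open>If \<open>s\<close> reached the tail of another arc \<open>(u', v')\<close>
        into the same component, it could go over \<open>u'\<close> and \<open>v'\<close> to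
        \<open>v\<close> and on to \<open>t\<close>. This detour avoids \<open>(u, v)\<close>:
        otherwise the component of \<open>v\<close> would lead back to \<open>u\<close> or
        \<open>u'\<close>, making an arc between components lie on a cycle.\<close>
      moreover have "(bl s, ?vt (\<alpha> a)) \<notin> BR\<^sup>*" if a: "a \<in> Dr" "\<not> ou a" "?vt a = ?vt e" "a \<noteq> e" for a
      proof
        assume r: "(bl s, ?vt (\<alpha> a)) \<in> BR\<^sup>*"
        obtain v' u' where av: "a = (v', u')" by (cases a)
        have uv': "(u', v') \<in> IA" using a F by (auto simp: av Dr ouA insert_commute)
        have "fst (\<alpha> a) = u'" using a \<alpha>F(1)[of v' u'] by (simp add: av Dr)
        then have "(s, u') \<in> A\<^sup>*" using BRr[of s "bl u'" u'] r bl_self TC st(1) IAC[OF uv'] by (auto simp: P_def)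
        have bb: "bl v = bl v'" using a(3) by (simp add: av ev)
        then have vv: "(v, v') \<in> A\<^sup>*" "(v', v) \<in> A\<^sup>*" using bl_self[of v'] bl_self[of v] by (auto simp: bl_def)
        have n1: "(v, u') \<notin> A\<^sup>*" using uv' vv by (auto simp: IA_iff dest: rtrancl_trans)
        have n2: "(v', u) \<notin> A\<^sup>*" using uv vv by (auto simp: IA_iff dest: rtrancl_trans)
        have "(s, u') \<in> ?A\<^sup>*" using rtrancl_remove[OF \<open>(s, u') \<in> A\<^sup>*\<close>, of u v] n1 sub_reach by blast
        moreover have "(u', v') \<in> ?A" using uv' a(4) IA_A by (auto simp: av ev)
        moreover have "(v', v) \<in> ?A\<^sup>*" using rtrancl_remove[OF vv(2), of u v] n2 sub_reach by blast
        ultimately have "(s, t) \<in> ?A\<^sup>*" using st(5) by (meson rtrancl.rtrancl_into_rtrancl rtrancl_trans)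
        then show False using st(3) by blast
      qed
      ultimately show "\<exists>s\<in>bl ` T. (s, ?vt (\<alpha> e)) \<in> BR\<^sup>* \<and>
        (\<forall>a\<in>Dr. \<not> ou a \<longrightarrow> ?vt a = ?vt e \<longrightarrow> a \<noteq> e \<longrightarrow> (s, ?vt (\<alpha> a)) \<notin> BR\<^sup>*)"
        using st(1) ae by (intro bexI[of _ "bl s"]) auto
    qed
    show "card (egs \<alpha> Dr) + 2 \<le> card (?vt ` Dr) + card (fcs Dr nx \<alpha>) + (2 * genus E + 1)"
      unfolding nx(2,3) using \<sigma>(4) nx(4) by linarith
  qed
  have "card (egs \<alpha> Dr) \<le> card (?vt ` Dr) + q * (3 * q + 2 * (2 * genus E + 1)) + q + (2 * genus E + 1)"
    by (rule card_edges)
  then show ?thesis using \<sigma>(2,3) nx(2,3) cF by (simp add: B0_def)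
qed


section \<open>Strong components with terminals or several incoming or outgoing arcs\<close>

definition "ins p = {(x, y) \<in> IA. y \<in> p}"
definition "outs p = {(x, y) \<in> IA. x \<in> p}"
definition "big p \<longleftrightarrow> p \<in> P \<and> (p \<inter> T \<noteq> {} \<or> 2 \<le> card (ins p) \<or> 2 \<le> card (outs p))"
text \<open>The attachment vertices. A path between terminals starts, ends, enters and leaves
  \<open>p\<close> only there, so connecting them is all that is asked of the arcs inside
  \<open>p\<close>.\<close>

definition "X p = (T \<inter> p) \<union> snd ` ins p \<union> fst ` outs p"

lemma fin_ins: "finite (ins p)" "finite (outs p)"
  using finIA by (auto simp: ins_def outs_def intro: rev_finite_subset)

lemma sum_ins: "(\<Sum>p\<in>P. card (ins p)) = card IA" "(\<Sum>p\<in>P. card (outs p)) = card IA"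
proof -
  have c: "x \<in> C \<and> y \<in> C" if "(x, y) \<in> IA" for x y using IA_A[OF that] AC by blast
  have "IA = (\<Union>p\<in>P. ins p)" "IA = (\<Union>p\<in>P. outs p)"
    using c bl_self by (auto simp: ins_def outs_def P_def)
  moreover have "ins p \<inter> ins p' = {}" "outs p \<inter> outs p' = {}" if "p \<in> P" "p' \<in> P" "p \<noteq> p'" for p p'
    using P_disj[OF that] by (auto simp: ins_def outs_def)
  ultimately show "(\<Sum>p\<in>P. card (ins p)) = card IA" "(\<Sum>p\<in>P. card (outs p)) = card IA"
    using card_UN_disjoint[of P ins] card_UN_disjoint[of P outs] finP fin_ins by auto
qed

lemma bigP: "big p \<Longrightarrow> p \<in> P" by (simp add: big_def)
lemma fin_big: "finite {p. big p}" using finP by (rule rev_finite_subset) (auto simp: big_def)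

lemma whole_big:
  assumes "C \<in> P" shows "P = {C}" "IA = {}" "big C"
proof -
  show "P = {C}"
  proof
    show "P \<subseteq> {C}"
    proof
      fix p assume p: "p \<in> P"
      then obtain v where "v \<in> p" using bl_self by (auto simp: P_def)
      then show "p \<in> {C}" using P_disj[OF p assms] P_mem[OF p] by blast
    qed
  qed (use assms in simp)
  show "IA = {}"
  proof (rule ccontr)
    assume "IA \<noteq> {}"
    then obtain x y where xy: "(x, y) \<in> IA" by auto
    then have "x \<in> C" "y \<in> C" using IA_A AC by blast+
    then show False using IA_cross[OF xy assms] by blast
  qed
  show "big C" using assms Tne TC by (auto simp: big_def)
qed

lemma big_bounds:
  "(\<Sum>p | big p. card (ins p) + card (outs p)) \<le> 6 * B0 + 6 * q"
proof (cases "C \<in> P")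
  case True
  then have "ins p = {}" "outs p = {}" for p using whole_big(2) by (auto simp: ins_def outs_def)
  then show ?thesis by simp
next
  case False
  define N where "N = {p \<in> P. p \<inter> T = {}}"
  have one: "1 \<le> card (ins p)" "1 \<le> card (outs p)" if "p \<in> N" for p
  proof -
    have "p \<in> P" "p \<noteq> C" "p \<inter> T = {}" using that False by (auto simp: N_def)
    from blob_in_out[OF this] have "ins p \<noteq> {}" "outs p \<noteq> {}" by (auto simp: ins_def outs_def)
    then show "1 \<le> card (ins p)" "1 \<le> card (outs p)" using fin_ins by (simp_all add: Suc_le_eq card_gt_0_iff)
  qed
  have NP: "N \<subseteq> P" by (auto simp: N_def)
  have PN: "card (P - N) \<le> q"
  proof -
    have "P - N \<subseteq> bl ` T" using P_mem by (fastforce simp: N_def)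
    then have "card (P - N) \<le> card (bl ` T)" using finT by (intro card_mono) auto
    also have "\<dots> \<le> q" using card_image_le[OF finT, of bl] cT by linarith
    finally show ?thesis .
  qed
  have si: "(\<Sum>p\<in>P. card (ins p)) \<le> card P + B0" "(\<Sum>p\<in>P. card (outs p)) \<le> card P + B0"
    using sum_ins card_IA by auto
  have bs: "{p. big p} \<subseteq> P" "P - N \<subseteq> {p. big p}" by (auto simp: big_def N_def)
  have e1: "card {p \<in> N. 2 \<le> card (ins p)} \<le> B0 + q" by (rule excess(1)[OF finP NP one(1) si(1) PN])
  have e2: "card {p \<in> N. 2 \<le> card (outs p)} \<le> B0 + q" by (rule excess(1)[OF finP NP one(2) si(2) PN])
  have e3: "(\<Sum>p | big p. card (ins p)) \<le> B0 + card {p. big p}" by (rule excess(2)[OF finP NP one(1) si(1) PN bs(2,1)])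
  have e4: "(\<Sum>p | big p. card (outs p)) \<le> B0 + card {p. big p}" by (rule excess(2)[OF finP NP one(2) si(2) PN bs(2,1)])
  have "{p. big p} \<subseteq> (P - N) \<union> {p \<in> N. 2 \<le> card (ins p)} \<union> {p \<in> N. 2 \<le> card (outs p)}"
    by (auto simp: big_def N_def)
  then have "card {p. big p} \<le> card ((P - N) \<union> {p \<in> N. 2 \<le> card (ins p)} \<union> {p \<in> N. 2 \<le> card (outs p)})"
    using finP NP by (intro card_mono) (auto intro: finite_subset)
  also have "\<dots> \<le> card (P - N) + card {p \<in> N. 2 \<le> card (ins p)} + card {p \<in> N. 2 \<le> card (outs p)}"
    by (meson add_le_mono1 card_Un_le order_trans)
  \<comment> \<open>\<open>q\<close> for the terminals and \<open>B0 + q\<close> for each direction.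
    By \<open>e3\<close> and \<open>e4\<close> another \<open>B0\<close> is added and the result
    doubled, which gives \<open>6 * B0 + 6 * q\<close>.\<close>
  finally have "card {p. big p} \<le> 2 * B0 + 3 * q" using e1 e2 PN by linarith
  then show ?thesis using e3 e4 by (simp add: sum.distrib)
qed

lemma X_bounds: "card (X p) \<le> card (T \<inter> p) + card (ins p) + card (outs p)"
proof -
  have "card (X p) \<le> card (T \<inter> p) + card (snd ` ins p) + card (fst ` outs p)"
    unfolding X_def by (meson add_le_mono1 card_Un_le order_trans)
  also have "\<dots> \<le> card (T \<inter> p) + card (ins p) + card (outs p)"
    using card_image_le[OF fin_ins(1), of snd p] card_image_le[OF fin_ins(2), of fst p] by linarith
  finally show ?thesis .
qed

text \<open>Suppose that a proper subset \<open>A'\<close> of the arcs still connects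
  \<open>X p\<close>. The path of a pair runs through \<open>p\<close> between members of
  \<open>X p\<close>, and these segments can be rerouted in \<open>A'\<close>; so the pair that
  needs a missing arc would stay connected without it.\<close>

lemma big_arrangement:
  assumes p: "big p"
  shows "\<exists>xs M. arrangement (AS p) M xs \<and> set xs = p \<and> X p \<subseteq> M \<and> card M \<le> 6 * card (X p)"
proof (rule sconn_arrangement)
  have pP: "p \<in> P" by (rule bigP[OF p])
  show "sconn (AS p) p" using blob_conn[OF pP] by (auto simp: sconn_def)
  show "AS p \<subseteq> p \<times> p" by (auto simp: AS_def)
  show "finite (X p)" using finT fin_ins by (simp add: X_def)
  show "X p \<subseteq> p" by (auto simp: X_def ins_def outs_def)
  show "X p \<noteq> {}" using p by (auto simp: X_def big_def)
  fix A' assume A': "A' \<subseteq> AS p" "sconn A' (X p)"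
  show "A' = AS p"
  proof (rule ccontr)
    assume "A' \<noteq> AS p"
    then obtain e where e: "e \<in> AS p" "e \<notin> A'" using A' by blast
    let ?R = "A' \<union> (A - AS p)"
    have eA: "e \<in> A" using e by (auto simp: AS_def)
    have RA: "?R \<subseteq> A - {e}" using A' e by (auto simp: AS_def)
    obtain s t where st: "s \<in> T" "t \<in> T" "(s, t) \<in> A\<^sup>*" "(s, t) \<notin> (A - {e})\<^sup>*" using crit[OF eA] by blast
    have mA: "(x, y) \<in> ?R\<^sup>*" if "(x, y) \<in> A'\<^sup>*" for x y using that rtrancl_mono[of A' ?R] by blast
    have XX: "(x, y) \<in> ?R\<^sup>*" if "x \<in> X p" "y \<in> X p" for x y using mA A'(2) that by (auto simp: sconn_def)
    \<comment> \<open>Inside \<open>p\<close> the induction only records that some attachment vertex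
      has been reached; the way from there to the vertex of exit is taken from
      \<open>XX\<close>.\<close>
    have "if t \<in> p then \<exists>x\<in>X p. (s, x) \<in> ?R\<^sup>* else (s, t) \<in> ?R\<^sup>*"
      using st(3)
    proof (induction)
      case base
      then show ?case using st(1) by (auto simp: X_def intro: bexI[of _ s])
    next
      case (step y z)
      have yz: "(y, z) \<in> ?R" if "\<not> (y \<in> p \<and> z \<in> p)" using step(2) that by (auto simp: AS_def)
      show ?case
      proof (cases "y \<in> p")
        case True
        then obtain x where x: "x \<in> X p" "(s, x) \<in> ?R\<^sup>*" using step.IH by auto
        show ?thesis
        proof (cases "z \<in> p")
          case True then show ?thesis using x by auto
        next
          case False
          then have "(y, z) \<in> IA" using cross_IA[OF step(2) pP] \<open>y \<in> p\<close> by blast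
          then have "y \<in> X p" using \<open>y \<in> p\<close> by (force simp: X_def outs_def)
          then have "(s, y) \<in> ?R\<^sup>*" using x XX by (meson rtrancl_trans)
          then show ?thesis using False yz by (auto intro: rtrancl.rtrancl_into_rtrancl)
        qed
      next
        case False
        then have sy: "(s, y) \<in> ?R\<^sup>*" "(y, z) \<in> ?R" using step.IH yz by auto
        then have sz: "(s, z) \<in> ?R\<^sup>*" by (rule rtrancl.rtrancl_into_rtrancl)
        show ?thesis
        proof (cases "z \<in> p")
          case True
          then have "(y, z) \<in> IA" using cross_IA[OF step(2) pP] False by blast
          then have "z \<in> X p" using True by (force simp: X_def ins_def)
          then show ?thesis using True sz by auto
        next
          case False then show ?thesis using sz by simp
        qed
      qed
    qed
    then have "(s, t) \<in> ?R\<^sup>*"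
    proof (cases "t \<in> p")
      case True
      then have "t \<in> X p" using st(2) by (simp add: X_def)
      moreover obtain x where "x \<in> X p" "(s, x) \<in> ?R\<^sup>*" using \<open>if t \<in> p then _ else _\<close> True by auto
      ultimately show ?thesis using XX[of x t] by (meson rtrancl_trans)
    qed simp
    then show False using st(4) rtrancl_mono[OF RA] by blast
  qed
qed

text \<open>The component is entered by one arc only, at \<open>y\<close>. If it had another vertex,
  it would contain an arc \<open>(z, y)\<close>. But a path from a terminal to \<open>z\<close> must
  enter at \<open>y\<close>, so the source of the pair that needs \<open>(z, y)\<close> reaches
  \<open>y\<close> without this arc.\<close>

lemma small_blob:
  assumes p: "p \<in> P" "\<not> big p"
  shows "\<exists>v. p = {v}"
proof -
  have pC: "p \<noteq> C" using whole_big p by blast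
  have pT: "p \<inter> T = {}" and one: "\<not> 2 \<le> card (ins p)" using p by (auto simp: big_def)
  from blob_in_out(1)[OF p(1) pC pT] obtain u y where uy: "(u, y) \<in> IA" "y \<in> p" by blast
  have ent: "b = y" if "(a, b) \<in> A" "a \<notin> p" "b \<in> p" for a b
  proof -
    have "(a, b) \<in> ins p" "(u, y) \<in> ins p" using cross_IA[OF that(1) p(1)] that uy by (auto simp: ins_def)
    then have "(a, b) = (u, y)" using one fin_ins(1)[of p] by (metis Suc_le_eq card_le_Suc0_iff_eq not_less_eq_eq numeral_2_eq_2)
    then show ?thesis by simp
  qed
  have "p = {y}"
  proof (rule ccontr)
    assume "p \<noteq> {y}"
    then obtain w where w: "w \<in> p" "w \<noteq> y" using uy by blast
    from blob_conn[OF p(1) w(1) uy(2)] obtain z where z: "(z, y) \<in> AS p"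
      by (cases rule: rtranclE) (use w in auto)
    then have zy: "(z, y) \<in> A" "z \<in> p" by (auto simp: AS_def)
    let ?A = "A - {(z, y)}"
    obtain s t where st: "s \<in> T" "t \<in> T" "(s, t) \<notin> ?A\<^sup>*" "(s, z) \<in> ?A\<^sup>*" "(y, t) \<in> ?A\<^sup>*"
      using zy(1) by (elim crit2)
    have "s \<notin> p" using pT st by blast
    from rtrancl_enter[OF st(4) this zy(2)] obtain a b where ab: "(a, b) \<in> ?A" "a \<notin> p" "b \<in> p" "(s, a) \<in> ?A\<^sup>*" by blast
    then have "b = y" using ent[of a b] by blast
    then have "(s, y) \<in> ?A\<^sup>*" using ab by (meson rtrancl.rtrancl_into_rtrancl)
    then show False using st(3,5) by (meson rtrancl_trans)
  qed
  then show ?thesis by blast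
qed

definition "W = {v \<in> C. \<not> big (bl v)}"

lemma W_bl: "v \<in> W \<Longrightarrow> bl v = {v} \<and> bl v \<in> P \<and> \<not> big (bl v)"
  using small_blob[of "bl v"] bl_self[of v] by (auto simp: W_def P_def)

lemma W_IA: "(x, y) \<in> A \<Longrightarrow> x \<in> W \<or> y \<in> W \<Longrightarrow> (x, y) \<in> IA"
  using noloop cross_IA[of x y "bl x"] cross_IA[of x y "bl y"] W_bl[of x] W_bl[of y] by fastforce

lemma W_unique:
  assumes "v \<in> W"
  shows "(x, v) \<in> A \<Longrightarrow> (y, v) \<in> A \<Longrightarrow> x = y" "(v, x) \<in> A \<Longrightarrow> (v, y) \<in> A \<Longrightarrow> x = y"
proof -
  have c: "\<not> 2 \<le> card (ins (bl v))" "\<not> 2 \<le> card (outs (bl v))" using W_bl[OF assms] by (auto simp: big_def)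
  have u: "d = e" if "d \<in> S" "e \<in> S" "\<not> 2 \<le> card S" "finite S" for d e :: "'a \<times> 'a" and S
    using that by (metis Suc_le_eq card_le_Suc0_iff_eq not_less_eq_eq numeral_2_eq_2)
  show "x = y" if "(x, v) \<in> A" "(y, v) \<in> A"
  proof -
    have "(x, v) \<in> ins (bl v)" "(y, v) \<in> ins (bl v)" using that W_IA assms bl_self by (auto simp: ins_def)
    from u[OF this c(1) fin_ins(1)] show ?thesis by simp
  qed
  show "x = y" if "(v, x) \<in> A" "(v, y) \<in> A"
  proof -
    have "(v, x) \<in> outs (bl v)" "(v, y) \<in> outs (bl v)" using that W_IA assms bl_self by (auto simp: outs_def)
    from u[OF this c(2) fin_ins(2)] show ?thesis by simp
  qed
qed

lemma W_arrangement:
  assumes M: "M \<subseteq> W"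
  shows "\<exists>xs. arrangement (AS W) M xs \<and> set xs = W"
proof -
  have finW: "finite W" using finC by (simp add: W_def)
  have sub: "AS W \<subseteq> W \<times> W" by (auto simp: AS_def)
  have ac: "acyclic (AS W)"
  proof (rule acyclicI, intro allI notI)
    fix x assume "(x, x) \<in> (AS W)\<^sup>+"
    then obtain z where z: "(x, z) \<in> AS W" "(z, x) \<in> (AS W)\<^sup>*" by (meson tranclD)
    have "AS W \<subseteq> A" by (auto simp: AS_def)
    then have "(z, x) \<in> A\<^sup>*" using z(2) rtrancl_mono by blast
    moreover have "(x, z) \<in> IA" using z(1) W_IA by (auto simp: AS_def)
    ultimately show False by (simp add: IA_iff)
  qed
  have u1: "y = z" if "(x, y) \<in> AS W" "(x, z) \<in> AS W" for x y z using that W_unique(2)[of x y z] by (auto simp: AS_def)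
  have u2: "y = z" if "(y, x) \<in> AS W" "(z, x) \<in> AS W" for x y z using that W_unique(1)[of x y z] by (auto simp: AS_def)
  have "\<exists>xs. distinct xs \<and> set xs = W \<and> (\<forall>(x, y)\<in>AS W. \<exists>ps qs. xs = ps @ x # y # qs)"
    by (rule consecutive_list[OF finW sub ac]) (fact u1, fact u2)
  then obtain xs where xs0: "distinct xs \<and> set xs = W \<and> (\<forall>(x, y)\<in>AS W. \<exists>ps qs. xs = ps @ x # y # qs)" by (elim exE)
  then have H: "\<forall>e\<in>AS W. case e of (x, y) \<Rightarrow> \<exists>ps qs. xs = ps @ x # y # qs" by (elim conjE)
  have xs3: "\<exists>ps qs. xs = ps @ x # y # qs" if "(x, y) \<in> AS W" for x y
    using bspec[OF H that] by (simp only: prod.case)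
  have "arrangement (AS W) M xs"
    by (rule consecutive_arrangement[OF sub u1 u2 _ _ xs3 M]) (use xs0 in \<open>simp_all only:\<close>)
  then show ?thesis using xs0 by blast
qed

text \<open>The arrangements of \<open>W\<close> and of the big components are concatenated. If
  \<open>s\<close> is the sum in \<open>big_bounds\<close>, the big components contribute at most
  \<open>6 * q + 6 * s\<close> marks and \<open>MW\<close> at most \<open>s\<close>; with
  \<open>s \<le> 6 * B0 + 6 * q\<close> this is \<open>42 * B0 + 48 * q\<close>.\<close>

lemma critical_arrangement:
  "\<exists>xs M. arrangement A M xs \<and> set xs = C \<and> M \<noteq> {} \<and> card M \<le> 42 * B0 + 48 * q"
proof -
  have "\<forall>p\<in>{p. big p}. \<exists>M. \<exists>xs. arrangement (AS p) M xs \<and> set xs = p \<and> X p \<subseteq> M \<and> card M \<le> 6 * card (X p)"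
    using big_arrangement by blast
  then obtain Mb where Mb: "\<forall>p\<in>{p. big p}. \<exists>xs. arrangement (AS p) (Mb p) xs \<and> set xs = p \<and> X p \<subseteq> Mb p \<and> card (Mb p) \<le> 6 * card (X p)"
    by (rule bchoice[THEN exE])
  \<comment> \<open>An arc between two parts is exempt only if both its ends are marked, so the
    neighbours of big components within \<open>W\<close> are marked as well.\<close>
  define MW where "MW = {v \<in> W. \<exists>u\<in>C - W. (u, v) \<in> A \<or> (v, u) \<in> A}"
  define MM where "MM p = (if p = W then MW else Mb p)" for p
  have bigW: "v \<notin> W" if "big p" "v \<in> p" for p v
    using P_mem[OF bigP[OF that(1)] that(2)] that(1) by (auto simp: W_def)
  have neW: "p \<noteq> W" if bp: "big p" for p
  proof -
    obtain v where "v \<in> p" using bigP[OF bp] bl_self by (auto simp: P_def)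
    then show ?thesis using bigW[OF bp] by blast
  qed
  let ?J = "insert W {p. big p}"
  have mem: "\<exists>p\<in>?J. x \<in> p" if "x \<in> C" for x
    using that bl_self[of x] by (cases "x \<in> W") (auto simp: W_def)
  have "\<exists>xs. arrangement A (\<Union>(MM ` ?J)) xs \<and> set xs = \<Union>((\<lambda>p. p) ` ?J)"
  proof (rule arrangement_Union[where AS = AS])
    show "finite ?J" using fin_big by simp
    show "\<exists>xs. arrangement (AS p) (MM p) xs \<and> set xs = p" if p: "p \<in> ?J" for p
    proof (cases "p = W")
      case True
      then show ?thesis using W_arrangement[of MW] by (auto simp: MM_def MW_def)
    next
      case False
      then have "big p" using p by blast
      then show ?thesis using Mb False by (auto simp: MM_def)
    qed
    show "p \<inter> p' = {}" if "p \<in> ?J" "p' \<in> ?J" "p \<noteq> p'" for p p'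
      using that bigW P_disj bigP by blast
    fix x y assume xy: "(x, y) \<in> A"
    then have xyC: "x \<in> C" "y \<in> C" using AC by auto
    obtain p where p1: "p \<in> ?J" "x \<in> p" using mem[OF xyC(1)] by (elim bexE)
    obtain p' where p2: "p' \<in> ?J" "y \<in> p'" using mem[OF xyC(2)] by (elim bexE)
    note p = p1 p2
    have other: "z \<in> C - W" if "z \<in> p" "big p" for z p using that bigW P_mem[OF bigP] by blast
    show "(\<exists>p\<in>?J. (x, y) \<in> AS p) \<or> (\<exists>p\<in>?J. \<exists>p'\<in>?J. p \<noteq> p' \<and> x \<in> MM p \<and> y \<in> MM p')"
    proof (cases "p = p'")
      case True then show ?thesis using p xy by (auto simp: AS_def)
    next
      case False
      have "x \<in> MM p"
      proof (cases "p = W")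
        case True
        then have "y \<in> C - W" using p other False by blast
        then show ?thesis using True xy p by (auto simp: MM_def MW_def)
      next
        case pW: False
        then have bp: "big p" using p by blast
        have "y \<notin> p"
        proof
          assume y: "y \<in> p"
          then have "y \<notin> W" using bigW bp by blast
          then have "big p'" using p by blast
          then show False using P_disj[OF bigP[OF bp] bigP[of p'] False] y p by blast
        qed
        then have "(x, y) \<in> IA" using cross_IA[OF xy bigP[OF bp]] p by blast
        then have "x \<in> X p" using p by (force simp: X_def outs_def)
        then show ?thesis using Mb bp pW by (auto simp: MM_def)
      qed
      moreover have "y \<in> MM p'"
      proof (cases "p' = W")
        case True
        then have "x \<in> C - W" using p other False by blast
        then show ?thesis using True xy p by (auto simp: MM_def MW_def)
      next
        case pW: False
        then have bp: "big p'" using p by blast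
        have "x \<notin> p'"
        proof
          assume x: "x \<in> p'"
          then have "x \<notin> W" using bigW bp by blast
          then have "big p" using p by blast
          then show False using P_disj[OF bigP[of p] bigP[OF bp] False] x p by blast
        qed
        then have "(x, y) \<in> IA" using cross_IA[OF xy bigP[OF bp]] p by blast
        then have "y \<in> X p'" using p by (force simp: X_def ins_def)
        then show ?thesis using Mb bp pW by (auto simp: MM_def)
      qed
      ultimately show ?thesis using False p by blast
    qed
  qed
  then obtain xs where xs: "arrangement A (\<Union>(MM ` ?J)) xs" "set xs = \<Union>((\<lambda>p. p) ` ?J)" by blast
  have "set xs = C"
  proof -
    have "\<Union>((\<lambda>p. p) ` ?J) = C"
    proof
      show "\<Union>((\<lambda>p. p) ` ?J) \<subseteq> C" using P_mem bigP by (auto simp: W_def)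
      show "C \<subseteq> \<Union>((\<lambda>p. p) ` ?J)" using mem by auto
    qed
    then show ?thesis using xs by simp
  qed
  moreover have "\<Union>(MM ` ?J) \<noteq> {}"
  proof -
    obtain t where t: "t \<in> T" using Tne by blast
    have b: "big (bl t)" using t TC bl_self[of t] by (auto simp: big_def P_def)
    then have "t \<in> X (bl t)" using t bl_self[of t] by (auto simp: X_def)
    then have "t \<in> MM (bl t)" using Mb b neW[OF b] by (auto simp: MM_def)
    then show ?thesis using b by blast
  qed
  moreover have "card (\<Union>(MM ` ?J)) \<le> 42 * B0 + 48 * q"
  proof -
    let ?s = "\<Sum>p | big p. card (ins p) + card (outs p)"
    have "\<Union>(MM ` ?J) = MW \<union> (\<Union>p\<in>{p. big p}. Mb p)" using neW by (auto simp: MM_def)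
    then have "card (\<Union>(MM ` ?J)) \<le> card MW + card (\<Union>p\<in>{p. big p}. Mb p)" using card_Un_le by metis
    moreover have "card (\<Union>p\<in>{p. big p}. Mb p) \<le> (\<Sum>p | big p. card (Mb p))" by (rule card_UN_le[OF fin_big])
    moreover have "(\<Sum>p | big p. card (Mb p)) \<le> (\<Sum>p | big p. 6 * (card (T \<inter> p) + (card (ins p) + card (outs p))))"
    proof (rule sum_mono)
      fix p assume "p \<in> {p. big p}"
      then have "card (Mb p) \<le> 6 * card (X p)" using Mb by blast
      then show "card (Mb p) \<le> 6 * (card (T \<inter> p) + (card (ins p) + card (outs p)))" using X_bounds[of p] by (simp add: algebra_simps)
    qed
    moreover have "(\<Sum>p | big p. 6 * (card (T \<inter> p) + (card (ins p) + card (outs p)))) = 6 * (\<Sum>p | big p. card (T \<inter> p)) + 6 * ?s"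
      by (simp add: sum.distrib sum_distrib_left)
    moreover have "(\<Sum>p | big p. card (T \<inter> p)) \<le> q"
    proof -
      have "(\<Sum>p | big p. card (T \<inter> p)) = card (\<Union>p\<in>{p. big p}. T \<inter> p)"
        using P_disj bigP finT fin_big by (intro card_UN_disjoint[symmetric]) auto
      also have "\<dots> \<le> card T" using finT by (intro card_mono) auto
      finally show ?thesis using cT by linarith
    qed
    moreover have "card MW \<le> ?s"
    proof -
      have "MW \<subseteq> (\<Union>p\<in>{p. big p}. fst ` ins p \<union> snd ` outs p)"
      proof
        fix v assume "v \<in> MW"
        then obtain u where u: "v \<in> W" "u \<in> C" "u \<notin> W" "(u, v) \<in> A \<or> (v, u) \<in> A" by (auto simp: MW_def)
        then have b: "big (bl u)" by (simp add: W_def)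
        have "(u, v) \<in> outs (bl u) \<or> (v, u) \<in> ins (bl u)"
          using u W_IA bl_self[of u] by (auto simp: ins_def outs_def)
        then have "v \<in> fst ` ins (bl u) \<union> snd ` outs (bl u)" by force
        then show "v \<in> (\<Union>p\<in>{p. big p}. fst ` ins p \<union> snd ` outs p)" using b by blast
      qed
      then have "card MW \<le> card (\<Union>p\<in>{p. big p}. fst ` ins p \<union> snd ` outs p)"
        using fin_big fin_ins by (intro card_mono) auto
      also have "\<dots> \<le> (\<Sum>p | big p. card (fst ` ins p \<union> snd ` outs p))" by (rule card_UN_le[OF fin_big])
      also have "\<dots> \<le> ?s"
      proof (rule sum_mono)
        fix p
        show "card (fst ` ins p \<union> snd ` outs p) \<le> card (ins p) + card (outs p)"
          using card_Un_le[of "fst ` ins p" "snd ` outs p"] card_image_le[OF fin_ins(1), of fst p] card_image_le[OF fin_ins(2), of snd p] by linarith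
      qed
      finally show ?thesis .
    qed
    ultimately show ?thesis using big_bounds by linarith
  qed
  ultimately show ?thesis using xs(1) by blast
qed

text \<open>Here the quadratic number of marks becomes a linear width: with layer distance
  \<open>q\<close>, the division leaves at most \<open>3150 * q + 3150 * G + 2250\<close>, which is
  at most \<open>14850 * k\<close> as \<open>G \<le> 3 * m\<close>. With \<open>9 * k\<close> for
  the tree paths, \<open>(9 + 14850) * 9 + 14 = 133745\<close> stays below
  \<open>133800\<close>.\<close>

theorem critical_has_td:
  "has_td C (ugraph_edges A) (133800 * max (genus E) 1 * q)"
proof -
  obtain xs M where xs: "arrangement A M xs" "set xs = C" "M \<noteq> {}" "card M \<le> 42 * B0 + 48 * q"
    using critical_arrangement by metis
  define m where "m = max (genus E) 1"
  define G where "G = 2 * genus E + 1"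
  have G: "G \<le> 3 * m" by (simp add: G_def m_def)
  have m1: "1 \<le> m" by (simp add: m_def)
  define k where "k = m * q"
  have mq: "q \<le> k" "m \<le> k" "1 \<le> k" using m1 q_pos by (auto simp: k_def)
  have td: "has_td C (ugraph_edges A) (((2 * G + 3) * q + 25 * card M div q) * 9 + 14)"
    using arrangement_has_td[OF finE E2 xs(1) UE _ xs(3) q_pos] conn unfolding xs(2) G_def by blast
  have B: "B0 = q * (3 * q + 2 * G + 1) + G" by (simp add: B0_def G_def algebra_simps)
  have "25 * card M div q \<le> (25 * (42 * (3 * q + 2 * G + 1) + 48) * q + 1050 * G) div q"
    by (rule div_le_mono) (use xs(4) B in \<open>simp add: algebra_simps\<close>)
  also have "\<dots> = 25 * (42 * (3 * q + 2 * G + 1) + 48) + 1050 * G div q" using q_pos by simp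
  also have "\<dots> \<le> 25 * (42 * (3 * q + 2 * G + 1) + 48) + 1050 * G" using div_le_dividend by simp
  also have "\<dots> \<le> 14850 * k" using G mq by (simp add: algebra_simps)
  finally have d: "25 * card M div q \<le> 14850 * k" .
  have "(2 * G + 3) * q \<le> 9 * k" using mult_right_mono[of "2 * G + 3" "9 * m" q] G m1 by (simp add: k_def)
  then have "((2 * G + 3) * q + 25 * card M div q) * 9 + 14 \<le> 133800 * k"
  proof -
    have "(a + b) * 9 + 14 \<le> 133800 * k" if "a \<le> 9 * k" "b \<le> 14850 * k" for a b
      using that mq(3) by simp
    then show ?thesis using \<open>(2 * G + 3) * q \<le> 9 * k\<close> d by blast
  qed
  then show ?thesis using has_td_mono[OF td] unfolding k_def m_def by (simp add: mult.assoc) blast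
qed

end

section \<open>Minimal solutions\<close>

lemma has_td_edgeless:
  assumes "finite C"
  shows "has_td C {} 1"
proof -
  obtain xs where xs: "distinct xs" "set xs = C" using finite_distinct_list[OF assms] by blast
  have "has_td (set xs) {{x, y} | x y. x \<in> set xs \<and> y \<in> set xs \<and> False} (0 + 1)"
    by (rule has_td_linear) (use xs in \<open>auto simp: cut_left_def\<close>)
  then show ?thesis using xs(2) by simp
qed

text \<open>The solution is split into weak components. The path of a pair that needs an arc stays
  in the component of this arc, so criticality is inherited with the terminals of that component.
  Isolated vertices need bags of size one, which is the reason for the \<open>+ 1\<close>; it
  disappears again when bag size is turned into width.\<close>

lemma min_solution_has_td:
  fixes V :: "'a set"
  assumes V: "finite V" "A \<subseteq> V \<times> V" and R: "VR \<subseteq> V" "AR \<subseteq> VR \<times> VR"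
    and min: "is_min_solution V A AR VH AH"
  shows "has_td VH (ugraph_edges AH) (133800 * max (genus (ugraph_edges A)) 1 * card VR + 1)"
proof -
  let ?U = "ugraph_edges AH"
  define w where "w = 133800 * max (genus (ugraph_edges A)) 1 * card VR + 1"
  have sub: "VH \<subseteq> V" "AH \<subseteq> A" "AH \<subseteq> VH \<times> VH" and sol: "is_solution AR VH AH"
    and crit: "\<And>e. e \<in> AH \<Longrightarrow> \<not> is_solution AR VH (AH - {e})"
    using min by (auto simp: is_min_solution_def is_subgraph_def)
  have finVH: "finite VH" using sub(1) V(1) finite_subset by blast
  have finVR: "finite VR" using R(1) V(1) finite_subset by blast
  have finA: "finite A" using V finite_subset by blast
  have critT: "\<exists>s\<in>VR \<inter> VH. \<exists>t\<in>VR \<inter> VH. (s, t) \<in> AH\<^sup>* \<and> (s, t) \<notin> (AH - {e})\<^sup>*" if e: "e \<in> AH" for e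
  proof -
    obtain s t where st: "(s, t) \<in> AR" "\<not> (s \<in> VH \<and> t \<in> VH \<and> (s, t) \<in> (AH - {e})\<^sup>*)"
      using crit[OF e] by (auto simp: is_solution_def)
    then have "s \<in> VH \<and> t \<in> VH \<and> (s, t) \<in> AH\<^sup>*" using sol by (auto simp: is_solution_def)
    then show ?thesis using st R(2) by blast
  qed
  have Uadj: "(x, y) \<in> adj ?U \<longleftrightarrow> ((x, y) \<in> AH \<or> (y, x) \<in> AH) \<and> x \<noteq> y" for x y
    by (auto simp: adj_def ugraph_edges_def doubleton_eq_iff)
  have symU: "sym (adj ?U)" by (auto simp: sym_def Uadj)
  have AHadj: "(x, y) \<in> (adj ?U)\<^sup>*" if "(x, y) \<in> AH\<^sup>*" for x y
    using that
  proof (induction)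
    case (step y z)
    then show ?case by (cases "y = z") (auto simp: Uadj intro: rtrancl.rtrancl_into_rtrancl)
  qed simp
  define K where "K v = {u. (v, u) \<in> (adj ?U)\<^sup>*}" for v
  have symU': "(x, y) \<in> (adj ?U)\<^sup>* \<Longrightarrow> (y, x) \<in> (adj ?U)\<^sup>*" for x y
    using symU by (meson sym_rtrancl symD)
  have K_self: "v \<in> K v" for v by (simp add: K_def)
  have K_eq: "u \<in> K v \<Longrightarrow> K u = K v" for u v
    unfolding K_def using symU' rtrancl_trans by (metis (no_types, lifting) mem_Collect_eq Collect_cong)
  have KVH: "K v \<subseteq> VH" if "v \<in> VH" for v
  proof
    fix u assume "u \<in> K v"
    then have "(v, u) \<in> (adj ?U)\<^sup>*" by (simp add: K_def)
    then show "u \<in> VH" using that by (induction) (use sub(3) in \<open>auto simp: Uadj\<close>)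
  qed
  have KA: "(x, y) \<in> AH \<Longrightarrow> x \<in> C \<longleftrightarrow> y \<in> C" if C: "C \<in> K ` VH" for x y C
  proof -
    assume xy: "(x, y) \<in> AH"
    then have "y \<in> K x" "x \<in> K y" using AHadj[of x y] symU' by (auto simp: K_def)
    then show "x \<in> C \<longleftrightarrow> y \<in> C" using C K_eq by (metis (no_types, lifting) image_iff)
  qed
  have Kpath: "(x, y) \<in> (AH \<inter> C \<times> C)\<^sup>* \<and> y \<in> C" if C: "C \<in> K ` VH" and xy: "(x, y) \<in> AH\<^sup>*" "x \<in> C" for x y C
    using xy
  proof (induction)
    case (step y z)
    then have "(y, z) \<in> AH \<inter> C \<times> C" using KA[OF C step(2)] by auto
    then show ?case using step by (auto intro: rtrancl.rtrancl_into_rtrancl)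
  qed simp
  have td: "has_td C (ugraph_edges (AH \<inter> C \<times> C)) w" if C: "C \<in> K ` VH" for C
  proof (cases "AH \<inter> C \<times> C = {}")
    case True
    have "finite C" using C KVH finVH finite_subset by blast
    from has_td_edgeless[OF this] show ?thesis by (rule has_td_mono) (use True in \<open>auto simp: w_def ugraph_edges_def\<close>)
  next
    case False
    have CVH: "C \<subseteq> VH" using C KVH by blast
    have Kc: "K v = C" if "v \<in> C" for v using that C K_eq by auto
    interpret critical_digraph "AH \<inter> C \<times> C" C "VR \<inter> C" "ugraph_edges A" "card VR"
    proof
      show "finite C" using CVH finVH finite_subset by blast
      show "AH \<inter> C \<times> C \<subseteq> C \<times> C" "VR \<inter> C \<subseteq> C" by auto
      show "card (VR \<inter> C) \<le> card VR" using finVR by (intro card_mono) auto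
      show "finite (ugraph_edges A)"
      proof -
        have "ugraph_edges A \<subseteq> (\<lambda>(u, v). {u, v}) ` A" by (auto simp: ugraph_edges_def)
        then show ?thesis using finA finite_subset by blast
      qed
      show "\<exists>u v. e = {u, v} \<and> u \<noteq> v" if "e \<in> ugraph_edges A" for e using that by (auto simp: ugraph_edges_def)
      show "ugraph_edges (AH \<inter> C \<times> C) \<subseteq> ugraph_edges A" using sub(2) unfolding ugraph_edges_def by blast
      show "AH \<inter> C \<times> C \<noteq> {}" by (rule False)
      show "(u, v) \<in> (adj (ugraph_edges (AH \<inter> C \<times> C)))\<^sup>*" if uv: "u \<in> C" "v \<in> C" for u v
      proof -
        have "(u, v) \<in> (adj ?U)\<^sup>*" using Kc[OF uv(1)] uv(2) by (auto simp: K_def)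
        then have "(u, v) \<in> (adj (ugraph_edges (AH \<inter> C \<times> C)))\<^sup>* \<and> v \<in> C" using uv(1)
        proof (induction)
          case (step y z)
          have yC: "y \<in> C" using step by blast
          have yz: "((y, z) \<in> AH \<or> (z, y) \<in> AH) \<and> y \<noteq> z" using step(2) by (simp add: Uadj)
          then have zC: "z \<in> C" using KA[OF C] yC by blast
          then have "(y, z) \<in> adj (ugraph_edges (AH \<inter> C \<times> C))" using yz yC
            by (auto simp: adj_def ugraph_edges_def doubleton_eq_iff)
          then show ?case using step zC by (auto intro: rtrancl.rtrancl_into_rtrancl)
        qed simp
        then show ?thesis by blast
      qed
      show "\<exists>s\<in>VR \<inter> C. \<exists>t\<in>VR \<inter> C. (s, t) \<in> (AH \<inter> C \<times> C)\<^sup>* \<and> (s, t) \<notin> (AH \<inter> C \<times> C - {e})\<^sup>*"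
        if e: "e \<in> AH \<inter> C \<times> C" for e
      proof -
        obtain u v where uv: "e = (u, v)" by (cases e)
        have eH: "e \<in> AH" using e by blast
        from critT[OF eH] obtain s t where st: "s \<in> VR" "t \<in> VR" "(s, t) \<in> AH\<^sup>*" "(s, t) \<notin> (AH - {e})\<^sup>*" by blast
        have "(s, u) \<in> (AH - {(u, v)})\<^sup>*" using rtrancl_remove[OF st(3), of u v] st(4) uv by blast
        then have "(s, u) \<in> AH\<^sup>*" using rtrancl_mono[of "AH - {(u, v)}" AH] by blast
        then have "s \<in> K u" using AHadj symU' by (auto simp: K_def)
        then have sC: "s \<in> C" using Kc[of u] e uv by auto
        have p: "(s, t) \<in> (AH \<inter> C \<times> C)\<^sup>* \<and> t \<in> C" by (rule Kpath[OF C st(3) sC])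
        have "AH \<inter> C \<times> C - {e} \<subseteq> AH - {e}" by blast
        then have "(s, t) \<notin> (AH \<inter> C \<times> C - {e})\<^sup>*" using st(4) rtrancl_mono by blast
        then show ?thesis using st p sC by blast
      qed
    qed
    show ?thesis by (rule has_td_mono[OF critical_has_td]) (auto simp: w_def)
  qed
  have "has_td (\<Union>C\<in>K ` VH. C) (\<Union>C\<in>K ` VH. ugraph_edges (AH \<inter> C \<times> C)) w"
  proof (rule has_td_disjoint_Union)
    show "finite (K ` VH)" using finVH by simp
    show "has_td C (ugraph_edges (AH \<inter> C \<times> C)) w" if "C \<in> K ` VH" for C by (rule td[OF that])
    show "e \<subseteq> C" if "e \<in> ugraph_edges (AH \<inter> C \<times> C)" for C e using that by (auto simp: ugraph_edges_def)
    show "C \<inter> C' = {}" if "C \<in> K ` VH" "C' \<in> K ` VH" "C \<noteq> C'" for C C'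
    proof (rule ccontr)
      assume "C \<inter> C' \<noteq> {}"
      then obtain z where "z \<in> C" "z \<in> C'" by blast
      then have "K z = C" "K z = C'" using that K_eq by auto
      then show False using that by simp
    qed
  qed
  moreover have "(\<Union>C\<in>K ` VH. C) = VH" using KVH K_self by blast
  ultimately have "has_td VH (\<Union>C\<in>K ` VH. ugraph_edges (AH \<inter> C \<times> C)) w" by simp
  then show ?thesis unfolding w_def[symmetric]
  proof (rule has_td_mono)
    fix e assume "e \<in> ?U"
    then obtain u v where uv: "e = {u, v}" "(u, v) \<in> AH" "u \<noteq> v" by (auto simp: ugraph_edges_def)
    have u: "u \<in> VH" using uv sub(3) by blast
    then have "u \<in> K u" "v \<in> K u" using uv K_self KA[of "K u" u v] by auto
    then have "e \<in> ugraph_edges (AH \<inter> K u \<times> K u)" using uv by (auto simp: ugraph_edges_def)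
    then show "\<exists>e'\<in>\<Union>C\<in>K ` VH. ugraph_edges (AH \<inter> C \<times> C). e \<subseteq> e'" using u by blast
  qed simp
qed

theorem theorem3:
  "\<exists>c::real. \<forall>(V::nat set) (A::(nat \<times> nat) set) (w::nat \<times> nat \<Rightarrow> real)
      (VR::nat set) (AR::(nat \<times> nat) set) (VH::nat set) (AH::(nat \<times> nat) set).
     finite V \<and> A \<subseteq> V \<times> V \<and> (\<forall>e\<in>A. w e > 0) \<and>
     VR \<subseteq> V \<and> AR \<subseteq> VR \<times> VR \<and>
     is_min_solution V A AR VH AH \<longrightarrow>
     real (treewidth VH (ugraph_edges AH))
       \<le> c * 20 ^ (4 * (4 * genus (ugraph_edges A) + 3))
            * real (max (genus (ugraph_edges A)) 1) * real (card VR)"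
proof (intro exI[of _ 133800] allI impI)
  fix V :: "nat set" and A and w :: "nat \<times> nat \<Rightarrow> real" and VR AR VH AH
  assume a: "finite V \<and> A \<subseteq> V \<times> V \<and> (\<forall>e\<in>A. w e > 0) \<and> VR \<subseteq> V \<and> AR \<subseteq> VR \<times> VR \<and> is_min_solution V A AR VH AH"
  define g where "g = genus (ugraph_edges A)"
  have "has_td VH (ugraph_edges AH) (133800 * max g 1 * card VR + 1)"
    unfolding g_def using a by (intro min_solution_has_td[of V A VR AR]) auto
  then have "treewidth VH (ugraph_edges AH) \<le> 133800 * max g 1 * card VR" using has_td_treewidth by fastforce
  then have "real (treewidth VH (ugraph_edges AH)) \<le> real (133800 * max g 1 * card VR)" by (simp only: of_nat_le_iff)
  also have "\<dots> = 133800 * 1 * (real (max g 1) * real (card VR))" by simp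
  also have "\<dots> \<le> 133800 * 20 ^ (4 * (4 * g + 3)) * (real (max g 1) * real (card VR))"
    by (rule mult_right_mono) (simp_all add: one_le_power)
  finally show "real (treewidth VH (ugraph_edges AH))
       \<le> 133800 * 20 ^ (4 * (4 * genus (ugraph_edges A) + 3))
            * real (max (genus (ugraph_edges A)) 1) * real (card VR)"
    by (simp only: g_def mult.assoc)
qed

end
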